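(* The truthful budget feasible threshold mechanisms, oracle mechanisms and large market mechanism for submodular valuations listed below, modified so that they stop considering items in the greedy order as soon as the marginal value of the next item is $0$, can also be used, without any loss in the approximation ratio, for the crowdsourcing problem described in the context, with the constraint that each agent in the winning set should be assigned to a unique task (matching constraint). That is, with threshold payments and the value function $v(S)=$ maximum weight of a matching in $G[S,T]$, they are truthful (universally truthful if randomized) and budget feasible, the agents in the winning set can be assigned to distinct tasks by a maximum weight matching, and the approximation ratios are: (i) Random-TM$(0.5,A,B)$: ratio $5$; and, in the large market limit, Greedy-TM$(0.5,A,B)$: ratio $3$; (ii) Random-EOM$(0.5,A,B)$: ratio $4$; and Deterministic-EOM: ratio $4.56$; (iii) with an $r$-approximation oracle, Random-OM$(0.5,A,B)$: ratio $1+4r$; and, in the large market limit, Greedy-OM$(0.5,A,B)$: ratio $2r$; (iv) with an $r$-approximation oracle, Modified-Random-OM$(0.5,A,B)$: ratio $4r$ (so $\frac{4e}{e-1}$, in polynomial time, with Sviridenko's greedy algorithm for submodular maximization under a knapsack constraint as the oracle, for which $r=\frac{e}{e-1}$); (v) with an $r$-approximation oracle, in the large market limit, Deterministic-Large$(\alpha,\gamma,A,B)$ with $\alpha,\gamma\in(0,1]$ and $\alpha\le\frac1{1+\gamma}$: ratio $\max\left(1+\frac1\gamma,\frac r\alpha\right)$; in particular Deterministic-Large$\left(\frac{r}{r+1},\frac1r,A,B\right)$: ratio $1+r$ (so $1+\frac{e}{e-1}$ for $r=\frac{e}{e-1}$).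
   Context: Problem. There is a finite set $A$ of agents and a finite set $T$ of tasks, and a bipartite graph $G=G(A,T)$; an edge $(a,t)$ means agent $a$ can do task $t$. Each task $t$ has a value $v_t\ge0$ for the buyer, and every edge entering $t$ has weight $v_t$. Each agent $a$ has a private cost $c_a\ge0$, and his utility when hired at payment $p_a$ is $p_a-c_a$. The buyer has budget $B>0$. For $S\subseteq A$, $v(S)$ is the maximum weight of a matching in the induced subgraph $G[S,T]$; this is a monotone submodular function. Write $v(i)=v(\{i\})$, $m_i(S)=v(S\cup\{i\})-v(S)$, $c(S)=\sum_{i\in S}c_i$, $opt(A',B)=\max\{v(S):S\subseteq A',c(S)\le B\}$ for $A'\subseteq A$. Mechanisms. A deterministic allocation rule $f$ maps each declared cost vector $c$ to a winning set $f(c)\subseteq A$. Threshold payments: a winner $i$ is paid $\inf\{b: i\notin f(b,c_{-i})\}$, losers are paid $0$. A deterministic mechanism is truthful if declaring the true cost is a dominant strategy; a randomized one is universally truthful if it is a randomization over truthful deterministic mechanisms. Budget feasible: the total payment is at most $B$ for every cost vector and every realization. Ratio $\rho$: the winning set $S$ satisfies $\rho\,E[v(S)]\ge opt(A,B)$ on all instances. Ratio $\rho$ in the large market limit: with $\theta=\max_{i\in A}v(i)/opt(A,B)$, for every $\varepsilon>0$ there is $\theta_0>0$ such that $(\rho+\varepsilon)v(S)\ge opt(A,B)$ whenever $\theta\le\theta_0$. Oracle. $Oracle(A',B)$ is a deterministic real-valued function of $A'\subseteq A$, $B$, $v$ and the declared costs in $A'$ only, with $Oracle(A',B)\le opt(A',B)$;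 it is an $r$-approximation ($r\ge1$) if also $r\cdot Oracle(A',B)\ge opt(A',B)$. Write $Oracle(A,(c_i',c_{-i}))$ for the value of $Oracle(A,B)$ when the cost of $i$ is replaced by $c_i'$. Greedy order. $S_0=\emptyset$, $S_i=S_{i-1}\cup\{\arg\max_{j\in A\setminus S_{i-1}} m_j(S_{i-1})/c_j\}$, ties broken by a fixed order; the ratio is $0$ if $m_j(S_{i-1})=0$ and $+\infty$ if $c_j=0<m_j(S_{i-1})$. Items are renamed so that $S_i\setminus S_{i-1}=\{i\}$. Greedy-TM$(\gamma,A,B)$: $k=1$; while $k\le|A|$ and $\frac{c_k}{m_k(S_{k-1})}\le\gamma\frac{B}{v(S_k)}$, increase $k$; return $S_{k-1}$. Greedy-EOM$(\alpha,A,B)$: $v^*=opt(A,B)$, $k=1$; while $k\le|A|$ and $v(S_k)\le\alpha v^*$, increase $k$; return $S_{k-1}$. Greedy-OM$(\alpha,A,B)$: $S=\emptyset$; for $i=1,\dots,|A|$ add $i$ to $S$ if $v(S_i)\le\alpha\,Oracle(A\setminus\{i\},B)$; return $S$. Modified-Greedy-OM$(\alpha,A,B)$: the same with $Oracle(A\setminus\{i\},B)$ replaced by $\max_{c_i'\ge c_i}Oracle(A,(c_i',c_{-i}))$ (read as a supremum if not attained). The following first replace $A$ by $\{i\in A:c_i\le B\}$ (returning $\emptyset$ if this is empty), and $i^*\in\arg\max_{i\in A}v(i)$ (fixed tie-breaking): Random-TM$(\gamma,A,B)$: with probability $\frac{\gamma+1}{\gamma+2}$ return Greedy-TM$(\gamma,A,B)$,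 else $\{i^*\}$. Random-EOM$(\alpha,A,B)$: with probability $\frac12$ return Greedy-EOM$(\alpha,A,B)$, else $\{i^*\}$. Deterministic-EOM: if $v(i^* )\ge\frac{\sqrt{17}-3}{4}opt(A\setminus\{i^*\},B)$ return $\{i^*\}$, else Greedy-EOM$(0.5,A,B)$. Random-OM$(\alpha,A,B)$: with probability $\frac{r}{\alpha+2r}$ return Greedy-OM$(\alpha,A,B)$, else $\{i^*\}$. Modified-Random-OM$(\alpha,A,B)$: with probability $\frac12$ return Modified-Greedy-OM$(\alpha,A,B)$, else $\{i^*\}$. Deterministic-Large$(\alpha,\gamma,A,B)$: return the intersection of the outputs of Greedy-OM$(\alpha,A,B)$ and Greedy-TM$(\gamma,A,B)$.
   Formalization: Deterministic-EOM is given its exact ratio (5+√17)/2 ≈ 4.5616, which 4.56 rounds (literal 4.56 fails); if v(i* )=0 the {i*} branch hires nobody, since i* may have no task. Polynomial time means unit-cost real operations to compute the winning set. *)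

theory Defs
  imports "HOL-Probability.Probability"
begin

section \<open>The crowdsourcing problem\<close>

type_synonym 'a costs = "'a \<Rightarrow> real"
type_synonym 'a rule = "'a costs \<Rightarrow> 'a set"

record ('a, 't) market =
  agents :: "'a set"
  tasks :: "'t set"
  edges :: "('a \<times> 't) set"
  worth :: "'t \<Rightarrow> real"
  budget :: real

definition crowdsourcing :: "('a, 't) market \<Rightarrow> bool" where
  "crowdsourcing I \<longleftrightarrow>
     finite (agents I) \<and> finite (tasks I) \<and> edges I \<subseteq> agents I \<times> tasks I \<and>
     (\<forall>t\<in>tasks I. 0 \<le> worth I t) \<and> 0 < budget I"

definition cost_vector :: "'a set \<Rightarrow> 'a costs \<Rightarrow> bool" where
  "cost_vector A c \<longleftrightarrow> (\<forall>i\<in>A. 0 \<le> c i)"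

definition matching :: "('a, 't) market \<Rightarrow> 'a set \<Rightarrow> ('a \<times> 't) set \<Rightarrow> bool" where
  "matching I S M \<longleftrightarrow> M \<subseteq> edges I \<inter> S \<times> tasks I \<and> inj_on fst M \<and> inj_on snd M"

definition weight :: "('a, 't) market \<Rightarrow> ('a \<times> 't) set \<Rightarrow> real" where
  "weight I M = (\<Sum>(a, t)\<in>M. worth I t)"

definition match_value :: "('a, 't) market \<Rightarrow> 'a set \<Rightarrow> real" where
  "match_value I S = Max {weight I M | M. matching I S M}"

definition marginal :: "('a set \<Rightarrow> real) \<Rightarrow> 'a \<Rightarrow> 'a set \<Rightarrow> real" where
  "marginal v i S = v (insert i S) - v S"

definition opt :: "('a set \<Rightarrow> real) \<Rightarrow> 'a set \<Rightarrow> real \<Rightarrow> 'a costs \<Rightarrow> real" where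
  "opt v A B c = Max {v S | S. S \<subseteq> A \<and> sum c S \<le> B}"


section \<open>Truthfulness, budget feasibility, matching constraint, approximation\<close>

text \<open>Extended reals make the payment \<open>\<infinity>\<close> when a winner wins with every bid.\<close>

definition threshold_payment :: "'a rule \<Rightarrow> 'a costs \<Rightarrow> 'a \<Rightarrow> ereal" where
  "threshold_payment f c i =
     (if i \<in> f c then (INF b\<in>{b. 0 \<le> b \<and> i \<notin> f (c(i := b))}. ereal b) else 0)"

text \<open>Utility of agent \<open>i\<close> with true cost \<open>t\<close> when the declared costs are \<open>d\<close>.\<close>

definition utility :: "'a rule \<Rightarrow> ('a costs \<Rightarrow> 'a \<Rightarrow> ereal) \<Rightarrow> 'a \<Rightarrow> real \<Rightarrow> 'a costs \<Rightarrow> ereal" where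
  "utility f p i t d = p d i - (if i \<in> f d then ereal t else 0)"

text \<open>Below, \<open>c i\<close> is the true cost of \<open>i\<close>; the other entries of \<open>c\<close> are arbitrary declarations.\<close>

definition truthful :: "'a set \<Rightarrow> 'a rule \<Rightarrow> ('a costs \<Rightarrow> 'a \<Rightarrow> ereal) \<Rightarrow> bool" where
  "truthful A f p \<longleftrightarrow>
     (\<forall>c i b. cost_vector A c \<and> i \<in> A \<and> 0 \<le> b \<longrightarrow>
        utility f p i (c i) (c(i := b)) \<le> utility f p i (c i) c)"

definition budget_feasible :: "'a set \<Rightarrow> real \<Rightarrow> ('a costs \<Rightarrow> 'a \<Rightarrow> ereal) \<Rightarrow> bool" where
  "budget_feasible A B p \<longleftrightarrow> (\<forall>c. cost_vector A c \<longrightarrow> (\<Sum>i\<in>A. p c i) \<le> ereal B)"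

definition matching_constraint :: "('a, 't) market \<Rightarrow> 'a rule \<Rightarrow> bool" where
  "matching_constraint I f \<longleftrightarrow>
     (\<forall>c. cost_vector (agents I) c \<longrightarrow>
        (\<exists>M. matching I (f c) M \<and> weight I M = match_value I (f c) \<and> fst ` M = f c))"

definition valid_mechanism :: "(('a, 't) market \<Rightarrow> 'a rule) \<Rightarrow> bool" where
  "valid_mechanism F \<longleftrightarrow>
     (\<forall>I. crowdsourcing I \<longrightarrow>
        truthful (agents I) (F I) (threshold_payment (F I)) \<and>
        budget_feasible (agents I) (budget I) (threshold_payment (F I)) \<and>
        matching_constraint I (F I))"

text \<open>A randomized mechanism is a distribution over allocation rules; universal truthfulness,
  budget feasibility and the matching constraint are required of every rule in its support.\<close>

definition valid_randomized_mechanism :: "(('a, 't) market \<Rightarrow> 'a rule pmf) \<Rightarrow> bool" where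
  "valid_randomized_mechanism R \<longleftrightarrow>
     (\<forall>I. crowdsourcing I \<longrightarrow> (\<forall>f\<in>set_pmf (R I).
        truthful (agents I) f (threshold_payment f) \<and>
        budget_feasible (agents I) (budget I) (threshold_payment f) \<and>
        matching_constraint I f))"

definition market_opt :: "('a, 't) market \<Rightarrow> 'a costs \<Rightarrow> real" where
  "market_opt I c = opt (match_value I) (agents I) (budget I) c"

definition has_ratio :: "real \<Rightarrow> (('a, 't) market \<Rightarrow> 'a rule) \<Rightarrow> bool" where
  "has_ratio \<rho> F \<longleftrightarrow>
     (\<forall>I c. crowdsourcing I \<and> cost_vector (agents I) c \<longrightarrow>
        market_opt I c \<le> \<rho> * match_value I (F I c))"

definition has_expected_ratio :: "real \<Rightarrow> (('a, 't) market \<Rightarrow> 'a rule pmf) \<Rightarrow> bool" where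
  "has_expected_ratio \<rho> R \<longleftrightarrow>
     (\<forall>I c. crowdsourcing I \<and> cost_vector (agents I) c \<longrightarrow>
        market_opt I c \<le> \<rho> * measure_pmf.expectation (R I) (\<lambda>f. match_value I (f c)))"

definition market_theta :: "('a, 't) market \<Rightarrow> 'a costs \<Rightarrow> real" where
  "market_theta I c = Max ((\<lambda>i. match_value I {i}) ` agents I) / market_opt I c"

definition has_large_market_ratio :: "real \<Rightarrow> (('a, 't) market \<Rightarrow> 'a rule) \<Rightarrow> bool" where
  "has_large_market_ratio \<rho> F \<longleftrightarrow>
     (\<forall>\<epsilon>>0. \<exists>\<theta>>0. \<forall>I c.
        crowdsourcing I \<and> cost_vector (agents I) c \<and> market_theta I c \<le> \<theta> \<longrightarrow>
          market_opt I c \<le> (\<rho> + \<epsilon>) * match_value I (F I c))"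


section \<open>Greedy order\<close>

text \<open>All ties are broken by the linear order of the type of agents.\<close>

definition efficiency :: "('a set \<Rightarrow> real) \<Rightarrow> 'a costs \<Rightarrow> 'a set \<Rightarrow> 'a \<Rightarrow> ereal" where
  "efficiency v c S j =
     (if marginal v j S = 0 then 0
      else if c j = 0 then \<infinity>
      else ereal (marginal v j S / c j))"

definition most_efficient :: "('a::linorder set \<Rightarrow> real) \<Rightarrow> 'a costs \<Rightarrow> 'a set \<Rightarrow> 'a set \<Rightarrow> 'a" where
  "most_efficient v c R S = Min {j \<in> R. \<forall>k\<in>R. efficiency v c S k \<le> efficiency v c S j}"

text \<open>\<open>greedy_set v c A k\<close> is \<open>S\<^sub>k\<close>, and \<open>item v c A k\<close> is, for \<open>1 \<le> k \<le> |A|\<close>, the \<open>k\<close>-th item.\<close>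

primrec greedy_set :: "('a::linorder set \<Rightarrow> real) \<Rightarrow> 'a costs \<Rightarrow> 'a set \<Rightarrow> nat \<Rightarrow> 'a set" where
  "greedy_set v c A 0 = {}"
| "greedy_set v c A (Suc k) =
     insert (most_efficient v c (A - greedy_set v c A k) (greedy_set v c A k)) (greedy_set v c A k)"

definition item :: "('a::linorder set \<Rightarrow> real) \<Rightarrow> 'a costs \<Rightarrow> 'a set \<Rightarrow> nat \<Rightarrow> 'a" where
  "item v c A k = most_efficient v c (A - greedy_set v c A (k - 1)) (greedy_set v c A (k - 1))"

definition item_marginal ::
  "('a::linorder set \<Rightarrow> real) \<Rightarrow> 'a costs \<Rightarrow> 'a set \<Rightarrow> nat \<Rightarrow> real" where
  "item_marginal v c A k = marginal v (item v c A k) (greedy_set v c A (k - 1))"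

text \<open>The loop \<open>k = 1\<close>; while \<open>k \<le> |A|\<close> and \<open>P k\<close>, increase \<open>k\<close>; return \<open>S\<^sub>k\<^sub>-\<^sub>1\<close>,
  stopped in addition as soon as the marginal value of the \<open>k\<close>-th item is \<open>0\<close>.
  \<open>greedy_length\<close> is the final value of \<open>k - 1\<close>.\<close>

definition greedy_length ::
  "('a::linorder set \<Rightarrow> real) \<Rightarrow> 'a costs \<Rightarrow> 'a set \<Rightarrow> (nat \<Rightarrow> bool) \<Rightarrow> nat" where
  "greedy_length v c A P =
     (LEAST k. \<not> (Suc k \<le> card A \<and> item_marginal v c A (Suc k) \<noteq> 0 \<and> P (Suc k)))"


section \<open>Mechanisms\<close>

definition greedy_tm ::
  "real \<Rightarrow> ('a::linorder set \<Rightarrow> real) \<Rightarrow> 'a set \<Rightarrow> real \<Rightarrow> 'a rule" where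
  "greedy_tm \<gamma> v A B c =
     greedy_set v c A (greedy_length v c A (\<lambda>k.
       c (item v c A k) / item_marginal v c A k \<le> \<gamma> * (B / v (greedy_set v c A k))))"

definition greedy_eom ::
  "real \<Rightarrow> ('a::linorder set \<Rightarrow> real) \<Rightarrow> 'a set \<Rightarrow> real \<Rightarrow> 'a rule" where
  "greedy_eom \<alpha> v A B c =
     greedy_set v c A (greedy_length v c A (\<lambda>k. v (greedy_set v c A k) \<le> \<alpha> * opt v A B c))"

text \<open>Greedy selection where item \<open>i\<close> is tested against \<open>b i\<close>; here a failed test only skips the
  item, and only a zero marginal value ends the loop.\<close>

definition greedy_select ::
  "('a::linorder set \<Rightarrow> real) \<Rightarrow> 'a costs \<Rightarrow> 'a set \<Rightarrow> ('a \<Rightarrow> real) \<Rightarrow> 'a set" where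
  "greedy_select v c A b =
     {item v c A k | k. 1 \<le> k \<and> k \<le> greedy_length v c A (\<lambda>_. True) \<and>
        v (greedy_set v c A k) \<le> b (item v c A k)}"

text \<open>An oracle is applied as \<open>orc A' B v c\<close>.\<close>

type_synonym 'a opt_oracle = "'a set \<Rightarrow> real \<Rightarrow> ('a set \<Rightarrow> real) \<Rightarrow> 'a costs \<Rightarrow> real"

definition approx_oracle :: "real \<Rightarrow> ('a set \<Rightarrow> real) \<Rightarrow> 'a set \<Rightarrow> 'a opt_oracle \<Rightarrow> bool" where
  "approx_oracle r v A orc \<longleftrightarrow>
     (\<forall>A' B c. A' \<subseteq> A \<and> 0 < B \<and> cost_vector A' c \<longrightarrow>
        orc A' B v c \<le> opt v A' B c \<and>
        opt v A' B c \<le> r * orc A' B v c \<and>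
        (\<forall>d. (\<forall>i\<in>A'. d i = c i) \<longrightarrow> orc A' B v d = orc A' B v c))"

definition greedy_om ::
  "'a opt_oracle \<Rightarrow> real \<Rightarrow> ('a::linorder set \<Rightarrow> real) \<Rightarrow> 'a set \<Rightarrow> real \<Rightarrow> 'a rule" where
  "greedy_om orc \<alpha> v A B c = greedy_select v c A (\<lambda>i. \<alpha> * orc (A - {i}) B v c)"

definition modified_greedy_om ::
  "'a opt_oracle \<Rightarrow> real \<Rightarrow> ('a::linorder set \<Rightarrow> real) \<Rightarrow> 'a set \<Rightarrow> real \<Rightarrow> 'a rule" where
  "modified_greedy_om orc \<alpha> v A B c =
     greedy_select v c A (\<lambda>i. \<alpha> * (SUP x\<in>{c i..}. orc A B v (c(i := x))))"

definition on_affordable ::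
  "('a set \<Rightarrow> real \<Rightarrow> 'a rule) \<Rightarrow> 'a set \<Rightarrow> real \<Rightarrow> 'a rule" where
  "on_affordable g A B c =
     (let A' = {i \<in> A. c i \<le> B} in if A' = {} then {} else g A' B c)"

definition best_agent :: "('a::linorder set \<Rightarrow> real) \<Rightarrow> 'a set \<Rightarrow> 'a" where
  "best_agent v A = Min {i \<in> A. \<forall>j\<in>A. v {j} \<le> v {i}}"

text \<open>The stopping rule also applies here: if \<open>v {i\<^sup>*} = 0\<close>, then \<open>i\<^sup>*\<close> may have no edge at all, and
  nobody is hired.\<close>

definition best_singleton ::
  "('a::linorder set \<Rightarrow> real) \<Rightarrow> 'a set \<Rightarrow> real \<Rightarrow> 'a rule" where
  "best_singleton v A B c = (if v {best_agent v A} = 0 then {} else {best_agent v A})"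

definition with_probability :: "real \<Rightarrow> 'a rule \<Rightarrow> 'a rule \<Rightarrow> 'a rule pmf" where
  "with_probability q f g = map_pmf (\<lambda>heads. if heads then f else g) (bernoulli_pmf q)"

definition random_tm ::
  "real \<Rightarrow> ('a::linorder set \<Rightarrow> real) \<Rightarrow> 'a set \<Rightarrow> real \<Rightarrow> 'a rule pmf" where
  "random_tm \<gamma> v A B =
     with_probability ((\<gamma> + 1) / (\<gamma> + 2))
       (on_affordable (greedy_tm \<gamma> v) A B) (on_affordable (best_singleton v) A B)"

definition random_eom ::
  "real \<Rightarrow> ('a::linorder set \<Rightarrow> real) \<Rightarrow> 'a set \<Rightarrow> real \<Rightarrow> 'a rule pmf" where
  "random_eom \<alpha> v A B =
     with_probability (1 / 2)
       (on_affordable (greedy_eom \<alpha> v) A B) (on_affordable (best_singleton v) A B)"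

definition deterministic_eom ::
  "('a::linorder set \<Rightarrow> real) \<Rightarrow> 'a set \<Rightarrow> real \<Rightarrow> 'a rule" where
  "deterministic_eom v =
     on_affordable (\<lambda>A B c.
       if v {best_agent v A} \<ge> (sqrt 17 - 3) / 4 * opt v (A - {best_agent v A}) B c
       then best_singleton v A B c else greedy_eom (1 / 2) v A B c)"

definition random_om ::
  "real \<Rightarrow> 'a opt_oracle \<Rightarrow> real \<Rightarrow> ('a::linorder set \<Rightarrow> real) \<Rightarrow> 'a set \<Rightarrow> real \<Rightarrow> 'a rule pmf" where
  "random_om r orc \<alpha> v A B =
     with_probability (r / (\<alpha> + 2 * r))
       (on_affordable (greedy_om orc \<alpha> v) A B) (on_affordable (best_singleton v) A B)"

definition modified_random_om ::
  "'a opt_oracle \<Rightarrow> real \<Rightarrow> ('a::linorder set \<Rightarrow> real) \<Rightarrow> 'a set \<Rightarrow> real \<Rightarrow> 'a rule pmf" where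
  "modified_random_om orc \<alpha> v A B =
     with_probability (1 / 2)
       (on_affordable (modified_greedy_om orc \<alpha> v) A B) (on_affordable (best_singleton v) A B)"

definition deterministic_large ::
  "'a opt_oracle \<Rightarrow> real \<Rightarrow> real \<Rightarrow> ('a::linorder set \<Rightarrow> real) \<Rightarrow> 'a set \<Rightarrow> real \<Rightarrow> 'a rule" where
  "deterministic_large orc \<alpha> \<gamma> v =
     on_affordable (\<lambda>A B c. greedy_om orc \<alpha> v A B c \<inter> greedy_tm \<gamma> v A B c)"


section \<open>Sviridenko's algorithm\<close>

text \<open>For every feasible \<open>U\<close> with three elements, the candidates outside \<open>U\<close> are considered in order
  of efficiency with respect to the current set; a candidate that does not fit is discarded. The result
  is the best of the sets obtained in this way and of the feasible sets with at most two elements.\<close>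

definition sviridenko_step ::
  "('a::linorder set \<Rightarrow> real) \<Rightarrow> real \<Rightarrow> 'a costs \<Rightarrow> 'a set \<times> 'a set \<Rightarrow> 'a set \<times> 'a set" where
  "sviridenko_step v B c = (\<lambda>(S, R).
     let j = most_efficient v c R S
     in (if sum c (insert j S) \<le> B then insert j S else S, R - {j}))"

definition sviridenko_extend ::
  "('a::linorder set \<Rightarrow> real) \<Rightarrow> 'a set \<Rightarrow> real \<Rightarrow> 'a costs \<Rightarrow> 'a set \<Rightarrow> 'a set" where
  "sviridenko_extend v A B c U = fst ((sviridenko_step v B c ^^ card (A - U)) (U, A - U))"

definition sviridenko :: "'a::linorder opt_oracle" where
  "sviridenko A B v c =
     Max ({v U | U. U \<subseteq> A \<and> card U \<le> 2 \<and> sum c U \<le> B} \<union>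
          {v (sviridenko_extend v A B c U) | U. U \<subseteq> A \<and> card U = 3 \<and> sum c U \<le> B})"


section \<open>Polynomial time\<close>

text \<open>A first-order language of programs over cells and exact real numbers in the unit-cost
  (real RAM) model. \<open>Loop p\<close>, run on \<open>Cell xs s\<close>, executes \<open>s := p (Cell x s)\<close> for the successive
  entries \<open>x\<close> of the list \<open>xs\<close>. Lists are built from \<open>Null\<close> and \<open>Cell\<close>, and \<open>Null\<close> is also the truth
  value false. All other instructions are constant-time operations on numbers and pointers.\<close>

datatype data = Null | Num real | Cell data data

datatype prog =
    Ident | Seq prog prog | Fork prog prog
  | Head | Tail | IsNull
  | NullConst | Zero | One
  | Plus | Minus | Times | Divide | Less
  | Cond prog prog prog
  | Loop prog

fun head :: "data \<Rightarrow> data" where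
  "head (Cell x y) = x"
| "head _ = Null"

fun tail :: "data \<Rightarrow> data" where
  "tail (Cell x y) = y"
| "tail _ = Null"

definition bool_data :: "bool \<Rightarrow> data" where
  "bool_data b = (if b then Num 1 else Null)"

fun on_numbers :: "(real \<Rightarrow> real \<Rightarrow> data) \<Rightarrow> data \<Rightarrow> data" where
  "on_numbers g (Cell (Num x) (Num y)) = g x y"
| "on_numbers g _ = Null"

fun loop :: "(data \<Rightarrow> data) \<Rightarrow> data \<Rightarrow> data \<Rightarrow> data" where
  "loop g (Cell x xs) s = loop g xs (g (Cell x s))"
| "loop g _ s = s"

fun loop_steps :: "(data \<Rightarrow> data) \<Rightarrow> (data \<Rightarrow> nat) \<Rightarrow> data \<Rightarrow> data \<Rightarrow> nat" where
  "loop_steps g t (Cell x xs) s = 1 + t (Cell x s) + loop_steps g t xs (g (Cell x s))"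
| "loop_steps g t _ s = 1"

primrec exec :: "prog \<Rightarrow> data \<Rightarrow> data" where
  "exec Ident x = x"
| "exec (Seq p q) x = exec q (exec p x)"
| "exec (Fork p q) x = Cell (exec p x) (exec q x)"
| "exec Head x = head x"
| "exec Tail x = tail x"
| "exec IsNull x = bool_data (x = Null)"
| "exec NullConst x = Null"
| "exec Zero x = Num 0"
| "exec One x = Num 1"
| "exec Plus x = on_numbers (\<lambda>a b. Num (a + b)) x"
| "exec Minus x = on_numbers (\<lambda>a b. Num (a - b)) x"
| "exec Times x = on_numbers (\<lambda>a b. Num (a * b)) x"
| "exec Divide x = on_numbers (\<lambda>a b. Num (a / b)) x"
| "exec Less x = on_numbers (\<lambda>a b. bool_data (a < b)) x"
| "exec (Cond p q r) x = (if exec p x = Null then exec r x else exec q x)"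
| "exec (Loop p) x = loop (exec p) (head x) (tail x)"

primrec steps :: "prog \<Rightarrow> data \<Rightarrow> nat" where
  "steps Ident x = 1"
| "steps (Seq p q) x = 1 + steps p x + steps q (exec p x)"
| "steps (Fork p q) x = 1 + steps p x + steps q x"
| "steps Head x = 1"
| "steps Tail x = 1"
| "steps IsNull x = 1"
| "steps NullConst x = 1"
| "steps Zero x = 1"
| "steps One x = 1"
| "steps Plus x = 1"
| "steps Minus x = 1"
| "steps Times x = 1"
| "steps Divide x = 1"
| "steps Less x = 1"
| "steps (Cond p q r) x = 1 + steps p x + (if exec p x = Null then steps r x else steps q x)"
| "steps (Loop p) x = loop_steps (exec p) (steps p) (head x) (tail x)"

definition list_data :: "data list \<Rightarrow> data" where
  "list_data xs = foldr Cell xs Null"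

definition set_data :: "nat set \<Rightarrow> data" where
  "set_data S = list_data (map (\<lambda>i. Num (real i)) (sorted_list_of_set S))"

text \<open>The input consists of the budget, the list of task values, and for each agent its cost and
  its list of tasks. Agents and tasks are numbered from 0.\<close>

definition numbered :: "(nat, nat) market \<Rightarrow> bool" where
  "numbered I \<longleftrightarrow> agents I = {..<card (agents I)} \<and> tasks I = {..<card (tasks I)}"

definition market_data :: "(nat, nat) market \<Rightarrow> nat costs \<Rightarrow> data" where
  "market_data I c =
     Cell (Num (budget I))
       (Cell (list_data (map (\<lambda>t. Num (worth I t)) [0..<card (tasks I)]))
             (list_data (map (\<lambda>i. Cell (Num (c i)) (set_data {t. (i, t) \<in> edges I}))
                [0..<card (agents I)])))"

definition polynomial_time :: "((nat, nat) market \<Rightarrow> nat rule) \<Rightarrow> bool" where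
  "polynomial_time F \<longleftrightarrow>
     (\<exists>p d. \<forall>I c. crowdsourcing I \<and> numbered I \<and> cost_vector (agents I) c \<longrightarrow>
        exec p (market_data I c) = set_data (F I c) \<and>
        steps p (market_data I c) \<le> (card (agents I) + card (tasks I) + 2) ^ d)"

text \<open>A randomized mechanism runs in polynomial time if it tosses a coin whose bias is the same for
  all instances, and then runs one of two polynomial-time algorithms.\<close>

definition randomized_polynomial_time :: "((nat, nat) market \<Rightarrow> nat rule pmf) \<Rightarrow> bool" where
  "randomized_polynomial_time R \<longleftrightarrow>
     (\<exists>q F G. polynomial_time F \<and> polynomial_time G \<and> 0 \<le> q \<and> q \<le> 1 \<and>
        (\<forall>I. crowdsourcing I \<and> numbered I \<longrightarrow> R I = with_probability q (F I) (G I)))"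

end

theory Submission
  imports Defs
begin

text \<open>A set whose members are added one by one with positive marginal value is covered by a maximum weight matching,
  since the exchange along an alternating path never unassigns an agent; so stopping at marginal value \<open>0\<close> takes
  care of the matching constraint. Every mechanism is then analysed for an arbitrary monotone submodular \<open>v\<close>.
  Lowering a bid moves a winner \<open>i\<close> forward in the greedy order without changing what precedes its new position,
  which gives monotonicity of the rule. The greedy order compares the cost of \<open>i\<close> with that of an arbitrary set \<open>U\<close>:
  \<open>c\<^sub>i (v(U) - v(P \<union> {i})) \<le> m\<^sub>i(P) c(U)\<close>, where \<open>P\<close> is the set preceding \<open>i\<close>. Combined with the stopping
  rule this bounds the threshold payment of \<open>i\<close> by \<open>B m\<^sub>i(P) / v(W)\<close>, where \<open>W\<close> is the winning set, and these
  bounds add up to at most \<open>B\<close>. The same inequality gives the approximation ratios.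

  For the running time, \<open>v\<close> is computed by augmenting a matching in agent order. The supremum over the declared costs of
  \<open>i\<close> in the modified oracle mechanism is reached at, or immediately to the right of, one of polynomially many costs at
  which a comparison made by the oracle changes; the latter case is simulated with an infinitesimally larger cost.\<close>

section \<open>Matchings\<close>

lemma crowdsourcingD:
  assumes "crowdsourcing I"
  shows "finite (agents I)" "finite (tasks I)" "edges I \<subseteq> agents I \<times> tasks I"
    "\<And>t. t \<in> tasks I \<Longrightarrow> 0 \<le> worth I t" "0 < budget I" "finite (edges I)"
  using assms finite_subset[of "edges I" "agents I \<times> tasks I"]
  by (auto simp: crowdsourcing_def)

lemma finite_matchings: "crowdsourcing I \<Longrightarrow> finite {M. matching I S M}"
  by (rule finite_subset[of _ "Pow (edges I)"]) (auto simp: matching_def crowdsourcingD)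

lemma finite_matching: "crowdsourcing I \<Longrightarrow> matching I S M \<Longrightarrow> finite M"
  by (meson crowdsourcingD(6) finite_subset le_infE matching_def)

lemma matching_empty: "matching I S {}"
  by (simp add: matching_def)

lemma matching_mono: "matching I S M \<Longrightarrow> S \<subseteq> S' \<Longrightarrow> matching I S' M"
  by (auto simp: matching_def)

lemma weight_eq_sum: "inj_on snd M \<Longrightarrow> weight I M = sum (worth I) (snd ` M)"
  by (simp add: weight_def sum.reindex case_prod_unfold)

lemma match_value_upper:
  assumes "crowdsourcing I" "matching I S M"
  shows "weight I M \<le> match_value I S"
  unfolding match_value_def
  by (rule Max_ge) (use assms finite_matchings[OF assms(1), of S] in \<open>auto simp: setcompr_eq_image\<close>)

lemma match_value_attained:
  assumes "crowdsourcing I"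
  obtains M where "matching I S M" "weight I M = match_value I S"
proof -
  have "match_value I S \<in> {weight I M | M. matching I S M}"
    unfolding match_value_def
    by (rule Max_in)
      (use assms finite_matchings[OF assms(1), of S] matching_empty[of I S] in \<open>auto simp: setcompr_eq_image\<close>)
  then show ?thesis using that by auto
qed

lemma match_value_mono:
  assumes "crowdsourcing I" "S \<subseteq> S'"
  shows "match_value I S \<le> match_value I S'"
proof -
  obtain M where "matching I S M" "weight I M = match_value I S"
    using match_value_attained assms(1) by blast
  then show ?thesis using match_value_upper[OF assms(1) matching_mono[OF _ assms(2)]] by metis
qed

lemma match_value_empty: "crowdsourcing I \<Longrightarrow> match_value I {} = 0"
  using match_value_attained[of I "{}"] by (auto simp: matching_def weight_def)

text \<open>Reinserting the task \<open>t\<close> along edges of \<open>M\<close>, the only task that can finally be lost is one that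
  \<open>M\<close> leaves free.\<close>

lemma alternating_exchange:
  assumes I: "crowdsourcing I" and M: "matching I S M" and SS': "S \<subseteq> S'"
    and K: "\<And>a t t'. t \<in> K \<Longrightarrow> (a, t) \<in> M \<Longrightarrow> (a, t') \<in> edges I \<Longrightarrow> t' \<in> K"
    and free: "\<And>t. t \<in> K \<Longrightarrow> t \<notin> snd ` M \<Longrightarrow> worth I t \<le> w" and w: "0 \<le> w"
  shows "matching I S' Q \<Longrightarrow> t \<in> K \<Longrightarrow> t \<in> tasks I \<Longrightarrow> t \<notin> snd ` Q \<Longrightarrow>
    weight I Q + worth I t \<le> match_value I S' + w"
proof (induction "card (Q - M)" arbitrary: Q t rule: less_induct)
  case less
  have finQ: "finite Q" using finite_matching[OF I less.prems(1)] .
  have snd_inj: "inj_on snd Q" and fst_inj: "inj_on fst Q"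
    and Qsub: "Q \<subseteq> edges I \<inter> S' \<times> tasks I"
    using less.prems(1) by (auto simp: matching_def)
  show ?case
  proof (cases "t \<in> snd ` M")
    case False
    then show ?thesis using match_value_upper[OF I less.prems(1)] free[OF less.prems(2)] by simp
  next
    case True
    then obtain a where a: "(a, t) \<in> M" by auto
    have aS: "a \<in> S'" "(a, t) \<in> edges I" using a M SS' by (auto simp: matching_def)
    show ?thesis
    proof (cases "a \<in> fst ` Q")
      case False
      have "matching I S' (insert (a, t) Q)"
        using less.prems aS False Qsub snd_inj fst_inj unfolding matching_def by auto
      from match_value_upper[OF I this] have "weight I (insert (a, t) Q) \<le> match_value I S'" .
      moreover have "(a, t) \<notin> Q" using less.prems(4) by force
      ultimately show ?thesis using finQ w by (simp add: weight_def)
    next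
      case True
      then obtain t2 where t2: "(a, t2) \<in> Q" by auto
      have ne: "t2 \<noteq> t" using t2 less.prems(4) by force
      have nM: "(a, t2) \<notin> M" using M a ne by (force simp: matching_def inj_on_def)
      define Q' where "Q' = insert (a, t) (Q - {(a, t2)})"
      have anQ: "a \<notin> fst ` (Q - {(a, t2)})" using fst_inj t2 by (force simp: inj_on_def)
      have m': "matching I S' Q'"
        using aS less.prems(3,4) Qsub snd_inj fst_inj anQ
        unfolding matching_def Q'_def by (auto simp: inj_on_def)
      have "Q' - M \<subset> Q - M" using a t2 nM by (auto simp: Q'_def)
      then have c: "card (Q' - M) < card (Q - M)" using finQ by (simp add: psubset_card_mono)
      have t2n: "t2 \<notin> snd ` Q'" using snd_inj t2 ne by (force simp: Q'_def inj_on_def)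
      have t2K: "t2 \<in> K" "t2 \<in> tasks I" using K[OF less.prems(2) a] t2 Qsub by auto
      have nt: "(a, t) \<notin> Q" using less.prems(4) by force
      have "weight I Q = worth I t2 + weight I (Q - {(a, t2)})"
        unfolding weight_def using sum.remove[OF finQ t2, of "\<lambda>(a,t). worth I t"] by simp
      moreover have "weight I Q' = worth I t + weight I (Q - {(a, t2)})"
        unfolding weight_def Q'_def using finQ nt by simp
      ultimately show ?thesis using less.hyps[OF c m' t2K t2n] by simp
    qed
  qed
qed

lemma match_value_insert_le:
  assumes I: "crowdsourcing I" and M: "matching I S M" and SS': "S \<subseteq> S'"
    and K: "\<And>a t t'. t \<in> K \<Longrightarrow> (a, t) \<in> M \<Longrightarrow> (a, t') \<in> edges I \<Longrightarrow> t' \<in> K"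
    and Ki: "\<And>t. (i, t) \<in> edges I \<Longrightarrow> t \<in> K"
    and free: "\<And>t. t \<in> K \<Longrightarrow> t \<notin> snd ` M \<Longrightarrow> worth I t \<le> w" and w: "0 \<le> w"
  shows "match_value I (insert i S') \<le> match_value I S' + w"
proof -
  obtain N where N: "matching I (insert i S') N" "weight I N = match_value I (insert i S')"
    using match_value_attained[OF I] by blast
  show ?thesis
  proof (cases "i \<in> fst ` N")
    case False
    then have "matching I S' N" using N(1) by (force simp: matching_def)
    then show ?thesis using match_value_upper[OF I] N(2) w by fastforce
  next
    case True
    then obtain t where t: "(i, t) \<in> N" by auto
    define Q where "Q = N - {(i, t)}"
    have "i \<notin> fst ` Q" using N(1) t unfolding matching_def Q_def by (force simp: inj_on_def)
    moreover have "inj_on fst Q" "inj_on snd Q"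
      using N(1) unfolding matching_def Q_def by (auto intro: inj_on_subset)
    ultimately have "matching I S' Q" using N(1) unfolding matching_def Q_def by force
    moreover have "t \<in> K" "t \<in> tasks I" using t N(1) Ki by (auto simp: matching_def)
    moreover have "t \<notin> snd ` Q" using N(1) t unfolding matching_def Q_def by (force simp: inj_on_def)
    ultimately have "weight I Q + worth I t \<le> match_value I S' + w"
      using alternating_exchange[OF I M SS', of K] K free w by blast
    moreover have "weight I N = worth I t + weight I Q"
      unfolding weight_def Q_def
      using sum.remove[OF finite_matching[OF I N(1)] t, of "\<lambda>(a,t). worth I t"] by simp
    ultimately show ?thesis using N(2) by simp
  qed
qed

text \<open>\<open>shift E M i t N V\<close>: along an alternating path of \<open>M\<close> from the new agent \<open>i\<close> to the task \<open>t\<close>, through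
  the tasks \<open>V\<close>, every agent is moved to the next task. This gives \<open>N\<close>, in which the agent that \<open>M\<close> assigns to \<open>t\<close> (if
  any) has no task.\<close>

inductive shift :: "('a \<times> 't) set \<Rightarrow> ('a \<times> 't) set \<Rightarrow> 'a \<Rightarrow> 't \<Rightarrow> ('a \<times> 't) set \<Rightarrow> 't set \<Rightarrow> bool"
  for E M i where
  start: "(i, t) \<in> E \<Longrightarrow> shift E M i t (insert (i, t) {e \<in> M. snd e \<noteq> t}) {t}"
| step: "shift E M i t N V \<Longrightarrow> (a, t) \<in> M \<Longrightarrow> (a, t') \<in> E \<Longrightarrow> t' \<notin> V \<Longrightarrow>
    shift E M i t' (insert (a, t') {e \<in> N. snd e \<noteq> t'}) (insert t' V)"

lemma shift_visited: "shift E M i t N V \<Longrightarrow> t \<in> V \<and> (\<forall>u\<in>V. \<exists>N V. shift E M i u N V)"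
  by (induction rule: shift.induct) (blast intro: shift.intros)+

lemma shift_closed:
  assumes "shift E M i t N V" "(a, t) \<in> M" "(a, t') \<in> E"
  shows "\<exists>N V. shift E M i t' N V"
proof (cases "t' \<in> V")
  case True then show ?thesis using shift_visited[OF assms(1)] by blast
next
  case False then show ?thesis using shift.step[OF assms] by blast
qed

lemma shift_invariant:
  assumes M: "matching I S M" and iM: "i \<notin> fst ` M" and I: "crowdsourcing I"
  shows "shift (edges I) M i t N V \<Longrightarrow> t \<in> V \<and> t \<in> tasks I \<and>
    matching I (insert i S) N \<and> snd ` N = insert t (snd ` M) \<and>
    (\<forall>a u. u \<notin> V \<longrightarrow> ((a, u) \<in> N \<longleftrightarrow> (a, u) \<in> M)) \<and> (\<forall>a. (a, t) \<in> M \<longrightarrow> a \<notin> fst ` N) \<and>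
    fst ` N \<union> {a. (a, t) \<in> M} = insert i (fst ` M)"
proof (induction rule: shift.induct)
  case (start t)
  have fM: "inj_on fst M" and sM: "inj_on snd M" and Ms: "M \<subseteq> edges I \<inter> S \<times> tasks I"
    using M by (auto simp: matching_def)
  have tt: "t \<in> tasks I" using start crowdsourcingD(3)[OF I] by auto
  have "matching I (insert i S) (insert (i, t) {e \<in> M. snd e \<noteq> t})"
    unfolding matching_def using start tt Ms iM
    by (auto intro: inj_on_subset[OF fM] inj_on_subset[OF sM] simp: image_iff)
  moreover have "\<forall>a. (a, t) \<in> M \<longrightarrow> a \<notin> fst ` insert (i, t) {e \<in> M. snd e \<noteq> t}"
    using fM iM by (force simp: inj_on_def)
  moreover have "snd ` insert (i, t) {e \<in> M. snd e \<noteq> t} = insert t (snd ` M)" by force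
  moreover have "fst ` insert (i, t) {e \<in> M. snd e \<noteq> t} \<union> {a. (a, t) \<in> M} = insert i (fst ` M)"
    by force
  ultimately show ?case using tt by auto
next
  case (step t N V a t')
  have fM: "inj_on fst M" and sM: "inj_on snd M" and Ms: "M \<subseteq> edges I \<inter> S \<times> tasks I"
    using M by (auto simp: matching_def)
  have fN: "inj_on fst N" and sN: "inj_on snd N" and Ns: "N \<subseteq> edges I \<inter> insert i S \<times> tasks I"
    using step.IH by (auto simp: matching_def)
  have tt: "t' \<in> tasks I" using step crowdsourcingD(3)[OF I] by auto
  have anN: "a \<notin> fst ` N" and tV: "t \<in> V" and snN: "snd ` N = insert t (snd ` M)"
    and out: "\<And>a u. u \<notin> V \<Longrightarrow> ((a, u) \<in> N \<longleftrightarrow> (a, u) \<in> M)"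
    and all: "fst ` N \<union> {a. (a, t) \<in> M} = insert i (fst ` M)"
    using step by auto
  have at: "{b. (b, t) \<in> M} = {a}" using sM step.hyps(2) by (force simp: inj_on_def)
  let ?N = "insert (a, t') {e \<in> N. snd e \<noteq> t'}"
  have aS: "a \<in> S" using step.hyps(2) Ms by auto
  have m: "matching I (insert i S) ?N"
    unfolding matching_def using step.hyps tt Ns anN aS
    by (auto intro: inj_on_subset[OF fN] inj_on_subset[OF sN] simp: image_iff)
  have tt': "t \<noteq> t'" using tV step.hyps by auto
  have "b \<notin> fst ` ?N" if b: "(b, t') \<in> M" for b
  proof -
    have "(b, t') \<in> N" using out b step.hyps by auto
    moreover have "b \<noteq> a" using b step.hyps(2) fM tt' by (force simp: inj_on_def)
    ultimately show ?thesis using fN by (force simp: inj_on_def)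
  qed
  moreover have "snd ` ?N = insert t' (snd ` M)"
  proof -
    have "t \<in> snd ` M" using step.hyps(2) by force
    moreover have "snd ` ?N = insert t' (snd ` N)" by force
    ultimately show ?thesis using snN by auto
  qed
  moreover have "fst ` ?N \<union> {b. (b, t') \<in> M} = insert i (fst ` M)"
  proof -
    have "{b. (b, t') \<in> M} = {b. (b, t') \<in> N}" using out step.hyps by auto
    then have "fst ` ?N \<union> {b. (b, t') \<in> M} = insert a (fst ` N)" by force
    also have "\<dots> = insert i (fst ` M)" using all at by auto
    finally show ?thesis .
  qed
  ultimately show ?case using m tt out by auto
qed

lemma shift_free:
  assumes "matching I S M" "i \<notin> fst ` M" "crowdsourcing I" "shift (edges I) M i t N V" "t \<notin> snd ` M"
  shows "matching I (insert i S) N" "weight I N = weight I M + worth I t" "fst ` N = insert i (fst ` M)"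
    "t \<in> tasks I"
proof -
  note inv = shift_invariant[OF assms(1-4)]
  show m: "matching I (insert i S) N" and "t \<in> tasks I" using inv by auto
  have "{a. (a, t) \<in> M} = {}" using assms(5) by force
  then show "fst ` N = insert i (fst ` M)" using inv by auto
  have "weight I N = sum (worth I) (insert t (snd ` M))"
    using weight_eq_sum[of N I] m inv by (auto simp: matching_def)
  also have "\<dots> = weight I M + worth I t"
    using assms(1,5) finite_matching[OF assms(3,1)] weight_eq_sum[of M I] by (auto simp: matching_def)
  finally show "weight I N = weight I M + worth I t" .
qed

lemma match_value_insert:
  assumes I: "crowdsourcing I" and M: "matching I S M" "weight I M = match_value I S" and i: "i \<notin> S"
  obtains w where "0 \<le> w" "\<And>S'. S \<subseteq> S' \<Longrightarrow> match_value I (insert i S') \<le> match_value I S' + w"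
    "match_value I (insert i S) = match_value I S + w"
    "0 < w \<Longrightarrow> \<exists>N. matching I (insert i S) N \<and> weight I N = match_value I (insert i S) \<and>
       fst ` N = insert i (fst ` M)"
proof -
  have iM: "i \<notin> fst ` M" using M(1) i by (force simp: matching_def)
  define K where "K = {t. \<exists>N V. shift (edges I) M i t N V}"
  define W where "W = insert 0 (worth I ` {t \<in> K. t \<notin> snd ` M})"
  have Kt: "K \<subseteq> tasks I" using shift_invariant[OF M(1) iM I] by (auto simp: K_def)
  then have finK: "finite K" using crowdsourcingD(2)[OF I] finite_subset by blast
  then have finW: "finite W" by (simp add: W_def)
  define w where "w = Max W"
  have w0: "0 \<le> w" using finW by (simp add: w_def W_def)
  have le: "match_value I (insert i S') \<le> match_value I S' + w" if "S \<subseteq> S'" for S'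
  proof (rule match_value_insert_le[OF I M(1) that, of K])
    show "t' \<in> K" if "t \<in> K" "(a, t) \<in> M" "(a, t') \<in> edges I" for a t t'
      using that shift_closed unfolding K_def by fast
    show "t \<in> K" if "(i, t) \<in> edges I" for t
      using that shift.start[of i t "edges I" M] unfolding K_def by blast
    show "worth I t \<le> w" if "t \<in> K" "t \<notin> snd ` M" for t
      unfolding w_def using finW by (rule Max_ge) (use that in \<open>auto simp: W_def\<close>)
  qed (rule w0)
  have N: "\<exists>N. matching I (insert i S) N \<and> weight I N = match_value I S + w \<and>
       fst ` N = insert i (fst ` M)" if "0 < w"
  proof -
    have "w \<in> W" unfolding w_def using finW by (rule Max_in) (simp add: W_def)
    with that obtain t N V where "shift (edges I) M i t N V" "t \<notin> snd ` M" "w = worth I t"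
      by (auto simp: W_def K_def)
    then show ?thesis using shift_free[OF M(1) iM I] M(2) by metis
  qed
  have eq: "match_value I (insert i S) = match_value I S + w"
  proof (cases "0 < w")
    case True
    then show ?thesis using N match_value_upper[OF I] le[of S] by fastforce
  next
    case False
    then show ?thesis
      using w0 le[OF order_refl] match_value_mono[OF I subset_insertI, of S i] by linarith
  qed
  show thesis using that[OF w0 le eq] N eq by metis
qed

section \<open>Monotone submodular functions\<close>

locale submodular =
  fixes v :: "'a set \<Rightarrow> real"
  assumes v_empty: "v {} = 0"
    and v_mono: "S \<subseteq> T \<Longrightarrow> v S \<le> v T"
    and marginal_antimono: "S \<subseteq> T \<Longrightarrow> marginal v i T \<le> marginal v i S"

inductive increasing :: "('a set \<Rightarrow> real) \<Rightarrow> 'a set \<Rightarrow> bool" for v where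
  increasing_empty: "increasing v {}"
| increasing_insert: "increasing v S \<Longrightarrow> 0 < marginal v i S \<Longrightarrow> increasing v (insert i S)"

lemma submodular_match_value:
  assumes I: "crowdsourcing I"
  shows "submodular (match_value I)"
proof
  show "match_value I {} = 0" using match_value_empty[OF I] .
  show "match_value I S \<le> match_value I T" if "S \<subseteq> T" for S T using match_value_mono[OF I that] .
  show "marginal (match_value I) i T \<le> marginal (match_value I) i S" if "S \<subseteq> T" for S T i
  proof (cases "i \<in> S")
    case True
    then show ?thesis using that by (simp add: marginal_def insert_absorb subsetD)
  next
    case False
    obtain M where "matching I S M" "weight I M = match_value I S"
      using match_value_attained[OF I] by blast
    from match_value_insert[OF I this False] that show ?thesis
      unfolding marginal_def by (metis add_diff_cancel_left' diff_le_eq add.commute)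
  qed
qed

lemma increasing_matching:
  assumes I: "crowdsourcing I" and S: "increasing (match_value I) S"
  shows "\<exists>M. matching I S M \<and> weight I M = match_value I S \<and> fst ` M = S"
  using S
proof induction
  case increasing_empty
  show ?case by (rule exI[of _ "{}"]) (simp add: matching_empty weight_def match_value_empty[OF I])
next
  case (increasing_insert S i)
  then obtain M where M: "matching I S M" "weight I M = match_value I S" "fst ` M = S" by auto
  have "i \<notin> S" using increasing_insert.hyps(2) by (auto simp: marginal_def insert_absorb)
  from match_value_insert[OF I M(1,2) this] show ?case
    using increasing_insert.hyps(2) M(3) unfolding marginal_def by (metis add_diff_cancel_left')
qed

section \<open>Monotone rules with bounded bids\<close>

text \<open>\<open>D\<close> is \<open>{0..}\<close>, or \<open>{0..B}\<close> if agents with larger bids have been discarded, and \<open>p i\<close> bounds the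
  threshold payment of \<open>i\<close>.\<close>

definition sound :: "real set \<Rightarrow> ('a set \<Rightarrow> real) \<Rightarrow> 'a set \<Rightarrow> real \<Rightarrow> 'a rule \<Rightarrow> bool" where
  "sound D v A B f \<longleftrightarrow> (\<forall>c. (\<forall>i\<in>A. c i \<in> D) \<longrightarrow>
     f c \<subseteq> A \<and> increasing v (f c) \<and>
     (\<forall>i\<in>f c. \<forall>b\<in>D. b \<le> c i \<longrightarrow> i \<in> f (c(i := b))) \<and>
     (\<exists>p. (\<forall>i\<in>f c. \<forall>b\<in>D. i \<in> f (c(i := b)) \<longrightarrow> b \<le> p i) \<and> sum p (f c) \<le> B))"

lemma soundE:
  assumes "sound D v A B f" "\<forall>i\<in>A. c i \<in> D"
  obtains p where "f c \<subseteq> A" "increasing v (f c)"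
    "\<And>i b. i \<in> f c \<Longrightarrow> b \<in> D \<Longrightarrow> b \<le> c i \<Longrightarrow> i \<in> f (c(i := b))"
    "\<And>i b. i \<in> f c \<Longrightarrow> b \<in> D \<Longrightarrow> i \<in> f (c(i := b)) \<Longrightarrow> b \<le> p i" "sum p (f c) \<le> B"
proof -
  have *: "f c \<subseteq> A \<and> increasing v (f c) \<and>
     (\<forall>i\<in>f c. \<forall>b\<in>D. b \<le> c i \<longrightarrow> i \<in> f (c(i := b))) \<and>
     (\<exists>p. (\<forall>i\<in>f c. \<forall>b\<in>D. i \<in> f (c(i := b)) \<longrightarrow> b \<le> p i) \<and> sum p (f c) \<le> B)"
    using assms(1)[unfolded sound_def, rule_format, of c] assms(2) by blast
  then obtain p where "\<forall>i\<in>f c. \<forall>b\<in>D. i \<in> f (c(i := b)) \<longrightarrow> b \<le> p i" "sum p (f c) \<le> B"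
    by (elim conjE exE)
  then show thesis using * by (intro that[of p]) blast+
qed

lemma sound_subset:
  assumes s: "sound D v A B f" and D: "D' \<subseteq> D"
  shows "sound D' v A B f"
  unfolding sound_def
proof (intro allI impI)
  fix c assume "\<forall>i\<in>A. c i \<in> D'"
  then have "\<forall>i\<in>A. c i \<in> D" using D by auto
  from soundE[OF s this] obtain p where "f c \<subseteq> A" "increasing v (f c)"
    "\<And>i b. i \<in> f c \<Longrightarrow> b \<in> D \<Longrightarrow> b \<le> c i \<Longrightarrow> i \<in> f (c(i := b))"
    "\<And>i b. i \<in> f c \<Longrightarrow> b \<in> D \<Longrightarrow> i \<in> f (c(i := b)) \<Longrightarrow> b \<le> p i" "sum p (f c) \<le> B" by blast
  then show "f c \<subseteq> A \<and> increasing v (f c) \<and> (\<forall>i\<in>f c. \<forall>b\<in>D'. b \<le> c i \<longrightarrow> i \<in> f (c(i := b))) \<and>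
     (\<exists>p. (\<forall>i\<in>f c. \<forall>b\<in>D'. i \<in> f (c(i := b)) \<longrightarrow> b \<le> p i) \<and> sum p (f c) \<le> B)"
    using D by (intro conjI exI[of _ p]) auto
qed

lemma cost_vector_update: "cost_vector A c \<Longrightarrow> 0 \<le> b \<Longrightarrow> cost_vector A (c(i := b))"
  by (auto simp: cost_vector_def)

lemma sound_truthful:
  assumes "sound {0..} v A B f"
  shows "truthful A f (threshold_payment f)"
  unfolding truthful_def
proof (intro allI impI)
  fix c i b assume a: "cost_vector A c \<and> i \<in> A \<and> (0::real) \<le> b"
  define th where "th = (INF x\<in>{x. 0 \<le> x \<and> i \<notin> f (c(i := x))}. ereal x)"
  have pay: "threshold_payment f (c(i := y)) i = (if i \<in> f (c(i := y)) then th else 0)" for y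
    by (simp add: threshold_payment_def th_def)
  have pay0: "threshold_payment f c i = (if i \<in> f c then th else 0)"
    using pay[of "c i"] by simp
  have lose: "th \<le> ereal (c i)" if "i \<notin> f c"
    unfolding th_def by (rule INF_lower) (use that a in \<open>auto simp: cost_vector_def\<close>)
  have win: "ereal (c i) \<le> th" if "i \<in> f c"
    unfolding th_def
  proof (rule INF_greatest)
    fix x assume "x \<in> {x. 0 \<le> x \<and> i \<notin> f (c(i := x))}"
    moreover have "x \<ge> 0 \<Longrightarrow> x \<le> c i \<Longrightarrow> i \<in> f (c(i := x))"
      using assms that a unfolding sound_def cost_vector_def by auto
    ultimately show "ereal (c i) \<le> ereal x" by force
  qed
  show "utility f (threshold_payment f) i (c i) (c(i := b)) \<le> utility f (threshold_payment f) i (c i) c"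
    unfolding utility_def pay pay0 using win lose
    by (cases th) (auto simp: zero_ereal_def)
qed

lemma sound_budget_feasible:
  assumes "sound {0..} v A B f" "finite A"
  shows "budget_feasible A B (threshold_payment f)"
  unfolding budget_feasible_def
proof (intro allI impI)
  fix c assume c: "cost_vector A c"
  have "\<forall>i\<in>A. c i \<in> {0..}" using c by (simp add: cost_vector_def)
  from soundE[OF assms(1) this] obtain p
    where p: "\<And>i b. i \<in> f c \<Longrightarrow> 0 \<le> b \<Longrightarrow> i \<in> f (c(i := b)) \<Longrightarrow> b \<le> p i"
      and sum: "sum p (f c) \<le> B" and sub: "f c \<subseteq> A"
    by (metis atLeast_iff)
  have "threshold_payment f c i \<le> ereal (p i)" if i: "i \<in> f c" for i
  proof (rule ccontr)
    assume "\<not> threshold_payment f c i \<le> ereal (p i)"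
    then obtain y where y: "ereal (p i) < ereal y" "ereal y < threshold_payment f c i"
      using ereal_dense2[of "ereal (p i)" "threshold_payment f c i"] by (auto simp: not_le)
    have "0 \<le> c i" using c i sub by (auto simp: cost_vector_def)
    then have "0 \<le> p i" using p[OF i, of "c i"] i by simp
    then have "i \<notin> f (c(i := y))" "0 \<le> y" using p[OF i, of y] y by auto
    then have "threshold_payment f c i \<le> ereal y"
      using i unfolding threshold_payment_def by (auto intro!: INF_lower)
    then show False using y by simp
  qed
  then have "(\<Sum>i\<in>f c. threshold_payment f c i) \<le> (\<Sum>i\<in>f c. ereal (p i))"
    by (rule sum_mono)
  also have "\<dots> = ereal (sum p (f c))" by simp
  also have "\<dots> \<le> ereal B" using sum by simp
  also have "(\<Sum>i\<in>f c. threshold_payment f c i) = (\<Sum>i\<in>A. threshold_payment f c i)"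
    using sub assms(2) by (intro sum.mono_neutral_left) (auto simp: threshold_payment_def)
  finally show "(\<Sum>i\<in>A. threshold_payment f c i) \<le> ereal B" .
qed

lemma sound_valid:
  assumes I: "crowdsourcing I" and s: "sound {0..} (match_value I) (agents I) (budget I) f"
  shows "truthful (agents I) f (threshold_payment f) \<and>
    budget_feasible (agents I) (budget I) (threshold_payment f) \<and> matching_constraint I f"
proof (intro conjI)
  show "matching_constraint I f" unfolding matching_constraint_def
    using increasing_matching[OF I] s unfolding sound_def cost_vector_def by auto
qed (use sound_truthful[OF s] sound_budget_feasible[OF s crowdsourcingD(1)[OF I]] in auto)

lemma sound_on_affordable:
  assumes g: "\<And>A'. A' \<subseteq> A \<Longrightarrow> A' \<noteq> {} \<Longrightarrow> sound {0..B} v A' B (g A' B)" and B: "0 \<le> B"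
  shows "sound {0..} v A B (on_affordable g A B)"
  unfolding sound_def
proof (intro allI impI)
  fix c :: "'a costs" assume c: "\<forall>i\<in>A. c i \<in> {0..}"
  let ?f = "on_affordable g A B"
  define A' where "A' = {i \<in> A. c i \<le> B}"
  show "?f c \<subseteq> A \<and> increasing v (?f c) \<and> (\<forall>i\<in>?f c. \<forall>b\<in>{0..}. b \<le> c i \<longrightarrow> i \<in> ?f (c(i := b))) \<and>
    (\<exists>p. (\<forall>i\<in>?f c. \<forall>b\<in>{0..}. i \<in> ?f (c(i := b)) \<longrightarrow> b \<le> p i) \<and> sum p (?f c) \<le> B)"
  proof (cases "A' = {}")
    case True
    then have "?f c = {}" by (simp add: on_affordable_def A'_def)
    then show ?thesis using B by (simp add: increasing_empty)
  next
    case False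
    have fc: "?f c = g A' B c" using False by (auto simp: on_affordable_def A'_def Let_def)
    have D: "\<forall>i\<in>A'. c i \<in> {0..B}" using c by (auto simp: A'_def)
    have s: "sound {0..B} v A' B (g A' B)" using g[of A'] False by (auto simp: A'_def)
    from soundE[OF s D] obtain p where sub: "g A' B c \<subseteq> A'" and inc: "increasing v (g A' B c)"
      and mono: "\<And>i b. i \<in> g A' B c \<Longrightarrow> b \<in> {0..B} \<Longrightarrow> b \<le> c i \<Longrightarrow> i \<in> g A' B (c(i := b))"
      and p: "\<And>i b. i \<in> g A' B c \<Longrightarrow> b \<in> {0..B} \<Longrightarrow> i \<in> g A' B (c(i := b)) \<Longrightarrow> b \<le> p i"
      and sum: "sum p (g A' B c) \<le> B"
      by blast
    have same: "?f (c(i := b)) = g A' B (c(i := b))" if "i \<in> A'" "b \<le> B" for i b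
    proof -
      have "{j \<in> A. (c(i := b)) j \<le> B} = A'" using that by (auto simp: A'_def)
      then show ?thesis using False by (simp add: on_affordable_def)
    qed
    have cap: "b \<le> B" if "0 \<le> b" "i \<in> A'" "i \<in> ?f (c(i := b))" for i b
    proof -
      define A'' where "A'' = {j \<in> A. (c(i := b)) j \<le> B}"
      have "A'' \<noteq> {}" using that(3) by (auto simp: on_affordable_def A''_def Let_def split: if_splits)
      moreover have "A'' \<subseteq> A" by (auto simp: A''_def)
      moreover have "\<forall>j\<in>A''. (c(i := b)) j \<in> {0..B}" using c that(1) by (auto simp: A''_def)
      ultimately have "g A'' B (c(i := b)) \<subseteq> A''" using g[of A''] unfolding sound_def by auto
      moreover have "on_affordable g A B (c(i := b)) = g A'' B (c(i := b))"
        using \<open>A'' \<noteq> {}\<close> unfolding on_affordable_def Let_def A''_def[symmetric] by simp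
      ultimately show ?thesis using that(3) by (auto simp: A''_def)
    qed
    have "b \<le> p i" if "i \<in> g A' B c" "0 \<le> b" "i \<in> ?f (c(i := b))" for i b
    proof -
      have i: "i \<in> A'" using that(1) sub by auto
      note b = cap[OF that(2) i that(3)]
      show ?thesis using that p[of i b] same[OF i b] b by simp
    qed
    moreover have "i \<in> ?f (c(i := b))" if "i \<in> g A' B c" "0 \<le> b" "b \<le> c i" for i b
      using that mono[of i b] same[of i b] sub D by (force dest: subsetD)
    ultimately show ?thesis unfolding fc using sub inc sum
      by (auto simp: A'_def)
  qed
qed

section \<open>The greedy order\<close>

lemma most_efficient_iff:
  assumes "finite R" "R \<noteq> {}"
  shows "most_efficient v c R S = j \<longleftrightarrow> j \<in> R \<and>
    (\<forall>k\<in>R. efficiency v c S k < efficiency v c S j \<or> efficiency v c S k = efficiency v c S j \<and> j \<le> k)"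
proof -
  let ?e = "efficiency v c S"
  define E where "E = {j \<in> R. \<forall>k\<in>R. ?e k \<le> ?e j}"
  have "Max (?e ` R) \<in> ?e ` R" using assms by (intro Max_in) auto
  then obtain m where "m \<in> R" "Max (?e ` R) = ?e m" by auto
  moreover have "?e k \<le> Max (?e ` R)" if "k \<in> R" for k using assms that by simp
  ultimately have "m \<in> E" by (simp add: E_def)
  then have ne: "E \<noteq> {}" by auto
  have fin: "finite E" using assms by (simp add: E_def)
  have me: "most_efficient v c R S = Min E" by (simp add: most_efficient_def E_def)
  show ?thesis
  proof
    assume j: "most_efficient v c R S = j"
    then have "j \<in> E" using me Min_in[OF fin ne] by simp
    moreover have "j \<le> k" if "k \<in> R" "?e k = ?e j" for k
    proof -
      have "k \<in> E" using that \<open>j \<in> E\<close> by (auto simp: E_def)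
      then show ?thesis using j me fin by auto
    qed
    ultimately show "j \<in> R \<and> (\<forall>k\<in>R. ?e k < ?e j \<or> ?e k = ?e j \<and> j \<le> k)"
      by (auto simp: E_def order_le_less)
  next
    assume j: "j \<in> R \<and> (\<forall>k\<in>R. ?e k < ?e j \<or> ?e k = ?e j \<and> j \<le> k)"
    show "most_efficient v c R S = j" unfolding me
    proof (rule Min_eqI[OF fin])
      show "j \<in> E" using j by (auto simp: E_def)
      show "j \<le> y" if "y \<in> E" for y
      proof -
        have "?e j \<le> ?e y" "?e y < ?e j \<or> ?e y = ?e j \<and> j \<le> y"
          using that j by (auto simp: E_def)
        then show ?thesis by auto
      qed
    qed
  qed
qed

lemma most_efficient_in: "finite R \<Longrightarrow> R \<noteq> {} \<Longrightarrow> most_efficient v c R S \<in> R"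
  using most_efficient_iff by blast

lemma most_efficient_ge:
  "finite R \<Longrightarrow> k \<in> R \<Longrightarrow> efficiency v c S k \<le> efficiency v c S (most_efficient v c R S)"
  using most_efficient_iff[of R v c S "most_efficient v c R S"] by force

lemma most_efficient_cong:
  "(\<And>i. i \<in> R \<Longrightarrow> c i = d i) \<Longrightarrow> most_efficient v c R S = most_efficient v d R S"
  by (simp add: most_efficient_def efficiency_def cong: conj_cong)

context submodular
begin

lemma v_nonneg: "0 \<le> v S"
  using v_mono[of "{}" S] v_empty by simp

lemma marginal_nonneg: "0 \<le> marginal v i S"
  using v_mono[of S "insert i S"] by (auto simp: marginal_def)

lemma marginal_le_single: "marginal v i S \<le> v {i}"
  using marginal_antimono[of "{}" S i] by (simp add: marginal_def v_empty)

lemma v_insert_le: "v (insert i S) \<le> v S + v {i}"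
  using marginal_le_single[of i S] by (simp add: marginal_def)

lemma v_union_le: "finite U \<Longrightarrow> v (S \<union> U) \<le> v S + (\<Sum>j\<in>U - S. marginal v j S)"
proof (induction U rule: finite_induct)
  case (insert x U)
  show ?case
  proof (cases "x \<in> S")
    case True
    then show ?thesis using insert by (simp add: insert_absorb insert_Diff_if)
  next
    case False
    have "v (S \<union> insert x U) = v (S \<union> U) + marginal v x (S \<union> U)" by (simp add: marginal_def)
    also have "\<dots> \<le> v (S \<union> U) + marginal v x S" using marginal_antimono[of S "S \<union> U" x] by auto
    finally show ?thesis using insert False by (simp add: insert_Diff_if)
  qed
qed simp

lemma efficiency_le_iff:
  assumes "0 \<le> c j" "0 \<le> c k"
  shows "efficiency v c S k \<le> efficiency v c S j \<longleftrightarrow> marginal v k S = 0 \<or>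
    marginal v j S \<noteq> 0 \<and> (c j = 0 \<or> c k \<noteq> 0 \<and> marginal v k S * c j \<le> marginal v j S * c k)"
  using assms marginal_nonneg[of k S] marginal_nonneg[of j S]
  by (auto simp: efficiency_def divide_simps mult_ac) 

lemma efficiency_le_mult:
  assumes "efficiency v c S k \<le> efficiency v c S j" "0 \<le> c j" "0 \<le> c k"
  shows "c j * marginal v k S \<le> marginal v j S * c k"
  using assms(1) unfolding efficiency_le_iff[OF assms(2,3)]
  using marginal_nonneg[of j S] assms(3) by (auto simp: mult_ac)

lemma efficiency_cover:
  assumes "finite U" "0 \<le> c i" "\<And>j. j \<in> U - S \<Longrightarrow> 0 \<le> c j \<and> efficiency v c S j \<le> efficiency v c S i"
  shows "c i * (v U - v S) \<le> marginal v i S * sum c (U - S)"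
proof -
  have "v U - v S \<le> (\<Sum>j\<in>U - S. marginal v j S)"
    using v_union_le[OF assms(1), of S] v_mono[of U "S \<union> U"] by auto
  then have "c i * (v U - v S) \<le> c i * (\<Sum>j\<in>U - S. marginal v j S)"
    using assms(2) by (rule mult_left_mono)
  also have "\<dots> = (\<Sum>j\<in>U - S. c i * marginal v j S)" by (simp add: sum_distrib_left)
  also have "\<dots> \<le> (\<Sum>j\<in>U - S. marginal v i S * c j)"
    by (intro sum_mono efficiency_le_mult) (use assms in auto)
  finally show ?thesis by (simp add: sum_distrib_left)
qed

lemma efficiency_cover_insert:
  assumes "finite U" "0 \<le> c i" "\<And>j. j \<in> U - S \<Longrightarrow> 0 \<le> c j \<and> efficiency v c S j \<le> efficiency v c S i"
  shows "c i * (v U - v (insert i S)) \<le> marginal v i S * sum c (U - insert i S)"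
proof -
  have "v U \<le> v (insert i S \<union> U)" by (rule v_mono) auto
  then have "v U - v (insert i S) \<le> (\<Sum>j\<in>U - insert i S. marginal v j (insert i S))"
    using v_union_le[OF assms(1), of "insert i S"] by linarith
  also have "\<dots> \<le> (\<Sum>j\<in>U - insert i S. marginal v j S)"
    by (intro sum_mono marginal_antimono) auto
  finally have "c i * (v U - v (insert i S)) \<le> c i * (\<Sum>j\<in>U - insert i S. marginal v j S)"
    using assms(2) by (intro mult_left_mono)
  also have "\<dots> = (\<Sum>j\<in>U - insert i S. c i * marginal v j S)" by (simp add: sum_distrib_left)
  also have "\<dots> \<le> (\<Sum>j\<in>U - insert i S. marginal v i S * c j)"
    by (intro sum_mono efficiency_le_mult) (use assms in auto)
  finally show ?thesis by (simp add: sum_distrib_left)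
qed

end

subsection \<open>Optimal sets\<close>

lemma opt_set:
  assumes "finite A"
  shows "finite {v S | S. S \<subseteq> A \<and> sum c S \<le> B}"
  by (rule finite_subset[of _ "v ` Pow A"]) (use assms in auto)

lemma opt_upper: "finite A \<Longrightarrow> S \<subseteq> A \<Longrightarrow> sum c S \<le> B \<Longrightarrow> v S \<le> opt v A B c"
  unfolding opt_def by (rule Max_ge[OF opt_set]) auto

lemma opt_attained:
  assumes "finite A" "0 \<le> B"
  obtains S where "S \<subseteq> A" "sum c S \<le> B" "opt v A B c = v S"
proof -
  have "opt v A B c \<in> {v S | S. S \<subseteq> A \<and> sum c S \<le> B}"
    unfolding opt_def by (rule Max_in[OF opt_set[OF assms(1)]]) (use assms in \<open>auto intro!: exI[of _ "{}"]\<close>)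
  then show ?thesis using that by auto
qed

lemma opt_mono:
  assumes "finite A'" "A \<subseteq> A'" "0 \<le> B" "\<And>i. i \<in> A \<Longrightarrow> d i \<le> c i"
  shows "opt v A B c \<le> opt v A' B d"
proof -
  obtain S where S: "S \<subseteq> A" "sum c S \<le> B" "opt v A B c = v S"
    using opt_attained[of A B] assms finite_subset by metis
  have "sum d S \<le> sum c S" using S assms by (intro sum_mono) auto
  then show ?thesis using S opt_upper[OF assms(1), of S d B v] assms(2) by auto
qed

lemma opt_affordable:
  assumes "finite A" "0 \<le> B" "cost_vector A c"
  shows "opt v {i \<in> A. c i \<le> B} B c = opt v A B c"
proof -
  have "S \<subseteq> {i \<in> A. c i \<le> B}" if "S \<subseteq> A" "sum c S \<le> B" for S
  proof
    fix i assume i: "i \<in> S"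
    have "c i \<le> sum c S" by (rule member_le_sum) (use that i assms finite_subset in \<open>auto simp: cost_vector_def\<close>)
    then show "i \<in> {i \<in> A. c i \<le> B}" using i that by auto
  qed
  then have "{v S | S. S \<subseteq> {i \<in> A. c i \<le> B} \<and> sum c S \<le> B} = {v S | S. S \<subseteq> A \<and> sum c S \<le> B}" by blast
  then show ?thesis by (simp add: opt_def)
qed

context submodular
begin

lemma opt_nonneg: "finite A \<Longrightarrow> 0 \<le> B \<Longrightarrow> 0 \<le> opt v A B c"
  using opt_upper[of A "{}" c B v] v_empty by simp

lemma opt_le: "finite A \<Longrightarrow> 0 \<le> B \<Longrightarrow> opt v A B c \<le> v A"
  using opt_attained[of A B c v] v_mono by metis

lemma opt_remove:
  assumes "finite A" "0 \<le> B" "cost_vector A c"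
  shows "opt v A B c \<le> opt v (A - {k}) B c + v {k}"
proof -
  obtain S where S: "S \<subseteq> A" "sum c S \<le> B" "opt v A B c = v S" using opt_attained assms by metis
  have "sum c (S - {k}) \<le> sum c S"
    by (rule sum_mono2) (use S assms finite_subset in \<open>auto simp: cost_vector_def\<close>)
  then have "v (S - {k}) \<le> opt v (A - {k}) B c"
    using S assms by (intro opt_upper) auto
  moreover have "v S \<le> v (insert k (S - {k}))" by (rule v_mono) auto
  then have "v S \<le> v (S - {k}) + v {k}" using v_insert_le[of k "S - {k}"] by linarith
  ultimately show ?thesis using S by simp
qed

end

subsection \<open>Greedy prefixes\<close>

definition reached :: "('a::linorder set \<Rightarrow> real) \<Rightarrow> 'a costs \<Rightarrow> 'a set \<Rightarrow> 'a set \<Rightarrow> 'a \<Rightarrow> bool" where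
  "reached v c A P i \<longleftrightarrow> (\<exists>k<card A. P = greedy_set v c A k \<and> i = item v c A (Suc k) \<and> marginal v i P \<noteq> 0)"

definition selected :: "('a::linorder set \<Rightarrow> real) \<Rightarrow> 'a costs \<Rightarrow> 'a set \<Rightarrow> ('a set \<Rightarrow> 'a \<Rightarrow> bool) \<Rightarrow> 'a set" where
  "selected v c A T = {i. \<exists>P. reached v c A P i \<and> T P i}"

lemma greedy_set_Suc_item: "greedy_set v c A (Suc k) = insert (item v c A (Suc k)) (greedy_set v c A k)"
  by (simp add: item_def)

lemma greedy_set_props:
  assumes "finite A"
  shows "k \<le> card A \<Longrightarrow> greedy_set v c A k \<subseteq> A \<and> card (greedy_set v c A k) = k"
proof (induction k)
  case (Suc k)
  then have IH: "greedy_set v c A k \<subseteq> A" "card (greedy_set v c A k) = k" by auto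
  let ?S = "greedy_set v c A k"
  have "A - ?S \<noteq> {}" using IH Suc.prems assms by (metis Diff_eq_empty_iff card_mono finite_subset not_less_eq_eq)
  then have "most_efficient v c (A - ?S) ?S \<in> A - ?S" using assms by (intro most_efficient_in) auto
  then show ?case using IH assms finite_subset[OF IH(1)] by auto
qed simp

lemma item_props:
  assumes "finite A" "k < card A"
  shows "item v c A (Suc k) \<in> A - greedy_set v c A k"
    and "j \<in> A - greedy_set v c A k \<Longrightarrow>
      efficiency v c (greedy_set v c A k) j \<le> efficiency v c (greedy_set v c A k) (item v c A (Suc k))"
proof -
  let ?S = "greedy_set v c A k"
  have "?S \<subseteq> A" "card ?S = k" using greedy_set_props[OF assms(1), of k v c] assms by auto
  then have "A - ?S \<noteq> {}" using assms by (metis Diff_eq_empty_iff card_mono finite_subset not_less)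
  then show "item v c A (Suc k) \<in> A - ?S" using assms by (simp add: item_def most_efficient_in del: Diff_iff)
  show "j \<in> A - ?S \<Longrightarrow> efficiency v c ?S j \<le> efficiency v c ?S (item v c A (Suc k))"
    using assms by (simp add: item_def most_efficient_ge)
qed

lemma greedy_set_mono: "k \<le> l \<Longrightarrow> greedy_set v c A k \<subseteq> greedy_set v c A l"
  by (rule lift_Suc_mono_le[of "greedy_set v c A"]) auto

lemma greedy_set_items: "greedy_set v c A k = {item v c A (Suc l) | l. l < k}"
proof (induction k)
  case (Suc k)
  then show ?case unfolding greedy_set_Suc_item Suc.IH by (auto simp: less_Suc_eq)
qed simp

lemma greedy_set_full: "finite A \<Longrightarrow> greedy_set v c A (card A) = A"
  using greedy_set_props[of A "card A" v c] card_subset_eq by blast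

locale greedy = submodular v for v :: "'a::linorder set \<Rightarrow> real" +
  fixes A :: "'a set"
  assumes finite_A: "finite A"
begin

lemma zero_item:
  assumes c: "cost_vector A c" and k: "k < card A"
    and z: "marginal v (item v c A (Suc k)) (greedy_set v c A k) = 0"
  shows "v (greedy_set v c A k) = v A"
proof -
  let ?S = "greedy_set v c A k"
  have S: "?S \<subseteq> A" using greedy_set_props[OF finite_A] k by auto
  have "marginal v j ?S = 0" if "j \<in> A - ?S" for j
  proof -
    have "efficiency v c ?S j \<le> efficiency v c ?S (item v c A (Suc k))"
      by (rule item_props(2)[OF finite_A k that])
    moreover have "0 \<le> c j" "0 \<le> c (item v c A (Suc k))"
      using c that item_props(1)[OF finite_A k] by (auto simp: cost_vector_def)
    ultimately show ?thesis using z by (auto simp: efficiency_le_iff)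
  qed
  then have "v (?S \<union> A) \<le> v ?S" using v_union_le[OF finite_A, of ?S] by simp
  then show ?thesis using v_mono[OF S] S by (simp add: sup.absorb2)
qed

lemma greedy_length_props:
  shows "greedy_length v c A Pr \<le> card A"
    and "k < greedy_length v c A Pr \<Longrightarrow> k < card A \<and>
      marginal v (item v c A (Suc k)) (greedy_set v c A k) \<noteq> 0 \<and> Pr (Suc k)"
    and "\<not> (greedy_length v c A Pr < card A \<and>
      marginal v (item v c A (Suc (greedy_length v c A Pr))) (greedy_set v c A (greedy_length v c A Pr)) \<noteq> 0 \<and>
      Pr (Suc (greedy_length v c A Pr)))"
proof -
  let ?Q = "\<lambda>k. \<not> (Suc k \<le> card A \<and> item_marginal v c A (Suc k) \<noteq> 0 \<and> Pr (Suc k))"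
  have eq: "greedy_length v c A Pr = (LEAST k. ?Q k)" by (simp add: greedy_length_def)
  have Q: "?Q (card A)" by simp
  show "greedy_length v c A Pr \<le> card A" unfolding eq by (rule Least_le[of ?Q, OF Q])
  show "k < greedy_length v c A Pr \<Longrightarrow> k < card A \<and>
      marginal v (item v c A (Suc k)) (greedy_set v c A k) \<noteq> 0 \<and> Pr (Suc k)"
    unfolding eq using not_less_Least[of k ?Q] by (auto simp: item_marginal_def)
  show "\<not> (greedy_length v c A Pr < card A \<and>
      marginal v (item v c A (Suc (greedy_length v c A Pr))) (greedy_set v c A (greedy_length v c A Pr)) \<noteq> 0 \<and>
      Pr (Suc (greedy_length v c A Pr)))"
    using LeastI[of ?Q, OF Q] unfolding eq[symmetric] by (auto simp: item_marginal_def)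
qed

lemma zero_item_mono:
  assumes c: "cost_vector A c" and k: "k < card A" "k \<le> l"
    and z: "marginal v (item v c A (Suc k)) (greedy_set v c A k) = 0" and l: "l < card A"
  shows "marginal v (item v c A (Suc l)) (greedy_set v c A l) = 0"
proof -
  have "v A \<le> v (greedy_set v c A l)"
    using zero_item[OF c k(1) z] v_mono[OF greedy_set_mono[OF k(2), of v c A]] by simp
  moreover have "insert (item v c A (Suc l)) (greedy_set v c A l) \<subseteq> A"
    using item_props(1)[OF finite_A l] greedy_set_props[OF finite_A, of l v c] l by auto
  then have "v (insert (item v c A (Suc l)) (greedy_set v c A l)) \<le> v A" by (rule v_mono)
  ultimately show ?thesis
    using marginal_nonneg[of "item v c A (Suc l)" "greedy_set v c A l"] by (simp add: marginal_def)
qed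

lemma positive_length:
  assumes c: "cost_vector A c"
  shows "k < greedy_length v c A (\<lambda>_. True) \<longleftrightarrow>
    k < card A \<and> marginal v (item v c A (Suc k)) (greedy_set v c A k) \<noteq> 0"
  using greedy_length_props(2)[of k c "\<lambda>_. True"] greedy_length_props(3)[of c "\<lambda>_. True"]
    zero_item_mono[OF c _ _ _ , of "greedy_length v c A (\<lambda>_. True)" k]
  by (meson le_less_trans not_less)

lemma reachedD:
  assumes "reached v c A P i"
  shows "i \<in> A" "i \<notin> P" "P \<subseteq> A" "0 < marginal v i P" "finite P"
    "\<And>j. j \<in> A - P \<Longrightarrow> efficiency v c P j \<le> efficiency v c P i"
proof -
  obtain k where k: "k < card A" "P = greedy_set v c A k" "i = item v c A (Suc k)" "marginal v i P \<noteq> 0"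
    using assms by (auto simp: reached_def)
  show "i \<in> A" "i \<notin> P" using item_props(1)[OF finite_A k(1)] k by auto
  show P: "P \<subseteq> A" using greedy_set_props[OF finite_A] k by auto
  show "finite P" using P finite_A finite_subset by blast
  show "0 < marginal v i P" using k(4) marginal_nonneg[of i P] by simp
  show "efficiency v c P j \<le> efficiency v c P i" if "j \<in> A - P" for j
    using item_props(2)[OF finite_A k(1)] that k by auto
qed

lemma reached_cases:
  assumes "reached v c A P i" "reached v c A Q j"
  shows "(P = Q \<and> i = j) \<or> insert i P \<subseteq> Q \<or> insert j Q \<subseteq> P"
proof -
  obtain k where k: "P = greedy_set v c A k" "i = item v c A (Suc k)" using assms(1) by (auto simp: reached_def)
  obtain l where l: "Q = greedy_set v c A l" "j = item v c A (Suc l)" using assms(2) by (auto simp: reached_def)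
  consider "k = l" | "Suc k \<le> l" | "Suc l \<le> k" by linarith
  then show ?thesis
  proof cases
    case 2
    then show ?thesis using greedy_set_mono[of "Suc k" l v c A] unfolding k l greedy_set_Suc_item by blast
  next
    case 3
    then show ?thesis using greedy_set_mono[of "Suc l" k v c A] unfolding k l greedy_set_Suc_item by blast
  qed (simp add: k l)
qed

lemma reached_unique: "reached v c A P i \<Longrightarrow> reached v c A Q i \<Longrightarrow> P = Q"
  using reached_cases[of c P i Q i] reachedD(2)[of c P i] reachedD(2)[of c Q i] by auto

lemma reached_prefix:
  assumes c: "cost_vector A c" and P: "reached v c A P i" and j: "j \<in> P"
  shows "\<exists>Q. reached v c A Q j \<and> insert j Q \<subseteq> P"
proof -
  obtain k where k: "k < card A" "P = greedy_set v c A k" "i = item v c A (Suc k)" "marginal v i P \<noteq> 0"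
    using P by (auto simp: reached_def)
  obtain l where l: "l < k" "j = item v c A (Suc l)" using j k greedy_set_items[of v c A k] by auto
  have "marginal v j (greedy_set v c A l) \<noteq> 0"
    using zero_item_mono[OF c, of l k] l k by auto
  then have "reached v c A (greedy_set v c A l) j"
    using l k unfolding reached_def by (intro exI[of _ l]) auto
  moreover have "insert j (greedy_set v c A l) \<subseteq> P"
    using greedy_set_mono[of "Suc l" k v c A] l k greedy_set_Suc_item by (metis Suc_leI)
  ultimately show ?thesis by blast
qed

lemma efficiency_update_le:
  assumes "0 \<le> b" "b \<le> c i"
  shows "efficiency v c S i \<le> efficiency v (c(i := b)) S i"
  using assms marginal_nonneg[of i S]
  by (auto simp: efficiency_def divide_left_mono)

lemma most_efficient_update:
  assumes R: "R \<subseteq> A" and b: "0 \<le> b" "b \<le> c i"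
    and ne: "most_efficient v (c(i := b)) R S \<noteq> i" and R0: "R \<noteq> {}"
  shows "most_efficient v c R S = most_efficient v (c(i := b)) R S"
proof -
  have fin: "finite R" using R finite_A finite_subset by blast
  define m where "m = most_efficient v (c(i := b)) R S"
  have other: "efficiency v (c(i := b)) S k = efficiency v c S k" if "k \<noteq> i" for k
    using that by (simp add: efficiency_def)
  have m: "m \<in> R" "\<And>k. k \<in> R \<Longrightarrow> efficiency v (c(i := b)) S k < efficiency v c S m \<or>
     efficiency v (c(i := b)) S k = efficiency v c S m \<and> m \<le> k"
    using most_efficient_iff[OF fin R0, of v "c(i := b)" S m] ne other[of m] by (auto simp: m_def)
  have "efficiency v c S k < efficiency v c S m \<or> efficiency v c S k = efficiency v c S m \<and> m \<le> k"
    if "k \<in> R" for k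
    using m(2)[OF that] efficiency_update_le[of b c i S, OF b] other[of k]
    by (cases "k = i") auto
  then have "most_efficient v c R S = m" using most_efficient_iff[OF fin R0] m(1) by blast
  then show ?thesis by (simp add: m_def)
qed

lemma reached_bid:
  assumes i: "reached v c A P i" and b: "0 \<le> b" "b \<le> c i"
  shows "\<exists>P'\<subseteq>P. reached v (c(i := b)) A P' i"
proof -
  obtain k where k: "k < card A" "P = greedy_set v c A k" "i = item v c A (Suc k)" "marginal v i P \<noteq> 0"
    using i by (auto simp: reached_def)
  define d where "d = c(i := b)"
  have "(\<exists>l<n. item v d A (Suc l) = i \<and> greedy_set v d A l \<subseteq> P) \<or> greedy_set v d A n = greedy_set v c A n"
    if "n \<le> k" for n
    using that
  proof (induction n)
    case (Suc n)
    from Suc.IH Suc.prems consider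
      "\<exists>l<n. item v d A (Suc l) = i \<and> greedy_set v d A l \<subseteq> P" | "greedy_set v d A n = greedy_set v c A n"
      by auto
    then show ?case
    proof cases
      case 1
      then show ?thesis using less_Suc_eq by blast
    next
      case 2
      have n: "n < card A" using Suc.prems k by simp
      have sub: "greedy_set v c A n \<subseteq> P" using greedy_set_mono[of n k] Suc.prems k by simp
      show ?thesis
      proof (cases "item v d A (Suc n) = i")
        case True
        then have "\<exists>l<Suc n. item v d A (Suc l) = i \<and> greedy_set v d A l \<subseteq> P"
          using sub 2 by (intro exI[of _ n]) simp
        then show ?thesis by blast
      next
        case False
        have "item v c A (Suc n) = item v d A (Suc n)"
          using most_efficient_update[of "A - greedy_set v c A n" b c i "greedy_set v c A n", OF _ b] False 2
            item_props(1)[OF finite_A n, of v c] unfolding d_def[symmetric] by (auto simp: item_def)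
        then show ?thesis using 2 unfolding greedy_set_Suc_item by simp
      qed
    qed
  qed simp
  from this[OF order_refl] consider
    l where "l < k" "item v d A (Suc l) = i" "greedy_set v d A l \<subseteq> P" | "greedy_set v d A k = P"
    using k by auto
  then show ?thesis
  proof cases
    case 1
    have "marginal v i P \<le> marginal v i (greedy_set v d A l)" using marginal_antimono 1 by auto
    then have "marginal v i (greedy_set v d A l) \<noteq> 0" using reachedD(4)[OF i] by simp
    then have "reached v d A (greedy_set v d A l) i"
      using 1 k unfolding reached_def by (intro exI[of _ l]) auto
    then show ?thesis using 1(3) unfolding d_def by blast
  next
    case 2
    have "item v d A (Suc k) = i"
    proof (rule ccontr)
      assume ne: "item v d A (Suc k) \<noteq> i"
      have "item v c A (Suc k) = item v d A (Suc k)"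
        using most_efficient_update[of "A - P" b c i P, OF _ b] ne 2
            item_props(1)[OF finite_A k(1), of v c] k(2) unfolding d_def[symmetric] by (auto simp: item_def)
      then show False using ne k by simp
    qed
    then have "reached v d A P i" using 2 k by (auto simp: reached_def)
    then show ?thesis using d_def by blast
  qed
qed

lemma greedy_select_eq:
  assumes c: "cost_vector A c"
  shows "greedy_select v c A b = selected v c A (\<lambda>P i. v (insert i P) \<le> b i)"
proof -
  have "greedy_select v c A b = {i. \<exists>k<greedy_length v c A (\<lambda>_. True).
      i = item v c A (Suc k) \<and> v (greedy_set v c A (Suc k)) \<le> b i}"
    (is "_ = ?R")
  proof (intro set_eqI iffI)
    fix i assume "i \<in> greedy_select v c A b"
    then obtain k where "1 \<le> k" "k \<le> greedy_length v c A (\<lambda>_. True)" "i = item v c A k"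
      "v (greedy_set v c A k) \<le> b (item v c A k)" by (auto simp: greedy_select_def)
    then show "i \<in> ?R" by (cases k) (auto simp: Suc_le_eq)
  next
    fix i assume "i \<in> ?R"
    then obtain k where "k < greedy_length v c A (\<lambda>_. True)" "i = item v c A (Suc k)"
      "v (greedy_set v c A (Suc k)) \<le> b i" by auto
    then show "i \<in> greedy_select v c A b"
      unfolding greedy_select_def by (intro CollectI exI[of _ "Suc k"]) (simp add: Suc_le_eq)
  qed
  then show ?thesis
    unfolding selected_def reached_def positive_length[OF c] greedy_set_Suc_item by auto
qed

lemma greedy_prefix_eq:
  assumes c: "cost_vector A c"
    and Pr: "\<And>k. k < card A \<Longrightarrow> Pr (Suc k) = T (greedy_set v c A k) (item v c A (Suc k))"
    and T: "\<And>P i Q j. reached v c A P i \<Longrightarrow> reached v c A Q j \<Longrightarrow> insert i P \<subseteq> Q \<Longrightarrow> T Q j \<Longrightarrow> T P i"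
  shows "greedy_set v c A (greedy_length v c A Pr) = selected v c A T"
proof -
  let ?L = "greedy_length v c A Pr"
  have "k < ?L \<longleftrightarrow> k < card A \<and> marginal v (item v c A (Suc k)) (greedy_set v c A k) \<noteq> 0 \<and>
      T (greedy_set v c A k) (item v c A (Suc k))" (is "_ \<longleftrightarrow> ?R") for k
  proof
    show "k < ?L \<Longrightarrow> ?R" using greedy_length_props(2)[of k c Pr] Pr by auto
    assume R: ?R
    show "k < ?L"
    proof (rule ccontr)
      assume "\<not> k < ?L"
      then have Lk: "?L \<le> k" by simp
      have L: "?L < card A" using Lk R by simp
      have m: "marginal v (item v c A (Suc ?L)) (greedy_set v c A ?L) \<noteq> 0"
        using zero_item_mono[OF c L Lk] R by auto
      have "T (greedy_set v c A ?L) (item v c A (Suc ?L))"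
      proof (cases "?L = k")
        case True then show ?thesis using R by simp
      next
        case False
        have rL: "reached v c A (greedy_set v c A ?L) (item v c A (Suc ?L))" using L m by (auto simp: reached_def)
        have rk: "reached v c A (greedy_set v c A k) (item v c A (Suc k))" using R by (auto simp: reached_def)
        have "insert (item v c A (Suc ?L)) (greedy_set v c A ?L) \<subseteq> greedy_set v c A k"
          using greedy_set_mono[of "Suc ?L" k v c A] False Lk greedy_set_Suc_item by (metis Suc_leI le_neq_implies_less)
        then show ?thesis using T[OF rL rk] R by blast
      qed
      then show False using greedy_length_props(3)[of c Pr] L m Pr by auto
    qed
  qed
  then show ?thesis unfolding greedy_set_items selected_def reached_def by auto
qed

lemma first_failure:
  assumes c: "cost_vector A c"
  obtains "v (selected v c A T) = v A"
  | P i where "reached v c A P i" "\<not> T P i" "P \<subseteq> selected v c A T"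
proof -
  let ?L = "greedy_length v c A (\<lambda>_. True)"
  let ?F = "\<lambda>k. k < ?L \<and> \<not> T (greedy_set v c A k) (item v c A (Suc k))"
  have pos: "reached v c A (greedy_set v c A k) (item v c A (Suc k))" if "k < ?L" for k
    using that positive_length[OF c] by (auto simp: reached_def)
  show thesis
  proof (cases "\<exists>k. ?F k")
    case True
    then obtain k where k: "?F k" "\<And>l. l < k \<Longrightarrow> \<not> ?F l" using exists_least_iff[of ?F] by blast
    have "greedy_set v c A k \<subseteq> selected v c A T"
    proof
      fix j assume "j \<in> greedy_set v c A k"
      then obtain l where l: "l < k" "j = item v c A (Suc l)" by (auto simp: greedy_set_items)
      then show "j \<in> selected v c A T" using k pos[of l] unfolding selected_def by auto
    qed
    then show thesis using that(2) pos[of k] k by blast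
  next
    case False
    have sub: "greedy_set v c A ?L \<subseteq> selected v c A T"
    proof
      fix j assume "j \<in> greedy_set v c A ?L"
      then obtain l where l: "l < ?L" "j = item v c A (Suc l)" by (auto simp: greedy_set_items)
      then show "j \<in> selected v c A T" using False pos[of l] unfolding selected_def by auto
    qed
    have "v (greedy_set v c A ?L) = v A"
    proof (cases "?L < card A")
      case True
      then show ?thesis using zero_item[OF c True] positive_length[OF c, of ?L] by auto
    next
      case False
      then have "?L = card A" using greedy_length_props(1)[of c "\<lambda>_. True"] by simp
      then show ?thesis using greedy_set_full[OF finite_A, of v c] by simp
    qed
    moreover have "selected v c A T \<subseteq> A" using reachedD(1) by (auto simp: selected_def)
    ultimately show thesis using that(1) v_mono[OF sub] v_mono[of "selected v c A T" A] by simp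
  qed
qed

lemma reached_sum:
  assumes W: "\<And>i. i \<in> W \<Longrightarrow> reached v c A (pre i) i"
  shows "increasing v W \<and> (\<Sum>i\<in>W. marginal v i (pre i)) \<le> v W"
proof -
  have "k \<le> card A \<Longrightarrow> increasing v (W \<inter> greedy_set v c A k) \<and>
    (\<Sum>i\<in>W \<inter> greedy_set v c A k. marginal v i (pre i)) \<le> v (W \<inter> greedy_set v c A k)" for k
  proof (induction k)
    case 0
    then show ?case by (simp add: v_empty increasing_empty)
  next
    case (Suc k)
    let ?S = "greedy_set v c A k" and ?j = "item v c A (Suc k)"
    have k: "k < card A" using Suc.prems by simp
    have jS: "?j \<notin> ?S" using item_props(1)[OF finite_A k, of v c] by simp
    have "?S \<subseteq> A" using greedy_set_props[OF finite_A, of k v c] k by simp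
    then have fS: "finite (W \<inter> ?S)" using finite_subset[OF _ finite_A] by simp
    show ?case
    proof (cases "?j \<in> W")
      case False
      then have "W \<inter> greedy_set v c A (Suc k) = W \<inter> ?S" unfolding greedy_set_Suc_item by auto
      then show ?thesis using Suc by simp
    next
      case True
      have pj: "pre ?j = ?S"
      proof -
        obtain l where l: "l < card A" "pre ?j = greedy_set v c A l" "?j = item v c A (Suc l)"
          using W[OF True] by (auto simp: reached_def)
        have "\<not> l < k" using l(3) jS greedy_set_items[of v c A k] by (metis (mono_tags, lifting) mem_Collect_eq)
        moreover have "\<not> k < l"
          using l(3) item_props(1)[OF finite_A l(1), of v c] greedy_set_items[of v c A l] by (metis (mono_tags, lifting) DiffE mem_Collect_eq)
        ultimately have "l = k" by linarith
        then show ?thesis using l(2) by simp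
      qed
      have eq: "W \<inter> greedy_set v c A (Suc k) = insert ?j (W \<inter> ?S)" using True unfolding greedy_set_Suc_item by auto
      have m: "marginal v ?j ?S \<le> marginal v ?j (W \<inter> ?S)" using marginal_antimono by blast
      moreover have "0 < marginal v ?j ?S" using reachedD(4)[OF W[OF True]] pj by simp
      ultimately have inc: "increasing v (insert ?j (W \<inter> ?S))" using Suc k by (intro increasing_insert) auto
      have "(\<Sum>i\<in>insert ?j (W \<inter> ?S). marginal v i (pre i)) = marginal v ?j ?S + (\<Sum>i\<in>W \<inter> ?S. marginal v i (pre i))"
        using jS fS pj by simp
      also have "\<dots> \<le> marginal v ?j (W \<inter> ?S) + v (W \<inter> ?S)" using m Suc k by simp
      finally show ?thesis unfolding eq using inc by (simp add: marginal_def)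
    qed
  qed
  from this[of "card A"] greedy_set_full[OF finite_A, of v c]
  have "increasing v (W \<inter> A) \<and> (\<Sum>i\<in>W \<inter> A. marginal v i (pre i)) \<le> v (W \<inter> A)" by auto
  moreover have "W \<inter> A = W" using W reachedD(1) by blast
  ultimately show ?thesis by simp
qed

lemma reached_ratio_mono:
  assumes c: "cost_vector A c" and j: "reached v c A P j" and l: "reached v c A Q l" and sub: "insert j P \<subseteq> Q"
  shows "c j * marginal v l Q \<le> marginal v j P * c l"
proof -
  have lA: "l \<in> A - P" using reachedD(1,2)[OF l] sub by auto
  have c0: "0 \<le> c j" "0 \<le> c l" using c lA reachedD(1)[OF j] by (auto simp: cost_vector_def)
  have "c j * marginal v l Q \<le> c j * marginal v l P"
    using marginal_antimono[of P Q l] sub c0 by (intro mult_left_mono) auto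
  also have "\<dots> \<le> marginal v j P * c l"
    by (rule efficiency_le_mult[OF reachedD(6)[OF j lA] c0])
  finally show ?thesis .
qed

lemma reached_cover:
  assumes c: "cost_vector A c" and i: "reached v c A P i" and U: "U \<subseteq> A"
  shows "c i * (v U - v (insert i P)) \<le> marginal v i P * sum c (U - insert i P)"
    and "c i * (v U - v P) \<le> marginal v i P * sum c (U - P)"
  using efficiency_cover_insert[of U c i P] efficiency_cover[of U c i P] reachedD[OF i] U c
    finite_subset[OF U finite_A]
  by (auto simp: cost_vector_def subset_iff)

text \<open>Let \<open>i\<close> win with \<open>b\<close> after \<open>P'\<close>, and let \<open>W = f c\<close>. The greedy order and \<open>thr\<close> give
  \<open>b \<cdot> v U \<le> (\<kappa> + \<gamma>) \<cdot> B \<cdot> marginal v i P'\<close>, hence \<open>b \<cdot> v W \<le> B \<cdot> marginal v i P'\<close> by \<open>tot\<close>.\<close>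

lemma sound_selected:
  assumes B: "0 \<le> B"
    and f: "\<And>c. cost_vector A c \<Longrightarrow> f c = selected v c A (T c)"
    and mono: "\<And>c i P P' b. cost_vector A c \<Longrightarrow> reached v c A P i \<Longrightarrow> T c P i \<Longrightarrow> 0 \<le> b \<Longrightarrow> b \<le> c i \<Longrightarrow>
      reached v (c(i := b)) A P' i \<Longrightarrow> P' \<subseteq> P \<Longrightarrow> T (c(i := b)) P' i"
    and thr: "\<And>c P i. cost_vector A c \<Longrightarrow> reached v c A P i \<Longrightarrow> T c P i \<Longrightarrow>
      c i * v (insert i P) \<le> \<gamma> * B * marginal v i P"
    and tot: "\<And>c. cost_vector A c \<Longrightarrow> f c \<noteq> {} \<Longrightarrow> \<exists>U\<subseteq>A. sum c U \<le> \<kappa> * B \<and> v (f c) \<le> \<alpha> * v U"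
    and \<alpha>: "0 \<le> \<alpha>" "\<alpha> * (\<kappa> + \<gamma>) \<le> 1"
  shows "sound {0..} v A B f"
  unfolding sound_def
proof (intro allI impI)
  fix c :: "'a costs" assume "\<forall>i\<in>A. c i \<in> {0..}"
  then have c: "cost_vector A c" by (simp add: cost_vector_def)
  define W where "W = f c"
  define pre where "pre i = (SOME P. reached v c A P i \<and> T c P i)" for i
  have pre: "reached v c A (pre i) i" "T c (pre i) i" if "i \<in> W" for i
    using that someI_ex[of "\<lambda>P. reached v c A P i \<and> T c P i"] f[OF c]
    by (auto simp: W_def selected_def pre_def)
  have WA: "W \<subseteq> A" using pre reachedD(1) by blast
  have inc: "increasing v W" and tot_m: "(\<Sum>i\<in>W. marginal v i (pre i)) \<le> v W"
    using reached_sum[of W c pre] pre by auto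
  have monoW: "i \<in> f (c(i := b))" if i: "i \<in> W" and b: "0 \<le> b" "b \<le> c i" for i b
  proof -
    obtain P' where "P' \<subseteq> pre i" "reached v (c(i := b)) A P' i"
      using reached_bid[OF pre(1)[OF i] b] by auto
    then show ?thesis
      using mono[OF c pre[OF i] b] f[OF cost_vector_update[OF c b(1)]] by (auto simp: selected_def)
  qed
  define p where "p i = B * marginal v i (pre i) / v W" for i
  have vW: "0 < v W" if "i \<in> W" for i
  proof -
    have "0 < v {i}" using marginal_le_single[of i "pre i"] reachedD(4)[OF pre(1)[OF that]] by simp
    then show ?thesis using v_mono[of "{i}" W] that by simp
  qed
  have bound: "b \<le> p i" if i: "i \<in> W" and b: "c i \<le> b" and win: "i \<in> f (c(i := b))" for i b
  proof -
    let ?d = "c(i := b)"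
    have c0: "0 \<le> c i" using c WA i by (auto simp: cost_vector_def)
    then have b0: "0 \<le> b" using b by simp
    have d: "cost_vector A ?d" by (rule cost_vector_update[OF c b0])
    obtain P' where P': "reached v ?d A P' i" "T ?d P' i" using win f[OF d] by (auto simp: selected_def)
    obtain P'' where "P'' \<subseteq> P'" "reached v (?d(i := c i)) A P'' i"
      using reached_bid[OF P'(1), of "c i"] c0 b by auto
    then have sub: "pre i \<subseteq> P'" using reached_unique[OF pre(1)[OF i]] by auto
    obtain U where U: "U \<subseteq> A" "sum c U \<le> \<kappa> * B" "v W \<le> \<alpha> * v U" using tot[OF c] i by (auto simp: W_def)
    have m0: "0 \<le> marginal v i P'" by (rule marginal_nonneg)
    have "b * (v U - v (insert i P')) \<le> marginal v i P' * sum ?d (U - insert i P')"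
      using reached_cover(1)[OF d P'(1) U(1)] by simp
    also have "sum ?d (U - insert i P') = sum c (U - insert i P')" by (rule sum.cong) auto
    also have "marginal v i P' * sum c (U - insert i P') \<le> marginal v i P' * sum c U"
      using U c finite_A m0 by (intro mult_left_mono sum_mono2) (auto simp: cost_vector_def finite_subset)
    also have "\<dots> \<le> marginal v i P' * (\<kappa> * B)" using U m0 by (intro mult_left_mono)
    finally have 1: "b * v U \<le> marginal v i P' * (\<kappa> * B) + b * v (insert i P')" by (simp add: algebra_simps)
    have 2: "b * v (insert i P') \<le> \<gamma> * B * marginal v i P'" using thr[OF d P'] by simp
    have "b * v W \<le> b * (\<alpha> * v U)" using U b0 by (intro mult_left_mono)
    also have "\<dots> = \<alpha> * (b * v U)" by simp
    also have "\<dots> \<le> \<alpha> * ((\<kappa> + \<gamma>) * (B * marginal v i P'))"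
      using 1 2 \<alpha>(1) by (intro mult_left_mono) (auto simp: algebra_simps)
    also have "\<dots> = \<alpha> * (\<kappa> + \<gamma>) * (B * marginal v i P')" by simp
    also have "\<dots> \<le> 1 * (B * marginal v i P')" using \<alpha>(2) B m0 by (intro mult_right_mono) auto
    also have "\<dots> \<le> B * marginal v i (pre i)"
      using B marginal_antimono[OF sub] by (simp add: mult_left_mono)
    finally show ?thesis using vW[OF i] by (simp add: p_def field_simps)
  qed
  have p: "b \<le> p i" if i: "i \<in> W" and win: "i \<in> f (c(i := b))" for i b
    using bound[OF i _ win] bound[OF i order_refl] i by (force simp: W_def)
  have "sum p W \<le> B"
  proof (cases "W = {}")
    case False
    then have v: "0 < v W" using vW by auto
    have "sum p W = B * (\<Sum>i\<in>W. marginal v i (pre i)) / v W"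
      by (simp add: p_def sum_divide_distrib sum_distrib_left)
    also have "\<dots> \<le> B * v W / v W" using tot_m B v by (intro divide_right_mono mult_left_mono) auto
    finally show ?thesis using v by simp
  qed (simp add: B)
  then show "f c \<subseteq> A \<and> increasing v (f c) \<and> (\<forall>i\<in>f c. \<forall>b\<in>{0..}. b \<le> c i \<longrightarrow> i \<in> f (c(i := b))) \<and>
    (\<exists>p. (\<forall>i\<in>f c. \<forall>b\<in>{0..}. i \<in> f (c(i := b)) \<longrightarrow> b \<le> p i) \<and> sum p (f c) \<le> B)"
    using WA inc monoW p unfolding W_def by (intro conjI exI[of _ p]) auto
qed

end

section \<open>The mechanisms\<close>

lemma selected_cong:
  "(\<And>P i. reached v c A P i \<Longrightarrow> T P i \<longleftrightarrow> T' P i) \<Longrightarrow> selected v c A T = selected v c A T'"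
  by (auto simp: selected_def)

lemma approx_oracleD:
  assumes "approx_oracle r v A orc" "A' \<subseteq> A" "0 < B" "cost_vector A' c"
  shows "orc A' B v c \<le> opt v A' B c" "opt v A' B c \<le> r * orc A' B v c"
    "\<And>d. (\<And>i. i \<in> A' \<Longrightarrow> d i = c i) \<Longrightarrow> orc A' B v d = orc A' B v c"
  using assms unfolding approx_oracle_def by blast+

lemma approx_oracle_subset: "approx_oracle r v A orc \<Longrightarrow> A' \<subseteq> A \<Longrightarrow> approx_oracle r v A' orc"
  unfolding approx_oracle_def by (meson subset_trans)

lemma opt_cong: "(\<And>i. i \<in> A \<Longrightarrow> d i = c i) \<Longrightarrow> opt v A B d = opt v A B c"
proof -
  assume *: "\<And>i. i \<in> A \<Longrightarrow> d i = c i"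
  have "sum d S = sum c S" if "S \<subseteq> A" for S using * that by (intro sum.cong) auto
  then have "{v S | S. S \<subseteq> A \<and> sum d S \<le> B} = {v S | S. S \<subseteq> A \<and> sum c S \<le> B}" by auto
  then show ?thesis by (simp add: opt_def)
qed

lemma approx_oracle_opt: "approx_oracle 1 v A (\<lambda>A B v c. opt v A B c)"
  unfolding approx_oracle_def using opt_cong by (metis mult_1 order_refl)

lemma cost_vector_subset: "cost_vector A c \<Longrightarrow> A' \<subseteq> A \<Longrightarrow> cost_vector A' c"
  by (auto simp: cost_vector_def)

context greedy
begin

lemma v_insert_mono: "S \<subseteq> S' \<Longrightarrow> v (insert i S) \<le> v (insert i S')"
  by (rule v_mono) auto

lemma v_le_insert: "S \<subseteq> S' \<Longrightarrow> v S \<le> v (insert j S')"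
  by (rule v_mono) auto

lemma last_selected:
  assumes "selected v c A T \<noteq> {}"
  obtains P i where "reached v c A P i" "T P i" "selected v c A T \<subseteq> insert i P"
proof -
  let ?Q = "\<lambda>(P, i). reached v c A P i \<and> T P i"
  obtain x where x: "?Q x" using assms by (auto simp: selected_def)
  have "card (fst y) \<le> card A" if "?Q y" for y
    using that by (cases y) (auto intro!: card_mono[OF finite_A] dest: reachedD(3))
  then have "\<exists>z. ?Q z \<and> (\<forall>y. ?Q y \<longrightarrow> card (fst y) \<le> card (fst z))"
    using ex_has_greatest_nat[of ?Q x "\<lambda>y. card (fst y)" "Suc (card A)"] x by (simp add: less_Suc_eq_le)
  then obtain z where z: "?Q z" "\<And>y. ?Q y \<Longrightarrow> card (fst y) \<le> card (fst z)" by blast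
  obtain P i where Pi: "z = (P, i)" by (cases z)
  have "selected v c A T \<subseteq> insert i P"
  proof
    fix j assume "j \<in> selected v c A T"
    then obtain Q where Q: "reached v c A Q j" "T Q j" by (auto simp: selected_def)
    have le: "card Q \<le> card P" using z(2)[of "(Q, j)"] Q Pi by simp
    have rP: "reached v c A P i" using z(1) Pi by simp
    have "\<not> insert i P \<subseteq> Q"
      using le reachedD(2,5)[OF rP] reachedD(5)[OF Q(1)] card_mono[of Q "insert i P"] by auto
    then show "j \<in> insert i P" using reached_cases[OF rP Q(1)] by auto
  qed
  then show thesis using that z(1) Pi by auto
qed

lemma v_insert_pos: "reached v c A P i \<Longrightarrow> 0 < v (insert i P)"
  using reachedD(4)[of c P i] v_nonneg[of P] by (simp add: marginal_def)

lemma tm_eq: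
  assumes c: "cost_vector A c" and "0 < B" "0 \<le> \<gamma>"
  shows "greedy_tm \<gamma> v A B c =
    selected v c A (\<lambda>P i. c i / marginal v i P \<le> \<gamma> * (B / v (insert i P)))"
  unfolding greedy_tm_def
proof (rule greedy_prefix_eq[OF c])
  fix P i Q j assume i: "reached v c A P i" and j: "reached v c A Q j" and sub: "insert i P \<subseteq> Q"
    and T: "c j / marginal v j Q \<le> \<gamma> * (B / v (insert j Q))"
  have "c i / marginal v i P \<le> c j / marginal v j Q"
    using reached_ratio_mono[OF c i j sub] reachedD(4)[OF i] reachedD(4)[OF j] by (simp add: field_simps)
  also note T
  also have "\<gamma> * (B / v (insert j Q)) \<le> \<gamma> * (B / v (insert i P))"
    using v_insert_pos[OF i] v_le_insert[OF sub, of j] assms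
    by (intro mult_left_mono divide_left_mono mult_pos_pos) auto
  finally show "c i / marginal v i P \<le> \<gamma> * (B / v (insert i P))" .
qed (simp add: item_marginal_def item_def)

lemma eom_eq:
  assumes c: "cost_vector A c"
  shows "greedy_eom \<alpha> v A B c = selected v c A (\<lambda>P i. v (insert i P) \<le> \<alpha> * opt v A B c)"
  unfolding greedy_eom_def
proof (rule greedy_prefix_eq[OF c])
  fix P i Q j assume "insert i P \<subseteq> Q" "v (insert j Q) \<le> \<alpha> * opt v A B c"
  then show "v (insert i P) \<le> \<alpha> * opt v A B c" using v_le_insert by (meson order_trans)
qed (simp add: item_def)

lemma eom_eq_modified:
  assumes c: "cost_vector A c" and B: "0 < B"
  shows "greedy_eom \<alpha> v A B c = modified_greedy_om (\<lambda>A B v c. opt v A B c) \<alpha> v A B c"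
  unfolding eom_eq[OF c] modified_greedy_om_def greedy_select_eq[OF c]
proof (rule selected_cong)
  fix P i
  have "(SUP x\<in>{c i..}. opt v A B (c(i := x))) = opt v A B c"
  proof (rule cSup_eq_maximum)
    show "opt v A B c \<in> (\<lambda>x. opt v A B (c(i := x))) ` {c i..}"
      by (rule image_eqI[of _ _ "c i"]) auto
    show "y \<le> opt v A B c" if "y \<in> (\<lambda>x. opt v A B (c(i := x))) ` {c i..}" for y
      using that opt_mono[OF finite_A order_refl, of B c _ v] B by auto
  qed
  then show "v (insert i P) \<le> \<alpha> * opt v A B c \<longleftrightarrow>
    v (insert i P) \<le> \<alpha> * (SUP x\<in>{c i..}. opt v A B (c(i := x)))" by simp
qed

lemma oracle_sup_le:
  assumes orc: "approx_oracle r v A orc" and c: "cost_vector A c" and B: "0 < B" and i: "i \<in> A"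
  shows "bdd_above ((\<lambda>x. orc A B v (c(i := x))) ` {c i..})"
    and "(SUP x\<in>{c i..}. orc A B v (c(i := x))) \<le> opt v A B c"
    and "orc A B v c \<le> (SUP x\<in>{c i..}. orc A B v (c(i := x)))"
proof -
  have c0: "0 \<le> c i" using c i by (simp add: cost_vector_def)
  have le: "orc A B v (c(i := x)) \<le> opt v A B c" if "c i \<le> x" for x
  proof -
    have "cost_vector A (c(i := x))" using cost_vector_update[OF c] c0 that by auto
    then have "orc A B v (c(i := x)) \<le> opt v A B (c(i := x))"
      by (rule approx_oracleD(1)[OF orc order_refl B])
    also have "\<dots> \<le> opt v A B c" by (rule opt_mono[OF finite_A]) (use B that in auto)
    finally show ?thesis .
  qed
  show bdd: "bdd_above ((\<lambda>x. orc A B v (c(i := x))) ` {c i..})"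
    by (rule bdd_aboveI[of _ "opt v A B c"]) (use le in auto)
  show "(SUP x\<in>{c i..}. orc A B v (c(i := x))) \<le> opt v A B c"
    by (rule cSUP_least) (use le in auto)
  show "orc A B v c \<le> (SUP x\<in>{c i..}. orc A B v (c(i := x)))"
    using cSUP_upper[OF _ bdd, of "c i"] by simp
qed

subsection \<open>Truthfulness and budget feasibility\<close>

lemma threshold_bound:
  assumes i: "reached v c A P i" and T: "c i / marginal v i P \<le> \<gamma> * (B / v (insert i P))"
  shows "c i * v (insert i P) \<le> \<gamma> * B * marginal v i P"
  using T reachedD(4)[OF i] v_insert_pos[OF i] by (simp add: field_simps)

lemma threshold_mono:
  assumes i: "reached v c A P i" and T: "c i / marginal v i P \<le> \<gamma> * (B / v (insert i P))"
    and b: "0 \<le> b" "b \<le> c i" and i': "reached v (c(i := b)) A P' i" and sub: "P' \<subseteq> P" and B: "0 < B" "0 \<le> \<gamma>"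
  shows "(c(i := b)) i / marginal v i P' \<le> \<gamma> * (B / v (insert i P'))"
proof -
  have "b / marginal v i P' \<le> c i / marginal v i P"
    using b reachedD(4)[OF i] reachedD(4)[OF i'] marginal_antimono[OF sub, of i] by (intro frac_le) auto
  also note T
  also have "\<gamma> * (B / v (insert i P)) \<le> \<gamma> * (B / v (insert i P'))"
    using v_insert_pos[OF i'] v_insert_mono[OF sub, of i] B
    by (intro mult_left_mono divide_left_mono mult_pos_pos) auto
  finally show ?thesis by simp
qed

lemma sound_tm:
  assumes B: "0 < B"
  shows "sound {0..} v A B (greedy_tm (1 / 2) v A B)"
proof (rule sound_selected[where \<kappa> = "1 / 2" and \<gamma> = "1 / 2" and \<alpha> = 1])
  let ?T = "\<lambda>c P i. c i / marginal v i P \<le> 1 / 2 * (B / v (insert i P))"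
  show eq: "greedy_tm (1 / 2) v A B c = selected v c A (?T c)" if "cost_vector A c" for c
    using tm_eq[OF that B] by simp
  show "?T (c(i := b)) P' i" if "reached v c A P i" "?T c P i" "0 \<le> b" "b \<le> c i"
    "reached v (c(i := b)) A P' i" "P' \<subseteq> P" for c i P P' b
    using threshold_mono[OF that B] by simp
  show "c i * v (insert i P) \<le> 1 / 2 * B * marginal v i P" if "reached v c A P i" "?T c P i" for c P i
    using threshold_bound[OF that] .
  show "\<exists>U\<subseteq>A. sum c U \<le> 1 / 2 * B \<and> v (greedy_tm (1 / 2) v A B c) \<le> 1 * v U"
    if c: "cost_vector A c" and ne: "greedy_tm (1 / 2) v A B c \<noteq> {}" for c
  proof -
    define W where "W = greedy_tm (1 / 2) v A B c"
    obtain P l where l: "reached v c A P l" "?T c P l" and sub: "W \<subseteq> insert l P"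
      by (rule last_selected[of c "?T c"]) (use ne eq[OF c] in \<open>simp_all add: W_def\<close>)
    define pre where "pre j = (SOME Q. reached v c A Q j)" for j
    have pre: "reached v c A (pre j) j" if "j \<in> insert l P" for j
      using that l(1) reached_prefix[OF c l(1)] someI_ex[of "\<lambda>Q. reached v c A Q j"]
      unfolding pre_def by blast
    have m0: "0 < marginal v l P" by (rule reachedD(4)[OF l(1)])
    have cl: "0 \<le> c l" using reachedD(1)[OF l(1)] c by (simp add: cost_vector_def)
    have "c j * marginal v l P \<le> marginal v j (pre j) * c l" if j: "j \<in> insert l P" for j
    proof (cases "j = l")
      case True
      then show ?thesis using reached_unique[OF pre[OF j]] l(1) by auto
    next
      case False
      then obtain Q where Q: "reached v c A Q j" "insert j Q \<subseteq> P" using reached_prefix[OF c l(1)] j by auto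
      then show ?thesis using reached_ratio_mono[OF c Q(1) l(1) Q(2)] reached_unique[OF pre[OF j] Q(1)] by simp
    qed
    then have "(\<Sum>j\<in>insert l P. c j * marginal v l P) \<le> (\<Sum>j\<in>insert l P. marginal v j (pre j) * c l)"
      by (rule sum_mono)
    also have "\<dots> = (\<Sum>j\<in>insert l P. marginal v j (pre j)) * c l" by (simp add: sum_distrib_right)
    also have "\<dots> \<le> v (insert l P) * c l"
      using reached_sum[of "insert l P" c pre] pre cl by (intro mult_right_mono) auto
    also have "\<dots> \<le> 1 / 2 * B * marginal v l P" using threshold_bound[OF l] by (simp add: mult.commute)
    finally have "sum c (insert l P) * marginal v l P \<le> 1 / 2 * B * marginal v l P"
      by (simp add: sum_distrib_right)
    then have le: "sum c (insert l P) \<le> 1 / 2 * B" using m0 by (simp only: mult_le_cancel_right_pos)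
    have "sum c W \<le> sum c (insert l P)"
      by (rule sum_mono2) (use sub reachedD(1,3,5)[OF l(1)] c in \<open>auto simp: cost_vector_def\<close>)
    moreover have "W \<subseteq> A" using sub reachedD(1,3)[OF l(1)] by auto
    ultimately show ?thesis using le unfolding W_def by (intro exI[of _ W]) (auto simp: W_def)
  qed
qed (use B in auto)

lemma sound_opt_half:
  assumes B: "0 < B"
    and f: "\<And>c. cost_vector A c \<Longrightarrow> f c = selected v c A (T c)"
    and mono: "\<And>c i P P' b. cost_vector A c \<Longrightarrow> reached v c A P i \<Longrightarrow> T c P i \<Longrightarrow> 0 \<le> b \<Longrightarrow> b \<le> c i \<Longrightarrow>
      reached v (c(i := b)) A P' i \<Longrightarrow> P' \<subseteq> P \<Longrightarrow> T (c(i := b)) P' i"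
    and half: "\<And>c P i. cost_vector A c \<Longrightarrow> reached v c A P i \<Longrightarrow> T c P i \<Longrightarrow>
      \<exists>U\<subseteq>A. sum c U \<le> B \<and> v (insert i P) \<le> 1 / 2 * v U"
  shows "sound {0..} v A B f"
proof (rule sound_selected[where \<kappa> = 1 and \<gamma> = 1 and \<alpha> = "1 / 2"])
  show "f c = selected v c A (T c)" if "cost_vector A c" for c by (rule f[OF that])
  show "T (c(i := b)) P' i" if "cost_vector A c" "reached v c A P i" "T c P i" "0 \<le> b" "b \<le> c i"
      "reached v (c(i := b)) A P' i" "P' \<subseteq> P" for c i P P' b
    by (rule mono[OF that])
  show "c i * v (insert i P) \<le> 1 * B * marginal v i P"
    if c: "cost_vector A c" and i: "reached v c A P i" "T c P i" for c P i
  proof -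
    obtain U where U: "U \<subseteq> A" "sum c U \<le> B" "v (insert i P) \<le> 1 / 2 * v U" using half[OF c i] by auto
    have "c i * v (insert i P) \<le> c i * (v U - v (insert i P))"
      using U(3) c reachedD(1)[OF i(1)] by (intro mult_left_mono) (auto simp: cost_vector_def)
    also have "\<dots> \<le> marginal v i P * sum c (U - insert i P)" by (rule reached_cover(1)[OF c i(1) U(1)])
    also have "\<dots> \<le> marginal v i P * sum c U"
      using U c finite_A marginal_nonneg
      by (intro mult_left_mono sum_mono2) (auto simp: cost_vector_def finite_subset)
    also have "\<dots> \<le> marginal v i P * B" using U(2) marginal_nonneg by (intro mult_left_mono)
    finally show ?thesis by (simp add: mult.commute)
  qed
  show "\<exists>U\<subseteq>A. sum c U \<le> 1 * B \<and> v (f c) \<le> 1 / 2 * v U" if c: "cost_vector A c" and ne: "f c \<noteq> {}" for c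
  proof -
    obtain P l where l: "reached v c A P l" "T c P l" and sub: "f c \<subseteq> insert l P"
      by (rule last_selected[of c "T c"]) (use ne f[OF c] in simp_all)
    obtain U where "U \<subseteq> A" "sum c U \<le> B" "v (insert l P) \<le> 1 / 2 * v U" using half[OF c l] by blast
    then show ?thesis using v_mono[OF sub] by (intro exI[of _ U]) simp
  qed
qed (use B in auto)

lemma oracle_remove_bid:
  assumes orc: "approx_oracle r v A orc" and c: "cost_vector A c" and B: "0 < B"
  shows "orc (A - {i}) B v (c(i := b)) = orc (A - {i}) B v c"
  by (rule approx_oracleD(3)[OF orc _ B]) (use c in \<open>auto simp: cost_vector_def\<close>)

lemma oracle_remove_attained:
  assumes orc: "approx_oracle r v A orc" and c: "cost_vector A c" and B: "0 < B"
  shows "\<exists>U\<subseteq>A. sum c U \<le> B \<and> orc (A - {i}) B v c \<le> v U"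
proof -
  obtain U where "U \<subseteq> A - {i}" "sum c U \<le> B" "opt v (A - {i}) B c = v U"
    using opt_attained[of "A - {i}" B c v] finite_A B by auto
  moreover have "orc (A - {i}) B v c \<le> opt v (A - {i}) B c"
    by (rule approx_oracleD(1)[OF orc _ B]) (use c in \<open>auto simp: cost_vector_def\<close>)
  ultimately show ?thesis by auto
qed

lemma om_eq: "cost_vector A c \<Longrightarrow> greedy_om orc \<alpha> v A B c =
    selected v c A (\<lambda>P i. v (insert i P) \<le> \<alpha> * orc (A - {i}) B v c)"
  by (simp add: greedy_om_def greedy_select_eq)

lemma mom_eq: "cost_vector A c \<Longrightarrow> modified_greedy_om orc \<alpha> v A B c =
    selected v c A (\<lambda>P i. v (insert i P) \<le> \<alpha> * (SUP x\<in>{c i..}. orc A B v (c(i := x))))"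
  by (simp add: modified_greedy_om_def greedy_select_eq)

lemma sound_om:
  assumes orc: "approx_oracle r v A orc" and B: "0 < B"
  shows "sound {0..} v A B (greedy_om orc (1 / 2) v A B)"
proof (rule sound_opt_half[OF B])
  let ?T = "\<lambda>c P i. v (insert i P) \<le> 1 / 2 * orc (A - {i}) B v c"
  show "greedy_om orc (1 / 2) v A B c = selected v c A (?T c)" if "cost_vector A c" for c
    by (rule om_eq[OF that])
  show "?T (c(i := b)) P' i" if "cost_vector A c" "?T c P i" "P' \<subseteq> P" for c i P P' b
    using that(2) oracle_remove_bid[OF orc that(1) B] v_insert_mono[OF that(3), of i] by simp
  show "\<exists>U\<subseteq>A. sum c U \<le> B \<and> v (insert i P) \<le> 1 / 2 * v U" if c: "cost_vector A c" and T: "?T c P i" for c P i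
  proof -
    obtain U where "U \<subseteq> A" "sum c U \<le> B" "orc (A - {i}) B v c \<le> v U"
      using oracle_remove_attained[OF orc c B, of i] by blast
    then show ?thesis using T by (intro exI[of _ U]) simp
  qed
qed

lemma sound_mom:
  assumes orc: "approx_oracle r v A orc" and B: "0 < B"
  shows "sound {0..} v A B (modified_greedy_om orc (1 / 2) v A B)"
proof (rule sound_opt_half[OF B])
  let ?T = "\<lambda>c P i. v (insert i P) \<le> 1 / 2 * (SUP x\<in>{c i..}. orc A B v (c(i := x)))"
  show "modified_greedy_om orc (1 / 2) v A B c = selected v c A (?T c)" if "cost_vector A c" for c
    by (rule mom_eq[OF that])
  show "?T (c(i := b)) P' i" if c: "cost_vector A c" and i: "reached v c A P i" and T: "?T c P i"
    and b: "0 \<le> b" "b \<le> c i" and sub: "P' \<subseteq> P" for c i P P' b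
  proof -
    have "(SUP x\<in>{c i..}. orc A B v (c(i := x))) \<le> (SUP x\<in>{b..}. orc A B v (c(i := x)))"
      using oracle_sup_le(1)[OF orc cost_vector_update[OF c b(1), of i] B reachedD(1)[OF i]] b
      by (intro cSUP_subset_mono) auto
    then show ?thesis using T v_insert_mono[OF sub, of i] by simp
  qed
  show "\<exists>U\<subseteq>A. sum c U \<le> B \<and> v (insert i P) \<le> 1 / 2 * v U"
    if c: "cost_vector A c" and i: "reached v c A P i" and T: "?T c P i" for c P i
  proof -
    obtain U where "U \<subseteq> A" "sum c U \<le> B" "opt v A B c = v U"
      using opt_attained[of A B c v] finite_A B by auto
    then show ?thesis using T oracle_sup_le(2)[OF orc c B reachedD(1)[OF i]]
      by (intro exI[of _ U]) simp
  qed
qed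

lemma sound_cong:
  assumes "sound {0..} v A B f" "\<And>c. cost_vector A c \<Longrightarrow> f c = g c"
  shows "sound {0..} v A B g"
  unfolding sound_def
proof (intro allI impI)
  fix c :: "'a costs" assume c: "\<forall>i\<in>A. c i \<in> {0..}"
  have eq: "f (c(i := b)) = g (c(i := b))" if "b \<in> {0..}" for i b
    using assms(2) cost_vector_update[of A c b i] c that by (auto simp: cost_vector_def)
  have eq0: "f c = g c" using assms(2) c by (auto simp: cost_vector_def)
  from soundE[OF assms(1) c] obtain p where "f c \<subseteq> A" "increasing v (f c)"
    "\<And>i b. i \<in> f c \<Longrightarrow> b \<in> {0..} \<Longrightarrow> b \<le> c i \<Longrightarrow> i \<in> f (c(i := b))"
    "\<And>i b. i \<in> f c \<Longrightarrow> b \<in> {0..} \<Longrightarrow> i \<in> f (c(i := b)) \<Longrightarrow> b \<le> p i" "sum p (f c) \<le> B" by blast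
  then show "g c \<subseteq> A \<and> increasing v (g c) \<and> (\<forall>i\<in>g c. \<forall>b\<in>{0..}. b \<le> c i \<longrightarrow> i \<in> g (c(i := b))) \<and>
     (\<exists>p. (\<forall>i\<in>g c. \<forall>b\<in>{0..}. i \<in> g (c(i := b)) \<longrightarrow> b \<le> p i) \<and> sum p (g c) \<le> B)"
    unfolding eq0 using eq by (intro conjI exI[of _ p]) auto
qed

lemma sound_eom:
  assumes "0 < B"
  shows "sound {0..} v A B (greedy_eom (1 / 2) v A B)"
  using sound_mom[OF approx_oracle_opt assms] by (rule sound_cong) (simp add: eom_eq_modified assms)

lemma selected_Int: "selected v c A T \<inter> selected v c A T' = selected v c A (\<lambda>P i. T P i \<and> T' P i)"
  unfolding selected_def using reached_unique by blast

lemma om_inter_tm_eq: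
  assumes c: "cost_vector A c" and "0 < B" "0 \<le> \<gamma>"
  shows "greedy_om orc \<alpha> v A B c \<inter> greedy_tm \<gamma> v A B c = selected v c A
    (\<lambda>P i. v (insert i P) \<le> \<alpha> * orc (A - {i}) B v c \<and> c i / marginal v i P \<le> \<gamma> * (B / v (insert i P)))"
  unfolding om_eq[OF c] tm_eq[OF assms] selected_Int ..

lemma sound_om_inter_tm:
  assumes orc: "approx_oracle r v A orc" and B: "0 < B" and \<alpha>: "0 \<le> \<alpha>" "0 \<le> \<gamma>" "\<alpha> * (1 + \<gamma>) \<le> 1"
  shows "sound {0..} v A B (\<lambda>c. greedy_om orc \<alpha> v A B c \<inter> greedy_tm \<gamma> v A B c)"
proof (rule sound_selected[where \<kappa> = 1 and \<gamma> = \<gamma> and \<alpha> = \<alpha>])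
  let ?T = "\<lambda>c P i. v (insert i P) \<le> \<alpha> * orc (A - {i}) B v c \<and> c i / marginal v i P \<le> \<gamma> * (B / v (insert i P))"
  show eq: "greedy_om orc \<alpha> v A B c \<inter> greedy_tm \<gamma> v A B c = selected v c A (?T c)" if "cost_vector A c" for c
    by (rule om_inter_tm_eq[OF that B \<alpha>(2)])
  show "?T (c(i := b)) P' i" if c: "cost_vector A c" and i: "reached v c A P i" and T: "?T c P i"
    and b: "0 \<le> b" "b \<le> c i" and i': "reached v (c(i := b)) A P' i" and sub: "P' \<subseteq> P" for c i P P' b
  proof
    show "v (insert i P') \<le> \<alpha> * orc (A - {i}) B v (c(i := b))"
      using T oracle_remove_bid[OF orc c B, of i b] v_insert_mono[OF sub, of i] by simp
    show "(c(i := b)) i / marginal v i P' \<le> \<gamma> * (B / v (insert i P'))"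
      using threshold_mono[OF i _ b i' sub B \<alpha>(2)] T by blast
  qed
  show "c i * v (insert i P) \<le> \<gamma> * B * marginal v i P" if "reached v c A P i" "?T c P i" for c P i
    using threshold_bound[OF that(1)] that(2) by blast
  show "\<exists>U\<subseteq>A. sum c U \<le> 1 * B \<and> v (greedy_om orc \<alpha> v A B c \<inter> greedy_tm \<gamma> v A B c) \<le> \<alpha> * v U"
    if c: "cost_vector A c" and ne: "greedy_om orc \<alpha> v A B c \<inter> greedy_tm \<gamma> v A B c \<noteq> {}" for c
  proof -
    obtain P l where l: "reached v c A P l" "?T c P l"
      and sub: "greedy_om orc \<alpha> v A B c \<inter> greedy_tm \<gamma> v A B c \<subseteq> insert l P"
      by (rule last_selected[of c "?T c"]) (use ne eq[OF c] in simp_all)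
    obtain U where U: "U \<subseteq> A" "sum c U \<le> B" "orc (A - {l}) B v c \<le> v U"
      using oracle_remove_attained[OF orc c B, of l] by auto
    have "v (insert l P) \<le> \<alpha> * v U" using l(2) mult_left_mono[OF U(3) \<alpha>(1)] by linarith
    then show ?thesis using U v_mono[OF sub] by (intro exI[of _ U]) auto
  qed
qed (use B \<alpha> in auto)

lemma best_agent_props:
  assumes "A \<noteq> {}"
  shows "best_agent v A \<in> A" "\<And>i. i \<in> A \<Longrightarrow> v {i} \<le> v {best_agent v A}"
proof -
  define E where "E = {i \<in> A. \<forall>j\<in>A. v {j} \<le> v {i}}"
  have "Max ((\<lambda>i. v {i}) ` A) \<in> (\<lambda>i. v {i}) ` A" using assms finite_A by (intro Max_in) auto
  then obtain m where "m \<in> A" "Max ((\<lambda>i. v {i}) ` A) = v {m}" by auto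
  moreover have "v {k} \<le> Max ((\<lambda>i. v {i}) ` A)" if "k \<in> A" for k using finite_A that by simp
  ultimately have "m \<in> E" by (simp add: E_def)
  then have "Min E \<in> E" using finite_A by (intro Min_in) (auto simp: E_def)
  then show "best_agent v A \<in> A" "\<And>i. i \<in> A \<Longrightarrow> v {i} \<le> v {best_agent v A}"
    by (auto simp: best_agent_def E_def)
qed

lemma increasing_best: "increasing v (best_singleton v A B c)"
proof (cases "v {best_agent v A} = 0")
  case False
  then have "0 < marginal v (best_agent v A) {}"
    using v_nonneg[of "{best_agent v A}"] by (simp add: marginal_def v_empty)
  then show ?thesis using increasing_insert[OF increasing_empty] False by (auto simp: best_singleton_def)
qed (simp add: best_singleton_def increasing_empty)

lemma sound_best:
  assumes "A \<noteq> {}" "0 \<le> B"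
  shows "sound {0..B} v A B (best_singleton v A B)"
  unfolding sound_def
proof (intro allI impI conjI)
  fix c :: "'a costs"
  show "increasing v (best_singleton v A B c)" by (rule increasing_best)
  show "\<exists>p. (\<forall>i\<in>best_singleton v A B c. \<forall>b\<in>{0..B}. i \<in> best_singleton v A B (c(i := b)) \<longrightarrow> b \<le> p i) \<and>
    sum p (best_singleton v A B c) \<le> B"
    using assms(2) by (intro exI[of _ "\<lambda>_. B"]) (auto simp: best_singleton_def)
qed (use best_agent_props[OF assms(1)] in \<open>auto simp: best_singleton_def\<close>)

lemma sound_deom:
  assumes ne: "A \<noteq> {}" and B: "0 < B" and \<beta>: "0 \<le> \<beta>"
  shows "sound {0..B} v A B (\<lambda>c. if v {best_agent v A} \<ge> \<beta> * opt v (A - {best_agent v A}) B c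
       then best_singleton v A B c else greedy_eom (1 / 2) v A B c)" (is "sound _ _ _ _ ?f")
  unfolding sound_def
proof (intro allI impI)
  fix c :: "'a costs" assume cB: "\<forall>i\<in>A. c i \<in> {0..B}"
  then have c: "\<forall>i\<in>A. c i \<in> {0..}" by auto
  define s where "s = best_agent v A"
  have sA: "s \<in> A" using best_agent_props(1)[OF ne] by (simp add: s_def)
  let ?P = "\<lambda>c. v {s} \<ge> \<beta> * opt v (A - {s}) B c"
  have f: "?f c = (if ?P c then best_singleton v A B c else greedy_eom (1 / 2) v A B c)" for c
    by (simp add: s_def)
  have best: "best_singleton v A B c \<subseteq> {s}" for c by (auto simp: best_singleton_def s_def)
  have same: "?P (c(s := b)) = ?P c" for b using opt_cong[of "A - {s}" "c(s := b)" c v B] by auto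
  from soundE[OF sound_eom[OF B] c] obtain p where e: "greedy_eom (1 / 2) v A B c \<subseteq> A"
    "increasing v (greedy_eom (1 / 2) v A B c)"
    "\<And>i b. i \<in> greedy_eom (1 / 2) v A B c \<Longrightarrow> b \<in> {0..} \<Longrightarrow> b \<le> c i \<Longrightarrow> i \<in> greedy_eom (1 / 2) v A B (c(i := b))"
    and p: "\<And>i b. i \<in> greedy_eom (1 / 2) v A B c \<Longrightarrow> b \<in> {0..} \<Longrightarrow> i \<in> greedy_eom (1 / 2) v A B (c(i := b)) \<Longrightarrow> b \<le> p i"
    "sum p (greedy_eom (1 / 2) v A B c) \<le> B" by blast
  show "?f c \<subseteq> A \<and> increasing v (?f c) \<and> (\<forall>i\<in>?f c. \<forall>b\<in>{0..B}. b \<le> c i \<longrightarrow> i \<in> ?f (c(i := b))) \<and>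
     (\<exists>p. (\<forall>i\<in>?f c. \<forall>b\<in>{0..B}. i \<in> ?f (c(i := b)) \<longrightarrow> b \<le> p i) \<and> sum p (?f c) \<le> B)"
  proof (cases "?P c")
    case True
    have "i \<in> ?f (c(i := b))" if "i \<in> best_singleton v A B c" for i b
    proof -
      have "i = s" using that best by auto
      then show ?thesis using that True same[of b] unfolding f by (simp add: best_singleton_def)
    qed
    moreover have "?f c = best_singleton v A B c" using True f by simp
    ultimately show ?thesis using best[of c] sA increasing_best B card_mono[OF _ best[of c]]
      by (intro conjI exI[of _ "\<lambda>_. B"]) auto
  next
    case False
    have eq: "?f c = greedy_eom (1 / 2) v A B c" using False f by simp
    have "?f (c(i := b)) = greedy_eom (1 / 2) v A B (c(i := b))" if "b \<le> c i" for i b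
    proof -
      have "opt v (A - {s}) B c \<le> opt v (A - {s}) B (c(i := b))"
        by (rule opt_mono) (use finite_A B that in auto)
      then have "\<not> ?P (c(i := b))" using False \<beta> by (meson mult_left_mono order_trans)
      then show ?thesis using f by simp
    qed
    moreover have "b \<le> p i" if "i \<in> greedy_eom (1 / 2) v A B c" "b \<in> {0..B}" "i \<in> ?f (c(i := b))" for i b
    proof -
      have "\<not> ?P (c(i := b))"
      proof
        assume P: "?P (c(i := b))"
        then have "i = s" using that(3) best[of "c(i := b)"] unfolding f by auto
        then show False using P same[of b] False by simp
      qed
      then show ?thesis using p(1)[OF that(1), of b] that unfolding f by auto
    qed
    ultimately show ?thesis unfolding eq using e p(2) by (intro conjI exI[of _ p]) auto
  qed
qed

subsection \<open>Approximation ratios\<close>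

lemma selected_ratio:
  assumes c: "cost_vector A c" and B: "0 < B" and M: "\<And>k. k \<in> A \<Longrightarrow> v {k} \<le> M"
  obtains "opt v A B c \<le> v (selected v c A T)"
  | P k where "reached v c A P k" "\<not> T P k" "v P \<le> v (selected v c A T)"
      "v (insert k P) \<le> v (selected v c A T) + M"
proof (rule first_failure[OF c, of T])
  assume "v (selected v c A T) = v A"
  then show thesis using that(1) opt_le[OF finite_A, of B c] B by simp
next
  fix P k assume k: "reached v c A P k" "\<not> T P k" "P \<subseteq> selected v c A T"
  then show thesis
    using that(2)[OF k(1,2)] v_mono[OF k(3)] v_insert_le[of k P] M[OF reachedD(1)[OF k(1)]] by linarith
qed

lemma tm_failure:
  assumes c: "cost_vector A c" and B: "0 < B" and \<gamma>: "0 < \<gamma>" and k: "reached v c A P k"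
    and T: "\<not> c k / marginal v k P \<le> \<gamma> * (B / v (insert k P))"
  shows "\<gamma> * opt v A B c \<le> \<gamma> * v P + v (insert k P)"
proof -
  obtain U where U: "U \<subseteq> A" "sum c U \<le> B" "opt v A B c = v U"
    using opt_attained[of A B c v] finite_A B by auto
  have m: "0 < marginal v k P" and vk: "0 < v (insert k P)" using reachedD(4)[OF k] v_insert_pos[OF k] by auto
  have T': "\<gamma> * B * marginal v k P < c k * v (insert k P)" using T m vk by (simp add: field_simps)
  moreover have "0 \<le> \<gamma> * B * marginal v k P" using \<gamma> B m by simp
  ultimately have ck: "0 < c k" using vk by (metis order_le_less_trans zero_less_mult_pos2)
  have "c k * (v U - v P) \<le> marginal v k P * sum c (U - P)" by (rule reached_cover(2)[OF c k U(1)])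
  also have "\<dots> \<le> marginal v k P * sum c U"
    using U c finite_A m by (intro mult_left_mono sum_mono2) (auto simp: cost_vector_def finite_subset)
  also have "\<dots> \<le> marginal v k P * B" using U(2) m by (intro mult_left_mono) auto
  finally have "\<gamma> * (c k * (v U - v P)) \<le> \<gamma> * (marginal v k P * B)" using \<gamma> by (intro mult_left_mono) auto
  then have "c k * (\<gamma> * (v U - v P)) \<le> c k * v (insert k P)" using T' by (simp add: mult_ac)
  then have "\<gamma> * (v U - v P) \<le> v (insert k P)" using ck by (simp only: mult_le_cancel_left_pos)
  then show ?thesis using U by (simp add: algebra_simps)
qed

lemma tm_ratio:
  assumes c: "cost_vector A c" and B: "0 < B" and \<gamma>: "0 < \<gamma>" and M: "0 \<le> M" "\<And>k. k \<in> A \<Longrightarrow> v {k} \<le> M"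
  shows "\<gamma> * opt v A B c \<le> (1 + \<gamma>) * v (greedy_tm \<gamma> v A B c) + M"
  unfolding tm_eq[OF c B less_imp_le[OF \<gamma>]]
proof (rule selected_ratio[OF c B M(2)])
  let ?W = "selected v c A (\<lambda>P i. c i / marginal v i P \<le> \<gamma> * (B / v (insert i P)))"
  assume "opt v A B c \<le> v ?W"
  then have "\<gamma> * opt v A B c \<le> \<gamma> * v ?W" using \<gamma> by simp
  then show "\<gamma> * opt v A B c \<le> (1 + \<gamma>) * v ?W + M" using v_nonneg[of ?W] M(1) by (simp add: algebra_simps)
next
  let ?W = "selected v c A (\<lambda>P i. c i / marginal v i P \<le> \<gamma> * (B / v (insert i P)))"
  fix P k assume k: "reached v c A P k" "\<not> c k / marginal v k P \<le> \<gamma> * (B / v (insert k P))"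
    and le: "v P \<le> v ?W" "v (insert k P) \<le> v ?W + M"
  have "\<gamma> * v P \<le> \<gamma> * v ?W" using le \<gamma> by simp
  then show "\<gamma> * opt v A B c \<le> (1 + \<gamma>) * v ?W + M"
    using tm_failure[OF c B \<gamma> k] le by (simp add: algebra_simps)
qed

lemma om_failure:
  assumes orc: "approx_oracle r v A orc" and c: "cost_vector A c" and B: "0 < B" and \<alpha>: "0 < \<alpha>" and r: "1 \<le> r"
    and M: "v {k} \<le> M" and T: "\<not> v (insert k P) \<le> \<alpha> * orc (A - {k}) B v c" and le: "v (insert k P) \<le> w + M"
  shows "\<alpha> * opt v A B c \<le> r * w + (\<alpha> + r) * M"
proof -
  have "\<alpha> * opt v (A - {k}) B c \<le> \<alpha> * (r * orc (A - {k}) B v c)"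
    using approx_oracleD(2)[OF orc _ B, of "A - {k}" c] c \<alpha> by (intro mult_left_mono) (auto simp: cost_vector_def)
  also have "\<dots> \<le> r * v (insert k P)" using T r by (simp add: mult.left_commute)
  also have "\<dots> \<le> r * (w + M)" using le r by (intro mult_left_mono) auto
  finally have 1: "\<alpha> * opt v (A - {k}) B c \<le> r * (w + M)" .
  have "\<alpha> * opt v A B c \<le> \<alpha> * (opt v (A - {k}) B c + M)"
    using opt_remove[OF finite_A _ c, of B k] B M \<alpha> by (intro mult_left_mono) auto
  then show ?thesis using 1 by (simp add: algebra_simps)
qed

lemma mult_le_mult_max:
  "0 \<le> M \<Longrightarrow> 0 \<le> w \<Longrightarrow> x \<le> w \<Longrightarrow> 0 < \<alpha> \<Longrightarrow> \<alpha> \<le> 1 \<Longrightarrow> 1 \<le> r \<Longrightarrow> \<alpha> * x \<le> r * (w::real) + (\<alpha> + r) * M"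
proof -
  assume a: "0 \<le> M" "0 \<le> w" "x \<le> w" "0 < \<alpha>" "\<alpha> \<le> 1" "1 \<le> r"
  have "\<alpha> * x \<le> \<alpha> * w" using a by simp
  also have "\<dots> \<le> r * w" using a by (intro mult_right_mono) auto
  finally show ?thesis using a by (simp add: add_increasing2)
qed

lemma om_ratio:
  assumes orc: "approx_oracle r v A orc" and c: "cost_vector A c" and B: "0 < B"
    and \<alpha>: "0 < \<alpha>" "\<alpha> \<le> 1" and r: "1 \<le> r" and M: "0 \<le> M" "\<And>k. k \<in> A \<Longrightarrow> v {k} \<le> M"
  shows "\<alpha> * opt v A B c \<le> r * v (greedy_om orc \<alpha> v A B c) + (\<alpha> + r) * M"
  unfolding om_eq[OF c]
proof (rule selected_ratio[OF c B M(2)])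
  let ?W = "selected v c A (\<lambda>P i. v (insert i P) \<le> \<alpha> * orc (A - {i}) B v c)"
  assume "opt v A B c \<le> v ?W"
  then show "\<alpha> * opt v A B c \<le> r * v ?W + (\<alpha> + r) * M"
    using mult_le_mult_max[OF M(1) v_nonneg _ \<alpha> r] by blast
next
  let ?W = "selected v c A (\<lambda>P i. v (insert i P) \<le> \<alpha> * orc (A - {i}) B v c)"
  fix P k assume "reached v c A P k" "\<not> v (insert k P) \<le> \<alpha> * orc (A - {k}) B v c" "v (insert k P) \<le> v ?W + M"
  then show "\<alpha> * opt v A B c \<le> r * v ?W + (\<alpha> + r) * M"
    using om_failure[OF orc c B \<alpha>(1) r M(2)] reachedD(1) by blast
qed

lemma mom_ratio:
  assumes orc: "approx_oracle r v A orc" and c: "cost_vector A c" and B: "0 < B"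
    and \<alpha>: "0 < \<alpha>" "\<alpha> \<le> 1" and r: "1 \<le> r" and M: "0 \<le> M" "\<And>k. k \<in> A \<Longrightarrow> v {k} \<le> M"
  shows "\<alpha> * opt v A B c \<le> r * (v (modified_greedy_om orc \<alpha> v A B c) + M)"
  unfolding mom_eq[OF c]
proof (rule selected_ratio[OF c B M(2)])
  let ?W = "selected v c A (\<lambda>P i. v (insert i P) \<le> \<alpha> * (SUP x\<in>{c i..}. orc A B v (c(i := x))))"
  assume "opt v A B c \<le> v ?W"
  then have "\<alpha> * opt v A B c \<le> \<alpha> * (v ?W + M)" using \<alpha> M by (intro mult_left_mono) auto
  also have "\<dots> \<le> r * (v ?W + M)" using \<alpha> r M v_nonneg[of ?W] by (intro mult_right_mono) auto
  finally show "\<alpha> * opt v A B c \<le> r * (v ?W + M)" .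
next
  let ?W = "selected v c A (\<lambda>P i. v (insert i P) \<le> \<alpha> * (SUP x\<in>{c i..}. orc A B v (c(i := x))))"
  fix P k assume k: "reached v c A P k" "\<not> v (insert k P) \<le> \<alpha> * (SUP x\<in>{c k..}. orc A B v (c(k := x)))"
    and le: "v (insert k P) \<le> v ?W + M"
  have "\<alpha> * opt v A B c \<le> \<alpha> * (r * orc A B v c)"
    using approx_oracleD(2)[OF orc order_refl B c] \<alpha> by (intro mult_left_mono) auto
  also have "\<dots> \<le> \<alpha> * (r * (SUP x\<in>{c k..}. orc A B v (c(k := x))))"
    using oracle_sup_le(3)[OF orc c B reachedD(1)[OF k(1)]] \<alpha> r by (intro mult_left_mono) auto
  also have "\<dots> \<le> r * v (insert k P)" using k(2) r by (simp add: mult.left_commute)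
  also have "\<dots> \<le> r * (v ?W + M)" using le r by (intro mult_left_mono) auto
  finally show "\<alpha> * opt v A B c \<le> r * (v ?W + M)" .
qed

lemma om_inter_tm_ratio:
  assumes orc: "approx_oracle r v A orc" and c: "cost_vector A c" and B: "0 < B"
    and \<alpha>: "0 < \<alpha>" "\<alpha> \<le> 1" and r: "1 \<le> r" and \<gamma>: "0 < \<gamma>" and M: "0 \<le> M" "\<And>k. k \<in> A \<Longrightarrow> v {k} \<le> M"
  shows "\<gamma> * opt v A B c \<le> (1 + \<gamma>) * v (greedy_om orc \<alpha> v A B c \<inter> greedy_tm \<gamma> v A B c) + M \<or>
    \<alpha> * opt v A B c \<le> r * v (greedy_om orc \<alpha> v A B c \<inter> greedy_tm \<gamma> v A B c) + (\<alpha> + r) * M"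
  unfolding om_inter_tm_eq[OF c B less_imp_le[OF \<gamma>]]
proof (rule selected_ratio[OF c B M(2)])
  let ?W = "selected v c A (\<lambda>P i. v (insert i P) \<le> \<alpha> * orc (A - {i}) B v c \<and>
    c i / marginal v i P \<le> \<gamma> * (B / v (insert i P)))"
  assume "opt v A B c \<le> v ?W"
  then show "\<gamma> * opt v A B c \<le> (1 + \<gamma>) * v ?W + M \<or> \<alpha> * opt v A B c \<le> r * v ?W + (\<alpha> + r) * M"
    using mult_le_mult_max[OF M(1) v_nonneg _ \<alpha> r] by blast
next
  let ?W = "selected v c A (\<lambda>P i. v (insert i P) \<le> \<alpha> * orc (A - {i}) B v c \<and>
    c i / marginal v i P \<le> \<gamma> * (B / v (insert i P)))"
  fix P k assume k: "reached v c A P k" and T: "\<not> (v (insert k P) \<le> \<alpha> * orc (A - {k}) B v c \<and>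
      c k / marginal v k P \<le> \<gamma> * (B / v (insert k P)))"
    and le: "v P \<le> v ?W" "v (insert k P) \<le> v ?W + M"
  show "\<gamma> * opt v A B c \<le> (1 + \<gamma>) * v ?W + M \<or> \<alpha> * opt v A B c \<le> r * v ?W + (\<alpha> + r) * M"
  proof (cases "v (insert k P) \<le> \<alpha> * orc (A - {k}) B v c")
    case False
    then show ?thesis using om_failure[OF orc c B \<alpha>(1) r M(2)[OF reachedD(1)[OF k]] _ le(2)] by blast
  next
    case True
    have "\<gamma> * v P \<le> \<gamma> * v ?W" using le \<gamma> by simp
    then show ?thesis using tm_failure[OF c B \<gamma> k] True T le by (simp add: algebra_simps)
  qed
qed

lemma deom_ratio:
  assumes c: "cost_vector A c" and B: "0 < B" and ne: "A \<noteq> {}" and \<beta>: "0 < \<beta>" and \<rho>: "\<rho> * \<beta> = 1 + \<beta>" "\<rho> * (1 / 2 - \<beta>) = 1"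
  shows "opt v A B c \<le> \<rho> * v (if v {best_agent v A} \<ge> \<beta> * opt v (A - {best_agent v A}) B c
       then best_singleton v A B c else greedy_eom (1 / 2) v A B c)"
proof -
  define s where "s = best_agent v A"
  have \<rho>0: "0 < \<rho>" using \<rho>(1) \<beta> by (metis add_pos_pos zero_less_mult_pos2 zero_less_one)
  show ?thesis unfolding s_def[symmetric]
  proof (cases "v {s} \<ge> \<beta> * opt v (A - {s}) B c")
    case True
    have "\<beta> * opt v A B c \<le> \<beta> * (opt v (A - {s}) B c + v {s})"
      using opt_remove[OF finite_A _ c, of B s] B \<beta> by (intro mult_left_mono) auto
    also have "\<dots> \<le> (1 + \<beta>) * v {s}" using True by (simp add: algebra_simps)
    also have "\<dots> = \<beta> * (\<rho> * v {s})" using \<rho>(1) by (metis mult.assoc mult.commute)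
    finally have "opt v A B c \<le> \<rho> * v {s}" using \<beta> by simp
    moreover have "v (best_singleton v A B c) = v {s}"
      using v_empty by (simp add: best_singleton_def s_def)
    ultimately show "opt v A B c \<le> \<rho> * v (if v {s} \<ge> \<beta> * opt v (A - {s}) B c
       then best_singleton v A B c else greedy_eom (1 / 2) v A B c)" using True by simp
  next
    case False
    have "opt v (A - {s}) B c \<le> opt v A B c" by (rule opt_mono) (use finite_A B in auto)
    then have "\<beta> * opt v (A - {s}) B c \<le> \<beta> * opt v A B c" using \<beta> by simp
    then have vs: "v {s} \<le> \<beta> * opt v A B c" using False by simp
    have M: "v {k} \<le> v {s}" if "k \<in> A" for k using best_agent_props(2)[OF ne that] by (simp add: s_def)
    have "1 / 2 * opt v A B c \<le> 1 * (v (greedy_eom (1 / 2) v A B c) + v {s})"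
      using mom_ratio[OF approx_oracle_opt c B, of "1 / 2" "v {s}"] v_nonneg M eom_eq_modified[OF c B] by simp
    then have "(1 / 2 - \<beta>) * opt v A B c \<le> v (greedy_eom (1 / 2) v A B c)" using vs by (simp add: algebra_simps)
    then have "\<rho> * ((1 / 2 - \<beta>) * opt v A B c) \<le> \<rho> * v (greedy_eom (1 / 2) v A B c)" using \<rho>0 by simp
    moreover have "\<rho> * ((1 / 2 - \<beta>) * opt v A B c) = opt v A B c" using \<rho>(2) by (metis mult.assoc mult_1)
    ultimately show "opt v A B c \<le> \<rho> * v (if v {s} \<ge> \<beta> * opt v (A - {s}) B c
       then best_singleton v A B c else greedy_eom (1 / 2) v A B c)" using False by simp
  qed
qed

end

section \<open>Mechanisms for the crowdsourcing problem\<close>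

lemma greedy_match_value:
  assumes "crowdsourcing I" "A \<subseteq> agents I"
  shows "greedy (match_value I) A"
  using submodular_match_value[OF assms(1)] finite_subset[OF assms(2) crowdsourcingD(1)[OF assms(1)]]
  by (simp add: greedy_def greedy_axioms_def)

lemma valid_mechanismI:
  assumes "\<And>I. crowdsourcing I \<Longrightarrow> sound {0..} (match_value I) (agents I) (budget I) (F I)"
  shows "valid_mechanism F"
  unfolding valid_mechanism_def using sound_valid assms by blast

lemma valid_with_probabilityI:
  assumes "\<And>I. crowdsourcing I \<Longrightarrow> sound {0..} (match_value I) (agents I) (budget I) (F I)"
    and "\<And>I. crowdsourcing I \<Longrightarrow> sound {0..} (match_value I) (agents I) (budget I) (G I)"
  shows "valid_randomized_mechanism (\<lambda>I. with_probability q (F I) (G I))"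
  unfolding valid_randomized_mechanism_def
proof (intro allI impI ballI)
  fix I :: "('a, 'b) market" and f
  assume I: "crowdsourcing I" and "f \<in> set_pmf (with_probability q (F I) (G I))"
  then have "f = F I \<or> f = G I" by (auto simp: with_probability_def split: if_splits)
  then show "truthful (agents I) f (threshold_payment f) \<and>
      budget_feasible (agents I) (budget I) (threshold_payment f) \<and> matching_constraint I f"
    using sound_valid[OF I] assms[OF I] by auto
qed

lemma expectation_with_probability:
  assumes "0 \<le> q" "q \<le> 1"
  shows "measure_pmf.expectation (with_probability q f g) h = q * h f + (1 - q) * (h g :: real)"
  using assms by (simp add: with_probability_def integral_map_pmf integral_bernoulli_pmf)

lemma sound_affordable_best:
  assumes I: "crowdsourcing I"
  shows "sound {0..} (match_value I) (agents I) (budget I)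
    (on_affordable (best_singleton (match_value I)) (agents I) (budget I))"
proof (rule sound_on_affordable)
  fix A' assume "A' \<subseteq> agents I" "A' \<noteq> {}"
  then show "sound {0..budget I} (match_value I) A' (budget I) (best_singleton (match_value I) A' (budget I))"
    using greedy.sound_best[OF greedy_match_value[OF I]] crowdsourcingD(5)[OF I] by simp
qed (use crowdsourcingD(5)[OF I] in simp)

lemma sound_affordable:
  assumes I: "crowdsourcing I"
    and g: "\<And>A'. A' \<subseteq> agents I \<Longrightarrow> sound {0..} (match_value I) A' (budget I) (g A' (budget I))"
  shows "sound {0..} (match_value I) (agents I) (budget I) (on_affordable g (agents I) (budget I))"
  by (rule sound_on_affordable)
    (use sound_subset[OF g] crowdsourcingD(5)[OF I] in \<open>auto simp: subset_eq\<close>)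

lemma affordable_cases:
  fixes I :: "('a::linorder, 't) market"
  assumes I: "crowdsourcing I" and c: "cost_vector (agents I) c"
  obtains "market_opt I c = 0"
  | A' where "A' \<subseteq> agents I" "A' \<noteq> {}" "cost_vector A' c" "greedy (match_value I) A'"
      "market_opt I c = opt (match_value I) A' (budget I) c"
      "\<And>g. on_affordable g (agents I) (budget I) c = g A' (budget I) c"
proof -
  define A' where "A' = {i \<in> agents I. c i \<le> budget I}"
  have eq: "market_opt I c = opt (match_value I) A' (budget I) c"
    unfolding market_opt_def A'_def
    using opt_affordable[OF crowdsourcingD(1)[OF I] _ c] crowdsourcingD(5)[OF I] by simp
  show thesis
  proof (cases "A' = {}")
    case True
    then have "market_opt I c = match_value I {}"
      using eq crowdsourcingD(5)[OF I] by (simp add: opt_def cong: conj_cong)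
    then show thesis using that(1) match_value_empty[OF I] by simp
  next
    case False
    have sub: "A' \<subseteq> agents I" by (auto simp: A'_def)
    have "on_affordable g (agents I) (budget I) c = g A' (budget I) c" for g :: "'a set \<Rightarrow> real \<Rightarrow> 'a rule"
      using False unfolding on_affordable_def Let_def A'_def[symmetric] by simp
    then show thesis
      using that(2)[OF sub False cost_vector_subset[OF c sub] greedy_match_value[OF I sub] eq] by blast
  qed
qed

lemma match_value_nonneg: "crowdsourcing I \<Longrightarrow> 0 \<le> match_value I S"
  using submodular.v_nonneg[OF submodular_match_value] .

lemma has_expected_ratioI:
  assumes q: "0 \<le> q" "q \<le> 1" and \<rho>: "0 \<le> \<rho>"
    and le: "\<And>I :: ('a::linorder, 't) market. \<And>A' c. crowdsourcing I \<Longrightarrow> A' \<subseteq> agents I \<Longrightarrow> A' \<noteq> {} \<Longrightarrow>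
      cost_vector A' c \<Longrightarrow> greedy (match_value I) A' \<Longrightarrow>
      opt (match_value I) A' (budget I) c \<le> \<rho> * (q * match_value I (g I A' (budget I) c) +
        (1 - q) * match_value I {best_agent (match_value I) A'})"
  shows "has_expected_ratio \<rho> (\<lambda>I :: ('a, 't) market. with_probability q
     (on_affordable (g I) (agents I) (budget I))
     (on_affordable (best_singleton (match_value I)) (agents I) (budget I)))"
  unfolding has_expected_ratio_def
proof (intro allI impI, elim conjE)
  fix I :: "('a, 't) market" and c assume I: "crowdsourcing I" and c: "cost_vector (agents I) c"
  show "market_opt I c \<le> \<rho> * measure_pmf.expectation (with_probability q
     (on_affordable (g I) (agents I) (budget I))
     (on_affordable (best_singleton (match_value I)) (agents I) (budget I))) (\<lambda>f. match_value I (f c))"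
  proof (rule affordable_cases[OF I c])
    assume "market_opt I c = 0"
    then show ?thesis using q \<rho> match_value_nonneg[OF I] by (simp add: expectation_with_probability)
  next
    fix A' assume A': "A' \<subseteq> agents I" "A' \<noteq> {}" "cost_vector A' c" "greedy (match_value I) A'"
      "market_opt I c = opt (match_value I) A' (budget I) c"
      "\<And>g. on_affordable g (agents I) (budget I) c = g A' (budget I) c"
    have "match_value I (best_singleton (match_value I) A' (budget I) c) =
      match_value I {best_agent (match_value I) A'}"
      using match_value_empty[OF I] by (simp add: best_singleton_def)
    then show ?thesis using le[OF I A'(1-4)] A'(5,6) q by (simp add: expectation_with_probability)
  qed
qed

lemma has_large_market_ratioI:
  fixes F :: "('a, 't) market \<Rightarrow> 'a rule"
  assumes \<rho>: "0 < \<rho>" and K: "0 \<le> K"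
    and le: "\<And>I c M. crowdsourcing I \<Longrightarrow> cost_vector (agents I) c \<Longrightarrow> 0 \<le> M \<Longrightarrow>
      (\<And>k. k \<in> agents I \<Longrightarrow> match_value I {k} \<le> M) \<Longrightarrow>
      market_opt I c \<le> \<rho> * match_value I (F I c) + K * M"
  shows "has_large_market_ratio \<rho> F"
  unfolding has_large_market_ratio_def
proof (intro allI impI)
  fix \<epsilon> :: real assume \<epsilon>: "0 < \<epsilon>"
  define \<theta> where "\<theta> = \<epsilon> / ((K + 1) * (\<rho> + \<epsilon>))"
  have \<theta>: "0 < \<theta>" using \<rho> K \<epsilon> by (simp add: \<theta>_def)
  have "K * \<theta> = (K / (K + 1)) * (\<epsilon> / (\<rho> + \<epsilon>))" by (simp add: \<theta>_def)
  also have "\<dots> \<le> 1 * (\<epsilon> / (\<rho> + \<epsilon>))" using K \<rho> \<epsilon> by (intro mult_right_mono) auto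
  finally have K\<theta>: "K * \<theta> * (\<rho> + \<epsilon>) \<le> \<epsilon>" using \<rho> \<epsilon> by (simp add: field_simps)
  show "\<exists>\<theta>>0. \<forall>I c. crowdsourcing I \<and> cost_vector (agents I) c \<and> market_theta I c \<le> \<theta> \<longrightarrow>
    market_opt I c \<le> (\<rho> + \<epsilon>) * match_value I (F I c)"
  proof (intro exI[of _ \<theta>] conjI \<theta> allI impI)
    fix I :: "('a, 't) market" and c assume a: "crowdsourcing I \<and> cost_vector (agents I) c \<and> market_theta I c \<le> \<theta>"
    then have I: "crowdsourcing I" and c: "cost_vector (agents I) c" by auto
    define w where "w = match_value I (F I c)"
    have w0: "0 \<le> w" unfolding w_def by (rule match_value_nonneg[OF I])
    define q where "q = market_opt I c"
    have q0: "0 \<le> q" unfolding q_def market_opt_def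
      using submodular.opt_nonneg[OF submodular_match_value[OF I] crowdsourcingD(1)[OF I]] crowdsourcingD(5)[OF I] by simp
    show "market_opt I c \<le> (\<rho> + \<epsilon>) * match_value I (F I c)"
    proof (cases "q = 0")
      case True
      then show ?thesis using w0 \<rho> \<epsilon> by (simp add: q_def w_def)
    next
      case False
      then have qp: "0 < q" using q0 by simp
      have "q \<le> \<rho> * w + K * (\<theta> * q)"
        unfolding q_def w_def
      proof (rule le[OF I c])
        show "0 \<le> \<theta> * market_opt I c" using \<theta> q0 by (simp add: q_def)
        fix k assume k: "k \<in> agents I"
        have "match_value I {k} \<le> Max ((\<lambda>i. match_value I {i}) ` agents I)"
          using k crowdsourcingD(1)[OF I] by simp
        also have "\<dots> \<le> \<theta> * market_opt I c"
          using a qp by (simp add: market_theta_def q_def field_simps)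
        finally show "match_value I {k} \<le> \<theta> * market_opt I c" .
      qed
      then have "q * (\<rho> + \<epsilon>) \<le> (\<rho> * w + K * (\<theta> * q)) * (\<rho> + \<epsilon>)"
        using \<rho> \<epsilon> by (intro mult_right_mono) auto
      also have "\<dots> = \<rho> * w * (\<rho> + \<epsilon>) + (K * \<theta> * (\<rho> + \<epsilon>)) * q" by (simp add: algebra_simps)
      also have "\<dots> \<le> \<rho> * w * (\<rho> + \<epsilon>) + \<epsilon> * q" using K\<theta> qp by simp
      finally have "\<rho> * q \<le> \<rho> * ((\<rho> + \<epsilon>) * w)" by (simp add: algebra_simps)
      then show ?thesis using \<rho> by (simp add: q_def w_def)
    qed
  qed
qed

lemma bounded_ratio:
  assumes "0 < a" "a * x \<le> b * w + d * (M::real)"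
  shows "x \<le> (b / a) * w + (d / a) * M"
  using assms by (simp add: field_simps)

subsection \<open>The individual mechanisms\<close>

abbreviation oracle_for :: "('a::linorder, 't) market itself \<Rightarrow> real \<Rightarrow> 'a opt_oracle \<Rightarrow> bool" where
  "oracle_for _ r orc \<equiv> \<forall>I :: ('a, 't) market. crowdsourcing I \<longrightarrow> approx_oracle r (match_value I) (agents I) orc"

lemma oracle_forD:
  fixes I :: "('a::linorder, 't) market"
  assumes "oracle_for TYPE(('a, 't) market) r orc" "crowdsourcing I" "A' \<subseteq> agents I"
  shows "approx_oracle r (match_value I) A' orc"
  using assms approx_oracle_subset by blast

lemma valid_random_tm:
  "valid_randomized_mechanism (\<lambda>I. random_tm (1/2) (match_value I) (agents I) (budget I))"
  unfolding random_tm_def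
  by (intro valid_with_probabilityI sound_affordable sound_affordable_best
      greedy.sound_tm[OF greedy_match_value] crowdsourcingD(5))

lemma valid_greedy_tm: "valid_mechanism (\<lambda>I. greedy_tm (1/2) (match_value I) (agents I) (budget I))"
  by (intro valid_mechanismI greedy.sound_tm[OF greedy_match_value] crowdsourcingD(5) order_refl)

lemma ratio_random_tm:
  "has_expected_ratio 5 (\<lambda>I :: ('a::linorder, 't) market. random_tm (1/2) (match_value I) (agents I) (budget I))"
  unfolding random_tm_def
proof (rule has_expected_ratioI)
  fix I :: "('a, 't) market" and A' c
  assume I: "crowdsourcing I" "A' \<noteq> {}" "cost_vector A' c" and g: "greedy (match_value I) A'"
  let ?b = "match_value I {best_agent (match_value I) A'}"
  have "1/2 * opt (match_value I) A' (budget I) c \<le>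
      (1 + 1/2) * match_value I (greedy_tm (1/2) (match_value I) A' (budget I) c) + ?b"
    using greedy.tm_ratio[OF g I(3) crowdsourcingD(5)[OF I(1)], of "1/2" ?b] greedy.best_agent_props(2)[OF g I(2)]
      match_value_nonneg[OF I(1)] by simp
  then show "opt (match_value I) A' (budget I) c \<le>
    5 * ((1/2 + 1) / (1/2 + 2) * match_value I (greedy_tm (1/2) (match_value I) A' (budget I) c) +
      (1 - (1/2 + 1) / (1/2 + 2)) * ?b)"
    by simp
qed auto

lemma large_greedy_tm:
  "has_large_market_ratio 3 (\<lambda>I :: ('a::linorder, 't) market. greedy_tm (1/2) (match_value I) (agents I) (budget I))"
proof (rule has_large_market_ratioI[where K = 2])
  fix I :: "('a, 't) market" and c M
  assume I: "crowdsourcing I" "cost_vector (agents I) c" "0 \<le> M"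
    and M: "\<And>k. k \<in> agents I \<Longrightarrow> match_value I {k} \<le> M"
  show "market_opt I c \<le> 3 * match_value I (greedy_tm (1/2) (match_value I) (agents I) (budget I) c) + 2 * M"
    using greedy.tm_ratio[OF greedy_match_value[OF I(1) order_refl] I(2) crowdsourcingD(5)[OF I(1)] _ I(3) M, of "1/2"]
    by (simp add: market_opt_def)
qed auto

lemma valid_random_eom:
  "valid_randomized_mechanism (\<lambda>I. random_eom (1/2) (match_value I) (agents I) (budget I))"
  unfolding random_eom_def
  by (intro valid_with_probabilityI sound_affordable sound_affordable_best
      greedy.sound_eom[OF greedy_match_value] crowdsourcingD(5))

lemma ratio_modified:
  fixes orc :: "'a::linorder opt_oracle"
  assumes r: "1 \<le> r" and orc: "oracle_for TYPE(('a, 't) market) r orc"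
  shows "has_expected_ratio (4 * r) (\<lambda>I :: ('a, 't) market. modified_random_om orc (1/2) (match_value I) (agents I) (budget I))"
  unfolding modified_random_om_def
proof (rule has_expected_ratioI)
  fix I :: "('a, 't) market" and A' c
  assume I: "crowdsourcing I" "A' \<subseteq> agents I" "A' \<noteq> {}" "cost_vector A' c" and g: "greedy (match_value I) A'"
  let ?b = "match_value I {best_agent (match_value I) A'}"
  have "1/2 * opt (match_value I) A' (budget I) c \<le>
      r * (match_value I (modified_greedy_om orc (1/2) (match_value I) A' (budget I) c) + ?b)"
    using greedy.mom_ratio[OF g oracle_forD[OF orc I(1,2)] I(4) crowdsourcingD(5)[OF I(1)], of "1/2" ?b]
      greedy.best_agent_props(2)[OF g I(3)] match_value_nonneg[OF I(1)] r by simp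
  then show "opt (match_value I) A' (budget I) c \<le>
    4 * r * (1/2 * match_value I (modified_greedy_om orc (1/2) (match_value I) A' (budget I) c) + (1 - 1/2) * ?b)"
    by (simp add: algebra_simps)
qed (use r in auto)

lemma ratio_random_eom:
  "has_expected_ratio 4 (\<lambda>I :: ('a::linorder, 't) market. random_eom (1/2) (match_value I) (agents I) (budget I))"
  unfolding random_eom_def
proof (rule has_expected_ratioI)
  fix I :: "('a, 't) market" and A' c
  assume I: "crowdsourcing I" "A' \<noteq> {}" "cost_vector A' c" and g: "greedy (match_value I) A'"
  let ?b = "match_value I {best_agent (match_value I) A'}"
  have "1/2 * opt (match_value I) A' (budget I) c \<le>
      1 * (match_value I (greedy_eom (1/2) (match_value I) A' (budget I) c) + ?b)"
    unfolding greedy.eom_eq_modified[OF g I(3) crowdsourcingD(5)[OF I(1)]]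
    using greedy.mom_ratio[OF g approx_oracle_opt I(3) crowdsourcingD(5)[OF I(1)], of "1/2" ?b]
      greedy.best_agent_props(2)[OF g I(2)] match_value_nonneg[OF I(1)] by simp
  then show "opt (match_value I) A' (budget I) c \<le>
    4 * (1/2 * match_value I (greedy_eom (1/2) (match_value I) A' (budget I) c) + (1 - 1/2) * ?b)"
    by simp
qed auto

lemma sqrt_17_bounds: "4.123 < sqrt 17" "sqrt 17 < 4.1232"
  by (rule real_less_rsqrt, simp add: power2_eq_square) (rule real_less_lsqrt; simp add: power2_eq_square)

lemma valid_deterministic_eom:
  "valid_mechanism (\<lambda>I. deterministic_eom (match_value I) (agents I) (budget I))"
  unfolding deterministic_eom_def
proof (intro valid_mechanismI sound_on_affordable)
  fix I :: "('a::linorder, 't) market" and A' assume I: "crowdsourcing I" "A' \<subseteq> agents I" "A' \<noteq> {}"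
  show "sound {0..budget I} (match_value I) A' (budget I)
    (\<lambda>c. if (sqrt 17 - 3) / 4 * opt (match_value I) (A' - {best_agent (match_value I) A'}) (budget I) c
          \<le> match_value I {best_agent (match_value I) A'}
       then best_singleton (match_value I) A' (budget I) c
       else greedy_eom (1 / 2) (match_value I) A' (budget I) c)"
    by (rule greedy.sound_deom[OF greedy_match_value[OF I(1,2)] I(3) crowdsourcingD(5)[OF I(1)]])
      (use sqrt_17_bounds in simp)
qed (simp add: crowdsourcingD less_imp_le)

lemma ratio_deterministic_eom:
  "has_ratio ((5 + sqrt 17) / 2)
    (\<lambda>I :: ('a::linorder, 't) market. deterministic_eom (match_value I) (agents I) (budget I))"
  unfolding has_ratio_def deterministic_eom_def
proof (intro allI impI, elim conjE)
  fix I :: "('a, 't) market" and c assume I: "crowdsourcing I" and c: "cost_vector (agents I) c"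
  show "market_opt I c \<le> (5 + sqrt 17) / 2 * match_value I (on_affordable (\<lambda>A B c.
       if match_value I {best_agent (match_value I) A} \<ge>
          (sqrt 17 - 3) / 4 * opt (match_value I) (A - {best_agent (match_value I) A}) B c
       then best_singleton (match_value I) A B c else greedy_eom (1 / 2) (match_value I) A B c)
     (agents I) (budget I) c)" (is "_ \<le> _ * match_value I (on_affordable ?g _ _ _)")
  proof (rule affordable_cases[OF I c])
    assume "market_opt I c = 0"
    then show ?thesis using match_value_nonneg[OF I] by simp
  next
    fix A' assume A': "A' \<subseteq> agents I" "A' \<noteq> {}" "cost_vector A' c" and g: "greedy (match_value I) A'"
      and eq: "market_opt I c = opt (match_value I) A' (budget I) c"
      "\<And>g. on_affordable g (agents I) (budget I) c = g A' (budget I) c"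
    have "sqrt 17 * sqrt 17 = 17" by simp
    then have "(5 + sqrt 17) / 2 * ((sqrt 17 - 3) / 4) = 1 + (sqrt 17 - 3) / 4"
      "(5 + sqrt 17) / 2 * (1 / 2 - (sqrt 17 - 3) / 4) = 1"
      by (auto simp: field_simps)
    from greedy.deom_ratio[OF g A'(3) crowdsourcingD(5)[OF I] A'(2) _ this] show ?thesis
      unfolding eq using sqrt_17_bounds by simp
  qed
qed

context
  fixes r :: real and orc :: "'a::linorder opt_oracle" and market_type :: "('a, 't) market itself"
  assumes r: "1 \<le> r" and orc: "oracle_for market_type r orc"
begin

lemma orc_on: "crowdsourcing I \<Longrightarrow> A' \<subseteq> agents I \<Longrightarrow> approx_oracle r (match_value I) A' orc"
  for I :: "('a, 't) market"
  using orc approx_oracle_subset by blast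

lemma valid_random_om:
  "valid_randomized_mechanism (\<lambda>I :: ('a, 't) market. random_om r orc (1/2) (match_value I) (agents I) (budget I))"
  unfolding random_om_def
  by (intro valid_with_probabilityI sound_affordable sound_affordable_best
      greedy.sound_om[OF greedy_match_value orc_on] crowdsourcingD(5))

lemma valid_greedy_om:
  "valid_mechanism (\<lambda>I :: ('a, 't) market. greedy_om orc (1/2) (match_value I) (agents I) (budget I))"
  by (intro valid_mechanismI greedy.sound_om[OF greedy_match_value orc_on] crowdsourcingD(5) order_refl)

lemma valid_modified_random_om:
  "valid_randomized_mechanism (\<lambda>I :: ('a, 't) market. modified_random_om orc (1/2) (match_value I) (agents I) (budget I))"
  unfolding modified_random_om_def
  by (intro valid_with_probabilityI sound_affordable sound_affordable_best
      greedy.sound_mom[OF greedy_match_value orc_on] crowdsourcingD(5))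

lemma valid_deterministic_large:
  assumes "0 < \<alpha>" "0 < \<gamma>" "\<alpha> \<le> 1 / (1 + \<gamma>)"
  shows "valid_mechanism (\<lambda>I :: ('a, 't) market. deterministic_large orc \<alpha> \<gamma> (match_value I) (agents I) (budget I))"
  unfolding deterministic_large_def
proof (intro valid_mechanismI sound_affordable)
  fix I :: "('a, 't) market" and A' assume I: "crowdsourcing I" "A' \<subseteq> agents I"
  have "\<alpha> * (1 + \<gamma>) \<le> 1" using assms by (simp add: field_simps)
  then show "sound {0..} (match_value I) A' (budget I) (\<lambda>c. greedy_om orc \<alpha> (match_value I) A' (budget I) c \<inter>
      greedy_tm \<gamma> (match_value I) A' (budget I) c)"
    using greedy.sound_om_inter_tm[OF greedy_match_value[OF I] orc_on[OF I] crowdsourcingD(5)[OF I(1)]] assms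
    by simp
qed

lemma ratio_random_om:
  "has_expected_ratio (1 + 4 * r) (\<lambda>I :: ('a, 't) market. random_om r orc (1/2) (match_value I) (agents I) (budget I))"
  unfolding random_om_def
proof (rule has_expected_ratioI)
  fix I :: "('a, 't) market" and A' c
  assume I: "crowdsourcing I" "A' \<subseteq> agents I" "A' \<noteq> {}" "cost_vector A' c" and g: "greedy (match_value I) A'"
  let ?b = "match_value I {best_agent (match_value I) A'}"
  let ?w = "match_value I (greedy_om orc (1/2) (match_value I) A' (budget I) c)"
  have le: "1/2 * opt (match_value I) A' (budget I) c \<le> r * ?w + (1/2 + r) * ?b"
    using greedy.om_ratio[OF g orc_on[OF I(1,2)] I(4) crowdsourcingD(5)[OF I(1)], of "1/2" ?b]
      greedy.best_agent_props(2)[OF g I(3)] match_value_nonneg[OF I(1)] r by simp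
  define D where "D = 1/2 + 2 * r"
  have D: "D \<noteq> 0" "1/2 + r = D - r" "1 + 4 * r = 2 * D" using r by (auto simp: D_def)
  have "opt (match_value I) A' (budget I) c \<le> 2 * (r * ?w + (D - r) * ?b)" using le D(2) by simp
  also have "\<dots> = 2 * D * (r / D * ?w + (1 - r / D) * ?b)" using D(1) by (simp add: field_simps)
  finally show "opt (match_value I) A' (budget I) c \<le>
    (1 + 4 * r) * (r / (1/2 + 2 * r) * ?w + (1 - r / (1/2 + 2 * r)) * ?b)"
    unfolding D(3) D_def[symmetric] .
qed (use r in auto)

lemma large_greedy_om:
  "has_large_market_ratio (2 * r) (\<lambda>I :: ('a, 't) market. greedy_om orc (1/2) (match_value I) (agents I) (budget I))"
proof (rule has_large_market_ratioI[where K = "1 + 2 * r"])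
  fix I :: "('a, 't) market" and c M
  assume I: "crowdsourcing I" "cost_vector (agents I) c" "0 \<le> M"
    and M: "\<And>k. k \<in> agents I \<Longrightarrow> match_value I {k} \<le> M"
  show "market_opt I c \<le> 2 * r * match_value I (greedy_om orc (1/2) (match_value I) (agents I) (budget I) c) + (1 + 2 * r) * M"
    using greedy.om_ratio[OF greedy_match_value[OF I(1) order_refl] orc_on[OF I(1) order_refl] I(2)
        crowdsourcingD(5)[OF I(1)] _ _ r I(3) M, of "1/2"]
    by (simp add: market_opt_def algebra_simps)
qed (use r in auto)

lemma large_deterministic_large:
  assumes \<alpha>: "0 < \<alpha>" "\<alpha> \<le> 1" and \<gamma>: "0 < \<gamma>"
  shows "has_large_market_ratio (max (1 + 1 / \<gamma>) (r / \<alpha>))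
    (\<lambda>I :: ('a, 't) market. deterministic_large orc \<alpha> \<gamma> (match_value I) (agents I) (budget I))"
  unfolding deterministic_large_def
proof (rule has_large_market_ratioI[where K = "1 / \<gamma> + (\<alpha> + r) / \<alpha>"])
  show "0 < max (1 + 1 / \<gamma>) (r / \<alpha>)" using \<gamma> by (simp add: less_max_iff_disj add_pos_pos)
  show "0 \<le> 1 / \<gamma> + (\<alpha> + r) / \<alpha>" using r \<alpha> \<gamma> by (simp add: add_nonneg_nonneg)
  fix I :: "('a, 't) market" and c M
  assume I: "crowdsourcing I" and c: "cost_vector (agents I) c" and M0: "0 \<le> M"
    and M: "\<And>k. k \<in> agents I \<Longrightarrow> match_value I {k} \<le> M"
  let ?f = "on_affordable (\<lambda>A B c. greedy_om orc \<alpha> (match_value I) A B c \<inter> greedy_tm \<gamma> (match_value I) A B c)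
    (agents I) (budget I) c"
  show "market_opt I c \<le> max (1 + 1 / \<gamma>) (r / \<alpha>) * match_value I ?f + (1 / \<gamma> + (\<alpha> + r) / \<alpha>) * M"
  proof (rule affordable_cases[OF I c])
    assume "market_opt I c = 0"
    then show ?thesis using match_value_nonneg[OF I] M0 r \<alpha> \<gamma>
      by (auto intro!: add_nonneg_nonneg mult_nonneg_nonneg simp: le_max_iff_disj)
  next
    fix A' assume A': "A' \<subseteq> agents I" "A' \<noteq> {}" "cost_vector A' c" and g: "greedy (match_value I) A'"
      and eq: "market_opt I c = opt (match_value I) A' (budget I) c"
      "\<And>g. on_affordable g (agents I) (budget I) c = g A' (budget I) c"
    let ?x = "opt (match_value I) A' (budget I) c"
    let ?w = "match_value I (greedy_om orc \<alpha> (match_value I) A' (budget I) c \<inter>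
      greedy_tm \<gamma> (match_value I) A' (budget I) c)"
    have w0: "0 \<le> ?w" by (rule match_value_nonneg[OF I])
    have ab: "0 \<le> 1 / \<gamma> * M" "0 \<le> (\<alpha> + r) / \<alpha> * M" using M0 r \<alpha> \<gamma> by auto
    have "M' \<in> A' \<Longrightarrow> match_value I {M'} \<le> M" for M' using M A' by auto
    from greedy.om_inter_tm_ratio[OF g orc_on[OF I A'(1)] A'(3) crowdsourcingD(5)[OF I] \<alpha> r \<gamma> M0 this]
    have "?x \<le> (1 + 1 / \<gamma>) * ?w + 1 / \<gamma> * M \<or> ?x \<le> r / \<alpha> * ?w + (\<alpha> + r) / \<alpha> * M"
      using bounded_ratio[of \<gamma> ?x "1 + \<gamma>" ?w 1 M] bounded_ratio[of \<alpha> ?x r ?w "\<alpha> + r" M] \<alpha> \<gamma>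
      by (auto simp: add_divide_distrib add.commute)
    moreover have "(1 + 1 / \<gamma>) * ?w \<le> max (1 + 1 / \<gamma>) (r / \<alpha>) * ?w"
      "r / \<alpha> * ?w \<le> max (1 + 1 / \<gamma>) (r / \<alpha>) * ?w"
      using w0 by (intro mult_right_mono; simp)+
    ultimately have "?x \<le> max (1 + 1 / \<gamma>) (r / \<alpha>) * ?w + 1 / \<gamma> * M + (\<alpha> + r) / \<alpha> * M"
      using ab by linarith
    then show ?thesis unfolding eq by (simp only: ring_distribs add.assoc)
  qed
qed

end

section \<open>Sviridenko's approximation\<close>

definition fill :: "('a::linorder set \<Rightarrow> real) \<Rightarrow> real \<Rightarrow> 'a costs \<Rightarrow> 'a set \<Rightarrow> 'a set \<Rightarrow> 'a set" where
  "fill v B c S R = fst ((sviridenko_step v B c ^^ card R) (S, R))"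

lemma sviridenko_extend_eq: "sviridenko_extend v A B c U = fill v B c U (A - U)"
  by (simp add: sviridenko_extend_def fill_def)

lemma fill_empty [simp]: "fill v B c S {} = S"
  by (simp add: fill_def)

lemma fill_step:
  assumes "finite R" "R \<noteq> {}" "j = most_efficient v c R S"
  shows "fill v B c S R = fill v B c (if sum c (insert j S) \<le> B then insert j S else S) (R - {j})"
proof -
  have "j \<in> R" using assms most_efficient_in by blast
  then have "card R = Suc (card (R - {j}))" using assms(1) by (metis card_Suc_Diff1)
  then show ?thesis
    using assms(3) by (simp add: fill_def funpow_swap1 sviridenko_step_def Let_def del: funpow.simps) (simp add: funpow_swap1)
qed

lemma fill_induct [consumes 1, case_names empty step]:
  assumes "finite R"
    and "\<And>S. P S {}"
    and "\<And>S R. finite R \<Longrightarrow> R \<noteq> {} \<Longrightarrow> (\<And>j S'. j \<in> R \<Longrightarrow> P S' (R - {j})) \<Longrightarrow> P S R"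
  shows "P S R"
  using assms(1)
proof (induction "card R" arbitrary: S R)
  case 0
  then show ?case using assms(2) by simp
next
  case (Suc n)
  show ?case
  proof (rule assms(3))
    show "P S' (R - {j})" if "j \<in> R" for j S'
      using Suc.hyps(1)[of "R - {j}" S'] Suc.hyps(2) Suc.prems that by simp
  qed (use Suc in auto)
qed

lemma fill_bounds:
  assumes "finite R"
  shows "S \<subseteq> fill v B c S R \<and> fill v B c S R \<subseteq> S \<union> R \<and> (sum c S \<le> B \<longrightarrow> sum c (fill v B c S R) \<le> B)"
  using assms
proof (induction S R rule: fill_induct)
  case (step S R)
  define j where "j = most_efficient v c R S"
  have j: "j \<in> R" using most_efficient_in[OF step(1,2)] by (simp add: j_def)
  show ?case
    using step(3)[OF j, of "if sum c (insert j S) \<le> B then insert j S else S"] j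
    unfolding fill_step[OF step(1,2) j_def, of B] by (auto split: if_splits)
qed simp

lemma fill_cong:
  assumes "finite R" "\<And>i. i \<in> S \<union> R \<Longrightarrow> c i = d i"
  shows "fill v B c S R = fill v B d S R"
  using assms
proof (induction S R rule: fill_induct)
  case (step S R)
  define j where "j = most_efficient v c R S"
  have j: "j \<in> R" using most_efficient_in[OF step(1,2)] by (simp add: j_def)
  have j': "j = most_efficient v d R S" unfolding j_def using step(4) by (intro most_efficient_cong) auto
  have "sum c (insert j S) = sum d (insert j S)" using step(4) j by (intro sum.cong) auto
  moreover have "fill v B c S' (R - {j}) = fill v B d S' (R - {j})" if "S' \<subseteq> insert j S" for S'
    by (rule step(3)[OF j]) (use that step(4) j in auto)
  ultimately show ?case
    unfolding fill_step[OF step(1,2) j_def, of B] fill_step[OF step(1,2) j', of B]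
    by auto
qed simp

lemma finite_argmax:
  assumes "finite X" "X \<noteq> {}"
  obtains m where "m \<in> X" "\<And>x. x \<in> X \<Longrightarrow> f x \<le> (f m :: real)"
proof -
  have "Max (f ` X) \<in> f ` X" using assms by (intro Max_in) auto
  then obtain m where "m \<in> X" "Max (f ` X) = f m" by auto
  moreover have "f x \<le> Max (f ` X)" if "x \<in> X" for x using assms that by simp
  ultimately show thesis using that by auto
qed

text \<open>As long as no item of the optimal set \<open>X\<close> has been discarded, an item of cost \<open>x\<close> closes at least
  the fraction \<open>x / (B - sum c U)\<close> of the gap to \<open>v X\<close>, and \<open>1 - y \<le> exp (- y)\<close>.\<close>

lemma fill_gap:
  fixes v :: "'a::linorder set \<Rightarrow> real"
  assumes v: "submodular v" and R: "finite R"
    and U: "finite U" "finite X" "U \<subseteq> X" and X: "sum c X \<le> B"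
    and S: "finite S" "U \<subseteq> S" "X - S \<subseteq> R" "sum c S \<le> B"
    and c: "\<And>i. i \<in> S \<union> R \<union> X \<Longrightarrow> 0 \<le> c i"
    and gap: "v X - v S \<le> (v X - v U) * exp (- (sum c S - sum c U) / (B - sum c U))"
  shows "v X \<le> v (fill v B c S R) \<or>
    (\<exists>j\<in>X - U. v X - (v X - v U) / exp 1 \<le> v (fill v B c S R) + marginal v j U)"
  using R S c gap
proof (induction S R rule: fill_induct)
  case (empty S)
  then show ?case using submodular.v_mono[OF v, of X S] by auto
next
  case (step S R)
  interpret submodular v by (rule v)
  define j where "j = most_efficient v c R S"
  have j: "j \<in> R" using step(1,2) most_efficient_in by (auto simp: j_def)
  note fs = fill_step[OF step(1,2) j_def, of B]
  define D0 where "D0 = v X - v U"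
  have D0: "0 \<le> D0" using v_mono[OF U(3)] by (simp add: D0_def)
  define B' where "B' = B - sum c U"
  have cXU: "sum c (X - U) = sum c X - sum c U" using U by (simp add: sum_diff finite_subset)
  have cj: "0 \<le> c j" using step.prems(5) j by auto
  have "c j * (v X - v S) \<le> marginal v j S * sum c (X - S)"
    by (rule efficiency_cover)
      (use U cj step.prems step(1) most_efficient_ge[OF step(1)] in \<open>auto simp: j_def subset_iff\<close>)
  also have "sum c (X - S) \<le> sum c (X - U)"
    using U step.prems by (intro sum_mono2) auto
  also have "\<dots> \<le> B'" using X cXU by (simp add: B'_def)
  finally have cover: "c j * (v X - v S) \<le> marginal v j S * B'"
    by (simp add: mult_left_mono marginal_nonneg)
  have decrease: "v X - v (insert j S) \<le> D0 * exp (- (sum c S + c j - sum c U) / B')"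
    if B': "0 < B'" and cjB: "c j \<le> B'"
  proof -
    have m: "c j / B' * (v X - v S) \<le> marginal v j S" using cover B' by (simp add: field_simps)
    have "v X - v (insert j S) = (v X - v S) - marginal v j S" by (simp add: marginal_def)
    also have "\<dots> \<le> (v X - v S) * (1 - c j / B')" using m by (simp add: algebra_simps)
    also have "\<dots> \<le> (D0 * exp (- (sum c S - sum c U) / B')) * (1 - c j / B')"
      using step.prems(6) cjB B' by (intro mult_right_mono) (auto simp: D0_def B'_def)
    also have "\<dots> \<le> (D0 * exp (- (sum c S - sum c U) / B')) * exp (- c j / B')"
      using D0 exp_ge_add_one_self[of "- c j / B'"] by (intro mult_left_mono) auto
    also have "\<dots> = D0 * exp (- (sum c S - sum c U) / B' + - c j / B')"
      by (simp only: exp_add mult.assoc)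
    also have "- (sum c S - sum c U) / B' + - c j / B' = - (sum c S + c j - sum c U) / B'"
      by (simp add: add_divide_distrib diff_divide_distrib)
    finally show ?thesis .
  qed
  have cUS: "sum c U \<le> sum c S" using step.prems by (intro sum_mono2) auto
  show ?case
  proof (cases "j \<in> S")
    case True
    then have e: "insert j S = S" by auto
    have "v X \<le> v (fill v B c S (R - {j})) \<or>
      (\<exists>j'\<in>X - U. v X - (v X - v U) / exp 1 \<le> v (fill v B c S (R - {j})) + marginal v j' U)"
      by (rule step.IH[OF j]) (use step.prems True in auto)
    then show ?thesis using fs e by simp
  next
    case jS: False
    then have sumj: "sum c (insert j S) = sum c S + c j" using step.prems by simp
    show ?thesis
    proof (cases "sum c (insert j S) \<le> B")
      case True
      have gap': "v X - v (insert j S) \<le> (v X - v U) * exp (- (sum c (insert j S) - sum c U) / (B - sum c U))"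
      proof (cases "0 < B'")
        case True
        then show ?thesis using decrease \<open>sum c (insert j S) \<le> B\<close> cUS sumj by (simp add: D0_def B'_def)
      next
        case False
        then have "B - sum c U = 0" using cUS step.prems(4) by (simp add: B'_def)
        then show ?thesis using step.prems(6) v_mono[OF subset_insertI, of S j] by auto
      qed
      have "v X \<le> v (fill v B c (insert j S) (R - {j})) \<or>
        (\<exists>j'\<in>X - U. v X - (v X - v U) / exp 1 \<le> v (fill v B c (insert j S) (R - {j})) + marginal v j' U)"
        by (rule step.IH[OF j]) (use step.prems True j gap' in auto)
      then show ?thesis using fs True by simp
    next
      case False
      show ?thesis
      proof (cases "j \<in> X")
        case True
        have jU: "j \<in> X - U" using True jS step.prems by auto
        have "c j \<le> sum c (X - U)" by (rule member_le_sum) (use jU U step.prems in auto)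
        then have cjB: "c j \<le> B'" using X cXU by (simp add: B'_def)
        have "0 < c j" using False sumj step.prems(4) by simp
        then have B': "0 < B'" using cjB by simp
        have "1 \<le> (sum c S + c j - sum c U) / B'" using False sumj B' by (simp add: B'_def)
        then have "exp (- (sum c S + c j - sum c U) / B') \<le> exp (- 1)"
          by (simp only: exp_le_cancel_iff minus_divide_left[symmetric] neg_le_iff_le)
        then have "v X - v (insert j S) \<le> D0 * exp (- 1)"
          using decrease[OF B' cjB] D0 by (meson mult_left_mono order_trans)
        then have "v X - D0 / exp 1 \<le> v S + marginal v j S"
          by (simp add: marginal_def exp_minus divide_inverse)
        also have "v S \<le> v (fill v B c S R)" using v_mono[OF conjunct1[OF fill_bounds[OF step(1)]]] .
        also have "marginal v j S \<le> marginal v j U" using marginal_antimono[OF step.prems(2)] .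
        finally show ?thesis using jU unfolding D0_def by auto
      next
        case jX: False
        have "v X \<le> v (fill v B c S (R - {j})) \<or>
          (\<exists>j'\<in>X - U. v X - (v X - v U) / exp 1 \<le> v (fill v B c S (R - {j})) + marginal v j' U)"
          by (rule step.IH[OF j]) (use step.prems jX in auto)
        then show ?thesis using fs False by simp
      qed
    qed
  qed
qed

context submodular
begin

lemma three_best:
  assumes X: "finite X" "3 \<le> card X"
  obtains U where "U \<subseteq> X" "card U = 3" "\<And>j. j \<in> X - U \<Longrightarrow> 3 * marginal v j U \<le> v U"
proof -
  have ne: "X - T \<noteq> {}" if "card T \<le> 2" "finite T" for T
    using that X card_mono[of T X] by fastforce
  obtain x where x: "x \<in> X - {}" "\<And>j. j \<in> X - {} \<Longrightarrow> marginal v j {} \<le> marginal v x {}"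
    by (rule finite_argmax[of "X - {}" "\<lambda>j. marginal v j {}"]) (use X ne[of "{}"] in auto)
  obtain y where y: "y \<in> X - {x}" "\<And>j. j \<in> X - {x} \<Longrightarrow> marginal v j {x} \<le> marginal v y {x}"
    by (rule finite_argmax[of "X - {x}" "\<lambda>j. marginal v j {x}"]) (use X ne[of "{x}"] in auto)
  have xy: "x \<noteq> y" using y by auto
  obtain z where z: "z \<in> X - {x, y}" "\<And>j. j \<in> X - {x, y} \<Longrightarrow> marginal v j {x, y} \<le> marginal v z {x, y}"
    by (rule finite_argmax[of "X - {x, y}" "\<lambda>j. marginal v j {x, y}"]) (use X ne[of "{x, y}"] xy in auto)
  let ?U = "{x, y, z}"
  have vU: "v ?U = marginal v x {} + marginal v y {x} + marginal v z {x, y}"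
    by (simp add: marginal_def v_empty insert_commute)
  have "3 * marginal v j ?U \<le> v ?U" if j: "j \<in> X - ?U" for j
  proof -
    have "marginal v j ?U \<le> marginal v j {}" "marginal v j ?U \<le> marginal v j {x}"
      "marginal v j ?U \<le> marginal v j {x, y}" by (intro marginal_antimono; auto)+
    moreover have "marginal v j {} \<le> marginal v x {}" "marginal v j {x} \<le> marginal v y {x}"
      "marginal v j {x, y} \<le> marginal v z {x, y}" using x y z j by auto
    ultimately show ?thesis unfolding vU by linarith
  qed
  moreover have "card ?U = 3" using y z by auto
  ultimately show thesis using that[of ?U] x y z by auto
qed

end

lemma sviridenko_candidates:
  assumes "finite A"
  shows "finite ({v U | U. U \<subseteq> A \<and> card U \<le> 2 \<and> sum c U \<le> B} \<union>
          {v (sviridenko_extend v A B c U) | U. U \<subseteq> A \<and> card U = 3 \<and> sum c U \<le> B})"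
proof -
  have "{v U | U. U \<subseteq> A \<and> card U \<le> 2 \<and> sum c U \<le> B} \<subseteq> v ` Pow A"
    "{v (sviridenko_extend v A B c U) | U. U \<subseteq> A \<and> card U = 3 \<and> sum c U \<le> B} \<subseteq>
      (\<lambda>U. v (sviridenko_extend v A B c U)) ` Pow A" by auto
  then show ?thesis using assms by (meson finite_Pow_iff finite_UnI finite_imageI finite_subset)
qed

lemma sviridenko_ge_iff:
  assumes "finite A" "0 \<le> B"
  shows "\<tau> \<le> sviridenko A B v c \<longleftrightarrow>
    (\<exists>U\<subseteq>A. sum c U \<le> B \<and> (card U \<le> 2 \<and> \<tau> \<le> v U \<or> card U = 3 \<and> \<tau> \<le> v (fill v B c U (A - U))))"
proof -
  have "{v U | U. U \<subseteq> A \<and> card U \<le> 2 \<and> sum c U \<le> B} \<noteq> {}" using assms by (auto intro!: exI[of _ "{}"])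
  then show ?thesis unfolding sviridenko_def
    using Max_ge_iff[OF sviridenko_candidates[OF assms(1)], of v c B \<tau>] unfolding sviridenko_extend_eq by blast
qed

lemma sviridenko_le_opt:
  assumes "finite A" "0 \<le> B"
  shows "sviridenko A B v c \<le> opt v A B c"
proof -
  have "sviridenko A B v c \<le> sviridenko A B v c" by simp
  then obtain U where U: "U \<subseteq> A" "sum c U \<le> B"
    "sviridenko A B v c \<le> v U \<or> sviridenko A B v c \<le> v (fill v B c U (A - U))"
    unfolding sviridenko_ge_iff[OF assms] by blast
  have f: "fill v B c U (A - U) \<subseteq> A" "sum c (fill v B c U (A - U)) \<le> B"
    using fill_bounds[of "A - U" U v B c] U assms by auto
  show ?thesis using U(3) opt_upper[OF assms(1) U(1,2), of v] opt_upper[OF assms(1) f, of v] by linarith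
qed

lemma sviridenko_cong:
  assumes "finite A" "\<And>i. i \<in> A \<Longrightarrow> d i = c i"
  shows "sviridenko A B v d = sviridenko A B v c"
proof -
  have s: "sum d U = sum c U" if "U \<subseteq> A" for U using assms that by (intro sum.cong) auto
  have e: "sviridenko_extend v A B d U = sviridenko_extend v A B c U" if "U \<subseteq> A" for U
    unfolding sviridenko_extend_eq using assms that by (intro fill_cong) auto
  have "{v U | U. U \<subseteq> A \<and> card U \<le> 2 \<and> sum d U \<le> B} = {v U | U. U \<subseteq> A \<and> card U \<le> 2 \<and> sum c U \<le> B}"
    using s by auto
  moreover have "{v (sviridenko_extend v A B d U) | U. U \<subseteq> A \<and> card U = 3 \<and> sum d U \<le> B} =
    {v (sviridenko_extend v A B c U) | U. U \<subseteq> A \<and> card U = 3 \<and> sum c U \<le> B}"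
    using s e by (metis (no_types, lifting))
  ultimately show ?thesis by (simp add: sviridenko_def)
qed

context greedy
begin

lemma sviridenko_ratio:
  assumes c: "cost_vector A c" and B: "0 < B"
  shows "(1 - 1 / exp 1) * opt v A B c \<le> sviridenko A B v c"
proof -
  obtain X where X: "X \<subseteq> A" "sum c X \<le> B" "opt v A B c = v X"
    using opt_attained[of A B c v] finite_A B by auto
  have finX: "finite X" using X finite_A finite_subset by blast
  have B0: "0 \<le> B" using B by simp
  have e: "exp 1 \<le> (3::real)" by (rule exp_le)
  have "(1 - 1 / exp 1) * v X \<le> sviridenko A B v c"
  proof (cases "card X \<le> 2")
    case True
    have "(1 - 1 / exp 1) * v X \<le> 1 * v X" by (intro mult_right_mono v_nonneg) simp
    moreover have "v X \<le> sviridenko A B v c"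
      unfolding sviridenko_ge_iff[OF finite_A B0] using True X by auto
    ultimately show ?thesis by simp
  next
    case False
    then have "3 \<le> card X" by simp
    then obtain U where U: "U \<subseteq> X" "card U = 3" "\<And>j. j \<in> X - U \<Longrightarrow> 3 * marginal v j U \<le> v U"
      using three_best finX by metis
    have finU: "finite U" using U finX finite_subset by blast
    have "sum c U \<le> sum c X" by (rule sum_mono2) (use U X finX c in \<open>auto simp: cost_vector_def\<close>)
    then have cU: "sum c U \<le> B" using X by simp
    define F where "F = fill v B c U (A - U)"
    have "v F \<le> sviridenko A B v c"
      unfolding sviridenko_ge_iff[OF finite_A B0] F_def using U X cU by (intro exI[of _ U]) auto
    moreover have "(1 - 1 / exp 1) * v X \<le> v F"
    proof -
      have "v X \<le> v F \<or> (\<exists>j\<in>X - U. v X - (v X - v U) / exp 1 \<le> v F + marginal v j U)"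
        unfolding F_def
        by (rule fill_gap[OF submodular_axioms])
          (use finite_A finX finU U X cU c in \<open>auto simp: cost_vector_def\<close>)
      then show ?thesis
      proof
        assume "v X \<le> v F"
        moreover have "(1 - 1 / exp 1) * v X \<le> 1 * v X" by (intro mult_right_mono v_nonneg) simp
        ultimately show ?thesis by simp
      next
        assume "\<exists>j\<in>X - U. v X - (v X - v U) / exp 1 \<le> v F + marginal v j U"
        then obtain j where j: "j \<in> X - U" "v X - (v X - v U) / exp 1 \<le> v F + marginal v j U" by auto
        have "marginal v j U \<le> v U / 3" using U(3)[OF j(1)] by simp
        also have "\<dots> \<le> v U / exp 1" using e v_nonneg by (intro divide_left_mono) auto
        finally show ?thesis using j(2) by (simp add: field_simps)
      qed
    qed
    ultimately show ?thesis by simp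
  qed
  then show ?thesis using X by simp
qed

lemma approx_oracle_sviridenko: "approx_oracle (exp 1 / (exp 1 - 1)) v A sviridenko"
  unfolding approx_oracle_def
proof (intro allI impI, elim conjE, intro conjI allI impI)
  fix A' B c assume A': "A' \<subseteq> A" and B: "(0::real) < B" and c: "cost_vector A' c"
  interpret A': greedy v A' using A' finite_A finite_subset by unfold_locales auto
  have B0: "0 \<le> B" using B by simp
  show "sviridenko A' B v c \<le> opt v A' B c" by (rule sviridenko_le_opt[OF A'.finite_A B0])
  have e: "exp 1 > (1::real)" by simp
  have "(1 - 1 / exp 1) * opt v A' B c \<le> sviridenko A' B v c" by (rule A'.sviridenko_ratio[OF c B])
  then have "exp 1 / (exp 1 - 1) * ((1 - 1 / exp 1) * opt v A' B c) \<le> exp 1 / (exp 1 - 1) * sviridenko A' B v c"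
    using e by (intro mult_left_mono) auto
  moreover have "exp 1 / (exp 1 - 1) * (1 - 1 / exp 1) = (1::real)" using e by (simp add: field_simps)
  ultimately show "opt v A' B c \<le> exp 1 / (exp 1 - 1) * sviridenko A' B v c"
    by (simp only: mult.assoc[symmetric] mult_1)
  show "sviridenko A' B v d = sviridenko A' B v c" if "\<forall>i\<in>A'. d i = c i" for d
    by (rule sviridenko_cong[OF A'.finite_A]) (use that in auto)
qed

end

section \<open>Sviridenko's value as a function of one cost\<close>

text \<open>If the flag \<open>f\<close> is set, the cost of \<open>i\<close> is regarded as infinitesimally larger than \<open>c i\<close>.\<close>

definition no_better :: "bool \<Rightarrow> 'a \<Rightarrow> ('a set \<Rightarrow> real) \<Rightarrow> 'a costs \<Rightarrow> 'a set \<Rightarrow> 'a \<Rightarrow> 'a \<Rightarrow> bool" where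
  "no_better f i v c S k j \<longleftrightarrow> (if f \<and> j = i \<and> k \<noteq> i \<and> marginal v i S \<noteq> 0
     then efficiency v c S k < efficiency v c S j else efficiency v c S k \<le> efficiency v c S j)"

definition pick :: "bool \<Rightarrow> 'a::linorder \<Rightarrow> ('a set \<Rightarrow> real) \<Rightarrow> 'a costs \<Rightarrow> 'a set \<Rightarrow> 'a set \<Rightarrow> 'a" where
  "pick f i v c R S = Min {j \<in> R. \<forall>k\<in>R. no_better f i v c S k j}"

definition fits :: "bool \<Rightarrow> 'a \<Rightarrow> real \<Rightarrow> 'a costs \<Rightarrow> 'a set \<Rightarrow> bool" where
  "fits f i B c S \<longleftrightarrow> (if f \<and> i \<in> S then sum c S < B else sum c S \<le> B)"

definition flag_step :: "bool \<Rightarrow> 'a::linorder \<Rightarrow> ('a set \<Rightarrow> real) \<Rightarrow> real \<Rightarrow> 'a costs \<Rightarrow> 'a set \<times> 'a set \<Rightarrow> 'a set \<times> 'a set" where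
  "flag_step f i v B c = (\<lambda>(S, R). let j = pick f i v c R S in
     (if fits f i B c (insert j S) then insert j S else S, R - {j}))"

definition flag_fill :: "bool \<Rightarrow> 'a::linorder \<Rightarrow> ('a set \<Rightarrow> real) \<Rightarrow> real \<Rightarrow> 'a costs \<Rightarrow> 'a set \<Rightarrow> 'a set \<Rightarrow> 'a set" where
  "flag_fill f i v B c S R = fst ((flag_step f i v B c ^^ card R) (S, R))"

lemma pick_False: "pick False i v c R S = most_efficient v c R S"
  by (simp add: pick_def no_better_def most_efficient_def)

lemma flag_step_False: "flag_step False i v B c = sviridenko_step v B c"
  by (auto simp: flag_step_def sviridenko_step_def pick_False fits_def Let_def fun_eq_iff)

lemma flag_fill_False: "flag_fill False i v B c S R = fill v B c S R"
  by (simp add: flag_fill_def fill_def flag_step_False)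

lemma eventually_right_le:
  assumes "0 < (a::real)"
  shows "\<forall>\<^sub>F y in at_right x. (a * y \<le> b) = (a * x < b)"
proof (cases "a * x < b")
  case True
  then have "x < b / a" using assms by (simp add: field_simps)
  then have "\<forall>\<^sub>F y in at_right x. y < b / a" using eventually_at_right_less[of x] eventually_at_right by blast
  then show ?thesis by eventually_elim (use True assms in \<open>simp add: field_simps\<close>)
next
  case False
  have "\<forall>\<^sub>F y in at_right x. x < y" by (rule eventually_at_right_less)
  then show ?thesis
  proof eventually_elim
    case (elim y)
    then have "a * x < a * y" using assms by simp
    then show ?case using False by auto
  qed
qed

lemma eventually_right_ge:
  assumes "0 < (a::real)"
  shows "\<forall>\<^sub>F y in at_right x. (b \<le> a * y) = (b \<le> a * x)"
proof (cases "b \<le> a * x")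
  case True
  have "\<forall>\<^sub>F y in at_right x. x < y" by (rule eventually_at_right_less)
  then show ?thesis
  proof eventually_elim
    case (elim y)
    then have "a * x < a * y" using assms by simp
    then show ?case using True by auto
  qed
next
  case False
  then have "x < b / a" using assms by (simp add: field_simps)
  then have "\<forall>\<^sub>F y in at_right x. y < b / a" using eventually_at_right_less[of x] eventually_at_right by blast
  then show ?thesis by eventually_elim (use False assms in \<open>simp add: field_simps\<close>)
qed

context greedy
begin

lemma no_better_right:
  assumes c: "cost_vector A c" and k: "k \<in> A" and j: "j \<in> A" and x: "0 \<le> x"
  shows "\<forall>\<^sub>F y in at_right x. (efficiency v (c(i := y)) S k \<le> efficiency v (c(i := y)) S j) =
    no_better True i v (c(i := x)) S k j"
proof -
  have pos: "\<forall>\<^sub>F y in at_right x. x < y" by (rule eventually_at_right_less)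
  have m0: "0 \<le> marginal v l S" for l by (rule marginal_nonneg)
  have ck: "0 \<le> c k" and cj: "0 \<le> c j" using c k j by (auto simp: cost_vector_def)
  note le_iff = efficiency_le_iff[where S = S]
  consider "k = j" | "k \<noteq> i" "j \<noteq> i" | "j = i" "k \<noteq> i" | "k = i" "j \<noteq> i" by auto
  then show ?thesis
  proof cases
    case 1
    then show ?thesis by (simp add: no_better_def)
  next
    case 2
    then show ?thesis by (simp add: no_better_def efficiency_def)
  next
    case 3
    have strict: "efficiency v (c(i := x)) S k < efficiency v (c(i := x)) S i \<longleftrightarrow>
      marginal v i S \<noteq> 0 \<and> (marginal v k S = 0 \<or> c k \<noteq> 0 \<and> (x = 0 \<or> marginal v k S * x < marginal v i S * c k))"
      using le_iff[of "c(i := x)" k i] x ck 3 by (auto simp: not_le[symmetric] mult_ac)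
    have weak: "efficiency v (c(i := y)) S k \<le> efficiency v (c(i := y)) S i \<longleftrightarrow> marginal v k S = 0 \<or>
      marginal v i S \<noteq> 0 \<and> c k \<noteq> 0 \<and> marginal v k S * y \<le> marginal v i S * c k" if "x < y" for y
      using le_iff[of "c(i := y)" i k] x ck 3 that by auto
    show ?thesis
    proof (cases "marginal v i S = 0 \<or> marginal v k S = 0")
      case True
      show ?thesis using pos
      proof eventually_elim
        case (elim y)
        then show ?case using weak[OF elim] strict True 3 le_iff[of "c(i := x)" i k] x ck
          by (auto simp: no_better_def)
      qed
    next
      case False
      then have mk: "0 < marginal v k S" and mi: "0 < marginal v i S" using m0[of k] m0[of i] by auto
      show ?thesis using pos eventually_right_le[OF mk, of "marginal v i S * c k" x]
      proof eventually_elim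
        case (elim y)
        have "c k \<noteq> 0 \<Longrightarrow> x = 0 \<Longrightarrow> marginal v k S * x < marginal v i S * c k" using mi ck by simp
        then show ?case using weak[OF elim(1)] elim(2) strict False 3 by (auto simp: no_better_def)
      qed
    qed
  next
    case 4
    have weak: "efficiency v (c(i := y)) S i \<le> efficiency v (c(i := y)) S j \<longleftrightarrow> marginal v i S = 0 \<or>
      marginal v j S \<noteq> 0 \<and> (c j = 0 \<or> y \<noteq> 0 \<and> marginal v i S * c j \<le> marginal v j S * y)" if "x \<le> y" for y
      using le_iff[of "c(i := y)" j i] x cj 4 that by auto
    show ?thesis
    proof (cases "marginal v i S = 0 \<or> marginal v j S = 0")
      case True
      show ?thesis using pos
        by eventually_elim (use weak weak[OF order_refl] True 4 in \<open>auto simp: no_better_def\<close>)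
    next
      case False
      then have mj: "0 < marginal v j S" and mi: "0 < marginal v i S" using m0[of j] m0[of i] by auto
      show ?thesis using pos eventually_right_ge[OF mj, of "marginal v i S * c j" x]
      proof eventually_elim
        case (elim y)
        have "c j \<noteq> 0 \<Longrightarrow> x = 0 \<Longrightarrow> \<not> marginal v i S * c j \<le> marginal v j S * x" using mi cj by (simp add: not_le)
        then show ?case using weak[of y] weak[OF order_refl] elim x False 4 by (auto simp: no_better_def)
      qed
    qed
  qed
qed

lemma flag_step_right:
  assumes c: "cost_vector A c" and x: "0 \<le> x"
  shows "\<forall>\<^sub>F y in at_right x. \<forall>S\<in>Pow A. fits True i B (c(i := x)) S = (sum (c(i := y)) S \<le> B) \<and>
    (\<forall>R\<in>Pow A. pick True i v (c(i := x)) R S = most_efficient v (c(i := y)) R S)"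
proof -
  have f: "\<forall>\<^sub>F y in at_right x. fits True i B (c(i := x)) S = (sum (c(i := y)) S \<le> B)" if S: "S \<subseteq> A" for S
  proof (cases "i \<in> S")
    case True
    have fin: "finite S" using S finite_A finite_subset by blast
    have eq: "sum (c(i := y)) S = y + sum c (S - {i})" for y
      using True fin by (simp add: sum.remove[of S i])
    have "\<forall>\<^sub>F y in at_right x. (1 * y \<le> B - sum c (S - {i})) = (1 * x < B - sum c (S - {i}))"
      by (rule eventually_right_le) simp
    then show ?thesis unfolding eq fits_def using True by (auto elim!: eventually_mono)
  next
    case False
    then have "sum (c(i := y)) S = sum c S" for y by (intro sum.cong) auto
    then show ?thesis using False by (simp add: fits_def)
  qed
  have "\<forall>\<^sub>F y in at_right x. \<forall>k\<in>A. \<forall>j\<in>A.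
    (efficiency v (c(i := y)) S k \<le> efficiency v (c(i := y)) S j) = no_better True i v (c(i := x)) S k j" for S
    using no_better_right[OF c _ _ x] finite_A by (intro eventually_ball_finite ballI) auto
  then have p: "\<forall>\<^sub>F y in at_right x. \<forall>R\<in>Pow A. pick True i v (c(i := x)) R S = most_efficient v (c(i := y)) R S" for S
  proof (rule eventually_mono, intro ballI)
    fix y R assume *: "\<forall>k\<in>A. \<forall>j\<in>A. (efficiency v (c(i := y)) S k \<le> efficiency v (c(i := y)) S j) =
      no_better True i v (c(i := x)) S k j" and R: "R \<in> Pow A"
    have "{j \<in> R. \<forall>k\<in>R. no_better True i v (c(i := x)) S k j} =
      {j \<in> R. \<forall>k\<in>R. efficiency v (c(i := y)) S k \<le> efficiency v (c(i := y)) S j}"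
      using * R by blast
    then show "pick True i v (c(i := x)) R S = most_efficient v (c(i := y)) R S"
      by (simp add: pick_def most_efficient_def)
  qed
  have "\<forall>\<^sub>F y in at_right x. fits True i B (c(i := x)) S = (sum (c(i := y)) S \<le> B) \<and>
    (\<forall>R\<in>Pow A. pick True i v (c(i := x)) R S = most_efficient v (c(i := y)) R S)" if "S \<in> Pow A" for S
    using f[of S] p[of S] that by (intro eventually_conj) auto
  then show ?thesis using finite_A by (intro eventually_ball_finite ballI) auto
qed

lemma flag_fill_eq:
  assumes eq: "\<forall>S\<in>Pow A. fits True i B (c(i := x)) S = (sum (c(i := y)) S \<le> B) \<and>
      (\<forall>R\<in>Pow A. pick True i v (c(i := x)) R S = most_efficient v (c(i := y)) R S)"
    and S: "S \<subseteq> A" "R \<subseteq> A"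
  shows "flag_fill True i v B (c(i := x)) S R = fill v B (c(i := y)) S R"
proof -
  have "(flag_step True i v B (c(i := x)) ^^ n) (S, R) = (sviridenko_step v B (c(i := y)) ^^ n) (S, R)"
    if "card R = n" for n
    using S that
  proof (induction n arbitrary: S R)
    case (Suc n)
    have fin: "finite R" using Suc.prems finite_A finite_subset by blast
    have ne: "R \<noteq> {}" using Suc.prems by auto
    define j where "j = most_efficient v (c(i := y)) R S"
    have j: "j \<in> R" using most_efficient_in[OF fin ne] by (simp add: j_def)
    have j': "pick True i v (c(i := x)) R S = j" using eq Suc.prems by (simp add: j_def)
    have "insert j S \<in> Pow A" using Suc.prems j by auto
    then have fit: "fits True i B (c(i := x)) (insert j S) = (sum (c(i := y)) (insert j S) \<le> B)"
      using eq by blast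
    define S' where "S' = (if sum (c(i := y)) (insert j S) \<le> B then insert j S else S)"
    have "flag_step True i v B (c(i := x)) (S, R) = (S', R - {j})"
      "sviridenko_step v B (c(i := y)) (S, R) = (S', R - {j})"
      using fit j' by (simp_all add: flag_step_def sviridenko_step_def Let_def S'_def j_def[symmetric])
    moreover have "S' \<subseteq> A" "R - {j} \<subseteq> A" "card (R - {j}) = n" using Suc.prems j by (auto simp: S'_def)
    ultimately show ?case using Suc.IH[of S' "R - {j}"] by (simp add: funpow_swap1 del: fun_upd_apply)
  qed simp
  then show ?thesis by (simp add: flag_fill_def fill_def)
qed

lemma rejected_dominates:
  assumes R: "finite R" and S: "finite S" and c: "\<And>k. k \<in> S \<union> R \<Longrightarrow> 0 \<le> c k"
    and j: "j \<in> R" "j = most_efficient v c R S" and B: "sum c S \<le> B" "B < sum c (insert j S)"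
    and F: "S \<subseteq> F" "F \<subseteq> S \<union> R" "sum c F \<le> B"
  shows "v F \<le> v (insert j S)"
proof -
  have fin: "finite F" using F R S by (meson finite_UnI finite_subset)
  have jS: "j \<notin> S" using B by (auto simp: insert_absorb)
  then have cj: "B - sum c S < c j" "0 < c j" using B S by auto
  have "c j * (v F - v S) \<le> marginal v j S * sum c (F - S)"
    by (rule efficiency_cover) (use fin c j F most_efficient_ge[OF R] in \<open>auto simp: subset_iff\<close>)
  also have "sum c (F - S) = sum c F - sum c S" using F fin by (simp add: sum_diff S)
  also have "marginal v j S * (sum c F - sum c S) \<le> marginal v j S * c j"
    using F(3) cj marginal_nonneg by (intro mult_left_mono) auto
  finally have "c j * (v F - v S) \<le> c j * marginal v j S" by (simp add: mult.commute)
  then have "v F - v S \<le> marginal v j S" using cj(2) by simp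
  then show ?thesis by (simp add: marginal_def)
qed

lemma fill_antimono:
  assumes R: "finite R" and A: "S \<subseteq> A" "R \<subseteq> A" and c: "cost_vector A c"
    and x: "0 \<le> x1" "x1 \<le> x2" and B: "sum (c(i := x2)) S \<le> B"
    and Q: "\<And>S R. (S, R) \<in> Q \<Longrightarrow> R \<noteq> {} \<Longrightarrow> sviridenko_step v B c (S, R) \<in> Q"
    and choice: "\<And>S R. (S, R) \<in> Q \<Longrightarrow>
      most_efficient v (c(i := x1)) (insert i R) S = most_efficient v (c(i := x2)) (insert i R) S"
    and start: "i \<in> R \<Longrightarrow> i \<notin> S \<and> (S, R - {i}) \<in> Q"
  shows "v (fill v B (c(i := x2)) S R) \<le> v (fill v B (c(i := x1)) S R)"
  using R A B start
proof (induction S R rule: fill_induct)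
  case (step S R)
  let ?c1 = "c(i := x1)" and ?c2 = "c(i := x2)"
  define j where "j = most_efficient v ?c2 R S"
  have j: "j \<in> R" using most_efficient_in[OF step(1,2)] by (simp add: j_def)
  have finS: "finite S" using step.prems finite_A finite_subset by blast
  have j1: "j = most_efficient v ?c1 R S"
  proof (cases "i \<in> R")
    case True
    then show ?thesis using choice[of S "R - {i}"] step.prems(4) by (simp add: j_def insert_absorb)
  next
    case False
    then show ?thesis unfolding j_def by (intro most_efficient_cong) auto
  qed
  note f1 = fill_step[OF step(1,2) j1, of B] and f2 = fill_step[OF step(1,2) j_def, of B]
  have c2: "0 \<le> ?c2 k" if "k \<in> S \<union> R" for k using that c x step.prems by (auto simp: cost_vector_def)
  have le: "sum ?c1 (insert j S) \<le> sum ?c2 (insert j S)" by (rule sum_mono) (use x in auto)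
  have less: "(if sum c (insert j S) \<le> B then insert j S else S, R - {i} - {j}) \<in> Q \<and>
      sum c (insert j S) = sum ?c2 (insert j S)" if "i \<in> R" "j \<noteq> i"
  proof -
    have "j = most_efficient v c (R - {i}) S"
    proof -
      have jR: "j \<in> R - {i}" using j that by auto
      have "efficiency v c S k < efficiency v c S j \<or> efficiency v c S k = efficiency v c S j \<and> j \<le> k"
        if "k \<in> R - {i}" for k
      proof -
        have other: "efficiency v ?c2 S l = efficiency v c S l" if "l \<in> R - {i}" for l
          using that by (simp add: efficiency_def)
        have "efficiency v ?c2 S k < efficiency v ?c2 S j \<or> efficiency v ?c2 S k = efficiency v ?c2 S j \<and> j \<le> k"
          using most_efficient_iff[OF step(1,2), of v ?c2 S j] j_def \<open>k \<in> R - {i}\<close> by blast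
        then show ?thesis unfolding other[OF \<open>k \<in> R - {i}\<close>] other[OF jR] .
      qed
      then show ?thesis using most_efficient_iff[of "R - {i}" v c S j] jR step(1) by auto
    qed
    then have "sviridenko_step v B c (S, R - {i}) = (if sum c (insert j S) \<le> B then insert j S else S, R - {i} - {j})"
      by (simp add: sviridenko_step_def Let_def)
    moreover have "R - {i} \<noteq> {}" using j that by auto
    ultimately have "(if sum c (insert j S) \<le> B then insert j S else S, R - {i} - {j}) \<in> Q"
      using Q[of S "R - {i}"] step.prems(4) that(1) by auto
    moreover have "sum c (insert j S) = sum ?c2 (insert j S)"
      using step.prems(4) that by (intro sum.cong) auto
    ultimately show ?thesis by simp
  qed
  have swap: "R - {j} - {i} = R - {i} - {j}" by auto
  show ?case
  proof (cases "sum ?c2 (insert j S) \<le> B")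
    case True
    then have True1: "sum ?c1 (insert j S) \<le> B" using le by simp
    have "v (fill v B ?c2 (insert j S) (R - {j})) \<le> v (fill v B ?c1 (insert j S) (R - {j}))"
    proof (rule step(3)[OF j])
      show "i \<notin> insert j S \<and> (insert j S, R - {j} - {i}) \<in> Q" if "i \<in> R - {j}"
        using less step.prems(4) that True by (auto simp: swap)
    qed (use step.prems j True in auto)
    then show ?thesis using f1 f2 True True1 by (simp del: fun_upd_apply)
  next
    case False
    note reject = rejected_dominates[OF step(1) finS c2 j j_def step.prems(3)]
    show ?thesis
    proof (cases "sum ?c1 (insert j S) \<le> B")
      case True
      have "v (fill v B ?c2 S R) \<le> v (insert j S)"
        using reject False fill_bounds[OF step(1), of S v B ?c2] step.prems(3) by auto
      also have "\<dots> \<le> v (fill v B ?c1 (insert j S) (R - {j}))"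
        using fill_bounds[of "R - {j}" "insert j S" v B ?c1] step(1) by (intro v_mono) auto
      finally show ?thesis using f1 True by (simp del: fun_upd_apply)
    next
      case False1: False
      have "v (fill v B ?c2 S (R - {j})) \<le> v (fill v B ?c1 S (R - {j}))"
      proof (rule step(3)[OF j])
        show "i \<notin> S \<and> (S, R - {j} - {i}) \<in> Q" if "i \<in> R - {j}"
          using less step.prems(4) that False by (auto simp: swap)
      qed (use step.prems in auto)
      then show ?thesis using f1 f2 False False1 by (simp del: fun_upd_apply)
    qed
  qed
qed simp

text \<open>Until \<open>i\<close> is picked, every run agrees with the run without \<open>i\<close>. So the order in which items are picked
  changes only at bids for which \<open>i\<close> is as efficient as some \<open>j\<close> with respect to a set of the run without \<open>i\<close>.
  Between two such bids the value of the outcome is antitone, since a smaller bid can only make more sets affordable.\<close>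

definition run_without :: "real \<Rightarrow> 'a costs \<Rightarrow> 'a \<Rightarrow> 'a set \<Rightarrow> nat \<Rightarrow> 'a set \<times> 'a set" where
  "run_without B c i U q = (sviridenko_step v B c ^^ q) (U, A - U - {i})"

definition candidates :: "real \<Rightarrow> 'a costs \<Rightarrow> 'a \<Rightarrow> 'a set \<Rightarrow> real set" where
  "candidates B c i U = insert (c i) {marginal v i S * c j / marginal v j S | S q j.
     q \<le> card (A - U - {i}) \<and> S = fst (run_without B c i U q) \<and> j \<in> A}"

lemma run_without_card:
  "q \<le> card (A - U - {i}) \<Longrightarrow> snd (run_without B c i U q) \<subseteq> A - U - {i} \<and>
    card (snd (run_without B c i U q)) = card (A - U - {i}) - q"
proof (induction q)
  case (Suc q)
  obtain S R where SR: "run_without B c i U q = (S, R)" by (cases "run_without B c i U q")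
  have R: "R \<subseteq> A - U - {i}" "card R = card (A - U - {i}) - q" using Suc SR by auto
  have fin: "finite R" using R finite_A finite_subset by blast
  have "R \<noteq> {}" using R Suc.prems by auto
  then have "most_efficient v c R S \<in> R" using most_efficient_in fin by blast
  moreover have "snd (run_without B c i U (Suc q)) = R - {most_efficient v c R S}"
    using SR by (simp add: run_without_def sviridenko_step_def Let_def)
  ultimately show ?case using R fin by auto
qed (simp add: run_without_def)

lemma finite_candidates: "finite (candidates B c i U)"
proof -
  have "{marginal v i S * c j / marginal v j S | S q j. q \<le> card (A - U - {i}) \<and> S = fst (run_without B c i U q) \<and> j \<in> A}
    \<subseteq> (\<lambda>(q, j). marginal v i (fst (run_without B c i U q)) * c j / marginal v j (fst (run_without B c i U q))) `
      ({..card (A - U - {i})} \<times> A)" by auto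
  then have "finite {marginal v i S * c j / marginal v j S | S q j.
      q \<le> card (A - U - {i}) \<and> S = fst (run_without B c i U q) \<and> j \<in> A}"
    by (rule finite_subset) (simp add: finite_A)
  then show ?thesis unfolding candidates_def by simp
qed

lemma candidate_exists:
  assumes c: "cost_vector A c" and i: "i \<in> A" and U: "U \<subseteq> A"
    and y: "c i \<le> y" "sum (c(i := y)) U \<le> B" "\<tau> \<le> v (fill v B (c(i := y)) U (A - U))"
  shows "\<exists>x\<in>candidates B c i U. \<exists>f. c i \<le> x \<and> fits f i B (c(i := x)) U \<and>
    \<tau> \<le> v (flag_fill f i v B (c(i := x)) U (A - U))"
proof -
  have c0: "0 \<le> c i" using c i by (simp add: cost_vector_def)
  define X where "X = {x \<in> candidates B c i U. c i \<le> x \<and> x \<le> y}"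
  have X: "finite X" "c i \<in> X" using finite_candidates y by (auto simp: X_def candidates_def)
  define x where "x = Max X"
  have x: "x \<in> X" using Max_in[of X] X unfolding x_def by blast
  have max: "t \<le> x" if "t \<in> X" for t using X that by (simp add: x_def)
  show ?thesis
  proof (cases "x = y")
    case True
    then show ?thesis using x y
      by (intro bexI[of _ x] exI[of _ False]) (auto simp: flag_fill_False fits_def X_def)
  next
    case False
    then have xy: "x < y" using x by (auto simp: X_def)
    have x0: "0 \<le> x" using x c0 by (auto simp: X_def)
    have "\<forall>\<^sub>F z in at_right x. x < z \<and> z < y \<and> (\<forall>S\<in>Pow A. fits True i B (c(i := x)) S = (sum (c(i := z)) S \<le> B) \<and>
      (\<forall>R\<in>Pow A. pick True i v (c(i := x)) R S = most_efficient v (c(i := z)) R S))"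
      using eventually_at_right_less[of x] eventually_at_right[OF xy] flag_step_right[OF c x0, of i B] xy
      by (intro eventually_conj) blast+
    then obtain z where z: "x < z" "z < y" and eq: "\<forall>S\<in>Pow A. fits True i B (c(i := x)) S = (sum (c(i := z)) S \<le> B) \<and>
      (\<forall>R\<in>Pow A. pick True i v (c(i := x)) R S = most_efficient v (c(i := z)) R S)"
      using eventually_happens trivial_limit_at_right_real by blast
    have fz: "sum (c(i := z)) U \<le> B"
    proof -
      have "sum (c(i := z)) U \<le> sum (c(i := y)) U" by (rule sum_mono) (use z in auto)
      then show ?thesis using y by simp
    qed
    define Q where "Q = {run_without B c i U q | q. q \<le> card (A - U - {i})}"
    have "v (fill v B (c(i := y)) U (A - U)) \<le> v (fill v B (c(i := z)) U (A - U))"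
    proof (rule fill_antimono[where Q = Q])
      show "sviridenko_step v B c (S, R) \<in> Q" if "(S, R) \<in> Q" "R \<noteq> {}" for S R
      proof -
        obtain q where q: "(S, R) = run_without B c i U q" "q \<le> card (A - U - {i})" using \<open>(S, R) \<in> Q\<close> by (auto simp: Q_def)
        have "R = snd (run_without B c i U q)" using q(1) by (metis snd_conv)
        then have "card R = card (A - U - {i}) - q" "R \<subseteq> A - U - {i}" using run_without_card[OF q(2)] by auto
        moreover have "card R \<noteq> 0" using \<open>R \<noteq> {}\<close> calculation(2) finite_A by (meson card_0_eq finite_Diff finite_subset)
        ultimately have "Suc q \<le> card (A - U - {i})" by simp
        moreover have "sviridenko_step v B c (S, R) = run_without B c i U (Suc q)" using q(1) by (simp add: run_without_def)
        ultimately show ?thesis unfolding Q_def by blast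
      qed
      show "most_efficient v (c(i := z)) (insert i R) S = most_efficient v (c(i := y)) (insert i R) S"
        if "(S, R) \<in> Q" for S R
      proof -
        obtain q where q: "(S, R) = run_without B c i U q" "q \<le> card (A - U - {i})" using \<open>(S, R) \<in> Q\<close> by (auto simp: Q_def)
        have SR: "S = fst (run_without B c i U q)" "R = snd (run_without B c i U q)" using q(1) by (metis fst_conv, metis snd_conv)
        have R: "R \<subseteq> A - U - {i}" using run_without_card[OF q(2)] SR by auto
        have t: "t \<le> x \<or> y < t" if k: "k \<in> R" and "t = marginal v i S * c k / marginal v k S" for k t
        proof -
          have "t \<in> candidates B c i U" unfolding candidates_def using that q(2) SR R by blast
          then show ?thesis using max[of t] x by (cases "c i \<le> t") (auto simp: X_def)
        qed
        have same: "(efficiency v (c(i := z)) S k \<le> efficiency v (c(i := z)) S j) =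
            (efficiency v (c(i := y)) S k \<le> efficiency v (c(i := y)) S j)"
          if kj: "k \<in> insert i R" "j \<in> insert i R" for k j
        proof -
          have ck: "0 \<le> c k" and cj: "0 \<le> c j" using kj R c i by (auto simp: cost_vector_def)
          have yz: "0 < y" "0 < z" using x0 z by auto
          consider "k = i" "j = i" | "k \<noteq> i" "j \<noteq> i" | "j = i" "k \<noteq> i" | "k = i" "j \<noteq> i" by auto
          then show ?thesis
          proof cases
            case 3
            have "(marginal v k S * z \<le> marginal v i S * c k) = (marginal v k S * y \<le> marginal v i S * c k)" if "marginal v k S \<noteq> 0"
            proof -
              define t0 where "t0 = marginal v i S * c k / marginal v k S"
              have m: "0 < marginal v k S" using that marginal_nonneg[of k S] by simp
              have e: "(marginal v k S * w \<le> marginal v i S * c k) \<longleftrightarrow> w \<le> t0" for w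
                using m by (simp add: t0_def field_simps)
              have "t0 \<le> x \<or> y < t0" using t[of k t0] kj 3 t0_def by auto
              then show ?thesis unfolding e using z by (intro iffI) linarith+
            qed
            then show ?thesis using 3 yz ck efficiency_le_iff[of "c(i := z)" i k S] efficiency_le_iff[of "c(i := y)" i k S]
              by auto
          next
            case 4
            have "(marginal v i S * c j \<le> marginal v j S * z) = (marginal v i S * c j \<le> marginal v j S * y)" if "marginal v j S \<noteq> 0"
            proof -
              define t0 where "t0 = marginal v i S * c j / marginal v j S"
              have m: "0 < marginal v j S" using that marginal_nonneg[of j S] by simp
              have e: "(marginal v i S * c j \<le> marginal v j S * w) \<longleftrightarrow> t0 \<le> w" for w
                using m by (simp add: t0_def field_simps)
              have "t0 \<le> x \<or> y < t0" using t[of j t0] kj 4 t0_def by auto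
              then show ?thesis unfolding e using z by (intro iffI) linarith+
            qed
            then show ?thesis using 4 yz cj efficiency_le_iff[of "c(i := z)" j i S] efficiency_le_iff[of "c(i := y)" j i S]
              by auto
          qed (auto simp: efficiency_def)
        qed
        then have "{j \<in> insert i R. \<forall>k\<in>insert i R. efficiency v (c(i := z)) S k \<le> efficiency v (c(i := z)) S j} =
          {j \<in> insert i R. \<forall>k\<in>insert i R. efficiency v (c(i := y)) S k \<le> efficiency v (c(i := y)) S j}" by blast
        then show ?thesis by (simp only: most_efficient_def)
      qed
      show "i \<notin> U \<and> (U, A - U - {i}) \<in> Q" if "i \<in> A - U"
        using that unfolding Q_def by (auto simp: run_without_def intro!: exI[of _ 0])
    qed (use U finite_A c z x0 y in auto)
    also have "fill v B (c(i := z)) U (A - U) = flag_fill True i v B (c(i := x)) U (A - U)"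
      using flag_fill_eq[OF eq, of U "A - U"] U by simp
    finally have "\<tau> \<le> v (flag_fill True i v B (c(i := x)) U (A - U))" using y(3) by (simp del: fun_upd_apply)
    moreover have "fits True i B (c(i := x)) U" using eq fz U by auto
    moreover have "x \<in> candidates B c i U" "c i \<le> x" using x by (auto simp: X_def)
    ultimately show ?thesis by blast
  qed
qed

lemma candidate_sound:
  assumes c: "cost_vector A c" and i: "i \<in> A" and U: "U \<subseteq> A" and x: "c i \<le> x"
    and f: "fits f i B (c(i := x)) U" "\<tau> \<le> v (flag_fill f i v B (c(i := x)) U (A - U))"
  shows "\<exists>y\<ge>c i. sum (c(i := y)) U \<le> B \<and> \<tau> \<le> v (fill v B (c(i := y)) U (A - U))"
proof (cases f)
  case False
  then show ?thesis using f x by (intro exI[of _ x]) (auto simp: flag_fill_False fits_def)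
next
  case True
  have x0: "0 \<le> x" using c i x by (auto simp: cost_vector_def)
  have "\<forall>\<^sub>F z in at_right x. x < z \<and> (\<forall>S\<in>Pow A. fits True i B (c(i := x)) S = (sum (c(i := z)) S \<le> B) \<and>
      (\<forall>R\<in>Pow A. pick True i v (c(i := x)) R S = most_efficient v (c(i := z)) R S))"
    using eventually_at_right_less[of x] flag_step_right[OF c x0, of i B] by (intro eventually_conj)
  then obtain z where z: "x < z" and eq: "\<forall>S\<in>Pow A. fits True i B (c(i := x)) S = (sum (c(i := z)) S \<le> B) \<and>
      (\<forall>R\<in>Pow A. pick True i v (c(i := x)) R S = most_efficient v (c(i := z)) R S)"
    using eventually_happens trivial_limit_at_right_real by blast
  show ?thesis using f True flag_fill_eq[OF eq, of U "A - U"] eq U z x by (intro exI[of _ z]) auto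
qed

lemma sviridenko_in: "0 \<le> B \<Longrightarrow> sviridenko A B v c \<in> v ` Pow A"
proof -
  assume "0 \<le> B"
  then have "{v U | U. U \<subseteq> A \<and> card U \<le> 2 \<and> sum c U \<le> B} \<noteq> {}" by (auto intro!: exI[of _ "{}"])
  then have "sviridenko A B v c \<in> {v U | U. U \<subseteq> A \<and> card U \<le> 2 \<and> sum c U \<le> B} \<union>
          {v (sviridenko_extend v A B c U) | U. U \<subseteq> A \<and> card U = 3 \<and> sum c U \<le> B}"
    unfolding sviridenko_def by (intro Max_in sviridenko_candidates finite_A) blast
  moreover have "fill v B c U (A - U) \<subseteq> A" if "U \<subseteq> A" for U
    using fill_bounds[of "A - U" U v B c] that finite_A by auto
  ultimately show ?thesis by (auto simp: sviridenko_extend_eq)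
qed

lemma sviridenko_sup_iff:
  assumes c: "cost_vector A c" and i: "i \<in> A" and B: "0 \<le> B"
  shows "\<tau> \<le> (SUP x\<in>{c i..}. sviridenko A B v (c(i := x))) \<longleftrightarrow>
    (\<exists>U\<subseteq>A. card U \<le> 2 \<and> sum c U \<le> B \<and> \<tau> \<le> v U) \<or>
    (\<exists>U\<subseteq>A. card U = 3 \<and> (\<exists>x\<in>candidates B c i U. \<exists>f. c i \<le> x \<and> fits f i B (c(i := x)) U \<and>
      \<tau> \<le> v (flag_fill f i v B (c(i := x)) U (A - U))))" (is "_ \<longleftrightarrow> ?L \<or> ?R")
proof -
  let ?V = "(\<lambda>x. sviridenko A B v (c(i := x))) ` {c i..}"
  have fin: "finite ?V" by (rule finite_subset[of _ "v ` Pow A"]) (use sviridenko_in[OF B] finite_A in auto)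
  have "(SUP x\<in>{c i..}. sviridenko A B v (c(i := x))) = Max ?V"
    by (rule cSup_eq_Max[OF fin]) simp
  then have "\<tau> \<le> (SUP x\<in>{c i..}. sviridenko A B v (c(i := x))) \<longleftrightarrow> (\<exists>y\<ge>c i. \<tau> \<le> sviridenko A B v (c(i := y)))"
    using Max_ge_iff[OF fin, of \<tau>] by auto
  also have "\<dots> \<longleftrightarrow> (\<exists>y\<ge>c i. \<exists>U\<subseteq>A. sum (c(i := y)) U \<le> B \<and> card U \<le> 2 \<and> \<tau> \<le> v U) \<or>
     (\<exists>y\<ge>c i. \<exists>U\<subseteq>A. card U = 3 \<and> sum (c(i := y)) U \<le> B \<and> \<tau> \<le> v (fill v B (c(i := y)) U (A - U)))"
    unfolding sviridenko_ge_iff[OF finite_A B] by blast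
  also have "(\<exists>y\<ge>c i. \<exists>U\<subseteq>A. sum (c(i := y)) U \<le> B \<and> card U \<le> 2 \<and> \<tau> \<le> v U) \<longleftrightarrow> ?L"
  proof
    assume "\<exists>y\<ge>c i. \<exists>U\<subseteq>A. sum (c(i := y)) U \<le> B \<and> card U \<le> 2 \<and> \<tau> \<le> v U"
    then obtain y U where y: "c i \<le> y" "U \<subseteq> A" "sum (c(i := y)) U \<le> B" "card U \<le> 2" "\<tau> \<le> v U" by blast
    have "sum c U \<le> sum (c(i := y)) U" by (rule sum_mono) (use y in auto)
    from order_trans[OF this y(3)] show ?L using y(2,4,5) by blast
  next
    assume ?L
    then show "\<exists>y\<ge>c i. \<exists>U\<subseteq>A. sum (c(i := y)) U \<le> B \<and> card U \<le> 2 \<and> \<tau> \<le> v U"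
      by (intro exI[of _ "c i"]) auto
  qed
  also have "(\<exists>y\<ge>c i. \<exists>U\<subseteq>A. card U = 3 \<and> sum (c(i := y)) U \<le> B \<and> \<tau> \<le> v (fill v B (c(i := y)) U (A - U))) \<longleftrightarrow> ?R"
  proof
    assume "\<exists>y\<ge>c i. \<exists>U\<subseteq>A. card U = 3 \<and> sum (c(i := y)) U \<le> B \<and> \<tau> \<le> v (fill v B (c(i := y)) U (A - U))"
    then obtain y U where "c i \<le> y" "U \<subseteq> A" "card U = 3" "sum (c(i := y)) U \<le> B"
      "\<tau> \<le> v (fill v B (c(i := y)) U (A - U))" by blast
    then show ?R using candidate_exists[OF c i, of U y B \<tau>] by blast
  next
    assume ?R
    then obtain U x f where U: "U \<subseteq> A" "card U = 3" "c i \<le> x" "fits f i B (c(i := x)) U"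
      "\<tau> \<le> v (flag_fill f i v B (c(i := x)) U (A - U))" by blast
    from candidate_sound[OF c i U(1,3-5)] U(1,2)
    show "\<exists>y\<ge>c i. \<exists>U\<subseteq>A. card U = 3 \<and> sum (c(i := y)) U \<le> B \<and> \<tau> \<le> v (fill v B (c(i := y)) U (A - U))"
      by blast
  qed
  finally show ?thesis .
qed

end

section \<open>Polynomial-time computable families\<close>

text \<open>The context \<open>X i\<close> collects the values of all variables in scope.\<close>

definition ptime :: "('i \<Rightarrow> nat) \<Rightarrow> 'i set \<Rightarrow> ('i \<Rightarrow> data) \<Rightarrow> ('i \<Rightarrow> data) \<Rightarrow> bool" where
  "ptime N D X Y \<longleftrightarrow> (\<exists>p d. \<forall>i\<in>D. exec p (X i) = Y i \<and> steps p (X i) \<le> (N i + 2) ^ d)"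

lemma ptimeI:
  assumes "\<And>i. i \<in> D \<Longrightarrow> exec p (X i) = Y i" "\<And>i. i \<in> D \<Longrightarrow> steps p (X i) \<le> (N i + 2) ^ d"
  shows "ptime N D X Y"
  using assms unfolding ptime_def by blast

lemma ptimeE:
  assumes "ptime N D X Y"
  obtains p d where "\<And>i. i \<in> D \<Longrightarrow> exec p (X i) = Y i" "\<And>i. i \<in> D \<Longrightarrow> steps p (X i) \<le> (N i + 2) ^ d"
  using assms unfolding ptime_def by blast

lemma power_sum_bound: "Suc ((n + 2) ^ a + (n + 2) ^ b) \<le> (n + 2) ^ (a + b + 2)" for n :: nat
proof -
  have "(n + 2) ^ a \<le> (n + 2) ^ (a + b)" "(n + 2) ^ b \<le> (n + 2) ^ (a + b)"
    by (simp_all add: power_add)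
  moreover have "1 \<le> (n + 2) ^ (a + b)" by simp
  ultimately have "Suc ((n + 2) ^ a + (n + 2) ^ b) \<le> 4 * (n + 2) ^ (a + b)" by linarith
  also have "\<dots> \<le> (n + 2) ^ 2 * (n + 2) ^ (a + b)"
    by (intro mult_right_mono) (auto simp: power2_eq_square)
  also have "\<dots> = (n + 2) ^ (a + b + 2)" by (metis add.commute power_add)
  finally show ?thesis .
qed

lemma ptime_cong: "ptime N D X Y \<Longrightarrow> (\<And>i. i \<in> D \<Longrightarrow> Y i = Z i) \<Longrightarrow> ptime N D X Z"
  unfolding ptime_def by metis

lemma ptime_reindex:
  assumes "ptime N D X Y" "\<And>j. j \<in> D' \<Longrightarrow> h j \<in> D \<and> N (h j) \<le> N' j"
  shows "ptime N' D' (\<lambda>j. X (h j)) (\<lambda>j. Y (h j))"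
proof (rule ptimeE[OF assms(1)])
  fix p d assume p: "\<And>i. i \<in> D \<Longrightarrow> exec p (X i) = Y i" "\<And>i. i \<in> D \<Longrightarrow> steps p (X i) \<le> (N i + 2) ^ d"
  show ?thesis
  proof (rule ptimeI[of _ p _ _ _ d])
    fix j assume j: "j \<in> D'"
    show "exec p (X (h j)) = Y (h j)" using p assms(2)[OF j] by auto
    have "steps p (X (h j)) \<le> (N (h j) + 2) ^ d" using p assms(2)[OF j] by auto
    also have "\<dots> \<le> (N' j + 2) ^ d" using assms(2)[OF j] by (intro power_mono) auto
    finally show "steps p (X (h j)) \<le> (N' j + 2) ^ d" .
  qed
qed

lemma ptime_subset: "ptime N D X Y \<Longrightarrow> D' \<subseteq> D \<Longrightarrow> ptime N D' X Y"
  unfolding ptime_def by blast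

lemma ptime_id: "ptime N D X X"
  by (rule ptimeI[of _ Ident _ _ _ 0]) auto

lemma ptime_seq:
  assumes "ptime N D X Y" "ptime N D Y Z"
  shows "ptime N D X Z"
proof (rule ptimeE[OF assms(1)], rule ptimeE[OF assms(2)])
  fix p d q e assume *: "\<And>i. i \<in> D \<Longrightarrow> exec p (X i) = Y i" "\<And>i. i \<in> D \<Longrightarrow> steps p (X i) \<le> (N i + 2) ^ d"
    "\<And>i. i \<in> D \<Longrightarrow> exec q (Y i) = Z i" "\<And>i. i \<in> D \<Longrightarrow> steps q (Y i) \<le> (N i + 2) ^ e"
  show ?thesis
  proof (rule ptimeI[of _ "Seq p q" _ _ _ "d + e + 2"])
    fix i assume i: "i \<in> D"
    show "steps (Seq p q) (X i) \<le> (N i + 2) ^ (d + e + 2)"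
      using *(1,2,4)[OF i] power_sum_bound[of "N i" d e] by simp
  qed (use * in simp)
qed

lemma ptime_Cell:
  assumes "ptime N D X Y" "ptime N D X Z"
  shows "ptime N D X (\<lambda>i. Cell (Y i) (Z i))"
proof (rule ptimeE[OF assms(1)], rule ptimeE[OF assms(2)])
  fix p d q e assume *: "\<And>i. i \<in> D \<Longrightarrow> exec p (X i) = Y i" "\<And>i. i \<in> D \<Longrightarrow> steps p (X i) \<le> (N i + 2) ^ d"
    "\<And>i. i \<in> D \<Longrightarrow> exec q (X i) = Z i" "\<And>i. i \<in> D \<Longrightarrow> steps q (X i) \<le> (N i + 2) ^ e"
  show ?thesis
  proof (rule ptimeI[of _ "Fork p q" _ _ _ "d + e + 2"])
    fix i assume i: "i \<in> D"
    show "steps (Fork p q) (X i) \<le> (N i + 2) ^ (d + e + 2)"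
      using *(2,4)[OF i] power_sum_bound[of "N i" d e] by simp
  qed (use * in simp)
qed

lemma ptime_prim:
  assumes "ptime N D X Y" "\<And>x. steps p x = 1" "\<And>i. i \<in> D \<Longrightarrow> exec p (Y i) = Z i"
  shows "ptime N D X Z"
  by (rule ptime_seq[OF assms(1)], rule ptimeI[of _ p _ _ _ 0]) (use assms in auto)

lemma ptime_head: "ptime N D X Y \<Longrightarrow> ptime N D X (\<lambda>i. head (Y i))"
  by (rule ptime_prim[where p = Head]) auto

lemma ptime_left: "ptime N D X (\<lambda>i. Cell (Y i) (Z i)) \<Longrightarrow> ptime N D X Y"
  by (rule ptime_prim[where p = Head]) auto

lemma ptime_right: "ptime N D X (\<lambda>i. Cell (Y i) (Z i)) \<Longrightarrow> ptime N D X Z"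
  by (rule ptime_prim[where p = Tail]) auto

lemma ptime_Null: "ptime N D X (\<lambda>i. Null)"
  by (rule ptime_prim[OF ptime_id, where p = NullConst]) auto

lemma ptime_zero: "ptime N D X (\<lambda>i. Num 0)"
  by (rule ptime_prim[OF ptime_id, where p = Zero]) auto

lemma ptime_one: "ptime N D X (\<lambda>i. Num 1)"
  by (rule ptime_prim[OF ptime_id, where p = One]) auto

lemma ptime_is_Null: "ptime N D X Y \<Longrightarrow> ptime N D X (\<lambda>i. bool_data (Y i = Null))"
  by (rule ptime_prim[where p = IsNull]) auto

context
  fixes N :: "'i \<Rightarrow> nat" and D X a b
  assumes a: "ptime N D X (\<lambda>i. Num (a i))" and b: "ptime N D X (\<lambda>i. Num (b i))"
begin

lemma ptime_plus: "ptime N D X (\<lambda>i. Num (a i + b i))"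
  by (rule ptime_prim[OF ptime_Cell[OF a b], where p = Plus]) auto

lemma ptime_times: "ptime N D X (\<lambda>i. Num (a i * b i))"
  by (rule ptime_prim[OF ptime_Cell[OF a b], where p = Times]) auto

lemma ptime_minus: "ptime N D X (\<lambda>i. Num (a i - b i))"
  by (rule ptime_prim[OF ptime_Cell[OF a b], where p = Minus]) auto

lemma ptime_divide: "ptime N D X (\<lambda>i. Num (a i / b i))"
  by (rule ptime_prim[OF ptime_Cell[OF a b], where p = Divide]) auto

lemma ptime_less: "ptime N D X (\<lambda>i. bool_data (a i < b i))"
  by (rule ptime_prim[OF ptime_Cell[OF a b], where p = Less]) auto

end

lemma ptime_if:
  assumes b: "ptime N D X (\<lambda>i. bool_data (b i))"
    and Y: "ptime N {i \<in> D. b i} X Y" and Z: "ptime N {i \<in> D. \<not> b i} X Z"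
  shows "ptime N D X (\<lambda>i. if b i then Y i else Z i)"
proof (rule ptimeE[OF b], rule ptimeE[OF Y], rule ptimeE[OF Z])
  fix p d q e r f
  assume p: "\<And>i. i \<in> D \<Longrightarrow> exec p (X i) = bool_data (b i)" "\<And>i. i \<in> D \<Longrightarrow> steps p (X i) \<le> (N i + 2) ^ d"
    and q: "\<And>i. i \<in> {i \<in> D. b i} \<Longrightarrow> exec q (X i) = Y i" "\<And>i. i \<in> {i \<in> D. b i} \<Longrightarrow> steps q (X i) \<le> (N i + 2) ^ e"
    and r: "\<And>i. i \<in> {i \<in> D. \<not> b i} \<Longrightarrow> exec r (X i) = Z i" "\<And>i. i \<in> {i \<in> D. \<not> b i} \<Longrightarrow> steps r (X i) \<le> (N i + 2) ^ f"
  show ?thesis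
  proof (rule ptimeI[of _ "Cond p q r" _ _ _ "d + (e + f) + 2"])
    fix i assume i: "i \<in> D"
    show "exec (Cond p q r) (X i) = (if b i then Y i else Z i)"
      using p(1)[OF i] q(1)[of i] r(1)[of i] i by (simp add: bool_data_def)
    have ef: "(N i + 2) ^ e \<le> (N i + 2) ^ (e + f)" "(N i + 2) ^ f \<le> (N i + 2) ^ (e + f)"
      by (simp_all add: power_add)
    have "(if exec p (X i) = Null then steps r (X i) else steps q (X i)) \<le> (N i + 2) ^ (e + f)"
    proof (cases "b i")
      case True
      then have "steps q (X i) \<le> (N i + 2) ^ (e + f)" using order_trans[OF q(2) ef(1)] i by blast
      then show ?thesis using p(1)[OF i] True by (simp add: bool_data_def)
    next
      case False
      then have "steps r (X i) \<le> (N i + 2) ^ (e + f)" using order_trans[OF r(2) ef(2)] i by blast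
      then show ?thesis using p(1)[OF i] False by (simp add: bool_data_def)
    qed
    then show "steps (Cond p q r) (X i) \<le> (N i + 2) ^ (d + (e + f) + 2)"
      using p(2)[OF i] power_sum_bound[of "N i" d "e + f"] by simp
  qed
qed

lemma ptime_If:
  assumes "ptime N D X (\<lambda>i. bool_data (b i))" "ptime N D X Y" "ptime N D X Z"
  shows "ptime N D X (\<lambda>i. if b i then Y i else Z i)"
  by (rule ptime_if[OF assms(1)]) (use assms(2,3) in \<open>auto elim: ptime_subset\<close>)

lemma ptime_False: "ptime N D X (\<lambda>i. bool_data False)"
  using ptime_Null by (simp add: bool_data_def)

lemma ptime_True: "ptime N D X (\<lambda>i. bool_data True)"
  using ptime_one by (simp add: bool_data_def)

lemma ptime_not: "ptime N D X (\<lambda>i. bool_data (a i)) \<Longrightarrow> ptime N D X (\<lambda>i. bool_data (\<not> a i))"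
  by (rule ptime_cong[OF ptime_If[OF _ ptime_False ptime_True]]) auto

context
  fixes N :: "'i \<Rightarrow> nat" and D X a b
  assumes a: "ptime N D X (\<lambda>i. bool_data (a i))" and b: "ptime N D X (\<lambda>i. bool_data (b i))"
begin

lemma ptime_and: "ptime N D X (\<lambda>i. bool_data (a i \<and> b i))"
  by (rule ptime_cong[OF ptime_If[OF a b ptime_False]]) auto

lemma ptime_or: "ptime N D X (\<lambda>i. bool_data (a i \<or> b i))"
  by (rule ptime_cong[OF ptime_If[OF a ptime_True b]]) auto

lemma ptime_imp: "ptime N D X (\<lambda>i. bool_data (a i \<longrightarrow> b i))"
  by (rule ptime_cong[OF ptime_If[OF a b ptime_True]]) auto

end

lemma ptime_and_then:
  assumes "ptime N D X (\<lambda>i. bool_data (a i))" "ptime N {i \<in> D. a i} X (\<lambda>i. bool_data (b i))"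
  shows "ptime N D X (\<lambda>i. bool_data (a i \<and> b i))"
  by (rule ptime_cong[OF ptime_if[OF assms ptime_False]]) auto

lemma ptime_le:
  assumes "ptime N D X (\<lambda>i. Num (a i))" "ptime N D X (\<lambda>i. Num (b i))"
  shows "ptime N D X (\<lambda>i. bool_data (a i \<le> b i))"
  using ptime_not[OF ptime_less[OF assms(2,1)]] by (simp add: not_less)

lemma ptime_eq:
  assumes "ptime N D X (\<lambda>i. Num (a i))" "ptime N D X (\<lambda>i. Num (b i))"
  shows "ptime N D X (\<lambda>i. bool_data (a i = b i))"
  using ptime_and[OF ptime_le[OF assms] ptime_le[OF assms(2,1)]] by (simp add: order_antisym_conv eq_iff)

lemma ptime_eq_nat:
  assumes "ptime N D X (\<lambda>i. Num (real (a i)))" "ptime N D X (\<lambda>i. Num (real (b i)))"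
  shows "ptime N D X (\<lambda>i. bool_data (a i = b i))"
  using ptime_eq[OF assms] by simp

lemma ptime_weaken:
  assumes "ptime N D X Y" "\<And>j. j \<in> D' \<Longrightarrow> fst j \<in> D"
  shows "ptime (\<lambda>j. N (fst j)) D' (\<lambda>j. Cell (X (fst j)) (E j)) (\<lambda>j. Y (fst j))"
proof (rule ptime_seq)
  show "ptime (\<lambda>j. N (fst j)) D' (\<lambda>j. Cell (X (fst j)) (E j)) (\<lambda>j. X (fst j))"
    by (rule ptime_left[OF ptime_id])
  show "ptime (\<lambda>j. N (fst j)) D' (\<lambda>j. X (fst j)) (\<lambda>j. Y (fst j))"
    by (rule ptime_reindex[OF assms(1)]) (use assms(2) in auto)
qed

lemma ptime_snd: "ptime N D (\<lambda>j. Cell (X j) (E j)) E"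
  by (rule ptime_right[OF ptime_id])

subsection \<open>Loops\<close>

lemma loop_list:
  assumes "\<And>k. a \<le> k \<Longrightarrow> k < b \<Longrightarrow> g (Cell (e k) (s k)) = s (Suc k)" "a \<le> b"
  shows "loop g (list_data (map e [a..<b])) (s a) = s b"
  using assms(2,1)
proof (induction a rule: inc_induct)
  case (step a)
  then show ?case by (simp add: upt_conv_Cons list_data_def)
qed (simp add: list_data_def)

lemma loop_steps_list:
  assumes "\<And>k. a \<le> k \<Longrightarrow> k < b \<Longrightarrow> g (Cell (e k) (s k)) = s (Suc k) \<and> t (Cell (e k) (s k)) \<le> m" "a \<le> b"
  shows "loop_steps g t (list_data (map e [a..<b])) (s a) \<le> Suc ((b - a) * Suc m)"
  using assms(2,1)
proof (induction a rule: inc_induct)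
  case (step a)
  have "g (Cell (e a) (s a)) = s (Suc a)" "t (Cell (e a) (s a)) \<le> m" using step by auto
  moreover have "loop_steps g t (list_data (map e [Suc a..<b])) (s (Suc a)) \<le> Suc ((b - Suc a) * Suc m)"
    using step by auto
  moreover have "b - a = Suc (b - Suc a)" using step by simp
  ultimately show ?case using step(1,2) by (simp add: upt_conv_Cons list_data_def)
qed (simp add: list_data_def)

lemma ptime_iterate:
  assumes list: "ptime N D X (\<lambda>i. list_data (map (e i) [0..<K i]))"
    and init: "ptime N D X (\<lambda>i. s i 0)"
    and body: "ptime (\<lambda>j. N (fst j)) (SIGMA i:D. {..<K i})
      (\<lambda>j. Cell (X (fst j)) (Cell (e (fst j) (snd j)) (s (fst j) (snd j)))) (\<lambda>j. s (fst j) (Suc (snd j)))"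
    and bound: "\<And>i. i \<in> D \<Longrightarrow> K i \<le> N i"
  shows "ptime N D X (\<lambda>i. s i (K i))"
proof -
  define D' where "D' = (SIGMA i:D. {..<K i})"
  let ?N = "\<lambda>j :: 'a \<times> nat. N (fst j)"
  let ?Z = "\<lambda>j. Cell (e (fst j) (snd j)) (Cell (X (fst j)) (s (fst j) (snd j)))"
  have id: "ptime ?N D' ?Z ?Z" by (rule ptime_id)
  have sX: "ptime ?N D' ?Z (\<lambda>j. X (fst j))" by (rule ptime_left[OF ptime_right[OF id]])
  have "ptime ?N D' ?Z (\<lambda>j. Cell (X (fst j)) (Cell (e (fst j) (snd j)) (s (fst j) (snd j))))"
    by (rule ptime_Cell[OF sX ptime_Cell[OF ptime_left[OF id] ptime_right[OF ptime_right[OF id]]]])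
  then have "ptime ?N D' ?Z (\<lambda>j. Cell (X (fst j)) (s (fst j) (Suc (snd j))))"
    using ptime_seq body ptime_Cell[OF sX] unfolding D'_def by blast
  then obtain p d where p: "\<And>j. j \<in> D' \<Longrightarrow> exec p (?Z j) = Cell (X (fst j)) (s (fst j) (Suc (snd j)))"
    "\<And>j. j \<in> D' \<Longrightarrow> steps p (?Z j) \<le> (N (fst j) + 2) ^ d" by (rule ptimeE) blast
  let ?st = "\<lambda>i k. Cell (X i) (s i k)"
  have step: "exec p (Cell (e i k) (?st i k)) = ?st i (Suc k) \<and> steps p (Cell (e i k) (?st i k)) \<le> (N i + 2) ^ d"
    if "i \<in> D" "k < K i" for i k
    using p[of "(i, k)"] that by (simp add: D'_def)
  have "ptime N D (\<lambda>i. Cell (list_data (map (e i) [0..<K i])) (?st i 0)) (\<lambda>i. ?st i (K i))"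
  proof (rule ptimeI[of _ "Loop p" _ _ _ "d + 3"])
    fix i assume i: "i \<in> D"
    show "exec (Loop p) (Cell (list_data (map (e i) [0..<K i])) (?st i 0)) = ?st i (K i)"
      using loop_list[of 0 "K i" "exec p" "e i" "?st i"] step[OF i] by simp
    have "steps (Loop p) (Cell (list_data (map (e i) [0..<K i])) (?st i 0)) \<le> Suc (K i * Suc ((N i + 2) ^ d))"
      using loop_steps_list[of 0 "K i" "exec p" "e i" "?st i" "steps p" "(N i + 2) ^ d"] step[OF i] by simp
    also have "\<dots> \<le> Suc (N i * Suc ((N i + 2) ^ d))" by (simp only: Suc_le_mono mult_le_mono1[OF bound[OF i]])
    also have "\<dots> \<le> (N i + 2) * (2 * (N i + 2) ^ d)"
    proof -
      have "1 \<le> (N i + 2) ^ d" by simp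
      then have "N i * Suc ((N i + 2) ^ d) \<le> N i * (2 * (N i + 2) ^ d)" by (intro mult_left_mono) auto
      moreover have "Suc (N i * (2 * (N i + 2) ^ d)) \<le> (N i + 2) * (2 * (N i + 2) ^ d)"
        using \<open>1 \<le> (N i + 2) ^ d\<close> by (simp add: algebra_simps)
      ultimately show ?thesis by linarith
    qed
    also have "\<dots> \<le> (N i + 2) * ((N i + 2) * (N i + 2) ^ d)" by (intro mult_left_mono mult_right_mono) auto
    also have "\<dots> \<le> (N i + 2) ^ (d + 3)" by (simp add: power_add numeral_eq_Suc)
    finally show "steps (Loop p) (Cell (list_data (map (e i) [0..<K i])) (?st i 0)) \<le> (N i + 2) ^ (d + 3)" .
  qed
  from ptime_right[OF this]
  have "ptime N D (\<lambda>i. Cell (list_data (map (e i) [0..<K i])) (?st i 0)) (\<lambda>i. s i (K i))" .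
  then show ?thesis using ptime_seq ptime_Cell[OF list ptime_Cell[OF ptime_id init]] by blast
qed

lemma list_data_simps: "list_data [] = Null" "list_data (x # xs) = Cell x (list_data xs)"
  by (simp_all add: list_data_def)

lemma list_data_Null: "list_data xs = Null \<longleftrightarrow> xs = []"
  by (cases xs) (simp_all add: list_data_simps)

lemma ptime_rev:
  assumes "ptime N D X (\<lambda>i. list_data (l i))" "\<And>i. i \<in> D \<Longrightarrow> length (l i) \<le> N i"
  shows "ptime N D X (\<lambda>i. list_data (rev (l i)))"
proof -
  have "ptime N D X (\<lambda>i. list_data (rev (take (length (l i)) (l i))))"
  proof (rule ptime_iterate[where e = "\<lambda>i k. l i ! k"])
    show "ptime N D X (\<lambda>i. list_data (map (\<lambda>k. l i ! k) [0..<length (l i)]))" using assms(1) by (simp add: map_nth)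
    show "ptime N D X (\<lambda>i. list_data (rev (take 0 (l i))))" using ptime_Null by (simp add: list_data_simps)
    let ?Z = "\<lambda>j. Cell (X (fst j)) (Cell (l (fst j) ! snd j) (list_data (rev (take (snd j) (l (fst j))))))"
    show "ptime (\<lambda>j. N (fst j)) (SIGMA i:D. {..<length (l i)}) ?Z
      (\<lambda>j. list_data (rev (take (Suc (snd j)) (l (fst j)))))"
      by (rule ptime_cong[OF ptime_right[OF ptime_id]]) (auto simp: take_Suc_conv_app_nth list_data_simps)
  qed (use assms in auto)
  then show ?thesis by simp
qed

lemma ptime_filter_map:
  assumes l: "ptime N D X (\<lambda>i. list_data (map (e i) (l i)))"
    and bound: "\<And>i. i \<in> D \<Longrightarrow> length (l i) \<le> N i"
    and P: "ptime (\<lambda>j. N (fst j)) (SIGMA i:D. set (l i)) (\<lambda>j. Cell (X (fst j)) (e (fst j) (snd j)))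
      (\<lambda>j. bool_data (P (fst j) (snd j)))"
    and f: "ptime (\<lambda>j. N (fst j)) (SIGMA i:D. {a \<in> set (l i). P i a}) (\<lambda>j. Cell (X (fst j)) (e (fst j) (snd j)))
      (\<lambda>j. f (fst j) (snd j))"
  shows "ptime N D X (\<lambda>i. list_data (map (f i) (filter (P i) (l i))))"
proof -
  have "ptime N D X (\<lambda>i. list_data (rev (map (f i) (filter (P i) (take (length (l i)) (l i))))))"
  proof (rule ptime_iterate[where e = "\<lambda>i k. e i (l i ! k)"])
    show "ptime N D X (\<lambda>i. list_data (map (\<lambda>k. e i (l i ! k)) [0..<length (l i)]))"
    proof (rule ptime_cong[OF l])
      show "list_data (map (e i) (l i)) = list_data (map (\<lambda>k. e i (l i ! k)) [0..<length (l i)])" for i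
        by (metis (no_types) map_nth map_map comp_def map_eq_conv)
    qed
    show "ptime N D X (\<lambda>i. list_data (rev (map (f i) (filter (P i) (take 0 (l i))))))"
      using ptime_Null by (simp add: list_data_simps)
    let ?s = "\<lambda>i k. list_data (rev (map (f i) (filter (P i) (take k (l i)))))"
    let ?Z = "\<lambda>j. Cell (X (fst j)) (Cell (e (fst j) (l (fst j) ! snd j)) (?s (fst j) (snd j)))"
    let ?D = "SIGMA i:D. {..<length (l i)}"
    let ?N = "\<lambda>j :: 'a \<times> nat. N (fst j)"
    have id: "ptime ?N D'' ?Z ?Z" for D'' by (rule ptime_id)
    have elt: "ptime ?N D'' ?Z (\<lambda>j. Cell (X (fst j)) (e (fst j) (l (fst j) ! snd j)))" for D''
      by (rule ptime_Cell[OF ptime_left[OF id] ptime_left[OF ptime_right[OF id]]])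
    have P': "ptime ?N ?D ?Z (\<lambda>j. bool_data (P (fst j) (l (fst j) ! snd j)))"
    proof (rule ptime_seq[OF elt])
      show "ptime ?N ?D (\<lambda>j. Cell (X (fst j)) (e (fst j) (l (fst j) ! snd j)))
        (\<lambda>j. bool_data (P (fst j) (l (fst j) ! snd j)))"
        using ptime_reindex[OF P, of ?D "\<lambda>j. (fst j, l (fst j) ! snd j)" ?N] by (auto simp: split_beta)
    qed
    let ?D1 = "{j \<in> ?D. P (fst j) (l (fst j) ! snd j)}"
    have f': "ptime ?N ?D1 ?Z (\<lambda>j. f (fst j) (l (fst j) ! snd j))"
    proof (rule ptime_seq[OF elt])
      show "ptime ?N ?D1 (\<lambda>j. Cell (X (fst j)) (e (fst j) (l (fst j) ! snd j)))
        (\<lambda>j. f (fst j) (l (fst j) ! snd j))"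
        using ptime_reindex[OF f, of ?D1 "\<lambda>j. (fst j, l (fst j) ! snd j)" ?N] by (auto simp: split_beta)
    qed
    have st: "ptime ?N D'' ?Z (\<lambda>j. ?s (fst j) (snd j))" for D''
      by (rule ptime_right[OF ptime_right[OF id]])
    show "ptime ?N ?D ?Z (\<lambda>j. ?s (fst j) (Suc (snd j)))"
      by (rule ptime_cong[OF ptime_if[OF P' ptime_Cell[OF f' st] st]])
        (auto simp: take_Suc_conv_app_nth list_data_simps)
  qed (use bound in auto)
  then have "ptime N D X (\<lambda>i. list_data (rev (map (f i) (filter (P i) (l i)))))" by simp
  moreover have "length (rev (map (f i) (filter (P i) (l i)))) \<le> N i" if "i \<in> D" for i
    using order_trans[OF length_filter_le bound[OF that]] by simp
  ultimately show ?thesis using ptime_rev[of N D X "\<lambda>i. rev (map (f i) (filter (P i) (l i)))"] by simp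
qed

lemma sorted_list_of_set_filter:
  "finite S \<Longrightarrow> filter P (sorted_list_of_set S) = sorted_list_of_set {a \<in> S. P a}"
  by (rule sorted_distinct_set_unique) (auto simp: sorted_wrt_filter)

lemma subset_lessThan: "S \<subseteq> {..<n} \<Longrightarrow> finite S \<and> card S \<le> n" for S :: "nat set"
  using card_mono[of "{..<n}" S] finite_subset[of S "{..<n}"] by simp

lemma ptime_filter:
  assumes S: "ptime N D X (\<lambda>i. set_data (S i))" and b: "\<And>i. i \<in> D \<Longrightarrow> S i \<subseteq> {..<N i}"
    and P: "ptime (\<lambda>j. N (fst j)) (SIGMA i:D. S i) (\<lambda>j. Cell (X (fst j)) (Num (real (snd j))))
      (\<lambda>j. bool_data (P (fst j) (snd j)))"
  shows "ptime N D X (\<lambda>i. set_data {a \<in> S i. P i a})"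
proof -
  note fin = subset_lessThan[OF b]
  have eq: "(SIGMA i:D. set (sorted_list_of_set (S i))) = (SIGMA i:D. S i)" using fin by (auto intro: Sigma_cong)
  have "ptime N D X (\<lambda>i. list_data (map (\<lambda>a. Num (real a)) (filter (P i) (sorted_list_of_set (S i)))))"
  proof (rule ptime_filter_map[where e = "\<lambda>_ a. Num (real a)"])
    show "ptime N D X (\<lambda>i. list_data (map (\<lambda>a. Num (real a)) (sorted_list_of_set (S i))))"
      using S by (simp add: set_data_def)
    show "ptime (\<lambda>j. N (fst j)) (SIGMA i:D. set (sorted_list_of_set (S i)))
       (\<lambda>j. Cell (X (fst j)) (Num (real (snd j)))) (\<lambda>j. bool_data (P (fst j) (snd j)))"
      unfolding eq by (rule P)
  qed (use fin ptime_snd in auto)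
  then show ?thesis
    by (rule ptime_cong) (simp add: sorted_list_of_set_filter fin set_data_def)
qed

lemma set_data_Null: "finite S \<Longrightarrow> set_data S = Null \<longleftrightarrow> S = {}"
  by (simp add: set_data_def list_data_Null)

lemma ptime_is_empty:
  assumes "ptime N D X (\<lambda>i. set_data (S i))" "\<And>i. i \<in> D \<Longrightarrow> S i \<subseteq> {..<N i}"
  shows "ptime N D X (\<lambda>i. bool_data (S i = {}))"
  by (rule ptime_cong[OF ptime_is_Null[OF assms(1)]]) (simp add: set_data_Null subset_lessThan[OF assms(2)])

lemma ptime_Bex:
  assumes S: "ptime N D X (\<lambda>i. set_data (S i))" and b: "\<And>i. i \<in> D \<Longrightarrow> S i \<subseteq> {..<N i}"
    and P: "ptime (\<lambda>j. N (fst j)) (SIGMA i:D. S i) (\<lambda>j. Cell (X (fst j)) (Num (real (snd j))))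
      (\<lambda>j. bool_data (P (fst j) (snd j)))"
  shows "ptime N D X (\<lambda>i. bool_data (\<exists>a\<in>S i. P i a))"
proof (rule ptime_cong[OF ptime_not[OF ptime_is_empty[OF ptime_filter[OF assms]]]])
  show "{a \<in> S i. P i a} \<subseteq> {..<N i}" if "i \<in> D" for i using b[OF that] by auto
qed (simp_all add: Bex_def)

lemma ptime_Ball:
  assumes S: "ptime N D X (\<lambda>i. set_data (S i))" and b: "\<And>i. i \<in> D \<Longrightarrow> S i \<subseteq> {..<N i}"
    and P: "ptime (\<lambda>j. N (fst j)) (SIGMA i:D. S i) (\<lambda>j. Cell (X (fst j)) (Num (real (snd j))))
      (\<lambda>j. bool_data (P (fst j) (snd j)))"
  shows "ptime N D X (\<lambda>i. bool_data (\<forall>a\<in>S i. P i a))"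
  by (rule ptime_cong[OF ptime_not[OF ptime_Bex[OF S b ptime_not[OF P]]]]) auto

lemma ptime_mem:
  assumes "ptime N D X (\<lambda>i. set_data (S i))" "\<And>i. i \<in> D \<Longrightarrow> S i \<subseteq> {..<N i}" "ptime N D X (\<lambda>i. Num (real (a i)))"
  shows "ptime N D X (\<lambda>i. bool_data (a i \<in> S i))"
proof (rule ptime_cong[OF ptime_Bex[OF assms(1,2)]])
  show "ptime (\<lambda>j. N (fst j)) (SIGMA i:D. S i) (\<lambda>j. Cell (X (fst j)) (Num (real (snd j))))
    (\<lambda>j. bool_data (snd j = a (fst j)))"
    by (rule ptime_eq_nat[OF ptime_snd ptime_weaken[OF assms(3)]]) auto
qed auto

lemma ptime_Min:
  assumes "ptime N D X (\<lambda>i. set_data (S i))" "\<And>i. i \<in> D \<Longrightarrow> S i \<subseteq> {..<N i} \<and> S i \<noteq> {}"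
  shows "ptime N D X (\<lambda>i. Num (real (Min (S i))))"
proof (rule ptime_cong[OF ptime_head[OF assms(1)]])
  fix i assume i: "i \<in> D"
  have fin: "finite (S i)" and ne: "S i \<noteq> {}" using assms(2)[OF i] subset_lessThan by auto
  have "sorted_list_of_set (S i) = Min (S i) # sorted_list_of_set (S i - {Min (S i)})"
    by (rule sorted_list_of_set_nonempty[OF fin ne])
  then show "head (set_data (S i)) = Num (real (Min (S i)))"
    by (simp only: set_data_def list.map list_data_simps head.simps)
qed

lemma ptime_sum:
  assumes S: "ptime N D X (\<lambda>i. set_data (S i))" and b: "\<And>i. i \<in> D \<Longrightarrow> S i \<subseteq> {..<N i}"
    and f: "ptime (\<lambda>j. N (fst j)) (SIGMA i:D. S i) (\<lambda>j. Cell (X (fst j)) (Num (real (snd j))))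
      (\<lambda>j. Num (f (fst j) (snd j)))"
  shows "ptime N D X (\<lambda>i. Num (sum (f i) (S i)))"
proof -
  note fin = subset_lessThan[OF b]
  define l where "l i = sorted_list_of_set (S i)" for i
  have l: "set (l i) = S i" "distinct (l i)" "length (l i) \<le> N i" if "i \<in> D" for i using fin[OF that] by (auto simp: l_def)
  have "ptime N D X (\<lambda>i. Num (sum_list (map (f i) (take (length (l i)) (l i)))))"
  proof (rule ptime_iterate[where e = "\<lambda>i k. Num (real (l i ! k))"])
    show "ptime N D X (\<lambda>i. list_data (map (\<lambda>k. Num (real (l i ! k))) [0..<length (l i)]))"
    proof (rule ptime_cong[OF S])
      show "set_data (S i) = list_data (map (\<lambda>k. Num (real (l i ! k))) [0..<length (l i)])" for i
        unfolding set_data_def l_def by (metis (no_types) map_nth map_map comp_def map_eq_conv)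
    qed
    show "ptime N D X (\<lambda>i. Num (sum_list (map (f i) (take 0 (l i)))))" using ptime_zero by simp
    let ?s = "\<lambda>i k. Num (sum_list (map (f i) (take k (l i))))"
    let ?Z = "\<lambda>j. Cell (X (fst j)) (Cell (Num (real (l (fst j) ! snd j))) (?s (fst j) (snd j)))"
    let ?D = "SIGMA i:D. {..<length (l i)}"
    let ?N = "\<lambda>j :: 'a \<times> nat. N (fst j)"
    have id: "ptime ?N ?D ?Z ?Z" by (rule ptime_id)
    have "ptime ?N ?D (\<lambda>j. Cell (X (fst j)) (Num (real (l (fst j) ! snd j)))) (\<lambda>j. Num (f (fst j) (l (fst j) ! snd j)))"
    proof -
      have "(fst j, l (fst j) ! snd j) \<in> (SIGMA i:D. S i) \<and> N (fst (fst j, l (fst j) ! snd j)) \<le> N (fst j)"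
        if "j \<in> ?D" for j
      proof -
        have j: "fst j \<in> D" "snd j < length (l (fst j))" using that by auto
        then have "l (fst j) ! snd j \<in> S (fst j)" using nth_mem l(1) by blast
        then show ?thesis using j by simp
      qed
      from ptime_reindex[OF f, of ?D "\<lambda>j. (fst j, l (fst j) ! snd j)" ?N, OF this] show ?thesis by simp
    qed
    from ptime_seq[OF ptime_Cell[OF ptime_left[OF id] ptime_left[OF ptime_right[OF id]]] this]
    have "ptime ?N ?D ?Z (\<lambda>j. Num (f (fst j) (l (fst j) ! snd j)))" .
    from ptime_plus[OF ptime_right[OF ptime_right[OF id]] this]
    show "ptime ?N ?D ?Z (\<lambda>j. ?s (fst j) (Suc (snd j)))"
      by (rule ptime_cong) (auto simp: take_Suc_conv_app_nth)
  qed (use l in auto)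
  then show ?thesis by (rule ptime_cong) (use l in \<open>auto simp: sum_list_distinct_conv_sum_set\<close>)
qed

subsection \<open>Arrays\<close>

definition array :: "nat \<Rightarrow> (nat \<Rightarrow> data) \<Rightarrow> data" where
  "array n f = list_data (map f [0..<n])"

lemma ptime_array:
  assumes S: "ptime N D X (\<lambda>i. set_data {..<n i})" and b: "\<And>i. i \<in> D \<Longrightarrow> n i \<le> N i"
    and f: "ptime (\<lambda>j. N (fst j)) (SIGMA i:D. {..<n i}) (\<lambda>j. Cell (X (fst j)) (Num (real (snd j))))
      (\<lambda>j. f (fst j) (snd j))"
  shows "ptime N D X (\<lambda>i. array (n i) (f i))"
proof -
  have l: "sorted_list_of_set {..<n} = [0..<n]" for n by (simp add: lessThan_atLeast0)
  have set_l: "{a \<in> set [0..<n]. True} = {..<n}" for n by auto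
  have "ptime N D X (\<lambda>i. list_data (map (f i) (filter (\<lambda>_. True) [0..<n i])))"
  proof (rule ptime_filter_map[where e = "\<lambda>_ a. Num (real a)"])
    show "ptime N D X (\<lambda>i. list_data (map (\<lambda>a. Num (real a)) [0..<n i]))"
      using S by (simp add: set_data_def l)
    show "ptime (\<lambda>j. N (fst j)) (SIGMA i:D. {a \<in> set [0..<n i]. True})
      (\<lambda>j. Cell (X (fst j)) (Num (real (snd j)))) (\<lambda>j. f (fst j) (snd j))" unfolding set_l by (rule f)
  qed (use b ptime_True in auto)
  then show ?thesis by (simp add: array_def)
qed

lemma ptime_nth:
  assumes f: "ptime N D X (\<lambda>i. array (n i) (f i))" and k: "ptime N D X (\<lambda>i. Num (real (k i)))"
    and b: "\<And>i. i \<in> D \<Longrightarrow> k i < n i \<and> n i \<le> N i"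
  shows "ptime N D X (\<lambda>i. f i (k i))"
proof -
  let ?s = "\<lambda>i q. Cell (Num (real q)) (if k i < q then f i (k i) else Null)"
  have "ptime N D X (\<lambda>i. ?s i (n i))"
  proof (rule ptime_iterate[where e = f and s = ?s and K = n])
    show "ptime N D X (\<lambda>i. list_data (map (f i) [0..<n i]))" using f by (simp add: array_def)
    show "ptime N D X (\<lambda>i. ?s i 0)" using ptime_Cell[OF ptime_zero ptime_Null] by simp
    let ?Z = "\<lambda>j. Cell (X (fst j)) (Cell (f (fst j) (snd j)) (?s (fst j) (snd j)))"
    let ?D = "SIGMA i:D. {..<n i}"
    let ?N = "\<lambda>j :: 'a \<times> nat. N (fst j)"
    have id: "ptime ?N ?D ?Z ?Z" by (rule ptime_id)
    note st = ptime_right[OF ptime_right[OF id]]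
    have k': "ptime ?N ?D ?Z (\<lambda>j. Num (real (k (fst j))))" by (rule ptime_weaken[OF k]) auto
    show "ptime ?N ?D ?Z (\<lambda>j. ?s (fst j) (Suc (snd j)))"
      by (rule ptime_cong[OF ptime_Cell[OF ptime_plus[OF ptime_left[OF st] ptime_one]
          ptime_If[OF ptime_eq_nat[OF ptime_left[OF st] k'] ptime_left[OF ptime_right[OF id]] ptime_right[OF st]]]])
        auto
  qed (use b in auto)
  from ptime_right[OF this] show ?thesis by (rule ptime_cong) (use b in auto)
qed

section \<open>Computing the value of a set of agents\<close>

subsection \<open>Augmenting a matching\<close>

definition sources :: "('a, 't) market \<Rightarrow> ('a \<times> 't) set \<Rightarrow> 't set \<Rightarrow> 't \<Rightarrow> 't set" where
  "sources I M V t' = {t \<in> V. \<exists>a\<in>agents I. (a, t) \<in> M \<and> (a, t') \<in> edges I}"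

definition mates :: "('a, 't) market \<Rightarrow> ('a \<times> 't) set \<Rightarrow> 't \<Rightarrow> 'a set" where
  "mates I M t = {a \<in> agents I. (a, t) \<in> M}"

definition reassign :: "'a \<Rightarrow> 't \<Rightarrow> ('a \<times> 't) set \<Rightarrow> ('a \<times> 't) set" where
  "reassign a t N = insert (a, t) {e \<in> N. snd e \<noteq> t}"

text \<open>The search keeps the set \<open>V\<close> of tasks reached so far, and for every such task the matching shifted along the
  alternating path found.\<close>

definition search_step :: "(nat, nat) market \<Rightarrow> (nat \<times> nat) set \<Rightarrow> nat set \<times> (nat \<Rightarrow> (nat \<times> nat) set) \<Rightarrow>
    nat set \<times> (nat \<Rightarrow> (nat \<times> nat) set)" where
  "search_step I M = (\<lambda>(V, F). (V \<union> {t' \<in> tasks I. sources I M V t' \<noteq> {}},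
     \<lambda>t'. if t' \<in> V then F t' else if sources I M V t' \<noteq> {}
       then reassign (Min (mates I M (Min (sources I M V t')))) t' (F (Min (sources I M V t'))) else {}))"

definition search :: "(nat, nat) market \<Rightarrow> (nat \<times> nat) set \<Rightarrow> nat \<Rightarrow> nat \<Rightarrow> nat set \<times> (nat \<Rightarrow> (nat \<times> nat) set)" where
  "search I M i k = (search_step I M ^^ k) ({t \<in> tasks I. (i, t) \<in> edges I}, \<lambda>t. reassign i t M)"

definition best_free :: "(nat, nat) market \<Rightarrow> (nat \<times> nat) set \<Rightarrow> nat set \<Rightarrow> nat set" where
  "best_free I M V = {t \<in> V. mates I M t = {} \<and> (\<forall>u\<in>V. mates I M u = {} \<longrightarrow> worth I u \<le> worth I t)}"

definition augment :: "(nat, nat) market \<Rightarrow> (nat \<times> nat) set \<Rightarrow> nat \<Rightarrow> (nat \<times> nat) set" where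
  "augment I M i = (if best_free I M (fst (search I M i (card (tasks I)))) = {} then M
     else snd (search I M i (card (tasks I))) (Min (best_free I M (fst (search I M i (card (tasks I)))))))"

context
  fixes I :: "(nat, nat) market" and S M i
  assumes I: "crowdsourcing I" and M: "matching I S M" and i: "i \<notin> S"
begin

lemma unmatched: "i \<notin> fst ` M"
  using M i by (force simp: matching_def)

lemma matching_agents: "M \<subseteq> agents I \<times> tasks I"
  using M crowdsourcingD(3)[OF I] by (auto simp: matching_def)

lemma mates_unique: "a \<in> mates I M t \<Longrightarrow> (b, t) \<in> M \<Longrightarrow> a = b"
  using M by (force simp: mates_def matching_def inj_on_def)

lemma finite_sources: "V \<subseteq> tasks I \<Longrightarrow> finite (sources I M V t)"
  using finite_subset[OF _ crowdsourcingD(2)[OF I], of V] by (simp add: sources_def)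

lemma search_invariant:
  "fst (search I M i k) \<subseteq> tasks I \<and> {t. (i, t) \<in> edges I} \<subseteq> fst (search I M i k) \<and>
   (\<forall>t\<in>fst (search I M i k). \<exists>W\<subseteq>fst (search I M i k). shift (edges I) M i t (snd (search I M i k) t) W)"
proof (induction k)
  case 0
  have e: "t \<in> tasks I" if "(i, t) \<in> edges I" for t using that crowdsourcingD(3)[OF I] by auto
  have "\<exists>W\<subseteq>{t \<in> tasks I. (i, t) \<in> edges I}. shift (edges I) M i t (reassign i t M) W"
    if "(i, t) \<in> edges I" for t
    using shift.start[OF that, of M] that e[OF that] by (intro exI[of _ "{t}"]) (auto simp: reassign_def)
  then show ?case using e by (auto simp: search_def)
next
  case (Suc k)
  obtain V F where VF: "search I M i k = (V, F)" by (cases "search I M i k")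
  have V: "V \<subseteq> tasks I" "{t. (i, t) \<in> edges I} \<subseteq> V"
    and sh: "\<And>t. t \<in> V \<Longrightarrow> \<exists>W\<subseteq>V. shift (edges I) M i t (F t) W" using Suc VF by auto
  define V' where "V' = V \<union> {t' \<in> tasks I. sources I M V t' \<noteq> {}}"
  have eq: "search I M i (Suc k) = search_step I M (V, F)" using VF by (simp add: search_def)
  have V': "fst (search I M i (Suc k)) = V'" by (simp add: eq search_step_def V'_def)
  have "\<exists>W\<subseteq>V'. shift (edges I) M i t' (snd (search I M i (Suc k)) t') W" if t': "t' \<in> V'" for t'
  proof (cases "t' \<in> V")
    case True
    then have "snd (search I M i (Suc k)) t' = F t'" by (simp add: eq search_step_def)
    then show ?thesis using sh[OF True] by (auto simp: V'_def)
  next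
    case False
    then have ne: "sources I M V t' \<noteq> {}" using t' by (simp add: V'_def)
    define t where "t = Min (sources I M V t')"
    have t: "t \<in> sources I M V t'" using Min_in[OF finite_sources[OF V(1)] ne] by (simp add: t_def)
    then obtain a where a: "a \<in> agents I" "(a, t) \<in> M" "(a, t') \<in> edges I" by (auto simp: sources_def)
    have "Min (mates I M t) \<in> mates I M t"
      using a crowdsourcingD(1)[OF I] by (intro Min_in) (auto simp: mates_def)
    then have "Min (mates I M t) = a" using mates_unique a(2) by blast
    then have "snd (search I M i (Suc k)) t' = insert (a, t') {e \<in> F t. snd e \<noteq> t'}"
      using False ne by (simp add: eq search_step_def t_def reassign_def)
    moreover obtain W where W: "W \<subseteq> V" "shift (edges I) M i t (F t) W" using sh t by (auto simp: sources_def)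
    moreover have "shift (edges I) M i t' (insert (a, t') {e \<in> F t. snd e \<noteq> t'}) (insert t' W)"
      using shift.step[OF W(2) a(2,3)] False W(1) by auto
    ultimately show ?thesis using t' by (intro exI[of _ "insert t' W"]) (auto simp: V'_def)
  qed
  moreover have "V' \<subseteq> tasks I" "{t. (i, t) \<in> edges I} \<subseteq> V'" using V by (auto simp: V'_def)
  ultimately show ?case unfolding V' by blast
qed

lemma search_shift:
  assumes "t \<in> fst (search I M i k)"
  obtains W where "shift (edges I) M i t (snd (search I M i k) t) W"
  using assms search_invariant by blast

lemma search_subset:
  assumes "t \<in> fst (search I M i k)" "i \<in> agents I"
  shows "snd (search I M i k) t \<subseteq> agents I \<times> tasks I"
proof -
  obtain W where "shift (edges I) M i t (snd (search I M i k) t) W" using search_shift assms by blast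
  then have "matching I (insert i S) (snd (search I M i k) t)"
    using shift_invariant[OF M unmatched I] by blast
  then show ?thesis using crowdsourcingD(3)[OF I] by (auto simp: matching_def)
qed

lemma search_closed:
  assumes "sources I M (fst (search I M i (card (tasks I)))) t' \<noteq> {}" "t' \<in> tasks I"
  shows "t' \<in> fst (search I M i (card (tasks I)))"
proof -
  let ?V = "\<lambda>k. fst (search I M i k)"
  let ?cl = "\<lambda>V. \<forall>t'\<in>tasks I. sources I M V t' \<noteq> {} \<longrightarrow> t' \<in> V"
  have step: "?V (Suc k) = ?V k \<union> {t' \<in> tasks I. sources I M (?V k) t' \<noteq> {}}" for k
    by (simp add: search_def search_step_def split_beta)
  have fin: "finite (?V k)" for k using search_invariant crowdsourcingD(2)[OF I] finite_subset by blast
  have "?cl (?V k) \<or> k \<le> card (?V k)" for k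
  proof (induction k)
    case (Suc k)
    show ?case
    proof (cases "?cl (?V k)")
      case True
      then have "?V (Suc k) = ?V k" unfolding step by auto
      then show ?thesis using True by simp
    next
      case False
      then have "?V k \<subset> ?V (Suc k)" unfolding step by auto
      then have "card (?V k) < card (?V (Suc k))" using fin by (simp add: psubset_card_mono)
      then show ?thesis using Suc False by auto
    qed
  qed simp
  moreover have "?V k = tasks I" if "card (tasks I) \<le> card (?V k)" for k
    using card_subset_eq[OF crowdsourcingD(2)[OF I], of "?V k"] search_invariant that
      card_mono[OF crowdsourcingD(2)[OF I], of "?V k"] by (metis le_antisym)
  ultimately show ?thesis using assms by blast
qed

lemma augment_optimal:
  assumes w: "weight I M = match_value I S"
  shows "matching I (insert i S) (augment I M i) \<and> weight I (augment I M i) = match_value I (insert i S)"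
proof -
  define V where "V = fst (search I M i (card (tasks I)))"
  define F where "F = snd (search I M i (card (tasks I)))"
  have free: "mates I M t = {} \<longleftrightarrow> t \<notin> snd ` M" for t
    using matching_agents by (force simp: mates_def)
  have V: "V \<subseteq> tasks I" "{t. (i, t) \<in> edges I} \<subseteq> V" using search_invariant by (auto simp: V_def)
  have closed: "t' \<in> V" if "t \<in> V" "(a, t) \<in> M" "(a, t') \<in> edges I" for a t t'
  proof -
    have "sources I M V t' \<noteq> {}" using that matching_agents by (auto simp: sources_def)
    then show ?thesis using search_closed[of t'] crowdsourcingD(3)[OF I] that by (auto simp: V_def)
  qed
  have upper: "match_value I (insert i S) \<le> match_value I S + b"
    if "0 \<le> b" "\<And>t. t \<in> V \<Longrightarrow> t \<notin> snd ` M \<Longrightarrow> worth I t \<le> b" for b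
    by (rule match_value_insert_le[OF I M order_refl, of V]) (use V closed that in auto)
  define Z where "Z = best_free I M V"
  have aug: "augment I M i = (if Z = {} then M else F (Min Z))" by (simp add: augment_def Z_def V_def F_def)
  have finV: "finite V" using V crowdsourcingD(2)[OF I] finite_subset by blast
  show ?thesis
  proof (cases "Z = {}")
    case True
    have "t \<in> snd ` M" if "t \<in> V" for t
    proof (rule ccontr)
      assume "t \<notin> snd ` M"
      define U where "U = {t \<in> V. mates I M t = {}}"
      have "finite U" "U \<noteq> {}" using finV that free \<open>t \<notin> snd ` M\<close> by (auto simp: U_def)
      then obtain m where "m \<in> U" "\<And>x. x \<in> U \<Longrightarrow> worth I x \<le> worth I m"
        by (rule finite_argmax[of U "worth I"]) blast
      then have "m \<in> Z" by (auto simp: Z_def best_free_def U_def)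
      then show False using True by simp
    qed
    then have "match_value I (insert i S) \<le> match_value I S + 0" by (intro upper) auto
    then show ?thesis using aug True w match_value_mono[OF I subset_insertI, of S i] matching_mono[OF M subset_insertI]
      by auto
  next
    case False
    define t where "t = Min Z"
    have "finite Z" using finV by (simp add: Z_def best_free_def)
    then have t: "t \<in> Z" using False by (simp add: t_def)
    then have tV: "t \<in> V" and tM: "t \<notin> snd ` M" and best: "\<And>u. u \<in> V \<Longrightarrow> u \<notin> snd ` M \<Longrightarrow> worth I u \<le> worth I t"
      using free by (auto simp: Z_def best_free_def)
    obtain W where "shift (edges I) M i t (F t) W" using search_shift[of t] tV unfolding V_def F_def by blast
    note N = shift_free[OF M unmatched I this tM]
    have "match_value I (insert i S) \<le> match_value I S + worth I t"
      by (rule upper[OF crowdsourcingD(4)[OF I N(4)] best])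
    then show ?thesis using N aug False w match_value_upper[OF I N(1)] by (simp add: t_def)
  qed
qed

end

definition build :: "(nat, nat) market \<Rightarrow> nat list \<Rightarrow> nat \<Rightarrow> (nat \<times> nat) set" where
  "build I xs k = fold (\<lambda>a M. augment I M a) (take k xs) {}"

lemma build_optimal:
  assumes I: "crowdsourcing I" and "distinct xs"
  shows "k \<le> length xs \<Longrightarrow> matching I (set (take k xs)) (build I xs k) \<and>
    weight I (build I xs k) = match_value I (set (take k xs))"
proof (induction k)
  case 0
  show ?case by (simp add: build_def matching_empty weight_def match_value_empty[OF I])
next
  case (Suc k)
  have "xs ! k \<notin> set (take k xs)"
    using Suc.prems assms(2) by (auto simp: in_set_conv_nth nth_eq_iff_index_eq)
  moreover have "build I xs (Suc k) = augment I (build I xs k) (xs ! k)"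
    using Suc.prems by (simp add: build_def take_Suc_conv_app_nth)
  ultimately show ?case
    using augment_optimal[OF I, of "set (take k xs)" "build I xs k" "xs ! k"] Suc
    by (simp add: take_Suc_conv_app_nth)
qed

subsection \<open>Markets as data\<close>

definition rel_data :: "nat \<Rightarrow> (nat \<times> nat) set \<Rightarrow> data" where
  "rel_data n M = array n (\<lambda>a. set_data {t. (a, t) \<in> M})"

definition market_ctx :: "('i \<Rightarrow> nat) \<Rightarrow> 'i set \<Rightarrow> ('i \<Rightarrow> data) \<Rightarrow> ('i \<Rightarrow> (nat, nat) market) \<Rightarrow> bool" where
  "market_ctx N D X I \<longleftrightarrow>
     (\<forall>i\<in>D. crowdsourcing (I i) \<and> numbered (I i) \<and> card (agents (I i)) \<le> N i \<and> card (tasks (I i)) \<le> N i) \<and>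
     ptime N D X (\<lambda>i. set_data (agents (I i))) \<and> ptime N D X (\<lambda>i. set_data (tasks (I i))) \<and>
     ptime N D X (\<lambda>i. array (card (tasks (I i))) (\<lambda>t. Num (worth (I i) t))) \<and>
     ptime N D X (\<lambda>i. rel_data (card (agents (I i))) (edges (I i)))"

lemma market_ctxD:
  assumes "market_ctx N D X I"
  shows "i \<in> D \<Longrightarrow> crowdsourcing (I i)" "i \<in> D \<Longrightarrow> agents (I i) = {..<card (agents (I i))}"
    "i \<in> D \<Longrightarrow> tasks (I i) = {..<card (tasks (I i))}"
    "i \<in> D \<Longrightarrow> agents (I i) \<subseteq> {..<N i}" "i \<in> D \<Longrightarrow> tasks (I i) \<subseteq> {..<N i}"
    "i \<in> D \<Longrightarrow> card (agents (I i)) \<le> N i" "i \<in> D \<Longrightarrow> card (tasks (I i)) \<le> N i"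
    "ptime N D X (\<lambda>i. set_data (agents (I i)))" "ptime N D X (\<lambda>i. set_data (tasks (I i)))"
    "ptime N D X (\<lambda>i. array (card (tasks (I i))) (\<lambda>t. Num (worth (I i) t)))"
    "ptime N D X (\<lambda>i. rel_data (card (agents (I i))) (edges (I i)))"
proof -
  assume i: "i \<in> D"
  show A: "agents (I i) = {..<card (agents (I i))}" and T: "tasks (I i) = {..<card (tasks (I i))}"
    using assms i by (simp_all add: market_ctx_def numbered_def)
  show "card (agents (I i)) \<le> N i" "card (tasks (I i)) \<le> N i" using assms i by (simp_all add: market_ctx_def)
  then show "agents (I i) \<subseteq> {..<N i}" "tasks (I i) \<subseteq> {..<N i}"
    by (intro ord_eq_le_trans[OF A] ord_eq_le_trans[OF T]; simp)+
qed (use assms in \<open>simp_all add: market_ctx_def\<close>)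

lemma market_ctx_weaken:
  assumes "market_ctx N D X I" "\<And>j. j \<in> D' \<Longrightarrow> fst j \<in> D"
  shows "market_ctx (\<lambda>j. N (fst j)) D' (\<lambda>j. Cell (X (fst j)) (E j)) (\<lambda>j. I (fst j))"
  using assms(1) unfolding market_ctx_def
  by (intro conjI ptime_weaken[OF _ assms(2)]) (use assms(2) in auto)

lemma ptime_weaken2:
  assumes "ptime N D X Y" "\<And>j. j \<in> D' \<Longrightarrow> fst (fst j) \<in> D"
  shows "ptime (\<lambda>j. N (fst (fst j))) D' (\<lambda>j. Cell (Cell (X (fst (fst j))) (E (fst j))) (E' j)) (\<lambda>j. Y (fst (fst j)))"
proof -
  have "ptime (\<lambda>j. N (fst j)) {j. fst j \<in> D} (\<lambda>j. Cell (X (fst j)) (E j)) (\<lambda>j. Y (fst j))"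
    by (rule ptime_weaken[OF assms(1)]) simp
  then show ?thesis by (rule ptime_weaken) (use assms(2) in simp)
qed

lemma ptime_snd2: "ptime N D (\<lambda>j. Cell (Cell (X j) (E j)) (E' j)) E"
  by (rule ptime_right[OF ptime_left[OF ptime_id]])

lemma market_ctx_weaken2:
  assumes "market_ctx N D X I" "\<And>j. j \<in> D' \<Longrightarrow> fst (fst j) \<in> D"
  shows "market_ctx (\<lambda>j. N (fst (fst j))) D' (\<lambda>j. Cell (Cell (X (fst (fst j))) (E (fst j))) (E' j)) (\<lambda>j. I (fst (fst j)))"
  using assms(1) unfolding market_ctx_def
  by (intro conjI ptime_weaken2[OF _ assms(2)]) (use assms(2) in auto)

lemma market_ctx_subset: "market_ctx N D X I \<Longrightarrow> D' \<subseteq> D \<Longrightarrow> market_ctx N D' X I"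
  unfolding market_ctx_def by (auto elim: ptime_subset)

lemma ptime_worth:
  assumes ctx: "market_ctx N D X I" and t: "ptime N D X (\<lambda>i. Num (real (t i)))" "\<And>i. i \<in> D \<Longrightarrow> t i \<in> tasks (I i)"
  shows "ptime N D X (\<lambda>i. Num (worth (I i) (t i)))"
  by (rule ptime_nth[OF market_ctxD(10)[OF ctx] t(1)])
    (use t(2) market_ctxD(3,7)[OF ctx] in blast)

lemma ptime_rel_mem:
  assumes ctx: "market_ctx N D X I"
    and M: "ptime N D X (\<lambda>i. rel_data (card (agents (I i))) (M i))" "\<And>i. i \<in> D \<Longrightarrow> M i \<subseteq> agents (I i) \<times> tasks (I i)"
    and a: "ptime N D X (\<lambda>i. Num (real (a i)))" "\<And>i. i \<in> D \<Longrightarrow> a i \<in> agents (I i)"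
    and t: "ptime N D X (\<lambda>i. Num (real (t i)))"
  shows "ptime N D X (\<lambda>i. bool_data ((a i, t i) \<in> M i))"
proof -
  have "ptime N D X (\<lambda>i. set_data {t. (a i, t) \<in> M i})"
    by (rule ptime_nth[OF M(1)[unfolded rel_data_def] a(1)]) (use a(2) market_ctxD(2,6)[OF ctx] in blast)
  then have "ptime N D X (\<lambda>i. bool_data (t i \<in> {t. (a i, t) \<in> M i}))"
  proof (rule ptime_mem)
    show "{t. (a i, t) \<in> M i} \<subseteq> {..<N i}" if "i \<in> D" for i
      using M(2)[OF that] market_ctxD(5)[OF ctx that] by auto
  qed (rule t)
  then show ?thesis by simp
qed

lemma edges_subset: "market_ctx N D X I \<Longrightarrow> i \<in> D \<Longrightarrow> edges (I i) \<subseteq> agents (I i) \<times> tasks (I i)"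
  by (rule crowdsourcingD(3)[OF market_ctxD(1)])

lemma ptime_rel:
  assumes ctx: "market_ctx N D X I"
    and Q: "ptime (\<lambda>j. N (fst (fst j))) (SIGMA j:(SIGMA i:D. agents (I i)). tasks (I (fst j)))
      (\<lambda>j. Cell (Cell (X (fst (fst j))) (Num (real (snd (fst j))))) (Num (real (snd j))))
      (\<lambda>j. bool_data (Q (fst (fst j)) (snd (fst j)) (snd j)))"
    and M: "\<And>i a t. i \<in> D \<Longrightarrow> a \<in> agents (I i) \<Longrightarrow> (a, t) \<in> M i \<longleftrightarrow> t \<in> tasks (I i) \<and> Q i a t"
  shows "ptime N D X (\<lambda>i. rel_data (card (agents (I i))) (M i))"
proof -
  have "ptime N D X (\<lambda>i. set_data {..<card (agents (I i))})"
    by (rule ptime_cong[OF market_ctxD(8)[OF ctx]]) (use market_ctxD(2)[OF ctx] in metis)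
  then have "ptime N D X (\<lambda>i. array (card (agents (I i))) (\<lambda>a. set_data {t \<in> tasks (I i). Q i a t}))"
  proof (rule ptime_array)
    have eq: "(SIGMA i:D. {..<card (agents (I i))}) = (SIGMA i:D. agents (I i))"
      using market_ctxD(2)[OF ctx] by (auto simp: Sigma_def)
    show "ptime (\<lambda>j. N (fst j)) (SIGMA i:D. {..<card (agents (I i))}) (\<lambda>j. Cell (X (fst j)) (Num (real (snd j))))
      (\<lambda>j. set_data {t \<in> tasks (I (fst j)). Q (fst j) (snd j) t})"
      unfolding eq
    proof (rule ptime_filter)
      show "ptime (\<lambda>j. N (fst j)) (SIGMA i:D. agents (I i)) (\<lambda>j. Cell (X (fst j)) (Num (real (snd j))))
        (\<lambda>j. set_data (tasks (I (fst j))))" by (rule ptime_weaken[OF market_ctxD(9)[OF ctx]]) auto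
      show "tasks (I (fst j)) \<subseteq> {..<N (fst j)}" if "j \<in> (SIGMA i:D. agents (I i))" for j
        by (rule market_ctxD(5)[OF ctx]) (use that in auto)
    qed (rule Q)
  qed (rule market_ctxD(6)[OF ctx])
  then show ?thesis
  proof (rule ptime_cong)
    fix i assume i: "i \<in> D"
    have "{t \<in> tasks (I i). Q i a t} = {t. (a, t) \<in> M i}" if "a < card (agents (I i))" for a
      using M[OF i, of a] that market_ctxD(2)[OF ctx i] by blast
    then show "array (card (agents (I i))) (\<lambda>a. set_data {t \<in> tasks (I i). Q i a t}) =
      rel_data (card (agents (I i))) (M i)"
      unfolding rel_data_def array_def by (intro arg_cong[where f = list_data] map_cong) auto
  qed
qed

subsection \<open>The search in polynomial time\<close>

lemma ptime_mates:
  assumes ctx: "market_ctx N D X I"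
    and M: "ptime N D X (\<lambda>i. rel_data (card (agents (I i))) (M i))" "\<And>i. i \<in> D \<Longrightarrow> M i \<subseteq> agents (I i) \<times> tasks (I i)"
    and t: "ptime N D X (\<lambda>i. Num (real (t i)))"
  shows "ptime N D X (\<lambda>i. set_data (mates (I i) (M i) (t i)))"
  unfolding mates_def
  by (rule ptime_filter[OF market_ctxD(8)[OF ctx]], rule market_ctxD(4)[OF ctx], assumption,
      rule ptime_rel_mem[OF market_ctx_weaken[OF ctx] ptime_weaken[OF M(1)] _ ptime_snd _ ptime_weaken[OF t]])
    (auto dest: subsetD[OF M(2), rotated])

lemma mates_subset: "mates I M t \<subseteq> agents I"
  by (auto simp: mates_def)

lemma ptime_sources:
  assumes ctx: "market_ctx N D X I"
    and M: "ptime N D X (\<lambda>i. rel_data (card (agents (I i))) (M i))" "\<And>i. i \<in> D \<Longrightarrow> M i \<subseteq> agents (I i) \<times> tasks (I i)"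
    and V: "ptime N D X (\<lambda>i. set_data (V i))" "\<And>i. i \<in> D \<Longrightarrow> V i \<subseteq> tasks (I i)"
    and t: "ptime N D X (\<lambda>i. Num (real (t i)))"
  shows "ptime N D X (\<lambda>i. set_data (sources (I i) (M i) (V i) (t i)))"
  unfolding sources_def
proof (rule ptime_filter[OF V(1)])
  show "V i \<subseteq> {..<N i}" if "i \<in> D" for i using V(2)[OF that] market_ctxD(5)[OF ctx that] by auto
  let ?D = "SIGMA i:D. V i" and ?X = "\<lambda>j. Cell (X (fst j)) (Num (real (snd j)))" and ?N = "\<lambda>j. N (fst j)"
  have ctx1: "market_ctx ?N ?D ?X (\<lambda>j. I (fst j))" by (rule market_ctx_weaken[OF ctx]) auto
  show "ptime ?N ?D ?X (\<lambda>j. bool_data (\<exists>a\<in>agents (I (fst j)). (a, snd j) \<in> M (fst j) \<and> (a, t (fst j)) \<in> edges (I (fst j))))"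
  proof (rule ptime_Bex[OF market_ctxD(8)[OF ctx1] market_ctxD(4)[OF ctx1]], assumption)
    let ?D' = "SIGMA j:?D. agents (I (fst j))" and ?X' = "\<lambda>j. Cell (?X (fst j)) (Num (real (snd j)))"
    have ctx2: "market_ctx (\<lambda>j. ?N (fst j)) ?D' ?X' (\<lambda>j. I (fst (fst j)))" by (rule market_ctx_weaken[OF ctx1]) auto
    show "ptime (\<lambda>j. ?N (fst j)) ?D' ?X' (\<lambda>j. bool_data ((snd j, snd (fst j)) \<in> M (fst (fst j)) \<and>
      (snd j, t (fst (fst j))) \<in> edges (I (fst (fst j)))))"
      by (intro ptime_and ptime_rel_mem[OF ctx2] ptime_snd ptime_weaken2[OF M(1)] ptime_weaken2[OF t] ptime_snd2
          market_ctxD(11)[OF ctx2] edges_subset[OF ctx2])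
        (auto dest: subsetD[OF M(2), rotated])
  qed
qed

lemma sources_subset: "sources I M V t \<subseteq> V"
  by (auto simp: sources_def)

lemma ptime_reassign:
  assumes ctx: "market_ctx N D X I"
    and M: "ptime N D X (\<lambda>i. rel_data (card (agents (I i))) (M i))" "\<And>i. i \<in> D \<Longrightarrow> M i \<subseteq> agents (I i) \<times> tasks (I i)"
    and a: "ptime N D X (\<lambda>i. Num (real (a i)))" "\<And>i. i \<in> D \<Longrightarrow> a i \<in> agents (I i)"
    and t: "ptime N D X (\<lambda>i. Num (real (t i)))" "\<And>i. i \<in> D \<Longrightarrow> t i \<in> tasks (I i)"
  shows "ptime N D X (\<lambda>i. rel_data (card (agents (I i))) (reassign (a i) (t i) (M i)))"
proof (rule ptime_rel[OF ctx, where Q = "\<lambda>i b u. b = a i \<and> u = t i \<or> (b, u) \<in> M i \<and> u \<noteq> t i"])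
  let ?D = "SIGMA i:D. agents (I i)" and ?X = "\<lambda>j. Cell (X (fst j)) (Num (real (snd j)))" and ?N = "\<lambda>j. N (fst j)"
  let ?D' = "SIGMA j:?D. tasks (I (fst j))" and ?X' = "\<lambda>j. Cell (?X (fst j)) (Num (real (snd j)))"
  have ctx2: "market_ctx (\<lambda>j. ?N (fst j)) ?D' ?X' (\<lambda>j. I (fst (fst j)))"
    by (rule market_ctx_weaken2[OF ctx]) auto
  show "ptime (\<lambda>j. ?N (fst j)) ?D' ?X' (\<lambda>j. bool_data (snd (fst j) = a (fst (fst j)) \<and> snd j = t (fst (fst j)) \<or>
    (snd (fst j), snd j) \<in> M (fst (fst j)) \<and> snd j \<noteq> t (fst (fst j))))"
    by (intro ptime_or ptime_and ptime_not ptime_eq_nat ptime_rel_mem[OF ctx2] ptime_weaken2[OF M(1)]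
        ptime_weaken2[OF t(1)] ptime_weaken2[OF a(1)] ptime_snd ptime_snd2)
      (auto dest: subsetD[OF M(2), rotated])
  show "(b, u) \<in> reassign (a i) (t i) (M i) \<longleftrightarrow> u \<in> tasks (I i) \<and> (b = a i \<and> u = t i \<or> (b, u) \<in> M i \<and> u \<noteq> t i)"
    if "i \<in> D" for i b u using M(2)[OF that] t(2)[OF that] by (auto simp: reassign_def)
qed

definition search_data :: "(nat, nat) market \<Rightarrow> nat set \<times> (nat \<Rightarrow> (nat \<times> nat) set) \<Rightarrow> data" where
  "search_data I = (\<lambda>(V, F). Cell (set_data V) (array (card (tasks I)) (\<lambda>t. rel_data (card (agents I)) (F t))))"

lemma task_array:
  assumes ctx: "market_ctx N D X I"
    and f: "ptime (\<lambda>j. N (fst j)) (SIGMA i:D. tasks (I i)) (\<lambda>j. Cell (X (fst j)) (Num (real (snd j))))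
      (\<lambda>j. f (fst j) (snd j))"
  shows "ptime N D X (\<lambda>i. array (card (tasks (I i))) (f i))"
proof (rule ptime_array)
  show "ptime N D X (\<lambda>i. set_data {..<card (tasks (I i))})"
    by (rule ptime_cong[OF market_ctxD(9)[OF ctx]]) (use market_ctxD(3)[OF ctx] in metis)
  have "(SIGMA i:D. {..<card (tasks (I i))}) = (SIGMA i:D. tasks (I i))"
    using market_ctxD(3)[OF ctx] by (auto simp: Sigma_def)
  then show "ptime (\<lambda>j. N (fst j)) (SIGMA i:D. {..<card (tasks (I i))})
    (\<lambda>j. Cell (X (fst j)) (Num (real (snd j)))) (\<lambda>j. f (fst j) (snd j))" using f by simp
qed (rule market_ctxD(7)[OF ctx])

lemma ptime_search_step:
  assumes ctx: "market_ctx N D X I"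
    and M: "ptime N D X (\<lambda>i. rel_data (card (agents (I i))) (M i))" "\<And>i. i \<in> D \<Longrightarrow> M i \<subseteq> agents (I i) \<times> tasks (I i)"
    and VF: "ptime N D X (\<lambda>i. search_data (I i) (V i, F i))" "\<And>i. i \<in> D \<Longrightarrow> V i \<subseteq> tasks (I i)"
      "\<And>i t. i \<in> D \<Longrightarrow> t \<in> V i \<Longrightarrow> F i t \<subseteq> agents (I i) \<times> tasks (I i)"
  shows "ptime N D X (\<lambda>i. search_data (I i) (search_step (I i) (M i) (V i, F i)))"
proof -
  have V: "ptime N D X (\<lambda>i. set_data (V i))"
    using ptime_left[OF VF(1)[unfolded search_data_def prod.case]] .
  have F: "ptime N D X (\<lambda>i. array (card (tasks (I i))) (\<lambda>t. rel_data (card (agents (I i))) (F i t)))"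
    using ptime_right[OF VF(1)[unfolded search_data_def prod.case]] .
  let ?D = "SIGMA i:D. tasks (I i)" and ?X = "\<lambda>j. Cell (X (fst j)) (Num (real (snd j)))"
  let ?N = "\<lambda>j :: 'a \<times> nat. N (fst j)"
  have ctx1: "market_ctx ?N D' ?X (\<lambda>j. I (fst j))" if "D' \<subseteq> ?D" for D'
    by (rule market_ctx_weaken[OF ctx]) (use that in auto)
  let ?S = "\<lambda>j. sources (I (fst j)) (M (fst j)) (V (fst j)) (snd j)"
  have Vn: "V i \<subseteq> {..<N i}" if "i \<in> D" for i using VF(2)[OF that] market_ctxD(5)[OF ctx that] by auto
  have S: "ptime ?N D' ?X (\<lambda>j. set_data (?S j))" if "D' \<subseteq> ?D" for D'
    by (rule ptime_sources[OF ctx1[OF that] ptime_weaken[OF M(1)] _ ptime_weaken[OF V] _ ptime_snd])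
      (auto dest!: subsetD[OF that] dest: subsetD[OF M(2), rotated] subsetD[OF VF(2), rotated])
  have Sn: "?S j \<subseteq> {..<N (fst j)}" if "j \<in> ?D" for j
    by (rule subset_trans[OF sources_subset Vn]) (use that in auto)
  have ne: "ptime ?N D' ?X (\<lambda>j. bool_data (?S j \<noteq> {}))" if "D' \<subseteq> ?D" for D'
    by (rule ptime_not[OF ptime_is_empty[OF S[OF that]]]) (use that Sn in auto)
  have memV: "ptime ?N ?D ?X (\<lambda>j. bool_data (snd j \<in> V (fst j)))"
    by (rule ptime_mem[OF ptime_weaken[OF V] _ ptime_snd]) (auto dest: subsetD[OF Vn, rotated])
  have fst': "ptime N D X (\<lambda>i. set_data {t \<in> tasks (I i). t \<in> V i \<or> sources (I i) (M i) (V i) t \<noteq> {}})"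
    by (rule ptime_filter[OF market_ctxD(9)[OF ctx] market_ctxD(5)[OF ctx]], assumption,
        rule ptime_or[OF memV ne[OF order_refl]])
  let ?D1 = "{j \<in> ?D. snd j \<in> V (fst j)}" and ?D2 = "{j \<in> ?D. \<not> snd j \<in> V (fst j)}"
  let ?D3 = "{j \<in> ?D2. ?S j \<noteq> {}}"
  have D3: "?D3 \<subseteq> ?D" by auto
  let ?t = "\<lambda>j. Min (?S j)"
  have t: "ptime ?N ?D3 ?X (\<lambda>j. Num (real (?t j)))"
    by (rule ptime_Min[OF S[OF D3]]) (use Sn in auto)
  have tS: "?t j \<in> ?S j" if "j \<in> ?D3" for j
  proof (rule Min_in)
    show "finite (?S j)" using Sn[of j] that by (auto intro: finite_subset)
  qed (use that in auto)
  have tV: "?t j \<in> V (fst j)" if "j \<in> ?D3" for j using tS[OF that] by (auto simp: sources_def)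
  let ?m = "\<lambda>j. mates (I (fst j)) (M (fst j)) (?t j)"
  have m: "ptime ?N ?D3 ?X (\<lambda>j. set_data (?m j))"
    by (rule ptime_mates[OF ctx1[OF D3] ptime_weaken[OF M(1)] _ t]) (auto dest: subsetD[OF M(2), rotated])
  have mne: "?m j \<noteq> {}" if "j \<in> ?D3" for j
    using tS[OF that] by (auto simp: sources_def mates_def)
  have a: "ptime ?N ?D3 ?X (\<lambda>j. Num (real (Min (?m j))))"
  proof (rule ptime_Min[OF m])
    fix j assume j: "j \<in> ?D3"
    then have "fst j \<in> D" by auto
    from subset_trans[OF mates_subset market_ctxD(4)[OF ctx this]] mne[OF j]
    show "?m j \<subseteq> {..<N (fst j)} \<and> ?m j \<noteq> {}" by blast
  qed
  have aA: "Min (?m j) \<in> agents (I (fst j))" if "j \<in> ?D3" for j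
  proof -
    have "fst j \<in> D" using that by auto
    then have "finite (?m j)"
      by (intro finite_subset[OF mates_subset] crowdsourcingD(1)[OF market_ctxD(1)[OF ctx]])
    from subsetD[OF mates_subset Min_in[OF this mne[OF that]]] show ?thesis .
  qed
  have Ft: "ptime ?N D' ?X (\<lambda>j. rel_data (card (agents (I (fst j)))) (F (fst j) (u j)))"
    if "D' \<subseteq> ?D" "ptime ?N D' ?X (\<lambda>j. Num (real (u j)))" "\<And>j. j \<in> D' \<Longrightarrow> u j \<in> tasks (I (fst j))" for D' u
  proof (rule ptime_nth[OF ptime_weaken[OF F] that(2)])
    fix j assume "j \<in> D'"
    then have j: "fst j \<in> D" "u j \<in> tasks (I (fst j))" using that by auto
    then show "u j < card (tasks (I (fst j))) \<and> card (tasks (I (fst j))) \<le> N (fst j)"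
      using market_ctxD(3,7)[OF ctx j(1)] by blast
  qed (use that in auto)
  have r3: "ptime ?N ?D3 ?X (\<lambda>j. rel_data (card (agents (I (fst j)))) (reassign (Min (?m j)) (snd j) (F (fst j) (?t j))))"
  proof (rule ptime_reassign[OF ctx1[OF D3] Ft[OF D3 t] _ a aA ptime_snd])
    show "?t j \<in> tasks (I (fst j))" if "j \<in> ?D3" for j using tV[OF that] VF(2)[of "fst j"] that by auto
    show "F (fst j) (?t j) \<subseteq> agents (I (fst j)) \<times> tasks (I (fst j))" if "j \<in> ?D3" for j
      using VF(3)[OF _ tV[OF that]] that by auto
    show "snd j \<in> tasks (I (fst j))" if "j \<in> ?D3" for j using that by auto
  qed
  have r0: "ptime ?N D' ?X (\<lambda>j. rel_data (card (agents (I (fst j)))) {})" if "D' \<subseteq> ?D" for D'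
    by (rule ptime_rel[OF ctx1[OF that], where Q = "\<lambda>_ _ _. False"]) (auto intro: ptime_False)
  have r1: "ptime ?N ?D1 ?X (\<lambda>j. rel_data (card (agents (I (fst j)))) (F (fst j) (snd j)))"
    by (rule Ft[OF _ ptime_snd]) auto
  have ne2: "ptime ?N ?D2 ?X (\<lambda>j. bool_data (?S j \<noteq> {}))" by (rule ne) auto
  have r4: "ptime ?N {j \<in> ?D2. \<not> ?S j \<noteq> {}} ?X (\<lambda>j. rel_data (card (agents (I (fst j)))) {})" by (rule r0) auto
  have "ptime N D X (\<lambda>i. array (card (tasks (I i))) (\<lambda>t'. rel_data (card (agents (I i)))
      (snd (search_step (I i) (M i) (V i, F i)) t')))"
  proof (rule task_array[OF ctx])
    show "ptime ?N ?D ?X (\<lambda>j. rel_data (card (agents (I (fst j))))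
      (snd (search_step (I (fst j)) (M (fst j)) (V (fst j), F (fst j))) (snd j)))"
      by (rule ptime_cong[OF ptime_if[OF memV r1 ptime_if[OF ne2 r3 r4]]]) (simp add: search_step_def)
  qed
  from ptime_Cell[OF fst' this] show ?thesis
  proof (rule ptime_cong)
    fix i assume "i \<in> D"
    then have "{t \<in> tasks (I i). t \<in> V i \<or> sources (I i) (M i) (V i) t \<noteq> {}} = fst (search_step (I i) (M i) (V i, F i))"
      using VF(2) by (auto simp: search_step_def)
    then show "Cell (set_data {t \<in> tasks (I i). t \<in> V i \<or> sources (I i) (M i) (V i) t \<noteq> {}})
        (array (card (tasks (I i))) (\<lambda>t'. rel_data (card (agents (I i))) (snd (search_step (I i) (M i) (V i, F i)) t'))) =
      search_data (I i) (search_step (I i) (M i) (V i, F i))"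
      by (simp only: search_data_def split_beta)
  qed
qed

lemma numbered_list:
  assumes "S = {..<card S}"
  shows "set_data S = list_data (map (\<lambda>k. Num (real k)) [0..<card S])"
proof -
  have "sorted_list_of_set {..<card S} = [0..<card S]" by (simp add: lessThan_atLeast0)
  then show ?thesis using assms by (metis set_data_def)
qed

lemma ptime_search:
  assumes ctx: "market_ctx N D X I"
    and M: "ptime N D X (\<lambda>i. rel_data (card (agents (I i))) (M i))" "\<And>i. i \<in> D \<Longrightarrow> matching (I i) (S i) (M i)"
    and a: "ptime N D X (\<lambda>i. Num (real (a i)))" "\<And>i. i \<in> D \<Longrightarrow> a i \<in> agents (I i) \<and> a i \<notin> S i"
  shows "ptime N D X (\<lambda>i. search_data (I i) (search (I i) (M i) (a i) (card (tasks (I i)))))"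
proof -
  have Ms: "M i \<subseteq> agents (I i) \<times> tasks (I i)" if "i \<in> D" for i
    using matching_agents[OF market_ctxD(1)[OF ctx that] M(2)[OF that]] a(2)[OF that] by blast
  show ?thesis
  proof (rule ptime_iterate[where e = "\<lambda>_ k. Num (real k)" and K = "\<lambda>i. card (tasks (I i))"
      and s = "\<lambda>i k. search_data (I i) (search (I i) (M i) (a i) k)"])
    show "ptime N D X (\<lambda>i. list_data (map (\<lambda>k. Num (real k)) [0..<card (tasks (I i))]))"
      by (rule ptime_cong[OF market_ctxD(9)[OF ctx]]) (rule numbered_list[OF market_ctxD(3)[OF ctx]])
    have V: "ptime N D X (\<lambda>i. set_data {t \<in> tasks (I i). (a i, t) \<in> edges (I i)})"
      by (rule ptime_filter[OF market_ctxD(9)[OF ctx] market_ctxD(5)[OF ctx]], assumption,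
          rule ptime_rel_mem[OF market_ctx_weaken[OF ctx] ptime_weaken[OF market_ctxD(11)[OF ctx]] _ ptime_weaken[OF a(1)] _ ptime_snd])
        (use a(2) in \<open>auto dest: subsetD[OF edges_subset[OF ctx], rotated]\<close>)
    have F: "ptime N D X (\<lambda>i. array (card (tasks (I i))) (\<lambda>t. rel_data (card (agents (I i))) (reassign (a i) t (M i))))"
      by (rule task_array[OF ctx],
          rule ptime_reassign[OF market_ctx_weaken[OF ctx] ptime_weaken[OF M(1)] _ ptime_weaken[OF a(1)] _ ptime_snd])
        (use a(2) in \<open>auto dest: subsetD[OF Ms, rotated]\<close>)
    show "ptime N D X (\<lambda>i. search_data (I i) (search (I i) (M i) (a i) 0))"
      using ptime_Cell[OF V F] by (simp add: search_def search_data_def)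
    let ?D = "SIGMA i:D. {..<card (tasks (I i))}"
    let ?s = "\<lambda>j. search (I (fst j)) (M (fst j)) (a (fst j)) (snd j)"
    let ?X = "\<lambda>j. Cell (X (fst j)) (Cell (Num (real (snd j))) (search_data (I (fst j)) (?s j)))"
    have st: "ptime (\<lambda>j. N (fst j)) ?D ?X (\<lambda>j. search_data (I (fst j)) (fst (?s j), snd (?s j)))"
      using ptime_right[OF ptime_right[OF ptime_id]] by simp
    have "ptime (\<lambda>j. N (fst j)) ?D ?X (\<lambda>j. search_data (I (fst j)) (search_step (I (fst j)) (M (fst j)) (fst (?s j), snd (?s j))))"
    proof (rule ptime_search_step[OF market_ctx_weaken[OF ctx] ptime_weaken[OF M(1)] _ st])
      fix j assume "j \<in> ?D"
      then have j: "fst j \<in> D" by auto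
      note inv = search_invariant[OF market_ctxD(1)[OF ctx j] M(2)[OF j] conjunct2[OF a(2)[OF j]]]
      show "fst (?s j) \<subseteq> tasks (I (fst j))" using inv by blast
      show "snd (?s j) t \<subseteq> agents (I (fst j)) \<times> tasks (I (fst j))" if "t \<in> fst (?s j)" for t
        using search_subset[OF market_ctxD(1)[OF ctx j] M(2)[OF j] conjunct2[OF a(2)[OF j]] that] a(2)[OF j] by blast
    qed (auto dest: subsetD[OF Ms, rotated])
    then show "ptime (\<lambda>j. N (fst j)) ?D ?X (\<lambda>j. search_data (I (fst j)) (search (I (fst j)) (M (fst j)) (a (fst j)) (Suc (snd j))))"
      by (simp add: search_def)
  qed (rule market_ctxD(7)[OF ctx])
qed

lemma ptime_augment:
  assumes ctx: "market_ctx N D X I"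
    and M: "ptime N D X (\<lambda>i. rel_data (card (agents (I i))) (M i))" "\<And>i. i \<in> D \<Longrightarrow> matching (I i) (S i) (M i)"
    and a: "ptime N D X (\<lambda>i. Num (real (a i)))" "\<And>i. i \<in> D \<Longrightarrow> a i \<in> agents (I i) \<and> a i \<notin> S i"
  shows "ptime N D X (\<lambda>i. rel_data (card (agents (I i))) (augment (I i) (M i) (a i)))"
proof -
  have Ms: "M i \<subseteq> agents (I i) \<times> tasks (I i)" if "i \<in> D" for i
    using matching_agents[OF market_ctxD(1)[OF ctx that] M(2)[OF that]] a(2)[OF that] by blast
  define V where "V i = fst (search (I i) (M i) (a i) (card (tasks (I i))))" for i
  define F where "F i = snd (search (I i) (M i) (a i) (card (tasks (I i))))" for i
  have VF: "ptime N D X (\<lambda>i. Cell (set_data (V i)) (array (card (tasks (I i))) (\<lambda>t. rel_data (card (agents (I i))) (F i t))))"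
    using ptime_search[OF assms] by (simp add: search_data_def V_def F_def split_beta)
  have Vs: "V i \<subseteq> tasks (I i)" if i: "i \<in> D" for i
    using search_invariant[OF market_ctxD(1)[OF ctx i] M(2)[OF i] conjunct2[OF a(2)[OF i]]] by (simp add: V_def)
  have Vn: "V i \<subseteq> {..<N i}" if "i \<in> D" for i using Vs[OF that] market_ctxD(5)[OF ctx that] by auto
  let ?free = "\<lambda>i t. mates (I i) (M i) t = {}"
  have free: "ptime (\<lambda>j. N (fst j)) (SIGMA i:D. V i) (\<lambda>j. Cell (X (fst j)) (Num (real (snd j))))
    (\<lambda>j. bool_data (?free (fst j) (snd j)))"
    by (rule ptime_is_empty[OF ptime_mates[OF market_ctx_weaken[OF ctx] ptime_weaken[OF M(1)] _ ptime_snd]])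
      (auto dest: subsetD[OF Ms, rotated] subsetD[OF subset_trans[OF mates_subset market_ctxD(4)[OF ctx]], rotated])
  let ?U = "\<lambda>i. {t \<in> V i. ?free i t}"
  have U: "ptime N D X (\<lambda>i. set_data (?U i))" by (rule ptime_filter[OF ptime_left[OF VF] Vn free])
  have Z: "ptime N D X (\<lambda>i. set_data {t \<in> ?U i. \<forall>u\<in>?U i. worth (I i) u \<le> worth (I i) t})"
  proof (rule ptime_filter[OF U])
    show "ptime (\<lambda>j. N (fst j)) (SIGMA i:D. ?U i) (\<lambda>j. Cell (X (fst j)) (Num (real (snd j))))
      (\<lambda>j. bool_data (\<forall>u\<in>?U (fst j). worth (I (fst j)) u \<le> worth (I (fst j)) (snd j)))"
    proof (rule ptime_Ball[OF ptime_weaken[OF U]])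
      let ?D = "SIGMA i:D. ?U i" and ?X = "\<lambda>j. Cell (X (fst j)) (Num (real (snd j)))"
      let ?D' = "SIGMA j:?D. ?U (fst j)"
      have ctx2: "market_ctx (\<lambda>j. N (fst (fst j))) ?D' (\<lambda>j. Cell (?X (fst j)) (Num (real (snd j)))) (\<lambda>j. I (fst (fst j)))"
        by (rule market_ctx_weaken2[OF ctx]) auto
      show "ptime (\<lambda>j. N (fst (fst j))) ?D' (\<lambda>j. Cell (?X (fst j)) (Num (real (snd j))))
        (\<lambda>j. bool_data (worth (I (fst (fst j))) (snd j) \<le> worth (I (fst (fst j))) (snd (fst j))))"
        by (intro ptime_le ptime_worth[OF ctx2] ptime_snd ptime_snd2)
          (auto dest: subsetD[OF Vs, rotated])
    qed (auto dest: subsetD[OF Vn, rotated])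
  qed (auto dest: subsetD[OF Vn, rotated])
  let ?Z = "\<lambda>i. best_free (I i) (M i) (V i)"
  have Zeq: "?Z i = {t \<in> ?U i. \<forall>u\<in>?U i. worth (I i) u \<le> worth (I i) t}" for i by (auto simp: best_free_def)
  have Zn: "?Z i \<subseteq> {..<N i}" if "i \<in> D" for i using Vn[OF that] by (auto simp: best_free_def)
  have Z': "ptime N D X (\<lambda>i. set_data (?Z i))" unfolding Zeq by (rule Z)
  let ?D1 = "{i \<in> D. \<not> ?Z i = {}}"
  have min: "ptime N ?D1 X (\<lambda>i. Num (real (Min (?Z i))))"
    by (rule ptime_Min[OF ptime_subset[OF Z']]) (use Zn in auto)
  have "ptime N ?D1 X (\<lambda>i. rel_data (card (agents (I i))) (F i (Min (?Z i))))"
  proof (rule ptime_nth[OF ptime_subset[OF ptime_right[OF VF]] min])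
    fix i assume i: "i \<in> ?D1"
    have "finite (?Z i)" using Zn[of i] i finite_subset by blast
    then have "Min (?Z i) \<in> ?Z i" using i by auto
    then have "Min (?Z i) \<in> tasks (I i)" using Vs[of i] i by (auto simp: best_free_def)
    then show "Min (?Z i) < card (tasks (I i)) \<and> card (tasks (I i)) \<le> N i"
      using market_ctxD(3,7)[OF ctx, of i] i by blast
  qed auto
  from ptime_if[OF ptime_is_empty[OF Z' Zn] ptime_subset[OF M(1)] this]
  show ?thesis by (rule ptime_cong) (auto simp: augment_def V_def F_def)
qed

lemma ptime_value:
  assumes ctx: "market_ctx N D X I"
    and S: "ptime N D X (\<lambda>i. set_data (S i))" "\<And>i. i \<in> D \<Longrightarrow> S i \<subseteq> agents (I i)"
  shows "ptime N D X (\<lambda>i. Num (match_value (I i) (S i)))"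
proof -
  define l where "l i = sorted_list_of_set (S i)" for i
  have l: "set (l i) = S i" "distinct (l i)" "length (l i) \<le> N i" if i: "i \<in> D" for i
    using subset_lessThan[OF subset_trans[OF S(2)[OF i] market_ctxD(4)[OF ctx i]]] by (auto simp: l_def)
  let ?M = "\<lambda>i k. build (I i) (l i) k"
  have opt: "matching (I i) (set (take k (l i))) (?M i k)" "weight (I i) (?M i k) = match_value (I i) (set (take k (l i)))"
    if "i \<in> D" "k \<le> length (l i)" for i k
    using build_optimal[OF market_ctxD(1)[OF ctx] l(2), of i i k] that by auto
  have M: "ptime N D X (\<lambda>i. rel_data (card (agents (I i))) (?M i (length (l i))))"
  proof (rule ptime_iterate[where e = "\<lambda>i k. Num (real (l i ! k))" and K = "\<lambda>i. length (l i)"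
      and s = "\<lambda>i k. rel_data (card (agents (I i))) (?M i k)"])
    show "ptime N D X (\<lambda>i. list_data (map (\<lambda>k. Num (real (l i ! k))) [0..<length (l i)]))"
    proof (rule ptime_cong[OF S(1)])
      show "set_data (S i) = list_data (map (\<lambda>k. Num (real (l i ! k))) [0..<length (l i)])" for i
        unfolding set_data_def l_def by (metis (no_types) map_nth map_map comp_def map_eq_conv)
    qed
    show "ptime N D X (\<lambda>i. rel_data (card (agents (I i))) (?M i 0))"
      by (rule ptime_rel[OF ctx, where Q = "\<lambda>_ _ _. False"]) (auto intro: ptime_False simp: build_def)
    let ?D = "SIGMA i:D. {..<length (l i)}"
    let ?X = "\<lambda>j. Cell (X (fst j)) (Cell (Num (real (l (fst j) ! snd j))) (rel_data (card (agents (I (fst j)))) (?M (fst j) (snd j))))"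
    have "ptime (\<lambda>j. N (fst j)) ?D ?X (\<lambda>j. rel_data (card (agents (I (fst j))))
        (augment (I (fst j)) (?M (fst j) (snd j)) (l (fst j) ! snd j)))"
    proof (rule ptime_augment[OF market_ctx_weaken[OF ctx] ptime_right[OF ptime_snd] _ ptime_left[OF ptime_snd],
          where S = "\<lambda>j. set (take (snd j) (l (fst j)))"])
      fix j assume "j \<in> ?D"
      then have j: "fst j \<in> D" "snd j < length (l (fst j))" by auto
      show "matching (I (fst j)) (set (take (snd j) (l (fst j)))) (?M (fst j) (snd j))" using opt j by auto
      have "l (fst j) ! snd j \<in> S (fst j)" using nth_mem[OF j(2)] l(1)[OF j(1)] by simp
      moreover have "l (fst j) ! snd j \<notin> set (take (snd j) (l (fst j)))"
        using j l(2)[OF j(1)] by (auto simp: in_set_conv_nth nth_eq_iff_index_eq)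
      ultimately show "l (fst j) ! snd j \<in> agents (I (fst j)) \<and> l (fst j) ! snd j \<notin> set (take (snd j) (l (fst j)))"
        using S(2)[OF j(1)] by blast
    qed auto
    then show "ptime (\<lambda>j. N (fst j)) ?D ?X (\<lambda>j. rel_data (card (agents (I (fst j)))) (?M (fst j) (Suc (snd j))))"
      by (rule ptime_cong) (auto simp: build_def take_Suc_conv_app_nth)
  qed (use l in auto)
  define M' where "M' i = ?M i (length (l i))" for i
  have mat: "matching (I i) (S i) (M' i)" "weight (I i) (M' i) = match_value (I i) (S i)" if "i \<in> D" for i
    using opt[OF that order_refl] l[OF that] by (auto simp: M'_def)
  have Ms: "M' i \<subseteq> agents (I i) \<times> tasks (I i)" if "i \<in> D" for i
    using mat(1)[OF that] crowdsourcingD(3)[OF market_ctxD(1)[OF ctx that]] by (auto simp: matching_def)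
  let ?D = "SIGMA i:D. tasks (I i)" and ?X = "\<lambda>j. Cell (X (fst j)) (Num (real (snd j)))"
  have ctx1: "market_ctx (\<lambda>j. N (fst j)) ?D ?X (\<lambda>j. I (fst j))" by (rule market_ctx_weaken[OF ctx]) auto
  have emp: "ptime (\<lambda>j. N (fst j)) ?D ?X (\<lambda>j. bool_data (mates (I (fst j)) (M' (fst j)) (snd j) = {}))"
    by (rule ptime_is_empty[OF ptime_mates[OF ctx1 ptime_weaken[OF M[folded M'_def]] _ ptime_snd]])
      (auto dest: subsetD[OF Ms, rotated] subsetD[OF subset_trans[OF mates_subset market_ctxD(4)[OF ctx]], rotated])
  have "ptime N D X (\<lambda>i. Num (\<Sum>t\<in>tasks (I i). if mates (I i) (M' i) t = {} then 0 else worth (I i) t))"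
  proof (rule ptime_sum[OF market_ctxD(9)[OF ctx] market_ctxD(5)[OF ctx]], assumption)
    show "ptime (\<lambda>j. N (fst j)) ?D ?X (\<lambda>j. Num (if mates (I (fst j)) (M' (fst j)) (snd j) = {} then 0
        else worth (I (fst j)) (snd j)))"
      by (rule ptime_cong[OF ptime_If[OF emp ptime_zero ptime_worth[OF ctx1 ptime_snd]]]) auto
  qed
  then show ?thesis
  proof (rule ptime_cong)
    fix i assume i: "i \<in> D"
    have I: "crowdsourcing (I i)" by (rule market_ctxD(1)[OF ctx i])
    have "{t \<in> tasks (I i). \<not> mates (I i) (M' i) t = {}} = snd ` M' i"
      using Ms[OF i] by (force simp: mates_def)
    then have "(\<Sum>t\<in>tasks (I i). if mates (I i) (M' i) t = {} then 0 else worth (I i) t) = sum (worth (I i)) (snd ` M' i)"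
      using crowdsourcingD(2)[OF I] by (simp add: sum.If_cases Int_def Compl_eq)
    also have "\<dots> = weight (I i) (M' i)" using weight_eq_sum[of "M' i" "I i"] mat(1)[OF i] by (simp add: matching_def)
    finally show "Num (\<Sum>t\<in>tasks (I i). if mates (I i) (M' i) t = {} then 0 else worth (I i) t) =
      Num (match_value (I i) (S i))" using mat(2)[OF i] by simp
  qed
qed

section \<open>The mechanism in polynomial time\<close>

lemma ptime_bool: "ptime N D X (\<lambda>i. bool_data f)"
  by (cases f) (auto intro: ptime_True ptime_False)

lemma ptime_card:
  assumes "ptime N D X (\<lambda>i. set_data (S i))" "\<And>i. i \<in> D \<Longrightarrow> S i \<subseteq> {..<N i}"
  shows "ptime N D X (\<lambda>i. Num (real (card (S i))))"
proof -
  have "ptime N D X (\<lambda>i. Num (\<Sum>_\<in>S i. 1))" by (rule ptime_sum[OF assms ptime_one])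
  then show ?thesis by simp
qed

lemma ptime_le_nat:
  assumes "ptime N D X (\<lambda>i. Num (real (a i)))" "ptime N D X (\<lambda>i. Num (real (b i)))"
  shows "ptime N D X (\<lambda>i. bool_data (a i \<le> b i))"
  using ptime_le[OF assms] by simp

lemma ptime_less_nat:
  assumes "ptime N D X (\<lambda>i. Num (real (a i)))" "ptime N D X (\<lambda>i. Num (real (b i)))"
  shows "ptime N D X (\<lambda>i. bool_data (a i < b i))"
  using ptime_less[OF assms] by simp

definition cost_ctx :: "('i \<Rightarrow> nat) \<Rightarrow> 'i set \<Rightarrow> ('i \<Rightarrow> data) \<Rightarrow> ('i \<Rightarrow> (nat, nat) market) \<Rightarrow> ('i \<Rightarrow> nat costs) \<Rightarrow> bool" where
  "cost_ctx N D X I c \<longleftrightarrow> market_ctx N D X I \<and> (\<forall>i\<in>D. cost_vector (agents (I i)) (c i)) \<and>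
     ptime N D X (\<lambda>i. array (card (agents (I i))) (\<lambda>a. Num (c i a)))"

lemma cost_ctxD:
  assumes "cost_ctx N D X I c"
  shows "market_ctx N D X I" "i \<in> D \<Longrightarrow> cost_vector (agents (I i)) (c i)"
    "ptime N D X (\<lambda>i. array (card (agents (I i))) (\<lambda>a. Num (c i a)))"
  using assms by (simp_all add: cost_ctx_def)

lemma cost_ctx_weaken:
  assumes "cost_ctx N D X I c" "\<And>j. j \<in> D' \<Longrightarrow> fst j \<in> D"
  shows "cost_ctx (\<lambda>j. N (fst j)) D' (\<lambda>j. Cell (X (fst j)) (E j)) (\<lambda>j. I (fst j)) (\<lambda>j. c (fst j))"
  using assms(1) unfolding cost_ctx_def
  by (intro conjI ptime_weaken[OF _ assms(2)] market_ctx_weaken[OF _ assms(2)]) (use assms(2) in auto)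

lemma cost_ctx_weaken2:
  assumes "cost_ctx N D X I c" "\<And>j. j \<in> D' \<Longrightarrow> fst (fst j) \<in> D"
  shows "cost_ctx (\<lambda>j. N (fst (fst j))) D' (\<lambda>j. Cell (Cell (X (fst (fst j))) (E (fst j))) (E' j))
    (\<lambda>j. I (fst (fst j))) (\<lambda>j. c (fst (fst j)))"
  using assms(1) unfolding cost_ctx_def
  by (intro conjI ptime_weaken2[OF _ assms(2)] market_ctx_weaken2[OF _ assms(2)]) (use assms(2) in auto)

lemma cost_ctx_subset: "cost_ctx N D X I c \<Longrightarrow> D' \<subseteq> D \<Longrightarrow> cost_ctx N D' X I c"
  unfolding cost_ctx_def by (auto elim: ptime_subset market_ctx_subset)

lemma agent_bound: "market_ctx N D X I \<Longrightarrow> i \<in> D \<Longrightarrow> S \<subseteq> agents (I i) \<Longrightarrow> S \<subseteq> {..<N i}"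
  by (rule subset_trans[OF _ market_ctxD(4)])

lemma ptime_cost:
  assumes ctx: "cost_ctx N D X I c" and a: "ptime N D X (\<lambda>i. Num (real (a i)))" "\<And>i. i \<in> D \<Longrightarrow> a i \<in> agents (I i)"
  shows "ptime N D X (\<lambda>i. Num (c i (a i)))"
  by (rule ptime_nth[OF cost_ctxD(3)[OF ctx] a(1)])
    (use a(2) market_ctxD(2,6)[OF cost_ctxD(1)[OF ctx]] in blast)

lemma agent_array:
  assumes ctx: "market_ctx N D X I"
    and f: "ptime (\<lambda>j. N (fst j)) (SIGMA i:D. agents (I i)) (\<lambda>j. Cell (X (fst j)) (Num (real (snd j))))
      (\<lambda>j. f (fst j) (snd j))"
  shows "ptime N D X (\<lambda>i. array (card (agents (I i))) (f i))"
proof (rule ptime_array)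
  show "ptime N D X (\<lambda>i. set_data {..<card (agents (I i))})"
    by (rule ptime_cong[OF market_ctxD(8)[OF ctx]]) (use market_ctxD(2)[OF ctx] in metis)
  have "(SIGMA i:D. {..<card (agents (I i))}) = (SIGMA i:D. agents (I i))"
    using market_ctxD(2)[OF ctx] by (auto simp: Sigma_def)
  then show "ptime (\<lambda>j. N (fst j)) (SIGMA i:D. {..<card (agents (I i))})
    (\<lambda>j. Cell (X (fst j)) (Num (real (snd j)))) (\<lambda>j. f (fst j) (snd j))" using f by simp
qed (rule market_ctxD(6)[OF ctx])

lemma cost_ctx_update:
  assumes ctx: "cost_ctx N D X I c" and a: "ptime N D X (\<lambda>i. Num (real (a i)))"
    and x: "ptime N D X (\<lambda>i. Num (x i))" "\<And>i. i \<in> D \<Longrightarrow> 0 \<le> x i"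
  shows "cost_ctx N D X I (\<lambda>i. (c i)(a i := x i))"
proof -
  have "ptime N D X (\<lambda>i. array (card (agents (I i))) (\<lambda>b. Num (((c i)(a i := x i)) b)))"
    by (rule agent_array[OF cost_ctxD(1)[OF ctx]],
        rule ptime_cong[OF ptime_If[OF ptime_eq_nat[OF ptime_snd ptime_weaken[OF a]] ptime_weaken[OF x(1)]
          ptime_cost[OF cost_ctx_weaken[OF ctx] ptime_snd]]])
      auto
  then show ?thesis using ctx x(2) unfolding cost_ctx_def by (auto intro: cost_vector_update)
qed

lemma ptime_insert:
  assumes ctx: "market_ctx N D X I" and S: "ptime N D X (\<lambda>i. set_data (S i))" "\<And>i. i \<in> D \<Longrightarrow> S i \<subseteq> agents (I i)"
    and a: "ptime N D X (\<lambda>i. Num (real (a i)))" "\<And>i. i \<in> D \<Longrightarrow> a i \<in> agents (I i)"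
  shows "ptime N D X (\<lambda>i. set_data (insert (a i) (S i)))"
proof -
  have "ptime N D X (\<lambda>i. set_data {b \<in> agents (I i). b = a i \<or> b \<in> S i})"
    by (rule ptime_filter[OF market_ctxD(8)[OF ctx] market_ctxD(4)[OF ctx]], assumption,
        rule ptime_or[OF ptime_eq_nat[OF ptime_snd ptime_weaken[OF a(1)]] ptime_mem[OF ptime_weaken[OF S(1)] _ ptime_snd]])
      (auto dest: subsetD[OF agent_bound[OF ctx _ S(2)], rotated -1])
  then show ?thesis by (rule ptime_cong) (use S(2) a(2) in \<open>auto intro!: arg_cong[where f = set_data]\<close>)
qed

lemma ptime_diff:
  assumes S: "ptime N D X (\<lambda>i. set_data (S i))" "\<And>i. i \<in> D \<Longrightarrow> S i \<subseteq> {..<N i}"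
    and T: "ptime N D X (\<lambda>i. set_data (T i))" "\<And>i. i \<in> D \<Longrightarrow> T i \<subseteq> {..<N i}"
  shows "ptime N D X (\<lambda>i. set_data (S i - T i))"
  unfolding set_diff_eq
  by (rule ptime_cong[OF ptime_filter[OF S ptime_not[OF ptime_mem[OF ptime_weaken[OF T(1)] _ ptime_snd]]]])
    (auto dest: subsetD[OF T(2), rotated])

lemma ptime_singleton:
  assumes ctx: "market_ctx N D X I" and a: "ptime N D X (\<lambda>i. Num (real (a i)))" "\<And>i. i \<in> D \<Longrightarrow> a i \<in> agents (I i)"
  shows "ptime N D X (\<lambda>i. set_data {a i})"
  by (rule ptime_insert[OF ctx _ _ a]) (auto intro: ptime_Null simp: set_data_def list_data_def)

lemma ptime_marginal:
  assumes ctx: "market_ctx N D X I" and S: "ptime N D X (\<lambda>i. set_data (S i))" "\<And>i. i \<in> D \<Longrightarrow> S i \<subseteq> agents (I i)"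
    and a: "ptime N D X (\<lambda>i. Num (real (a i)))" "\<And>i. i \<in> D \<Longrightarrow> a i \<in> agents (I i)"
  shows "ptime N D X (\<lambda>i. Num (marginal (match_value (I i)) (a i) (S i)))"
  unfolding marginal_def
  by (rule ptime_minus[OF ptime_value[OF ctx ptime_insert[OF ctx S a]] ptime_value[OF ctx S]])
    (use S(2) a(2) in auto)

lemma ptime_sum_cost:
  assumes ctx: "cost_ctx N D X I c" and S: "ptime N D X (\<lambda>i. set_data (S i))" "\<And>i. i \<in> D \<Longrightarrow> S i \<subseteq> agents (I i)"
  shows "ptime N D X (\<lambda>i. Num (sum (c i) (S i)))"
  by (rule ptime_sum[OF S(1) agent_bound[OF cost_ctxD(1)[OF ctx] _ S(2)]], assumption, assumption,
      rule ptime_cost[OF cost_ctx_weaken[OF ctx] ptime_snd])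
    (auto dest: subsetD[OF S(2), rotated])

context
  fixes N :: "'i \<Rightarrow> nat" and D X I c S k j
  assumes ctx: "cost_ctx N D X I c"
    and S: "ptime N D X (\<lambda>i. set_data (S i))" "\<And>i. i \<in> D \<Longrightarrow> S i \<subseteq> agents (I i)"
    and k: "ptime N D X (\<lambda>i. Num (real (k i)))" "\<And>i. i \<in> D \<Longrightarrow> k i \<in> agents (I i)"
    and j: "ptime N D X (\<lambda>i. Num (real (j i)))" "\<And>i. i \<in> D \<Longrightarrow> j i \<in> agents (I i)"
begin

lemma ptime_efficiency_le:
  "ptime N D X (\<lambda>i. bool_data (efficiency (match_value (I i)) (c i) (S i) (k i) \<le>
     efficiency (match_value (I i)) (c i) (S i) (j i)))"
proof -
  have mk: "ptime N D X (\<lambda>i. Num (marginal (match_value (I i)) (k i) (S i)))"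
    by (rule ptime_marginal[OF cost_ctxD(1)[OF ctx] S k])
  have mj: "ptime N D X (\<lambda>i. Num (marginal (match_value (I i)) (j i) (S i)))"
    by (rule ptime_marginal[OF cost_ctxD(1)[OF ctx] S j])
  have ck: "ptime N D X (\<lambda>i. Num (c i (k i)))" by (rule ptime_cost[OF ctx k])
  have cj: "ptime N D X (\<lambda>i. Num (c i (j i)))" by (rule ptime_cost[OF ctx j])
  show ?thesis
  proof (rule ptime_cong[OF ptime_or[OF ptime_eq[OF mk ptime_zero] ptime_and[OF ptime_not[OF ptime_eq[OF mj ptime_zero]]
        ptime_or[OF ptime_eq[OF cj ptime_zero] ptime_and[OF ptime_not[OF ptime_eq[OF ck ptime_zero]]
          ptime_le[OF ptime_times[OF mk cj] ptime_times[OF mj ck]]]]]]])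
    fix i assume i: "i \<in> D"
    interpret submodular "match_value (I i)"
      by (rule submodular_match_value[OF market_ctxD(1)[OF cost_ctxD(1)[OF ctx] i]])
    have "0 \<le> c i (j i)" "0 \<le> c i (k i)"
      using cost_ctxD(2)[OF ctx i] j(2)[OF i] k(2)[OF i] by (auto simp: cost_vector_def)
    then show "bool_data (marginal (match_value (I i)) (k i) (S i) = 0 \<or>
        \<not> marginal (match_value (I i)) (j i) (S i) = 0 \<and> (c i (j i) = 0 \<or>
          \<not> c i (k i) = 0 \<and> marginal (match_value (I i)) (k i) (S i) * c i (j i) \<le>
            marginal (match_value (I i)) (j i) (S i) * c i (k i))) =
      bool_data (efficiency (match_value (I i)) (c i) (S i) (k i) \<le> efficiency (match_value (I i)) (c i) (S i) (j i))"
      by (subst efficiency_le_iff) auto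
  qed
qed

end

lemma ptime_no_better:
  assumes ctx: "cost_ctx N D X I c"
    and S: "ptime N D X (\<lambda>i. set_data (S i))" "\<And>i. i \<in> D \<Longrightarrow> S i \<subseteq> agents (I i)"
    and k: "ptime N D X (\<lambda>i. Num (real (k i)))" "\<And>i. i \<in> D \<Longrightarrow> k i \<in> agents (I i)"
    and j: "ptime N D X (\<lambda>i. Num (real (j i)))" "\<And>i. i \<in> D \<Longrightarrow> j i \<in> agents (I i)"
    and a: "ptime N D X (\<lambda>i. Num (real (a i)))" "\<And>i. i \<in> D \<Longrightarrow> a i \<in> agents (I i)"
  shows "ptime N D X (\<lambda>i. bool_data (no_better f (a i) (match_value (I i)) (c i) (S i) (k i) (j i)))"
proof -
  have m: "ptime N D X (\<lambda>i. Num (marginal (match_value (I i)) (a i) (S i)))"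
    by (rule ptime_marginal[OF cost_ctxD(1)[OF ctx] S a])
  have kj: "ptime N D X (\<lambda>i. bool_data (efficiency (match_value (I i)) (c i) (S i) (k i) \<le>
      efficiency (match_value (I i)) (c i) (S i) (j i)))" by (rule ptime_efficiency_le[OF ctx S k j])
  have jk: "ptime N D X (\<lambda>i. bool_data (efficiency (match_value (I i)) (c i) (S i) (j i) \<le>
      efficiency (match_value (I i)) (c i) (S i) (k i)))" by (rule ptime_efficiency_le[OF ctx S j k])
  show ?thesis
    by (rule ptime_cong[OF ptime_If[OF ptime_and[OF ptime_bool[where f = f] ptime_and[OF ptime_eq_nat[OF j(1) a(1)]
          ptime_and[OF ptime_not[OF ptime_eq_nat[OF k(1) a(1)]] ptime_not[OF ptime_eq[OF m ptime_zero]]]]]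
          ptime_not[OF jk] kj]])
      (auto simp: no_better_def not_le)
qed

lemma (in greedy) pick_candidates:
  assumes c: "cost_vector A c" and a: "a \<in> A" and R: "R \<subseteq> A" "R \<noteq> {}"
  shows "{j \<in> R. \<forall>k\<in>R. no_better f a v c S k j} \<noteq> {}"
proof -
  have fin: "finite R" using R finite_A finite_subset by blast
  have ca: "0 \<le> c a" using c a by (simp add: cost_vector_def)
  have best: "{j \<in> R. \<forall>k\<in>R. efficiency v d S k \<le> efficiency v d S j} \<noteq> {}" for d
    using most_efficient_in[OF fin R(2), of v d S] most_efficient_ge[OF fin, of _ v d S] by blast
  show ?thesis
  proof (cases f)
    case False
    then show ?thesis using best[of c] by (simp add: no_better_def)
  next
    case True
    have "\<forall>\<^sub>F y in at_right (c a). \<forall>k\<in>A. \<forall>j\<in>A.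
      (efficiency v (c(a := y)) S k \<le> efficiency v (c(a := y)) S j) = no_better True a v (c(a := c a)) S k j"
      using no_better_right[OF c _ _ ca, where i = a and S = S] finite_A
      by (intro eventually_ball_finite ballI) simp_all
    then have "\<exists>y. \<forall>k\<in>A. \<forall>j\<in>A.
      (efficiency v (c(a := y)) S k \<le> efficiency v (c(a := y)) S j) = no_better True a v c S k j"
      unfolding fun_upd_triv by (rule eventually_happens'[OF trivial_limit_at_right_real])
    then obtain y where y: "\<forall>k\<in>A. \<forall>j\<in>A.
      (efficiency v (c(a := y)) S k \<le> efficiency v (c(a := y)) S j) = no_better True a v c S k j" ..
    obtain j where j: "j \<in> R" "\<And>k. k \<in> R \<Longrightarrow> efficiency v (c(a := y)) S k \<le> efficiency v (c(a := y)) S j"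
      using best[of "c(a := y)"] by blast
    have "no_better f a v c S k j" if "k \<in> R" for k
      using y j(2)[OF that] subsetD[OF R(1) that] subsetD[OF R(1) j(1)] True by metis
    then show ?thesis using j(1) by blast
  qed
qed

lemma greedy_ctx: "cost_ctx N D X I c \<Longrightarrow> i \<in> D \<Longrightarrow> greedy (match_value (I i)) (agents (I i))"
  by (rule greedy_match_value[OF market_ctxD(1)[OF cost_ctxD(1)]]) auto

lemma pick_in:
  assumes ctx: "cost_ctx N D X I c" and i: "i \<in> D" and a: "a \<in> agents (I i)" and R: "R \<subseteq> agents (I i)" "R \<noteq> {}"
  shows "pick f a (match_value (I i)) (c i) R S \<in> R"
proof -
  interpret greedy "match_value (I i)" "agents (I i)" by (rule greedy_ctx[OF ctx i])
  have "finite {j \<in> R. \<forall>k\<in>R. no_better f a (match_value (I i)) (c i) S k j}"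
    by (rule finite_subset[OF _ finite_subset[OF R(1) finite_A]]) auto
  from Min_in[OF this pick_candidates[OF cost_ctxD(2)[OF ctx i] a R]]
  show ?thesis unfolding pick_def by simp
qed

lemma ptime_pick:
  assumes ctx: "cost_ctx N D X I c"
    and S: "ptime N D X (\<lambda>i. set_data (S i))" "\<And>i. i \<in> D \<Longrightarrow> S i \<subseteq> agents (I i)"
    and R: "ptime N D X (\<lambda>i. set_data (R i))" "\<And>i. i \<in> D \<Longrightarrow> R i \<subseteq> agents (I i)" "\<And>i. i \<in> D \<Longrightarrow> R i \<noteq> {}"
    and a: "ptime N D X (\<lambda>i. Num (real (a i)))" "\<And>i. i \<in> D \<Longrightarrow> a i \<in> agents (I i)"
  shows "ptime N D X (\<lambda>i. Num (real (pick f (a i) (match_value (I i)) (c i) (R i) (S i))))"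
proof -
  note Rn = agent_bound[OF cost_ctxD(1)[OF ctx] _ R(2)]
  let ?E = "\<lambda>i. {j \<in> R i. \<forall>k\<in>R i. no_better f (a i) (match_value (I i)) (c i) (S i) k j}"
  have "ptime N D X (\<lambda>i. set_data (?E i))"
  proof (rule ptime_filter[OF R(1) Rn], assumption, assumption, rule ptime_Ball[OF ptime_weaken[OF R(1)]])
    let ?D = "SIGMA j:(SIGMA i:D. R i). R (fst j)"
    let ?X = "\<lambda>j. Cell (Cell (X (fst (fst j))) (Num (real (snd (fst j))))) (Num (real (snd j)))"
    have ctx2: "cost_ctx (\<lambda>j. N (fst (fst j))) ?D ?X (\<lambda>j. I (fst (fst j))) (\<lambda>j. c (fst (fst j)))"
      by (rule cost_ctx_weaken2[OF ctx]) auto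
    show "ptime (\<lambda>j. N (fst (fst j))) ?D ?X
      (\<lambda>j. bool_data (no_better f (a (fst (fst j))) (match_value (I (fst (fst j)))) (c (fst (fst j))) (S (fst (fst j)))
         (snd j) (snd (fst j))))"
      by (rule ptime_no_better[OF ctx2 ptime_weaken2[OF S(1)] _ ptime_snd _ ptime_snd2 _ ptime_weaken2[OF a(1)]])
        (use a(2) in \<open>auto dest: subsetD[OF S(2), rotated] subsetD[OF R(2), rotated]\<close>)
  qed (auto dest: subsetD[OF Rn, rotated -1])
  then show ?thesis unfolding pick_def
  proof (rule ptime_Min)
    fix i assume i: "i \<in> D"
    interpret greedy "match_value (I i)" "agents (I i)" by (rule greedy_ctx[OF ctx i])
    show "?E i \<subseteq> {..<N i} \<and> ?E i \<noteq> {}"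
      using Rn[OF i i] pick_candidates[OF cost_ctxD(2)[OF ctx i] a(2)[OF i] R(2,3)[OF i]] by blast
  qed
qed

subsection \<open>Runs of the greedy algorithms\<close>

lemma list_of_set: "set_data S = list_data (map (\<lambda>k. Num (real (sorted_list_of_set S ! k))) [0..<card S])"
  if "finite S"
proof -
  have "length (sorted_list_of_set S) = card S" by simp
  then show ?thesis unfolding set_data_def by (metis (no_types) map_nth map_map comp_def map_eq_conv)
qed

lemma ptime_greedy_set:
  assumes ctx: "cost_ctx N D X I c"
    and A: "ptime N D X (\<lambda>i. set_data (A i))" "\<And>i. i \<in> D \<Longrightarrow> A i \<subseteq> agents (I i)"
    and q: "ptime N D X (\<lambda>i. Num (real (q i)))" "\<And>i. i \<in> D \<Longrightarrow> q i \<le> card (A i)"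
  shows "ptime N D X (\<lambda>i. set_data (greedy_set (match_value (I i)) (c i) (A i) (q i)))"
proof -
  note ctx0 = cost_ctxD(1)[OF ctx]
  note An = agent_bound[OF ctx0 _ A(2)]
  have finA: "finite (A i)" if "i \<in> D" for i using subset_lessThan An that by blast
  have qn: "q i \<le> card (agents (I i))" if "i \<in> D" for i
    using card_mono[OF crowdsourcingD(1)[OF market_ctxD(1)[OF ctx0 that]] A(2)[OF that]] q(2)[OF that] by simp
  have Q: "ptime N D X (\<lambda>i. set_data {k \<in> agents (I i). k < q i})"
    by (rule ptime_filter[OF market_ctxD(8)[OF ctx0] market_ctxD(4)[OF ctx0]], assumption,
        rule ptime_less_nat[OF ptime_snd ptime_weaken[OF q(1)]]) auto
  have Qeq: "{k \<in> agents (I i). k < q i} = {..<q i}" if "i \<in> D" for i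
    using qn[OF that] market_ctxD(2)[OF ctx0 that] by (metis (no_types, lifting) Collect_cong lessThan_def lessThan_iff less_le_trans)
  show ?thesis
  proof (rule ptime_iterate[where e = "\<lambda>_ k. Num (real k)" and K = q
      and s = "\<lambda>i k. set_data (greedy_set (match_value (I i)) (c i) (A i) k)"])
    show "ptime N D X (\<lambda>i. list_data (map (\<lambda>k. Num (real k)) [0..<q i]))"
    proof (rule ptime_cong[OF Q])
      fix i assume "i \<in> D"
      have "card {..<q i} = q i" by simp
      then show "set_data {k \<in> agents (I i). k < q i} = list_data (map (\<lambda>k. Num (real k)) [0..<q i])"
        using numbered_list[of "{..<q i}"] Qeq[OF \<open>i \<in> D\<close>] by simp
    qed
    show "ptime N D X (\<lambda>i. set_data (greedy_set (match_value (I i)) (c i) (A i) 0))"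
      using ptime_Null by (simp add: set_data_def list_data_def)
    let ?D = "SIGMA i:D. {..<q i}"
    let ?s = "\<lambda>j. greedy_set (match_value (I (fst j))) (c (fst j)) (A (fst j)) (snd j)"
    let ?X = "\<lambda>j. Cell (X (fst j)) (Cell (Num (real (snd j))) (set_data (?s j)))"
    let ?N = "\<lambda>j :: 'a \<times> nat. N (fst j)"
    have ctx1: "cost_ctx ?N ?D ?X (\<lambda>j. I (fst j)) (\<lambda>j. c (fst j))" by (rule cost_ctx_weaken[OF ctx]) auto
    have st: "ptime ?N ?D ?X (\<lambda>j. set_data (?s j))" by (rule ptime_right[OF ptime_snd])
    have props: "?s j \<subseteq> A (fst j)" "card (?s j) = snd j" "snd j < card (A (fst j))" if "j \<in> ?D" for j
    proof -
      have j: "fst j \<in> D" "snd j < q (fst j)" using that by auto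
      show "snd j < card (A (fst j))" using q(2)[OF j(1)] j(2) by simp
      then show "?s j \<subseteq> A (fst j)" "card (?s j) = snd j"
        using greedy_set_props[OF finA[OF j(1)], of "snd j"] by auto
    qed
    have sA: "?s j \<subseteq> agents (I (fst j))" if "j \<in> ?D" for j
      by (rule subset_trans[OF props(1)[OF that] A(2)]) (use that in auto)
    have sN: "?s j \<subseteq> {..<N (fst j)}" if "j \<in> ?D" for j
      by (rule agent_bound[OF ctx0 _ sA[OF that]]) (use that in auto)
    have RA: "A (fst j) - ?s j \<subseteq> agents (I (fst j))" if "j \<in> ?D" for j
      using A(2)[of "fst j"] that by auto
    have R: "ptime ?N ?D ?X (\<lambda>j. set_data (A (fst j) - ?s j))"
      by (rule ptime_diff[OF ptime_weaken[OF A(1)] _ st sN]) (auto dest: subsetD[OF An, rotated -1])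
    have Rne: "A (fst j) - ?s j \<noteq> {}" if "j \<in> ?D" for j
      using props[OF that] finA[of "fst j"] that
      by (metis Diff_eq_empty_iff card_mono finite_subset less_irrefl mem_Sigma_iff not_less prod.collapse subset_antisym)
    have minR: "ptime ?N ?D ?X (\<lambda>j. Num (real (Min (A (fst j) - ?s j))))"
    proof (rule ptime_Min[OF R])
      show "A (fst j) - ?s j \<subseteq> {..<N (fst j)} \<and> A (fst j) - ?s j \<noteq> {}" if "j \<in> ?D" for j
        using agent_bound[OF cost_ctxD(1)[OF ctx1] that RA[OF that]] Rne[OF that] by (rule conjI)
    qed
    have mA: "Min (A (fst j) - ?s j) \<in> agents (I (fst j))" if "j \<in> ?D" for j
      using Min_in[OF _ Rne[OF that]] RA[OF that] finA[of "fst j"] that by auto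
    have p: "ptime ?N ?D ?X (\<lambda>j. Num (real (pick False (Min (A (fst j) - ?s j)) (match_value (I (fst j))) (c (fst j))
        (A (fst j) - ?s j) (?s j))))"
      by (rule ptime_pick[OF ctx1 st sA R RA Rne minR mA])
    have pA: "pick False (Min (A (fst j) - ?s j)) (match_value (I (fst j))) (c (fst j)) (A (fst j) - ?s j) (?s j)
        \<in> agents (I (fst j))" if "j \<in> ?D" for j
      using subsetD[OF RA[OF that] pick_in[OF ctx1 that mA[OF that] RA[OF that] Rne[OF that], of False "?s j"]] .
    show "ptime ?N ?D ?X (\<lambda>j. set_data (greedy_set (match_value (I (fst j))) (c (fst j)) (A (fst j)) (Suc (snd j))))"
      by (rule ptime_cong[OF ptime_insert[OF cost_ctxD(1)[OF ctx1] st sA p pA]]) (auto simp: pick_False)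
  qed (use qn market_ctxD(6)[OF ctx0] le_trans in blast)
qed

definition pair_data :: "nat set \<times> nat set \<Rightarrow> data" where
  "pair_data p = Cell (set_data (fst p)) (set_data (snd p))"

lemma flag_run_bounds:
  assumes ctx: "cost_ctx N D X I c" and i: "i \<in> D" and a: "a \<in> agents (I i)"
    and S: "S \<subseteq> agents (I i)" and R: "R \<subseteq> agents (I i)"
  shows "k \<le> card R \<Longrightarrow> fst ((flag_step f a (match_value (I i)) B (c i) ^^ k) (S, R)) \<subseteq> agents (I i) \<and>
    snd ((flag_step f a (match_value (I i)) B (c i) ^^ k) (S, R)) \<subseteq> R \<and>
    card (snd ((flag_step f a (match_value (I i)) B (c i) ^^ k) (S, R))) = card R - k"
proof (induction k)
  case (Suc k)
  obtain S' R' where eq: "(flag_step f a (match_value (I i)) B (c i) ^^ k) (S, R) = (S', R')" by fastforce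
  have IH: "S' \<subseteq> agents (I i)" "R' \<subseteq> R" "card R' = card R - k" using Suc eq by auto
  define j where "j = pick f a (match_value (I i)) (c i) R' S'"
  have "R' \<noteq> {}" using IH(3) Suc.prems by auto
  then have j: "j \<in> R'" unfolding j_def by (intro pick_in[OF ctx i a]) (use IH(2) R in auto)
  have "finite R" using R crowdsourcingD(1)[OF market_ctxD(1)[OF cost_ctxD(1)[OF ctx] i]] finite_subset by blast
  then have "finite R'" using IH(2) finite_subset by blast
  moreover have "(flag_step f a (match_value (I i)) B (c i) ^^ Suc k) (S, R) =
    (if fits f a B (c i) (insert j S') then insert j S' else S', R' - {j})"
    by (simp add: eq) (simp add: flag_step_def Let_def j_def)
  ultimately show ?case using j IH R by (simp only: fst_conv snd_conv) auto
qed (use S in auto)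

lemma ptime_flag_run:
  assumes ctx: "cost_ctx N D X I c"
    and S: "ptime N D X (\<lambda>i. set_data (S i))" "\<And>i. i \<in> D \<Longrightarrow> S i \<subseteq> agents (I i)"
    and R: "ptime N D X (\<lambda>i. set_data (R i))" "\<And>i. i \<in> D \<Longrightarrow> R i \<subseteq> agents (I i)"
    and a: "ptime N D X (\<lambda>i. Num (real (a i)))" "\<And>i. i \<in> D \<Longrightarrow> a i \<in> agents (I i)"
    and B: "ptime N D X (\<lambda>i. Num (B i))"
    and L: "ptime N D X (\<lambda>i. set_data (L i))" "\<And>i. i \<in> D \<Longrightarrow> L i \<subseteq> agents (I i)" "\<And>i. i \<in> D \<Longrightarrow> card (L i) \<le> card (R i)"
  shows "ptime N D X (\<lambda>i. pair_data ((flag_step f (a i) (match_value (I i)) (B i) (c i) ^^ card (L i)) (S i, R i)))"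
proof -
  note ctx0 = cost_ctxD(1)[OF ctx]
  have finL: "finite (L i)" "card (L i) \<le> N i" if "i \<in> D" for i
    using subset_lessThan[OF agent_bound[OF ctx0 that L(2)[OF that]]] by auto
  let ?run = "\<lambda>i k. (flag_step f (a i) (match_value (I i)) (B i) (c i) ^^ k) (S i, R i)"
  show ?thesis
  proof (rule ptime_iterate[where e = "\<lambda>i k. Num (real (sorted_list_of_set (L i) ! k))" and K = "\<lambda>i. card (L i)"
      and s = "\<lambda>i k. pair_data (?run i k)"])
    show "ptime N D X (\<lambda>i. list_data (map (\<lambda>k. Num (real (sorted_list_of_set (L i) ! k))) [0..<card (L i)]))"
      by (rule ptime_cong[OF L(1)]) (rule list_of_set[OF finL(1)])
    show "ptime N D X (\<lambda>i. pair_data (?run i 0))" using ptime_Cell[OF S(1) R(1)] by (simp add: pair_data_def)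
    let ?D = "SIGMA i:D. {..<card (L i)}"
    let ?s = "\<lambda>j. fst (?run (fst j) (snd j))" and ?r = "\<lambda>j. snd (?run (fst j) (snd j))"
    let ?X = "\<lambda>j. Cell (X (fst j)) (Cell (Num (real (sorted_list_of_set (L (fst j)) ! snd j))) (pair_data (?run (fst j) (snd j))))"
    let ?N = "\<lambda>j :: 'a \<times> nat. N (fst j)"
    have ctx1: "cost_ctx ?N ?D ?X (\<lambda>j. I (fst j)) (\<lambda>j. c (fst j))" by (rule cost_ctx_weaken[OF ctx]) auto
    have pair: "ptime ?N ?D ?X (\<lambda>j. Cell (set_data (?s j)) (set_data (?r j)))"
      using ptime_right[OF ptime_snd] by (simp add: pair_data_def)
    note st = ptime_left[OF pair] and rt = ptime_right[OF pair]
    have sA: "?s j \<subseteq> agents (I (fst j))" and rA: "?r j \<subseteq> agents (I (fst j))" and rne: "?r j \<noteq> {}" if "j \<in> ?D" for j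
    proof -
      have j: "fst j \<in> D" "snd j < card (L (fst j))" using that by auto
      then have "snd j < card (R (fst j))" using L(3)[OF j(1)] by simp
      then show "?s j \<subseteq> agents (I (fst j))" "?r j \<subseteq> agents (I (fst j))" "?r j \<noteq> {}"
        using flag_run_bounds[OF ctx j(1) a(2)[OF j(1)] S(2)[OF j(1)] R(2)[OF j(1)], of "snd j" f "B (fst j)"] R(2)[OF j(1)]
        by auto
    qed
    have a1: "ptime ?N ?D ?X (\<lambda>j. Num (real (a (fst j))))" by (rule ptime_weaken[OF a(1)]) auto
    have aA: "a (fst j) \<in> agents (I (fst j))" if "j \<in> ?D" for j using a(2) that by auto
    define p where "p j = pick f (a (fst j)) (match_value (I (fst j))) (c (fst j)) (?r j) (?s j)" for j
    have p: "ptime ?N ?D ?X (\<lambda>j. Num (real (p j)))"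
      unfolding p_def by (rule ptime_pick[OF ctx1 st sA rt rA rne a1 aA])
    have pr: "p j \<in> ?r j" if "j \<in> ?D" for j
      unfolding p_def by (rule pick_in[OF ctx1 that aA[OF that] rA[OF that] rne[OF that]])
    have pA: "p j \<in> agents (I (fst j))" if "j \<in> ?D" for j using pr[OF that] rA[OF that] by blast
    have ins: "ptime ?N ?D ?X (\<lambda>j. set_data (insert (p j) (?s j)))"
      by (rule ptime_insert[OF cost_ctxD(1)[OF ctx1] st sA p pA])
    have insA: "insert (p j) (?s j) \<subseteq> agents (I (fst j))" if "j \<in> ?D" for j using pA[OF that] sA[OF that] by blast
    have sm: "ptime ?N ?D ?X (\<lambda>j. Num (sum (c (fst j)) (insert (p j) (?s j))))"
      by (rule ptime_sum_cost[OF ctx1 ins insA])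
    have B1: "ptime ?N ?D ?X (\<lambda>j. Num (B (fst j)))" by (rule ptime_weaken[OF B]) auto
    have mem: "ptime ?N ?D ?X (\<lambda>j. bool_data (a (fst j) \<in> insert (p j) (?s j)))"
      by (rule ptime_mem[OF ins agent_bound[OF cost_ctxD(1)[OF ctx1] _ insA] a1])
    have fit: "ptime ?N ?D ?X (\<lambda>j. bool_data (fits f (a (fst j)) (B (fst j)) (c (fst j)) (insert (p j) (?s j))))"
      by (rule ptime_cong[OF ptime_If[OF ptime_and[OF ptime_bool[where f = f] mem] ptime_less[OF sm B1] ptime_le[OF sm B1]]])
        (auto simp: fits_def)
    have sing: "ptime ?N ?D ?X (\<lambda>j. set_data {p j})" by (rule ptime_singleton[OF cost_ctxD(1)[OF ctx1] p pA])
    have rem: "ptime ?N ?D ?X (\<lambda>j. set_data (?r j - {p j}))"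
    proof (rule ptime_diff[OF rt _ sing])
      show "?r j \<subseteq> {..<N (fst j)}" if "j \<in> ?D" for j by (rule agent_bound[OF cost_ctxD(1)[OF ctx1] that rA[OF that]])
      show "{p j} \<subseteq> {..<N (fst j)}" if "j \<in> ?D" for j
        by (rule agent_bound[OF cost_ctxD(1)[OF ctx1] that]) (use pA[OF that] in simp)
    qed
    show "ptime ?N ?D ?X (\<lambda>j. pair_data (?run (fst j) (Suc (snd j))))"
      by (rule ptime_cong[OF ptime_Cell[OF ptime_If[OF fit ins st] rem]])
        (simp add: pair_data_def flag_step_def split_beta Let_def p_def)
  qed (rule finL(2))
qed

lemma ptime_flag_fill:
  assumes ctx: "cost_ctx N D X I c"
    and S: "ptime N D X (\<lambda>i. set_data (S i))" "\<And>i. i \<in> D \<Longrightarrow> S i \<subseteq> agents (I i)"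
    and R: "ptime N D X (\<lambda>i. set_data (R i))" "\<And>i. i \<in> D \<Longrightarrow> R i \<subseteq> agents (I i)"
    and a: "ptime N D X (\<lambda>i. Num (real (a i)))" "\<And>i. i \<in> D \<Longrightarrow> a i \<in> agents (I i)"
    and B: "ptime N D X (\<lambda>i. Num (B i))"
  shows "ptime N D X (\<lambda>i. set_data (flag_fill f (a i) (match_value (I i)) (B i) (c i) (S i) (R i)))"
  unfolding flag_fill_def
  by (rule ptime_left[OF ptime_flag_run[OF assms R(1,2), unfolded pair_data_def]]) auto

lemma flag_fill_subset:
  assumes "cost_ctx N D X I c" "i \<in> D" "a \<in> agents (I i)" "S \<subseteq> agents (I i)" "R \<subseteq> agents (I i)"
  shows "flag_fill f a (match_value (I i)) B (c i) S R \<subseteq> agents (I i)"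
  unfolding flag_fill_def using flag_run_bounds[OF assms order_refl] by blast

subsection \<open>The winning test\<close>

definition ok_flag :: "bool \<Rightarrow> ('a::linorder set \<Rightarrow> real) \<Rightarrow> 'a set \<Rightarrow> real \<Rightarrow> 'a costs \<Rightarrow> 'a \<Rightarrow> real \<Rightarrow> 'a set \<Rightarrow> real \<Rightarrow> bool" where
  "ok_flag f v A B c a \<tau> U x \<longleftrightarrow> c a \<le> x \<and> fits f a B (c(a := x)) U \<and>
     \<tau> \<le> v (flag_fill f a v B (c(a := x)) U (A - U))"

definition ok_cost :: "('a::linorder set \<Rightarrow> real) \<Rightarrow> 'a set \<Rightarrow> real \<Rightarrow> 'a costs \<Rightarrow> 'a \<Rightarrow> real \<Rightarrow> 'a set \<Rightarrow> real \<Rightarrow> bool" where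
  "ok_cost v A B c a \<tau> U x \<longleftrightarrow> ok_flag True v A B c a \<tau> U x \<or> ok_flag False v A B c a \<tau> U x"

definition run_without_set :: "('a::linorder set \<Rightarrow> real) \<Rightarrow> 'a set \<Rightarrow> real \<Rightarrow> 'a costs \<Rightarrow> 'a \<Rightarrow> 'a set \<Rightarrow> nat \<Rightarrow> 'a set" where
  "run_without_set v A B c a U q = fst ((sviridenko_step v B c ^^ q) (U, A - U - {a}))"

definition ok_position :: "('a::linorder set \<Rightarrow> real) \<Rightarrow> 'a set \<Rightarrow> real \<Rightarrow> 'a costs \<Rightarrow> 'a \<Rightarrow> real \<Rightarrow> 'a set \<Rightarrow> 'a set \<Rightarrow> bool" where
  "ok_position v A B c a \<tau> U S \<longleftrightarrow> (\<exists>j\<in>A. ok_cost v A B c a \<tau> U (marginal v a S * c j / marginal v j S))"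

definition ok_start :: "('a::linorder set \<Rightarrow> real) \<Rightarrow> 'a set \<Rightarrow> real \<Rightarrow> 'a costs \<Rightarrow> 'a \<Rightarrow> real \<Rightarrow> 'a set \<Rightarrow> bool" where
  "ok_start v A B c a \<tau> U \<longleftrightarrow> ok_cost v A B c a \<tau> U (c a) \<or>
     (\<exists>q\<in>{..card (A - U - {a})}. ok_position v A B c a \<tau> U (run_without_set v A B c a U q))"

definition ok_sup :: "('a::linorder set \<Rightarrow> real) \<Rightarrow> 'a set \<Rightarrow> real \<Rightarrow> 'a costs \<Rightarrow> 'a \<Rightarrow> real \<Rightarrow> bool" where
  "ok_sup v A B c a \<tau> \<longleftrightarrow> \<tau> \<le> 0 \<or> (\<exists>x\<in>A. \<exists>y\<in>A. sum c {x, y} \<le> B \<and> \<tau> \<le> v {x, y}) \<or>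
     (\<exists>x\<in>A. \<exists>y\<in>A. \<exists>z\<in>A. x \<noteq> y \<and> x \<noteq> z \<and> y \<noteq> z \<and> ok_start v A B c a \<tau> {x, y, z})"

lemma card_le_2_cases: "finite U \<Longrightarrow> card U \<le> 2 \<Longrightarrow> U = {} \<or> (\<exists>x y. U = {x, y})"
proof -
  assume "finite U" "card U \<le> 2"
  then consider "card U = 0" | "card U = 1" | "card U = 2" by linarith
  then show ?thesis using \<open>finite U\<close> by cases (auto simp: card_1_singleton_iff card_2_iff)
qed

lemma (in greedy) ok_start_iff:
  "ok_start v A B c a \<tau> U \<longleftrightarrow> (\<exists>x\<in>candidates B c a U. \<exists>f. c a \<le> x \<and> fits f a B (c(a := x)) U \<and>
      \<tau> \<le> v (flag_fill f a v B (c(a := x)) U (A - U)))"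
proof -
  have "ok_cost v A B c a \<tau> U x \<longleftrightarrow> (\<exists>f. c a \<le> x \<and> fits f a B (c(a := x)) U \<and>
      \<tau> \<le> v (flag_fill f a v B (c(a := x)) U (A - U)))" for x
    unfolding ok_cost_def ok_flag_def by (metis (full_types))
  then have "(\<exists>x\<in>candidates B c a U. \<exists>f. c a \<le> x \<and> fits f a B (c(a := x)) U \<and>
      \<tau> \<le> v (flag_fill f a v B (c(a := x)) U (A - U))) \<longleftrightarrow> (\<exists>x\<in>candidates B c a U. ok_cost v A B c a \<tau> U x)" by simp
  also have "\<dots> \<longleftrightarrow> ok_start v A B c a \<tau> U"
    unfolding ok_start_def ok_position_def candidates_def run_without_set_def run_without_def by (auto 0 3)
  finally show ?thesis by simp
qed

lemma (in greedy) ok_sup_iff: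
  assumes c: "cost_vector A c" and a: "a \<in> A" and B: "0 \<le> B"
  shows "\<tau> \<le> (SUP x\<in>{c a..}. sviridenko A B v (c(a := x))) \<longleftrightarrow> ok_sup v A B c a \<tau>"
proof -
  have e1: "(\<exists>U\<subseteq>A. card U \<le> 2 \<and> sum c U \<le> B \<and> \<tau> \<le> v U) \<longleftrightarrow>
    \<tau> \<le> 0 \<or> (\<exists>x\<in>A. \<exists>y\<in>A. sum c {x, y} \<le> B \<and> \<tau> \<le> v {x, y})" (is "?l \<longleftrightarrow> ?r")
  proof
    assume ?l
    then obtain U where U: "U \<subseteq> A" "card U \<le> 2" "sum c U \<le> B" "\<tau> \<le> v U" by blast
    have "finite U" using U finite_A finite_subset by blast
    then show ?r using card_le_2_cases[OF _ U(2)] U v_empty by auto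
  next
    assume ?r
    then show ?l
    proof
      assume "\<tau> \<le> 0"
      then show ?l using B v_empty by (intro exI[of _ "{}"]) auto
    next
      assume "\<exists>x\<in>A. \<exists>y\<in>A. sum c {x, y} \<le> B \<and> \<tau> \<le> v {x, y}"
      then obtain x y where "x \<in> A" "y \<in> A" "sum c {x, y} \<le> B" "\<tau> \<le> v {x, y}" by blast
      moreover have "card {x, y} \<le> 2" by (simp add: card_insert_if)
      ultimately show ?l by (intro exI[of _ "{x, y}"]) simp
    qed
  qed
  have e2: "(\<exists>U\<subseteq>A. card U = 3 \<and> ok_start v A B c a \<tau> U) \<longleftrightarrow>
    (\<exists>x\<in>A. \<exists>y\<in>A. \<exists>z\<in>A. x \<noteq> y \<and> x \<noteq> z \<and> y \<noteq> z \<and> ok_start v A B c a \<tau> {x, y, z})" (is "?l \<longleftrightarrow> ?r")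
  proof
    assume ?l
    then obtain U where U: "U \<subseteq> A" "card U = 3" "ok_start v A B c a \<tau> U" by blast
    then obtain x y z where "U = {x, y, z}" "x \<noteq> y" "y \<noteq> z" "x \<noteq> z" by (auto simp: card_3_iff)
    then show ?r using U by blast
  next
    assume ?r
    then obtain x y z where xyz: "x \<in> A" "y \<in> A" "z \<in> A" "x \<noteq> y" "x \<noteq> z" "y \<noteq> z" "ok_start v A B c a \<tau> {x, y, z}"
      by blast
    then have "card {x, y, z} = 3" by simp
    with xyz show ?l by (intro exI[of _ "{x, y, z}"]) simp
  qed
  show ?thesis
    unfolding sviridenko_sup_iff[OF c a B] ok_start_iff[symmetric] ok_sup_def e1 e2 by (rule disj_assoc)
qed

definition test_ctx :: "('i \<Rightarrow> nat) \<Rightarrow> 'i set \<Rightarrow> ('i \<Rightarrow> data) \<Rightarrow> ('i \<Rightarrow> (nat, nat) market) \<Rightarrow> ('i \<Rightarrow> nat costs) \<Rightarrow>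
    ('i \<Rightarrow> nat set) \<Rightarrow> ('i \<Rightarrow> nat) \<Rightarrow> ('i \<Rightarrow> real) \<Rightarrow> ('i \<Rightarrow> real) \<Rightarrow> bool" where
  "test_ctx N D X I c A a B \<tau> \<longleftrightarrow> cost_ctx N D X I c \<and> ptime N D X (\<lambda>i. set_data (A i)) \<and>
     ptime N D X (\<lambda>i. Num (real (a i))) \<and> ptime N D X (\<lambda>i. Num (B i)) \<and> ptime N D X (\<lambda>i. Num (\<tau> i)) \<and>
     (\<forall>i\<in>D. A i \<subseteq> agents (I i) \<and> a i \<in> A i)"

lemma test_ctxD:
  assumes "test_ctx N D X I c A a B \<tau>"
  shows "cost_ctx N D X I c" "market_ctx N D X I" "ptime N D X (\<lambda>i. set_data (A i))" "ptime N D X (\<lambda>i. Num (real (a i)))"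
    "ptime N D X (\<lambda>i. Num (B i))" "ptime N D X (\<lambda>i. Num (\<tau> i))"
    "i \<in> D \<Longrightarrow> A i \<subseteq> agents (I i)" "i \<in> D \<Longrightarrow> a i \<in> A i" "i \<in> D \<Longrightarrow> a i \<in> agents (I i)" "i \<in> D \<Longrightarrow> A i \<subseteq> {..<N i}"
  using assms agent_bound[of N D X I i "A i"] by (auto simp: test_ctx_def cost_ctx_def)

lemma test_ctx_weaken:
  assumes "test_ctx N D X I c A a B \<tau>" "\<And>j. j \<in> D' \<Longrightarrow> fst j \<in> D"
  shows "test_ctx (\<lambda>j. N (fst j)) D' (\<lambda>j. Cell (X (fst j)) (E j)) (\<lambda>j. I (fst j)) (\<lambda>j. c (fst j)) (\<lambda>j. A (fst j))
    (\<lambda>j. a (fst j)) (\<lambda>j. B (fst j)) (\<lambda>j. \<tau> (fst j))"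
  using assms(1) unfolding test_ctx_def
  by (intro conjI ptime_weaken[OF _ assms(2)] cost_ctx_weaken[OF _ assms(2)]) (use assms(2) in auto)

lemma test_ctx_subset: "test_ctx N D X I c A a B \<tau> \<Longrightarrow> D' \<subseteq> D \<Longrightarrow> test_ctx N D' X I c A a B \<tau>"
  unfolding test_ctx_def by (auto elim: ptime_subset cost_ctx_subset)

lemma ptime_ok_flag:
  assumes ctx: "test_ctx N D X I c A a B \<tau>"
    and U: "ptime N D X (\<lambda>i. set_data (U i))" "\<And>i. i \<in> D \<Longrightarrow> U i \<subseteq> agents (I i)"
    and x: "ptime N D X (\<lambda>i. Num (x i))"
  shows "ptime N D X (\<lambda>i. bool_data (ok_flag f (match_value (I i)) (A i) (B i) (c i) (a i) (\<tau> i) (U i) (x i)))"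
  unfolding ok_flag_def
proof (rule ptime_and_then)
  show "ptime N D X (\<lambda>i. bool_data (c i (a i) \<le> x i))"
    by (rule ptime_le[OF ptime_cost[OF test_ctxD(1,4)[OF ctx]] x]) (rule test_ctxD(9)[OF ctx])
  let ?D = "{i \<in> D. c i (a i) \<le> x i}"
  have ctx1: "test_ctx N ?D X I c A a B \<tau>" by (rule test_ctx_subset[OF ctx]) auto
  have x1: "ptime N ?D X (\<lambda>i. Num (x i))" by (rule ptime_subset[OF x]) auto
  have U1: "ptime N ?D X (\<lambda>i. set_data (U i))" by (rule ptime_subset[OF U(1)]) auto
  have UA: "U i \<subseteq> agents (I i)" if "i \<in> ?D" for i using U(2) that by auto
  have x0: "0 \<le> x i" if "i \<in> ?D" for i
  proof -
    have "0 \<le> c i (a i)"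
      using cost_ctxD(2)[OF test_ctxD(1)[OF ctx1] that] test_ctxD(9)[OF ctx1 that] by (simp add: cost_vector_def)
    then show ?thesis using that by auto
  qed
  have ctx2: "cost_ctx N ?D X I (\<lambda>i. (c i)(a i := x i))"
    by (rule cost_ctx_update[OF test_ctxD(1,4)[OF ctx1] x1 x0])
  have sm: "ptime N ?D X (\<lambda>i. Num (sum ((c i)(a i := x i)) (U i)))" by (rule ptime_sum_cost[OF ctx2 U1 UA])
  have mem: "ptime N ?D X (\<lambda>i. bool_data (a i \<in> U i))"
  proof (rule ptime_mem[OF U1 _ test_ctxD(4)[OF ctx1]])
    show "U i \<subseteq> {..<N i}" if "i \<in> ?D" for i by (rule agent_bound[OF test_ctxD(2)[OF ctx1] that UA[OF that]])
  qed
  have fit: "ptime N ?D X (\<lambda>i. bool_data (fits f (a i) (B i) ((c i)(a i := x i)) (U i)))"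
    by (rule ptime_cong[OF ptime_If[OF ptime_and[OF ptime_bool[where f = f] mem] ptime_less[OF sm test_ctxD(5)[OF ctx1]]
        ptime_le[OF sm test_ctxD(5)[OF ctx1]]]])
      (auto simp: fits_def simp del: fun_upd_apply)
  have R: "ptime N ?D X (\<lambda>i. set_data (A i - U i))"
  proof (rule ptime_diff[OF test_ctxD(3)[OF ctx1] _ U1])
    show "U i \<subseteq> {..<N i}" if "i \<in> ?D" for i by (rule agent_bound[OF test_ctxD(2)[OF ctx1] that UA[OF that]])
  qed (rule test_ctxD(10)[OF ctx1])
  have RA: "A i - U i \<subseteq> agents (I i)" if "i \<in> ?D" for i using test_ctxD(7)[OF ctx1 that] by auto
  have fill: "ptime N ?D X (\<lambda>i. set_data (flag_fill f (a i) (match_value (I i)) (B i) ((c i)(a i := x i)) (U i) (A i - U i)))"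
    by (rule ptime_flag_fill[OF ctx2 U1 UA R RA test_ctxD(4)[OF ctx1] test_ctxD(9)[OF ctx1] test_ctxD(5)[OF ctx1]])
  have "ptime N ?D X (\<lambda>i. Num (match_value (I i)
      (flag_fill f (a i) (match_value (I i)) (B i) ((c i)(a i := x i)) (U i) (A i - U i))))"
  proof (rule ptime_value[OF test_ctxD(2)[OF ctx1] fill])
    show "flag_fill f (a i) (match_value (I i)) (B i) ((c i)(a i := x i)) (U i) (A i - U i) \<subseteq> agents (I i)"
      if "i \<in> ?D" for i
      by (rule flag_fill_subset[OF ctx2 that test_ctxD(9)[OF ctx1 that] UA[OF that] RA[OF that]])
  qed
  then show "ptime N ?D X (\<lambda>i. bool_data (fits f (a i) (B i) ((c i)(a i := x i)) (U i) \<and>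
      \<tau> i \<le> match_value (I i) (flag_fill f (a i) (match_value (I i)) (B i) ((c i)(a i := x i)) (U i) (A i - U i))))"
    by (rule ptime_and[OF fit ptime_le[OF test_ctxD(6)[OF ctx1]]])
qed

lemma ptime_ok_cost:
  assumes "test_ctx N D X I c A a B \<tau>"
    and "ptime N D X (\<lambda>i. set_data (U i))" "\<And>i. i \<in> D \<Longrightarrow> U i \<subseteq> agents (I i)"
    and "ptime N D X (\<lambda>i. Num (x i))"
  shows "ptime N D X (\<lambda>i. bool_data (ok_cost (match_value (I i)) (A i) (B i) (c i) (a i) (\<tau> i) (U i) (x i)))"
  unfolding ok_cost_def by (intro ptime_or ptime_ok_flag assms)

lemma ptime_ok_position:
  assumes ctx: "test_ctx N D X I c A a B \<tau>"
    and U: "ptime N D X (\<lambda>i. set_data (U i))" "\<And>i. i \<in> D \<Longrightarrow> U i \<subseteq> agents (I i)"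
    and S: "ptime N D X (\<lambda>i. set_data (S i))" "\<And>i. i \<in> D \<Longrightarrow> S i \<subseteq> agents (I i)"
  shows "ptime N D X (\<lambda>i. bool_data (ok_position (match_value (I i)) (A i) (B i) (c i) (a i) (\<tau> i) (U i) (S i)))"
  unfolding ok_position_def
proof (rule ptime_Bex[OF test_ctxD(3)[OF ctx] test_ctxD(10)[OF ctx]], assumption)
  let ?D = "SIGMA i:D. A i" and ?X = "\<lambda>j. Cell (X (fst j)) (Num (real (snd j)))" and ?N = "\<lambda>j :: 'a \<times> nat. N (fst j)"
  have ctx1: "test_ctx ?N ?D ?X (\<lambda>j. I (fst j)) (\<lambda>j. c (fst j)) (\<lambda>j. A (fst j))
      (\<lambda>j. a (fst j)) (\<lambda>j. B (fst j)) (\<lambda>j. \<tau> (fst j))" by (rule test_ctx_weaken[OF ctx]) auto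
  have U1: "ptime ?N ?D ?X (\<lambda>j. set_data (U (fst j)))" by (rule ptime_weaken[OF U(1)]) auto
  have UA: "U (fst j) \<subseteq> agents (I (fst j))" if "j \<in> ?D" for j by (rule U(2)) (use that in auto)
  have S1: "ptime ?N ?D ?X (\<lambda>j. set_data (S (fst j)))" by (rule ptime_weaken[OF S(1)]) auto
  have SA: "S (fst j) \<subseteq> agents (I (fst j))" if "j \<in> ?D" for j by (rule S(2)) (use that in auto)
  have jA: "snd j \<in> agents (I (fst j))" if "j \<in> ?D" for j
    by (rule subsetD[OF test_ctxD(7)[OF ctx]]) (use that in auto)
  have ma: "ptime ?N ?D ?X (\<lambda>j. Num (marginal (match_value (I (fst j))) (a (fst j)) (S (fst j))))"
    by (rule ptime_marginal[OF test_ctxD(2)[OF ctx1] S1 SA test_ctxD(4)[OF ctx1] test_ctxD(9)[OF ctx1]])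
  have mj: "ptime ?N ?D ?X (\<lambda>j. Num (marginal (match_value (I (fst j))) (snd j) (S (fst j))))"
    by (rule ptime_marginal[OF test_ctxD(2)[OF ctx1] S1 SA ptime_snd jA])
  have cj: "ptime ?N ?D ?X (\<lambda>j. Num (c (fst j) (snd j)))" by (rule ptime_cost[OF test_ctxD(1)[OF ctx1] ptime_snd jA])
  show "ptime ?N ?D ?X (\<lambda>j. bool_data (ok_cost (match_value (I (fst j))) (A (fst j)) (B (fst j)) (c (fst j)) (a (fst j))
    (\<tau> (fst j)) (U (fst j)) (marginal (match_value (I (fst j))) (a (fst j)) (S (fst j)) * c (fst j) (snd j) /
      marginal (match_value (I (fst j))) (snd j) (S (fst j)))))"
    by (rule ptime_ok_cost[OF ctx1 U1 UA ptime_divide[OF ptime_times[OF ma cj] mj]])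
qed

lemma ptime_ok_start:
  assumes ctx: "test_ctx N D X I c A a B \<tau>"
    and U: "ptime N D X (\<lambda>i. set_data (U i))" "\<And>i. i \<in> D \<Longrightarrow> U i \<subseteq> agents (I i)"
  shows "ptime N D X (\<lambda>i. bool_data (ok_start (match_value (I i)) (A i) (B i) (c i) (a i) (\<tau> i) (U i)))"
proof -
  note ctx0 = test_ctxD(2)[OF ctx]
  have sing: "ptime N D X (\<lambda>i. set_data {a i})"
    by (rule ptime_singleton[OF ctx0 test_ctxD(4)[OF ctx] test_ctxD(9)[OF ctx]])
  have Un: "U i \<subseteq> {..<N i}" if "i \<in> D" for i by (rule agent_bound[OF ctx0 that U(2)[OF that]])
  have sn: "{a i} \<subseteq> {..<N i}" if "i \<in> D" for i
    by (rule agent_bound[OF ctx0 that]) (use test_ctxD(9)[OF ctx that] in simp)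
  have AU: "ptime N D X (\<lambda>i. set_data (A i - U i))" by (rule ptime_diff[OF test_ctxD(3,10)[OF ctx] U(1) Un])
  have R: "ptime N D X (\<lambda>i. set_data (A i - U i - {a i}))"
    by (rule ptime_diff[OF AU _ sing sn]) (use test_ctxD(10)[OF ctx] in auto)
  have RA: "A i - U i - {a i} \<subseteq> agents (I i)" if "i \<in> D" for i using test_ctxD(7)[OF ctx that] by auto
  have Rn: "A i - U i - {a i} \<subseteq> {..<N i}" if "i \<in> D" for i by (rule agent_bound[OF ctx0 that RA[OF that]])
  have cR: "ptime N D X (\<lambda>i. Num (real (card (A i - U i - {a i}))))" by (rule ptime_card[OF R Rn])
  have ca: "ptime N D X (\<lambda>i. Num (c i (a i)))" by (rule ptime_cost[OF test_ctxD(1,4,9)[OF ctx]])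
  have first: "ptime N D X (\<lambda>i. bool_data (ok_cost (match_value (I i)) (A i) (B i) (c i) (a i) (\<tau> i) (U i) (c i (a i))))"
    by (rule ptime_ok_cost[OF ctx U ca])
  let ?S = "\<lambda>i q. run_without_set (match_value (I i)) (A i) (B i) (c i) (a i) (U i) q"
  let ?P = "\<lambda>i q. q \<le> card (A i - U i - {a i}) \<and> ok_position (match_value (I i)) (A i) (B i) (c i) (a i) (\<tau> i) (U i) (?S i q)"
  have "ptime N D X (\<lambda>i. bool_data (\<exists>q\<in>agents (I i). ?P i q))"
  proof (rule ptime_Bex[OF market_ctxD(8)[OF ctx0] market_ctxD(4)[OF ctx0]], assumption, rule ptime_and_then)
    let ?X = "\<lambda>j. Cell (X (fst j)) (Num (real (snd j)))" and ?N = "\<lambda>j :: 'a \<times> nat. N (fst j)"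
    show "ptime ?N (SIGMA i:D. agents (I i)) ?X (\<lambda>j. bool_data (snd j \<le> card (A (fst j) - U (fst j) - {a (fst j)})))"
      by (rule ptime_le_nat[OF ptime_snd ptime_weaken[OF cR]]) auto
    let ?D = "{j \<in> (SIGMA i:D. agents (I i)). snd j \<le> card (A (fst j) - U (fst j) - {a (fst j)})}"
    have ctx1: "test_ctx ?N ?D ?X (\<lambda>j. I (fst j)) (\<lambda>j. c (fst j)) (\<lambda>j. A (fst j))
        (\<lambda>j. a (fst j)) (\<lambda>j. B (fst j)) (\<lambda>j. \<tau> (fst j))" by (rule test_ctx_weaken[OF ctx]) auto
    have U1: "ptime ?N ?D ?X (\<lambda>j. set_data (U (fst j)))" by (rule ptime_weaken[OF U(1)]) auto
    have UA: "U (fst j) \<subseteq> agents (I (fst j))" if "j \<in> ?D" for j by (rule U(2)) (use that in auto)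
    have R1: "ptime ?N ?D ?X (\<lambda>j. set_data (A (fst j) - U (fst j) - {a (fst j)}))" by (rule ptime_weaken[OF R]) auto
    have RA1: "A (fst j) - U (fst j) - {a (fst j)} \<subseteq> agents (I (fst j))" if "j \<in> ?D" for j using RA[of "fst j"] that by auto
    let ?L = "\<lambda>j. {k \<in> agents (I (fst j)). k < snd j}"
    have L: "ptime ?N ?D ?X (\<lambda>j. set_data (?L j))"
    proof (rule ptime_filter)
      show "ptime ?N ?D ?X (\<lambda>j. set_data (agents (I (fst j))))" by (rule market_ctxD(8)[OF test_ctxD(2)[OF ctx1]])
      show "agents (I (fst j)) \<subseteq> {..<?N j}" if "j \<in> ?D" for j by (rule market_ctxD(4)[OF test_ctxD(2)[OF ctx1] that])
    qed (rule ptime_less_nat[OF ptime_snd ptime_snd2])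
    have Leq: "?L j = {..<snd j}" if "j \<in> ?D" for j
    proof -
      have "fst j \<in> D" "snd j \<in> agents (I (fst j))" using that by auto
      then have "snd j < card (agents (I (fst j)))" "agents (I (fst j)) = {..<card (agents (I (fst j)))}"
        using market_ctxD(2)[OF ctx0, of "fst j"] by (blast, blast)
      then show ?thesis by (metis (no_types, lifting) Collect_cong lessThan_def lessThan_iff order_less_trans)
    qed
    have Lc: "card (?L j) = snd j" if "j \<in> ?D" for j unfolding Leq[OF that] by simp
    have Lle: "card (?L j) \<le> card (A (fst j) - U (fst j) - {a (fst j)})" if "j \<in> ?D" for j
      unfolding Lc[OF that] using that by auto
    have "ptime ?N ?D ?X (\<lambda>j. pair_data ((flag_step False (a (fst j)) (match_value (I (fst j))) (B (fst j)) (c (fst j)) ^^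
        card (?L j)) (U (fst j), A (fst j) - U (fst j) - {a (fst j)})))"
      by (rule ptime_flag_run[OF test_ctxD(1)[OF ctx1] U1 UA R1 RA1 test_ctxD(4)[OF ctx1] test_ctxD(9)[OF ctx1]
            test_ctxD(5)[OF ctx1] L _ Lle]) auto
    from ptime_left[OF this[unfolded pair_data_def]]
    have S: "ptime ?N ?D ?X (\<lambda>j. set_data (?S (fst j) (snd j)))"
      by (rule ptime_cong) (simp only: Lc run_without_set_def flag_step_False)
    have SA: "?S (fst j) (snd j) \<subseteq> agents (I (fst j))" if "j \<in> ?D" for j
    proof -
      have "snd j \<le> card (A (fst j) - U (fst j) - {a (fst j)})" using that by auto
      from conjunct1[OF flag_run_bounds[OF test_ctxD(1)[OF ctx1] that test_ctxD(9)[OF ctx1 that] UA[OF that] RA1[OF that] this,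
        of False "B (fst j)"]]
      show ?thesis unfolding run_without_set_def flag_step_False .
    qed
    show "ptime ?N ?D ?X (\<lambda>j. bool_data (ok_position (match_value (I (fst j))) (A (fst j)) (B (fst j)) (c (fst j)) (a (fst j))
        (\<tau> (fst j)) (U (fst j)) (?S (fst j) (snd j))))"
      by (rule ptime_ok_position[OF ctx1 U1 UA S SA])
  qed
  from ptime_or[OF first this] show ?thesis
  proof (rule ptime_cong)
    fix i assume i: "i \<in> D"
    have "card (A i - U i - {a i}) < card (agents (I i))"
      by (rule psubset_card_mono[OF crowdsourcingD(1)[OF market_ctxD(1)[OF ctx0 i]]])
        (use RA[OF i] test_ctxD(9)[OF ctx i] in auto)
    moreover have "agents (I i) = {..<card (agents (I i))}" by (rule market_ctxD(2)[OF ctx0 i])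
    ultimately have "q \<in> agents (I i)" if "q \<le> card (A i - U i - {a i})" for q
      using that by (metis lessThan_iff order_le_less_trans)
    then have "(\<exists>q\<in>agents (I i). ?P i q) \<longleftrightarrow> (\<exists>q\<in>{..card (A i - U i - {a i})}.
        ok_position (match_value (I i)) (A i) (B i) (c i) (a i) (\<tau> i) (U i) (?S i q))" by auto
    then show "bool_data (ok_cost (match_value (I i)) (A i) (B i) (c i) (a i) (\<tau> i) (U i) (c i (a i)) \<or>
        (\<exists>q\<in>agents (I i). ?P i q)) = bool_data (ok_start (match_value (I i)) (A i) (B i) (c i) (a i) (\<tau> i) (U i))"
      unfolding ok_start_def by simp
  qed
qed

lemma ptime_third_item:
  assumes ctx: "test_ctx N D X I c A a B \<tau>" and x: "ptime N D X (\<lambda>i. Num (real (x i)))" "\<And>i. i \<in> D \<Longrightarrow> x i \<in> A i"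
    and y: "ptime N D X (\<lambda>i. Num (real (y i)))" "\<And>i. i \<in> D \<Longrightarrow> y i \<in> A i"
  shows "ptime N D X (\<lambda>i. bool_data (\<exists>z\<in>A i. x i \<noteq> y i \<and> x i \<noteq> z \<and> y i \<noteq> z \<and>
      ok_start (match_value (I i)) (A i) (B i) (c i) (a i) (\<tau> i) {x i, y i, z}))"
proof (rule ptime_Bex[OF test_ctxD(3)[OF ctx] test_ctxD(10)[OF ctx]], assumption)
  let ?D = "SIGMA i:D. A i" and ?X = "\<lambda>j. Cell (X (fst j)) (Num (real (snd j)))" and ?N = "\<lambda>j :: 'a \<times> nat. N (fst j)"
  have ctx1: "test_ctx ?N ?D ?X (\<lambda>j. I (fst j)) (\<lambda>j. c (fst j)) (\<lambda>j. A (fst j))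
      (\<lambda>j. a (fst j)) (\<lambda>j. B (fst j)) (\<lambda>j. \<tau> (fst j))" by (rule test_ctx_weaken[OF ctx]) auto
  have x1: "ptime ?N ?D ?X (\<lambda>j. Num (real (x (fst j))))" by (rule ptime_weaken[OF x(1)]) auto
  have y1: "ptime ?N ?D ?X (\<lambda>j. Num (real (y (fst j))))" by (rule ptime_weaken[OF y(1)]) auto
  have xA: "x (fst j) \<in> agents (I (fst j))" and yA: "y (fst j) \<in> agents (I (fst j))" and zA: "snd j \<in> agents (I (fst j))"
    if "j \<in> ?D" for j
    using x(2)[of "fst j"] y(2)[of "fst j"] test_ctxD(7)[OF ctx, of "fst j"] that by auto
  have z: "ptime ?N ?D ?X (\<lambda>j. set_data {snd j})" by (rule ptime_singleton[OF test_ctxD(2)[OF ctx1] ptime_snd zA])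
  have yz: "ptime ?N ?D ?X (\<lambda>j. set_data {y (fst j), snd j})"
    by (rule ptime_insert[OF test_ctxD(2)[OF ctx1] z _ y1 yA]) (use zA in auto)
  have xyz: "ptime ?N ?D ?X (\<lambda>j. set_data {x (fst j), y (fst j), snd j})"
    by (rule ptime_insert[OF test_ctxD(2)[OF ctx1] yz _ x1 xA]) (use zA yA in auto)
  have sub: "{x (fst j), y (fst j), snd j} \<subseteq> agents (I (fst j))" if "j \<in> ?D" for j
    using xA[OF that] yA[OF that] zA[OF that] by simp
  have start: "ptime ?N ?D ?X (\<lambda>j. bool_data (ok_start (match_value (I (fst j))) (A (fst j)) (B (fst j)) (c (fst j)) (a (fst j))
      (\<tau> (fst j)) {x (fst j), y (fst j), snd j}))" by (rule ptime_ok_start[OF ctx1 xyz sub])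
  show "ptime ?N ?D ?X (\<lambda>j. bool_data (x (fst j) \<noteq> y (fst j) \<and> x (fst j) \<noteq> snd j \<and> y (fst j) \<noteq> snd j \<and>
    ok_start (match_value (I (fst j))) (A (fst j)) (B (fst j)) (c (fst j)) (a (fst j)) (\<tau> (fst j)) {x (fst j), y (fst j), snd j}))"
    by (intro ptime_and ptime_not ptime_eq_nat x1 y1 ptime_snd start)
qed

lemma ptime_second_item:
  assumes ctx: "test_ctx N D X I c A a B \<tau>" and x: "ptime N D X (\<lambda>i. Num (real (x i)))" "\<And>i. i \<in> D \<Longrightarrow> x i \<in> A i"
  shows "ptime N D X (\<lambda>i. bool_data (\<exists>y\<in>A i. \<exists>z\<in>A i. x i \<noteq> y \<and> x i \<noteq> z \<and> y \<noteq> z \<and>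
      ok_start (match_value (I i)) (A i) (B i) (c i) (a i) (\<tau> i) {x i, y, z}))"
proof (rule ptime_Bex[OF test_ctxD(3)[OF ctx] test_ctxD(10)[OF ctx]], assumption)
  show "ptime (\<lambda>j. N (fst j)) (SIGMA i:D. A i) (\<lambda>j. Cell (X (fst j)) (Num (real (snd j))))
    (\<lambda>j. bool_data (\<exists>z\<in>A (fst j). x (fst j) \<noteq> snd j \<and> x (fst j) \<noteq> z \<and> snd j \<noteq> z \<and>
      ok_start (match_value (I (fst j))) (A (fst j)) (B (fst j)) (c (fst j)) (a (fst j)) (\<tau> (fst j)) {x (fst j), snd j, z}))"
    by (rule ptime_third_item[OF test_ctx_weaken[OF ctx] ptime_weaken[OF x(1)] _ ptime_snd]) (use x(2) in auto)
qed

lemma ptime_three_items: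
  assumes ctx: "test_ctx N D X I c A a B \<tau>"
  shows "ptime N D X (\<lambda>i. bool_data (\<exists>x\<in>A i. \<exists>y\<in>A i. \<exists>z\<in>A i. x \<noteq> y \<and> x \<noteq> z \<and> y \<noteq> z \<and>
    ok_start (match_value (I i)) (A i) (B i) (c i) (a i) (\<tau> i) {x, y, z}))"
proof (rule ptime_Bex[OF test_ctxD(3)[OF ctx] test_ctxD(10)[OF ctx]], assumption)
  show "ptime (\<lambda>j. N (fst j)) (SIGMA i:D. A i) (\<lambda>j. Cell (X (fst j)) (Num (real (snd j))))
    (\<lambda>j. bool_data (\<exists>y\<in>A (fst j). \<exists>z\<in>A (fst j). snd j \<noteq> y \<and> snd j \<noteq> z \<and> y \<noteq> z \<and>
      ok_start (match_value (I (fst j))) (A (fst j)) (B (fst j)) (c (fst j)) (a (fst j)) (\<tau> (fst j)) {snd j, y, z}))"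
    by (rule ptime_second_item[OF test_ctx_weaken[OF ctx] ptime_snd]) auto
qed

lemma ptime_pair_second:
  assumes ctx: "test_ctx N D X I c A a B \<tau>" and x: "ptime N D X (\<lambda>i. Num (real (x i)))" "\<And>i. i \<in> D \<Longrightarrow> x i \<in> A i"
  shows "ptime N D X (\<lambda>i. bool_data (\<exists>y\<in>A i. sum (c i) {x i, y} \<le> B i \<and> \<tau> i \<le> match_value (I i) {x i, y}))"
proof (rule ptime_Bex[OF test_ctxD(3)[OF ctx] test_ctxD(10)[OF ctx]], assumption)
  let ?D = "SIGMA i:D. A i" and ?X = "\<lambda>j. Cell (X (fst j)) (Num (real (snd j)))" and ?N = "\<lambda>j :: 'a \<times> nat. N (fst j)"
  have ctx1: "test_ctx ?N ?D ?X (\<lambda>j. I (fst j)) (\<lambda>j. c (fst j)) (\<lambda>j. A (fst j))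
      (\<lambda>j. a (fst j)) (\<lambda>j. B (fst j)) (\<lambda>j. \<tau> (fst j))" by (rule test_ctx_weaken[OF ctx]) auto
  have x1: "ptime ?N ?D ?X (\<lambda>j. Num (real (x (fst j))))" by (rule ptime_weaken[OF x(1)]) auto
  have xA: "x (fst j) \<in> agents (I (fst j))" and yA: "snd j \<in> agents (I (fst j))"
    if "j \<in> ?D" for j using x(2)[of "fst j"] test_ctxD(7)[OF ctx, of "fst j"] that by auto
  have y: "ptime ?N ?D ?X (\<lambda>j. set_data {snd j})" by (rule ptime_singleton[OF test_ctxD(2)[OF ctx1] ptime_snd yA])
  have xy: "ptime ?N ?D ?X (\<lambda>j. set_data {x (fst j), snd j})"
    by (rule ptime_insert[OF test_ctxD(2)[OF ctx1] y _ x1 xA]) (use yA in auto)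
  have sub: "{x (fst j), snd j} \<subseteq> agents (I (fst j))" if "j \<in> ?D" for j using xA[OF that] yA[OF that] by simp
  have sm: "ptime ?N ?D ?X (\<lambda>j. Num (sum (c (fst j)) {x (fst j), snd j}))"
    by (rule ptime_sum_cost[OF test_ctxD(1)[OF ctx1] xy sub])
  have vl: "ptime ?N ?D ?X (\<lambda>j. Num (match_value (I (fst j)) {x (fst j), snd j}))"
    by (rule ptime_value[OF test_ctxD(2)[OF ctx1] xy sub])
  show "ptime ?N ?D ?X (\<lambda>j. bool_data (sum (c (fst j)) {x (fst j), snd j} \<le> B (fst j) \<and>
      \<tau> (fst j) \<le> match_value (I (fst j)) {x (fst j), snd j}))"
    by (rule ptime_and[OF ptime_le[OF sm test_ctxD(5)[OF ctx1]] ptime_le[OF test_ctxD(6)[OF ctx1] vl]])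
qed

lemma ptime_ok_sup:
  assumes ctx: "test_ctx N D X I c A a B \<tau>"
  shows "ptime N D X (\<lambda>i. bool_data (ok_sup (match_value (I i)) (A i) (B i) (c i) (a i) (\<tau> i)))"
proof -
  have "ptime N D X (\<lambda>i. bool_data (\<exists>x\<in>A i. \<exists>y\<in>A i. sum (c i) {x, y} \<le> B i \<and> \<tau> i \<le> match_value (I i) {x, y}))"
  proof (rule ptime_Bex[OF test_ctxD(3)[OF ctx] test_ctxD(10)[OF ctx]], assumption)
    show "ptime (\<lambda>j. N (fst j)) (SIGMA i:D. A i) (\<lambda>j. Cell (X (fst j)) (Num (real (snd j))))
      (\<lambda>j. bool_data (\<exists>y\<in>A (fst j). sum (c (fst j)) {snd j, y} \<le> B (fst j) \<and>
        \<tau> (fst j) \<le> match_value (I (fst j)) {snd j, y}))"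
      by (rule ptime_pair_second[OF test_ctx_weaken[OF ctx] ptime_snd]) auto
  qed
  from ptime_or[OF ptime_le[OF test_ctxD(6)[OF ctx] ptime_zero] ptime_or[OF this ptime_three_items[OF ctx]]]
  show ?thesis unfolding ok_sup_def .
qed

definition winner :: "('a::linorder set \<Rightarrow> real) \<Rightarrow> 'a set \<Rightarrow> real \<Rightarrow> 'a costs \<Rightarrow> 'a \<Rightarrow> nat \<Rightarrow> bool" where
  "winner v A B c a k \<longleftrightarrow> a = most_efficient v c (A - greedy_set v c A k) (greedy_set v c A k) \<and>
     marginal v a (greedy_set v c A k) \<noteq> 0 \<and>
     ok_sup v A B c a (v (insert a (greedy_set v c A k)) + v (insert a (greedy_set v c A k)))"

lemma (in greedy) modified_winners:
  assumes c: "cost_vector A c" and B: "0 \<le> B"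
  shows "modified_greedy_om sviridenko (1/2) v A B c = {a \<in> A. \<exists>k<card A. winner v A B c a k}"
proof -
  have test: "v (insert a P) \<le> 1/2 * (SUP x\<in>{c a..}. sviridenko A B v (c(a := x))) \<longleftrightarrow>
      ok_sup v A B c a (v (insert a P) + v (insert a P))" if "a \<in> A" for a P
    unfolding ok_sup_iff[OF c that B, symmetric] by auto
  have item: "item v c A (Suc k) = most_efficient v c (A - greedy_set v c A k) (greedy_set v c A k)" for k
    by (simp add: item_def)
  show ?thesis
  proof (intro set_eqI iffI)
    fix a assume "a \<in> modified_greedy_om sviridenko (1/2) v A B c"
    then obtain P where P: "reached v c A P a" "v (insert a P) \<le> 1/2 * (SUP x\<in>{c a..}. sviridenko A B v (c(a := x)))"
      unfolding mom_eq[OF c] selected_def by blast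
    note aA = reachedD(1)[OF P(1)]
    obtain k where k: "k < card A" "P = greedy_set v c A k" "a = item v c A (Suc k)" "marginal v a P \<noteq> 0"
      using P(1) unfolding reached_def by blast
    have "a = most_efficient v c (A - P) P" using k(3) item unfolding k(2) by simp
    then have "winner v A B c a k" unfolding winner_def k(2)[symmetric] using k(4) P(2) test[OF aA] by blast
    then show "a \<in> {a \<in> A. \<exists>k<card A. winner v A B c a k}" using aA k(1) by blast
  next
    fix a assume "a \<in> {a \<in> A. \<exists>k<card A. winner v A B c a k}"
    then obtain k where k: "a \<in> A" "k < card A" "winner v A B c a k" by blast
    let ?P = "greedy_set v c A k"
    have "reached v c A ?P a" using k(2,3) unfolding reached_def winner_def item by blast
    moreover have "v (insert a ?P) \<le> 1/2 * (SUP x\<in>{c a..}. sviridenko A B v (c(a := x)))"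
      using k(3) test[OF k(1), of ?P] unfolding winner_def by blast
    ultimately show "a \<in> modified_greedy_om sviridenko (1/2) v A B c"
      unfolding mom_eq[OF c] selected_def by blast
  qed
qed

lemma ptime_winner:
  assumes ctx: "cost_ctx N D X I c"
    and A: "ptime N D X (\<lambda>i. set_data (A i))" "\<And>i. i \<in> D \<Longrightarrow> A i \<subseteq> agents (I i)"
    and a: "ptime N D X (\<lambda>i. Num (real (a i)))" "\<And>i. i \<in> D \<Longrightarrow> a i \<in> A i"
    and B: "ptime N D X (\<lambda>i. Num (B i))"
    and k: "ptime N D X (\<lambda>i. Num (real (k i)))" "\<And>i. i \<in> D \<Longrightarrow> k i < card (A i)"
  shows "ptime N D X (\<lambda>i. bool_data (winner (match_value (I i)) (A i) (B i) (c i) (a i) (k i)))"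
proof -
  note ctx0 = cost_ctxD(1)[OF ctx]
  define S where "S i = greedy_set (match_value (I i)) (c i) (A i) (k i)" for i
  have finA: "finite (A i)" if "i \<in> D" for i
    using subset_lessThan[OF agent_bound[OF ctx0 that A(2)[OF that]]] by simp
  have kle: "k i \<le> card (A i)" if "i \<in> D" for i using k(2)[OF that] by simp
  have S: "ptime N D X (\<lambda>i. set_data (S i))" unfolding S_def by (rule ptime_greedy_set[OF ctx A k(1) kle])
  have Sp: "S i \<subseteq> A i" "card (S i) = k i" if "i \<in> D" for i
    using greedy_set_props[OF finA[OF that] kle[OF that]] by (auto simp: S_def)
  have SA: "S i \<subseteq> agents (I i)" if "i \<in> D" for i using Sp(1)[OF that] A(2)[OF that] by blast
  have Sn: "S i \<subseteq> {..<N i}" if "i \<in> D" for i by (rule agent_bound[OF ctx0 that SA[OF that]])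
  have An: "A i \<subseteq> {..<N i}" if "i \<in> D" for i by (rule agent_bound[OF ctx0 that A(2)[OF that]])
  have R: "ptime N D X (\<lambda>i. set_data (A i - S i))" by (rule ptime_diff[OF A(1) An S Sn])
  have RA: "A i - S i \<subseteq> agents (I i)" if "i \<in> D" for i using A(2)[OF that] by auto
  have Rne: "A i - S i \<noteq> {}" if "i \<in> D" for i
  proof
    assume "A i - S i = {}"
    then have "A i = S i" using Sp(1)[OF that] by auto
    then show False using Sp(2)[OF that] k(2)[OF that] by simp
  qed
  have aA: "a i \<in> agents (I i)" if "i \<in> D" for i using a(2)[OF that] A(2)[OF that] by auto
  have p: "ptime N D X (\<lambda>i. Num (real (pick False (a i) (match_value (I i)) (c i) (A i - S i) (S i))))"
    by (rule ptime_pick[OF ctx S SA R RA Rne a(1) aA])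
  have m: "ptime N D X (\<lambda>i. Num (marginal (match_value (I i)) (a i) (S i)))"
    by (rule ptime_marginal[OF ctx0 S SA a(1) aA])
  have ins: "ptime N D X (\<lambda>i. set_data (insert (a i) (S i)))" by (rule ptime_insert[OF ctx0 S SA a(1) aA])
  have vl: "ptime N D X (\<lambda>i. Num (match_value (I i) (insert (a i) (S i))))"
    by (rule ptime_value[OF ctx0 ins]) (use SA aA in auto)
  have tctx: "test_ctx N D X I c A a B (\<lambda>i. match_value (I i) (insert (a i) (S i)) + match_value (I i) (insert (a i) (S i)))"
    unfolding test_ctx_def using ctx A a B ptime_plus[OF vl vl] by auto
  show ?thesis
    using ptime_and[OF ptime_eq_nat[OF a(1) p] ptime_and[OF ptime_not[OF ptime_eq[OF m ptime_zero]] ptime_ok_sup[OF tctx]]]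
    unfolding winner_def pick_False S_def[symmetric] .
qed

lemma ptime_modified:
  assumes ctx: "cost_ctx N D X I c"
    and A: "ptime N D X (\<lambda>i. set_data (A i))" "\<And>i. i \<in> D \<Longrightarrow> A i \<subseteq> agents (I i)"
    and B: "ptime N D X (\<lambda>i. Num (B i))" "\<And>i. i \<in> D \<Longrightarrow> 0 \<le> B i"
  shows "ptime N D X (\<lambda>i. set_data (modified_greedy_om sviridenko (1/2) (match_value (I i)) (A i) (B i) (c i)))"
proof -
  note ctx0 = cost_ctxD(1)[OF ctx]
  have An: "A i \<subseteq> {..<N i}" if "i \<in> D" for i by (rule agent_bound[OF ctx0 that A(2)[OF that]])
  have cA: "ptime N D X (\<lambda>i. Num (real (card (A i))))" by (rule ptime_card[OF A(1) An])
  let ?P = "\<lambda>i a k. k < card (A i) \<and> winner (match_value (I i)) (A i) (B i) (c i) a k"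
  have "ptime N D X (\<lambda>i. set_data {a \<in> A i. \<exists>k\<in>agents (I i). ?P i a k})"
  proof (rule ptime_filter[OF A(1) An], assumption)
    let ?D = "SIGMA i:D. A i" and ?X = "\<lambda>j. Cell (X (fst j)) (Num (real (snd j)))" and ?N = "\<lambda>j :: 'a \<times> nat. N (fst j)"
    have ctx1: "market_ctx ?N ?D ?X (\<lambda>j. I (fst j))" by (rule market_ctx_weaken[OF ctx0]) auto
    show "ptime ?N ?D ?X (\<lambda>j. bool_data (\<exists>k\<in>agents (I (fst j)). ?P (fst j) (snd j) k))"
    proof (rule ptime_Bex[OF market_ctxD(8)[OF ctx1] market_ctxD(4)[OF ctx1]], assumption, rule ptime_and_then)
      let ?D2 = "SIGMA j:?D. agents (I (fst j))"
      let ?X2 = "\<lambda>j. Cell (?X (fst j)) (Num (real (snd j)))" and ?N2 = "\<lambda>j :: ('a \<times> nat) \<times> nat. ?N (fst j)"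
      show "ptime ?N2 ?D2 ?X2 (\<lambda>j. bool_data (snd j < card (A (fst (fst j)))))"
        by (rule ptime_less_nat[OF ptime_snd ptime_weaken2[OF cA]]) auto
      let ?D3 = "{j \<in> ?D2. snd j < card (A (fst (fst j)))}"
      have ctx3: "cost_ctx ?N2 ?D3 ?X2 (\<lambda>j. I (fst (fst j))) (\<lambda>j. c (fst (fst j)))" by (rule cost_ctx_weaken2[OF ctx]) auto
      have A3: "ptime ?N2 ?D3 ?X2 (\<lambda>j. set_data (A (fst (fst j))))" by (rule ptime_weaken2[OF A(1)]) auto
      have B3: "ptime ?N2 ?D3 ?X2 (\<lambda>j. Num (B (fst (fst j))))" by (rule ptime_weaken2[OF B(1)]) auto
      have AA: "A (fst (fst j)) \<subseteq> agents (I (fst (fst j)))" if "j \<in> ?D3" for j by (rule A(2)) (use that in auto)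
      show "ptime ?N2 ?D3 ?X2 (\<lambda>j. bool_data (winner (match_value (I (fst (fst j)))) (A (fst (fst j))) (B (fst (fst j)))
          (c (fst (fst j))) (snd (fst j)) (snd j)))"
        by (rule ptime_winner[OF ctx3 A3 AA ptime_snd2 _ B3 ptime_snd]) auto
    qed
  qed
  then show ?thesis
  proof (rule ptime_cong)
    fix i assume i: "i \<in> D"
    interpret greedy "match_value (I i)" "A i" by (rule greedy_match_value[OF market_ctxD(1)[OF ctx0 i] A(2)[OF i]])
    have cv: "cost_vector (A i) (c i)" by (rule cost_vector_subset[OF cost_ctxD(2)[OF ctx i] A(2)[OF i]])
    have "card (A i) \<le> card (agents (I i))"
      by (rule card_mono[OF crowdsourcingD(1)[OF market_ctxD(1)[OF ctx0 i]] A(2)[OF i]])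
    moreover have "agents (I i) = {..<card (agents (I i))}" by (rule market_ctxD(2)[OF ctx0 i])
    ultimately have "k \<in> agents (I i)" if "k < card (A i)" for k using that by (metis lessThan_iff order_less_le_trans)
    then have "{a \<in> A i. \<exists>k\<in>agents (I i). ?P i a k} =
        {a \<in> A i. \<exists>k<card (A i). winner (match_value (I i)) (A i) (B i) (c i) a k}" by blast
    then show "set_data {a \<in> A i. \<exists>k\<in>agents (I i). ?P i a k} =
        set_data (modified_greedy_om sviridenko (1/2) (match_value (I i)) (A i) (B i) (c i))"
      unfolding modified_winners[OF cv B(2)[OF i]] by simp
  qed
qed

lemma (in greedy) best_singleton_eq:
  assumes "A \<noteq> {}"
  shows "best_singleton v A B c = {a \<in> A. v {a} \<noteq> 0 \<and> (\<forall>b\<in>A. v {b} \<le> v {a} \<and> (v {b} = v {a} \<longrightarrow> a \<le> b))}"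
proof -
  define s where "s = best_agent v A"
  have s: "s \<in> A" "\<And>i. i \<in> A \<Longrightarrow> v {i} \<le> v {s}" using best_agent_props[OF assms] by (auto simp: s_def)
  have min: "s \<le> b" if "b \<in> A" "v {b} = v {s}" for b
    unfolding s_def best_agent_def by (rule Min_le) (use that s finite_A in \<open>auto simp: s_def\<close>)
  have uniq: "a = s" if "a \<in> A" "\<forall>b\<in>A. v {b} \<le> v {a} \<and> (v {b} = v {a} \<longrightarrow> a \<le> b)" for a
  proof (rule antisym)
    have "v {s} = v {a}" using that s by (simp add: order_antisym)
    then show "a \<le> s" "s \<le> a" using that s(1) min[OF that(1)] by auto
  qed
  show ?thesis
  proof (intro set_eqI iffI)
    fix a assume "a \<in> best_singleton v A B c"
    then have "a = s" "v {s} \<noteq> 0" by (auto simp: best_singleton_def s_def split: if_splits)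
    then show "a \<in> {a \<in> A. v {a} \<noteq> 0 \<and> (\<forall>b\<in>A. v {b} \<le> v {a} \<and> (v {b} = v {a} \<longrightarrow> a \<le> b))}" using s min by blast
  next
    fix a assume a: "a \<in> {a \<in> A. v {a} \<noteq> 0 \<and> (\<forall>b\<in>A. v {b} \<le> v {a} \<and> (v {b} = v {a} \<longrightarrow> a \<le> b))}"
    then have "a = s" by (intro uniq) blast+
    then show "a \<in> best_singleton v A B c" using a by (simp add: best_singleton_def s_def)
  qed
qed

lemma ptime_single:
  assumes ctx: "market_ctx N D X I" and a: "ptime N D X (\<lambda>i. Num (real (a i)))" "\<And>i. i \<in> D \<Longrightarrow> a i \<in> agents (I i)"
  shows "ptime N D X (\<lambda>i. Num (match_value (I i) {a i}))"
proof -
  have "ptime N D X (\<lambda>i. set_data {a i})" by (rule ptime_singleton[OF ctx a])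
  then show ?thesis by (rule ptime_value[OF ctx]) (use a(2) in auto)
qed

lemma ptime_best:
  assumes ctx: "market_ctx N D X I"
    and A: "ptime N D X (\<lambda>i. set_data (A i))" "\<And>i. i \<in> D \<Longrightarrow> A i \<subseteq> agents (I i)"
  shows "ptime N D X (\<lambda>i. set_data {a \<in> A i. match_value (I i) {a} \<noteq> 0 \<and>
     (\<forall>b\<in>A i. match_value (I i) {b} \<le> match_value (I i) {a} \<and> (match_value (I i) {b} = match_value (I i) {a} \<longrightarrow> a \<le> b))})"
proof -
  have An: "A i \<subseteq> {..<N i}" if "i \<in> D" for i by (rule agent_bound[OF ctx that A(2)[OF that]])
  let ?D = "SIGMA i:D. A i" and ?X = "\<lambda>j. Cell (X (fst j)) (Num (real (snd j)))" and ?N = "\<lambda>j :: 'a \<times> nat. N (fst j)"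
  have ctx1: "market_ctx ?N ?D ?X (\<lambda>j. I (fst j))" by (rule market_ctx_weaken[OF ctx]) auto
  have aA: "snd j \<in> agents (I (fst j))" if "j \<in> ?D" for j by (rule subsetD[OF A(2)]) (use that in auto)
  have va: "ptime ?N ?D ?X (\<lambda>j. Num (match_value (I (fst j)) {snd j}))" by (rule ptime_single[OF ctx1 ptime_snd aA])
  have A1: "ptime ?N ?D ?X (\<lambda>j. set_data (A (fst j)))" by (rule ptime_weaken[OF A(1)]) auto
  have A1n: "A (fst j) \<subseteq> {..<N (fst j)}" if "j \<in> ?D" for j by (rule An) (use that in auto)
  let ?D2 = "SIGMA j:?D. A (fst j)"
  let ?X2 = "\<lambda>j. Cell (?X (fst j)) (Num (real (snd j)))" and ?N2 = "\<lambda>j :: ('a \<times> nat) \<times> nat. ?N (fst j)"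
  have ctx2: "market_ctx ?N2 ?D2 ?X2 (\<lambda>j. I (fst (fst j)))" by (rule market_ctx_weaken2[OF ctx]) auto
  have bA: "snd j \<in> agents (I (fst (fst j)))" "snd (fst j) \<in> agents (I (fst (fst j)))" if "j \<in> ?D2" for j
    using A(2)[of "fst (fst j)"] that by auto
  have vb: "ptime ?N2 ?D2 ?X2 (\<lambda>j. Num (match_value (I (fst (fst j))) {snd j}))"
    by (rule ptime_single[OF ctx2 ptime_snd bA(1)])
  have va2: "ptime ?N2 ?D2 ?X2 (\<lambda>j. Num (match_value (I (fst (fst j))) {snd (fst j)}))"
    by (rule ptime_single[OF ctx2 ptime_snd2 bA(2)])
  have all: "ptime ?N ?D ?X (\<lambda>j. bool_data (\<forall>b\<in>A (fst j). match_value (I (fst j)) {b} \<le> match_value (I (fst j)) {snd j} \<and>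
      (match_value (I (fst j)) {b} = match_value (I (fst j)) {snd j} \<longrightarrow> snd j \<le> b)))"
  proof (rule ptime_Ball[OF A1 A1n], assumption)
    show "ptime ?N2 ?D2 ?X2 (\<lambda>j. bool_data (match_value (I (fst (fst j))) {snd j} \<le> match_value (I (fst (fst j))) {snd (fst j)} \<and>
      (match_value (I (fst (fst j))) {snd j} = match_value (I (fst (fst j))) {snd (fst j)} \<longrightarrow> snd (fst j) \<le> snd j)))"
      by (rule ptime_and[OF ptime_le[OF vb va2] ptime_imp[OF ptime_eq[OF vb va2] ptime_le_nat[OF ptime_snd2 ptime_snd]]])
  qed
  show ?thesis
  proof (rule ptime_filter[OF A(1) An], assumption)
    show "ptime ?N ?D ?X (\<lambda>j. bool_data (match_value (I (fst j)) {snd j} \<noteq> 0 \<and>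
      (\<forall>b\<in>A (fst j). match_value (I (fst j)) {b} \<le> match_value (I (fst j)) {snd j} \<and>
      (match_value (I (fst j)) {b} = match_value (I (fst j)) {snd j} \<longrightarrow> snd j \<le> b))))"
      by (rule ptime_and[OF ptime_not[OF ptime_eq[OF va ptime_zero]] all])
  qed
qed

subsection \<open>Reading the input\<close>

lemma ptime_indices:
  assumes f: "ptime N D X (\<lambda>i. array (n i) (f i))" and b: "\<And>i. i \<in> D \<Longrightarrow> n i \<le> N i"
  shows "ptime N D X (\<lambda>i. set_data {..<n i})"
proof -
  let ?l = "\<lambda>k. map (\<lambda>k. Num (real k)) [0..<k]"
  have "ptime N D X (\<lambda>i. Cell (Num (real (n i))) (list_data (rev (?l (n i)))))"
  proof (rule ptime_iterate[where e = f and K = n and s = "\<lambda>i k. Cell (Num (real k)) (list_data (rev (?l k)))"])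
    show "ptime N D X (\<lambda>i. list_data (map (f i) [0..<n i]))" using f by (simp add: array_def)
    show "ptime N D X (\<lambda>i. Cell (Num (real 0)) (list_data (rev (?l 0))))"
      using ptime_Cell[OF ptime_zero ptime_Null] by (simp add: list_data_simps)
    let ?D = "SIGMA i:D. {..<n i}"
    let ?X = "\<lambda>j. Cell (X (fst j)) (Cell (f (fst j) (snd j)) (Cell (Num (real (snd j))) (list_data (rev (?l (snd j))))))"
    have st: "ptime (\<lambda>j. N (fst j)) ?D ?X (\<lambda>j. Cell (Num (real (snd j))) (list_data (rev (?l (snd j)))))"
      by (rule ptime_right[OF ptime_snd])
    show "ptime (\<lambda>j. N (fst j)) ?D ?X (\<lambda>j. Cell (Num (real (Suc (snd j)))) (list_data (rev (?l (Suc (snd j))))))"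
      by (rule ptime_cong[OF ptime_Cell[OF ptime_plus[OF ptime_left[OF st] ptime_one] ptime_Cell[OF ptime_left[OF st] ptime_right[OF st]]]])
        (simp add: list_data_simps)
  qed (rule b)
  from ptime_rev[OF ptime_right[OF this]]
  have "ptime N D X (\<lambda>i. list_data (?l (n i)))" using b by simp
  then show ?thesis by (simp add: set_data_def lessThan_atLeast0)
qed

lemma ptime_array_map:
  assumes f: "ptime N D X (\<lambda>i. array (n i) (f i))" and b: "\<And>i. i \<in> D \<Longrightarrow> n i \<le> N i"
    and g: "ptime (\<lambda>j. N (fst j)) (SIGMA i:D. {..<n i}) (\<lambda>j. Cell (X (fst j)) (f (fst j) (snd j))) (\<lambda>j. g (fst j) (snd j))"
  shows "ptime N D X (\<lambda>i. array (n i) (g i))"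
proof -
  have s: "{a \<in> set [0..<n]. True} = {..<n}" for n by auto
  have "ptime N D X (\<lambda>i. list_data (map (g i) (filter (\<lambda>_. True) [0..<n i])))"
  proof (rule ptime_filter_map[where e = f])
    show "ptime N D X (\<lambda>i. list_data (map (f i) [0..<n i]))" using f by (simp add: array_def)
    show "ptime (\<lambda>j. N (fst j)) (SIGMA i:D. {a \<in> set [0..<n i]. True}) (\<lambda>j. Cell (X (fst j)) (f (fst j) (snd j)))
      (\<lambda>j. g (fst j) (snd j))" unfolding s by (rule g)
  qed (use b ptime_True in auto)
  then show ?thesis by (simp add: array_def)
qed

definition instances :: "((nat, nat) market \<times> nat costs) set" where
  "instances = {p. crowdsourcing (fst p) \<and> numbered (fst p) \<and> cost_vector (agents (fst p)) (snd p)}"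

definition instance_size :: "(nat, nat) market \<times> nat costs \<Rightarrow> nat" where
  "instance_size p = card (agents (fst p)) + card (tasks (fst p))"

definition instance_data :: "(nat, nat) market \<times> nat costs \<Rightarrow> data" where
  "instance_data p = market_data (fst p) (snd p)"

lemma polynomial_timeI:
  assumes "ptime instance_size instances instance_data (\<lambda>p. set_data (F (fst p) (snd p)))"
  shows "polynomial_time F"
proof (rule ptimeE[OF assms])
  fix q d
  assume *: "\<And>p. p \<in> instances \<Longrightarrow> exec q (instance_data p) = set_data (F (fst p) (snd p))"
    "\<And>p. p \<in> instances \<Longrightarrow> steps q (instance_data p) \<le> (instance_size p + 2) ^ d"
  show ?thesis unfolding polynomial_time_def
  proof (intro exI[of _ q] exI[of _ d] allI impI)
    fix I c assume "crowdsourcing I \<and> numbered I \<and> cost_vector (agents I) c"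
    then have "(I, c) \<in> instances" by (simp add: instances_def)
    from *[OF this] show "exec q (market_data I c) = set_data (F I c) \<and>
        steps q (market_data I c) \<le> (card (agents I) + card (tasks I) + 2) ^ d"
      by (simp add: instance_data_def instance_size_def)
  qed
qed

lemma instance_ctx:
  shows "cost_ctx instance_size instances instance_data fst snd"
    and "ptime instance_size instances instance_data (\<lambda>p. Num (budget (fst p)))"
proof -
  let ?N = instance_size and ?D = instances and ?X = instance_data
  let ?nA = "\<lambda>p :: (nat, nat) market \<times> nat costs. card (agents (fst p))" and ?nT = "\<lambda>p :: (nat, nat) market \<times> nat costs. card (tasks (fst p))"
  let ?f = "\<lambda>p a. Cell (Num (snd p a)) (set_data {t. (a, t) \<in> edges (fst p)})"
  have id: "ptime ?N ?D ?X (\<lambda>p. Cell (Num (budget (fst p))) (Cell (array (?nT p) (\<lambda>t. Num (worth (fst p) t))) (array (?nA p) (?f p))))"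
    by (rule ptime_cong[OF ptime_id]) (simp add: instance_data_def market_data_def array_def)
  show "ptime ?N ?D ?X (\<lambda>p. Num (budget (fst p)))" by (rule ptime_left[OF id])
  note W = ptime_left[OF ptime_right[OF id]] and L = ptime_right[OF ptime_right[OF id]]
  have bA: "?nA p \<le> ?N p" and bT: "?nT p \<le> ?N p" for p by (simp_all add: instance_size_def)
  have c: "ptime ?N ?D ?X (\<lambda>p. array (?nA p) (\<lambda>a. Num (snd p a)))"
    by (rule ptime_array_map[OF L bA ptime_left[OF ptime_snd]])
  have r: "ptime ?N ?D ?X (\<lambda>p. rel_data (?nA p) (edges (fst p)))"
    unfolding rel_data_def by (rule ptime_array_map[OF L bA ptime_right[OF ptime_snd]])
  have A: "ptime ?N ?D ?X (\<lambda>p. set_data (agents (fst p)))"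
    by (rule ptime_cong[OF ptime_indices[OF L bA]]) (auto simp: instances_def numbered_def)
  have T: "ptime ?N ?D ?X (\<lambda>p. set_data (tasks (fst p)))"
    by (rule ptime_cong[OF ptime_indices[OF W bT]]) (auto simp: instances_def numbered_def)
  show "cost_ctx ?N ?D ?X fst snd"
    unfolding cost_ctx_def market_ctx_def using A T W r c bA bT by (auto simp: instances_def)
qed

lemma affordable_instance:
  "ptime instance_size instances instance_data (\<lambda>p. set_data {a \<in> agents (fst p). snd p a \<le> budget (fst p)})"
proof -
  note ctx = instance_ctx(1)
  show ?thesis
  proof (rule ptime_filter[OF market_ctxD(8)[OF cost_ctxD(1)[OF ctx]] market_ctxD(4)[OF cost_ctxD(1)[OF ctx]]], assumption)
    show "ptime (\<lambda>j. instance_size (fst j)) (SIGMA p:instances. agents (fst p))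
      (\<lambda>j. Cell (instance_data (fst j)) (Num (real (snd j)))) (\<lambda>j. bool_data (snd (fst j) (snd j) \<le> budget (fst (fst j))))"
      by (rule ptime_le[OF ptime_cost[OF cost_ctx_weaken[OF ctx] ptime_snd] ptime_weaken[OF instance_ctx(2)]]) auto
  qed
qed

lemma polynomial_time_modified:
  "polynomial_time (\<lambda>I. on_affordable (modified_greedy_om sviridenko (1/2) (match_value I)) (agents I) (budget I))"
proof (rule polynomial_timeI)
  let ?A = "\<lambda>p :: (nat, nat) market \<times> nat costs. {a \<in> agents (fst p). snd p a \<le> budget (fst p)}"
  have "ptime instance_size instances instance_data (\<lambda>p. set_data
      (modified_greedy_om sviridenko (1/2) (match_value (fst p)) (?A p) (budget (fst p)) (snd p)))"
    by (rule ptime_modified[OF instance_ctx(1) affordable_instance _ instance_ctx(2)])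
      (auto simp: instances_def crowdsourcing_def)
  then show "ptime instance_size instances instance_data (\<lambda>p. set_data
      (on_affordable (modified_greedy_om sviridenko (1/2) (match_value (fst p))) (agents (fst p)) (budget (fst p)) (snd p)))"
  proof (rule ptime_cong)
    fix p :: "(nat, nat) market \<times> nat costs" assume "p \<in> instances"
    then have I: "crowdsourcing (fst p)" "cost_vector (agents (fst p)) (snd p)" by (auto simp: instances_def)
    have sub: "?A p \<subseteq> agents (fst p)" by auto
    interpret greedy "match_value (fst p)" "?A p" by (rule greedy_match_value[OF I(1) sub])
    define A' where "A' = ?A p"
    have "modified_greedy_om sviridenko (1/2) (match_value (fst p)) A' (budget (fst p)) (snd p) = {}" if "A' = {}"
    proof -
      have "0 \<le> budget (fst p)" using crowdsourcingD(5)[OF I(1)] by simp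
      from modified_winners[OF cost_vector_subset[OF I(2) sub] this] that show ?thesis unfolding A'_def[symmetric] by simp
    qed
    then show "set_data (modified_greedy_om sviridenko (1/2) (match_value (fst p)) (?A p) (budget (fst p)) (snd p)) = set_data
      (on_affordable (modified_greedy_om sviridenko (1/2) (match_value (fst p))) (agents (fst p)) (budget (fst p)) (snd p))"
      unfolding on_affordable_def Let_def A'_def[symmetric] by (cases "A' = {}") simp_all
  qed
qed

lemma polynomial_time_best:
  "polynomial_time (\<lambda>I. on_affordable (best_singleton (match_value I)) (agents I) (budget I))"
proof (rule polynomial_timeI)
  let ?A = "\<lambda>p :: (nat, nat) market \<times> nat costs. {a \<in> agents (fst p). snd p a \<le> budget (fst p)}"
  let ?B = "\<lambda>p. {a \<in> ?A p. match_value (fst p) {a} \<noteq> 0 \<and> (\<forall>b\<in>?A p. match_value (fst p) {b} \<le> match_value (fst p) {a} \<and>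
      (match_value (fst p) {b} = match_value (fst p) {a} \<longrightarrow> a \<le> b))}"
  have "ptime instance_size instances instance_data (\<lambda>p. set_data (?B p))"
    by (rule ptime_best[OF cost_ctxD(1)[OF instance_ctx(1)] affordable_instance]) auto
  then show "ptime instance_size instances instance_data (\<lambda>p. set_data
      (on_affordable (best_singleton (match_value (fst p))) (agents (fst p)) (budget (fst p)) (snd p)))"
  proof (rule ptime_cong)
    fix p :: "(nat, nat) market \<times> nat costs" assume "p \<in> instances"
    then have I: "crowdsourcing (fst p)" by (auto simp: instances_def)
    have sub: "?A p \<subseteq> agents (fst p)" by auto
    interpret greedy "match_value (fst p)" "?A p" by (rule greedy_match_value[OF I sub])
    have "on_affordable (best_singleton (match_value (fst p))) (agents (fst p)) (budget (fst p)) (snd p) = ?B p"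
    proof (cases "?A p = {}")
      case True
      then show ?thesis unfolding on_affordable_def Let_def by auto
    next
      case False
      then show ?thesis unfolding on_affordable_def Let_def using best_singleton_eq[OF False, of "budget (fst p)" "snd p"]
        by (simp only: if_False)
    qed
    then show "set_data (?B p) = set_data
      (on_affordable (best_singleton (match_value (fst p))) (agents (fst p)) (budget (fst p)) (snd p))" by simp
  qed
qed

lemma deterministic_large_balanced:
  fixes orc :: "'a::linorder opt_oracle"
  assumes r: "1 \<le> r" and orc: "oracle_for TYPE(('a, 't) market) r orc"
  shows "valid_mechanism (\<lambda>I :: ('a, 't) market. deterministic_large orc (r / (r + 1)) (1 / r) (match_value I) (agents I) (budget I))"
    and "has_large_market_ratio (1 + r)
      (\<lambda>I :: ('a, 't) market. deterministic_large orc (r / (r + 1)) (1 / r) (match_value I) (agents I) (budget I))"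
proof -
  have "r / (r + 1) \<le> 1 / (1 + 1 / r)" "0 < r / (r + 1)" "r / (r + 1) \<le> 1" "0 < 1 / r"
    and eq: "max (1 + 1 / (1 / r)) (r / (r / (r + 1))) = 1 + r" using r by (simp_all add: field_simps)
  then show "valid_mechanism (\<lambda>I :: ('a, 't) market. deterministic_large orc (r / (r + 1)) (1 / r) (match_value I) (agents I) (budget I))"
    and "has_large_market_ratio (1 + r)
      (\<lambda>I :: ('a, 't) market. deterministic_large orc (r / (r + 1)) (1 / r) (match_value I) (agents I) (budget I))"
    using valid_deterministic_large[OF r orc, of "r / (r + 1)" "1 / r"]
      large_deterministic_large[OF r orc, of "r / (r + 1)" "1 / r"] by simp_all
qed

lemma randomized_polynomial_time_modified:
  "randomized_polynomial_time (\<lambda>I :: (nat, nat) market.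
     modified_random_om sviridenko (1/2) (match_value I) (agents I) (budget I))"
  unfolding randomized_polynomial_time_def modified_random_om_def
  using polynomial_time_modified polynomial_time_best
  by (intro exI[of _ "1/2"] exI conjI allI impI refl) simp_all

lemma sviridenko_ratio_ge_1: "1 \<le> exp 1 / (exp 1 - 1 :: real)"
proof -
  have "1 < exp (1::real)" by simp
  then show ?thesis by (simp add: le_divide_eq)
qed

lemma oracle_for_sviridenko: "oracle_for TYPE(('a::linorder, 't) market) (exp 1 / (exp 1 - 1)) sviridenko"
  using greedy.approx_oracle_sviridenko[OF greedy_match_value[OF _ order_refl]] by blast

theorem corollary5p3:
  shows
    "(let RTM = (\<lambda>I :: ('a::linorder, 't) market.
                   random_tm (1/2) (match_value I) (agents I) (budget I));
          GTM = (\<lambda>I :: ('a, 't) market. greedy_tm (1/2) (match_value I) (agents I) (budget I))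
      in valid_randomized_mechanism RTM \<and> has_expected_ratio 5 RTM \<and>
         valid_mechanism GTM \<and> has_large_market_ratio 3 GTM)
     \<and>
     (let REOM = (\<lambda>I :: ('a, 't) market. random_eom (1/2) (match_value I) (agents I) (budget I));
          DEOM = (\<lambda>I :: ('a, 't) market. deterministic_eom (match_value I) (agents I) (budget I))
      in valid_randomized_mechanism REOM \<and> has_expected_ratio 4 REOM \<and>
         valid_mechanism DEOM \<and> has_ratio ((5 + sqrt 17) / 2) DEOM \<and>
         \<bar>(5 + sqrt 17) / 2 - 4.56\<bar> < 0.005)
     \<and>
     (\<forall>r (orc :: 'a opt_oracle).
        1 \<le> r \<and>
        (\<forall>I :: ('a, 't) market. crowdsourcing I \<longrightarrow> approx_oracle r (match_value I) (agents I) orc) \<longrightarrow>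
        (let ROM = (\<lambda>I :: ('a, 't) market.
                      random_om r orc (1/2) (match_value I) (agents I) (budget I));
             GOM = (\<lambda>I :: ('a, 't) market. greedy_om orc (1/2) (match_value I) (agents I) (budget I));
             MROM = (\<lambda>I :: ('a, 't) market.
                       modified_random_om orc (1/2) (match_value I) (agents I) (budget I));
             DL = (\<lambda>\<alpha> \<gamma>. \<lambda>I :: ('a, 't) market.
                     deterministic_large orc \<alpha> \<gamma> (match_value I) (agents I) (budget I))
         in valid_randomized_mechanism ROM \<and> has_expected_ratio (1 + 4 * r) ROM \<and>
            valid_mechanism GOM \<and> has_large_market_ratio (2 * r) GOM \<and>
            valid_randomized_mechanism MROM \<and> has_expected_ratio (4 * r) MROM \<and>
            (\<forall>\<alpha> \<gamma>. 0 < \<alpha> \<and> \<alpha> \<le> 1 \<and> 0 < \<gamma> \<and> \<gamma> \<le> 1 \<and> \<alpha> \<le> 1 / (1 + \<gamma>) \<longrightarrow>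
               valid_mechanism (DL \<alpha> \<gamma>) \<and>
               has_large_market_ratio (max (1 + 1 / \<gamma>) (r / \<alpha>)) (DL \<alpha> \<gamma>)) \<and>
            valid_mechanism (DL (r / (r + 1)) (1 / r)) \<and>
            has_large_market_ratio (1 + r) (DL (r / (r + 1)) (1 / r))))
     \<and>
     (let e = exp 1;
          MROM = (\<lambda>I :: ('a, 't) market.
                    modified_random_om sviridenko (1/2) (match_value I) (agents I) (budget I))
      in (\<forall>I :: ('a, 't) market. crowdsourcing I \<longrightarrow>
            approx_oracle (e / (e - 1)) (match_value I) (agents I) sviridenko) \<and>
         valid_randomized_mechanism MROM \<and> has_expected_ratio (4 * e / (e - 1)) MROM \<and>
         randomized_polynomial_time (\<lambda>I :: (nat, nat) market.
           modified_random_om sviridenko (1/2) (match_value I) (agents I) (budget I)))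
     \<and>
     (let e = exp 1; r = e / (e - 1);
          DL = (\<lambda>I :: ('a, 't) market.
                  deterministic_large sviridenko (r / (r + 1)) (1 / r)
                    (match_value I) (agents I) (budget I))
      in valid_mechanism DL \<and> has_large_market_ratio (1 + e / (e - 1)) DL)"
  unfolding Let_def
proof ((intro conjI allI impI; (elim conjE)?), goal_cases)
  case 1 show ?case by (rule valid_random_tm)
next
  case 2 show ?case by (rule ratio_random_tm)
next
  case 3 show ?case by (rule valid_greedy_tm)
next
  case 4 show ?case by (rule large_greedy_tm)
next
  case 5 show ?case by (rule valid_random_eom)
next
  case 6 show ?case by (rule ratio_random_eom)
next
  case 7 show ?case by (rule valid_deterministic_eom)
next
  case 8 show ?case by (rule ratio_deterministic_eom)
next
  case 9 show ?case using sqrt_17_bounds by (simp add: abs_if)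
next
  case 10 then show ?case by (intro valid_random_om)
next
  case 11 then show ?case by (intro ratio_random_om)
next
  case 12 then show ?case by (intro valid_greedy_om)
next
  case 13 then show ?case by (intro large_greedy_om)
next
  case 14 then show ?case by (intro valid_modified_random_om)
next
  case 15 then show ?case by (intro ratio_modified)
next
  case 16 then show ?case by (intro valid_deterministic_large)
next
  case 17 then show ?case by (intro large_deterministic_large)
next
  case 18 then show ?case by (intro deterministic_large_balanced(1))
next
  case 19 then show ?case by (intro deterministic_large_balanced(2))
next
  case 20 then show ?case using oracle_for_sviridenko by blast
next
  case 21 show ?case by (rule valid_modified_random_om[OF sviridenko_ratio_ge_1 oracle_for_sviridenko])
next
  case 22 show ?case using ratio_modified[OF sviridenko_ratio_ge_1 oracle_for_sviridenko] by simp
next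
  case 23 show ?case by (rule randomized_polynomial_time_modified)
next
  case 24 show ?case by (rule deterministic_large_balanced(1)[OF sviridenko_ratio_ge_1 oracle_for_sviridenko])
next
  case 25 show ?case by (rule deterministic_large_balanced(2)[OF sviridenko_ratio_ge_1 oracle_for_sviridenko])
qed

end
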